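(* Let $p$ and $q$ be primes such that $q$ divides $(p^p-1)/(p-1)$, and let $n=p^pq$. Then there are, up to isomorphism, exactly two simple skew braces $B$ of order $n$. These two are mutually opposite (each is isomorphic to the opposite skew brace of the other). Both have additive group $(B,\cdot)\cong V\rtimes C_q$, where $V\cong C_p^p$ is an elementary abelian group of order $p^p$ and $C_q$ acts nontrivially on $V$; and there is a group $P$ of order $p^p$ such that both have multiplicative group $(B,\circ)\cong C_q\rtimes P$, where $P$ acts on $C_q$ via an automorphism of order $p$ (i.e. the image of the action $P\to\mathrm{Aut}(C_q)$ is generated by an automorphism of order $p$). Moreover, for each of these two skew braces, the group $\mathrm{Aut}_{\mathrm{sb}}(B)$ of skew brace automorphisms of $B$ is cyclic of order $p$.
   Context: A skew brace $(B,\cdot,\circ)$ is a set $B$ with two binary operations such that $(B,\cdot)$ (the additive group) and $(B,\circ)$ (the multiplicative group) are groups and $a\circ(b\cdot c)=(a\circ b)\cdot a^{-1}\cdot(a\circ c)$ for all $a,b,c\in B$, where $a^{-1}$ is the inverse of $a$ in $(B,\cdot)$. Its order is $|B|$. Homomorphisms of skew braces are maps respecting both operations; $\mathrm{Aut}_{\mathrm{sb}}(B)$ is the group of skew brace automorphisms. For $a\in B$ put $\lambda_a(b)=a^{-1}\cdot(a\circ b)$. An ideal of $B$ is a subgroup $I$ of $(B,\cdot)$ with $\lambda_a(I)\subseteq I$ for all $a\in B$ (such an $I$ is also a subgroup of $(B,\circ)$) which is normal in both $(B,\cdot)$ and $(B,\circ)$. $B$ is simple if $|B|>1$ and its only ideals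 are $\{1\}$ and $B$. The opposite skew brace of $(B,\cdot,\circ)$ is $(B,\cdot^{\mathrm{op}},\circ)$ with $a\cdot^{\mathrm{op}}b=b\cdot a$. $C_m$ denotes the cyclic group of order $m$. *)

theory Defs
  imports "HOL-Algebra.Bij" "HOL-Algebra.Product_Groups" "HOL-Algebra.Multiplicative_Group"
    "HOL-Computational_Algebra.Primes"
begin

(* The two identities are separate fields; in a skew brace they coincide. *)
record 'a sbrace = "'a partial_object" +
  sadd  :: "'a \<Rightarrow> 'a \<Rightarrow> 'a"
  sone  :: "'a"
  scirc :: "'a \<Rightarrow> 'a \<Rightarrow> 'a"
  sunit :: "'a"

definition additive_group :: "'a sbrace \<Rightarrow> 'a monoid" where
  "additive_group B = \<lparr>carrier = carrier B, monoid.mult = sadd B, one = sone B\<rparr>"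

definition multiplicative_group :: "'a sbrace \<Rightarrow> 'a monoid" where
  "multiplicative_group B = \<lparr>carrier = carrier B, monoid.mult = scirc B, one = sunit B\<rparr>"

definition skew_brace :: "'a sbrace \<Rightarrow> bool" where
  "skew_brace B \<longleftrightarrow>
     group (additive_group B) \<and> group (multiplicative_group B) \<and>
     (\<forall>a \<in> carrier B. \<forall>b \<in> carrier B. \<forall>c \<in> carrier B.
        scirc B a (sadd B b c) =
        sadd B (sadd B (scirc B a b) (inv\<^bsub>additive_group B\<^esub> a)) (scirc B a c))"

definition lambda_map :: "'a sbrace \<Rightarrow> 'a \<Rightarrow> 'a \<Rightarrow> 'a" where
  "lambda_map B a b = sadd B (inv\<^bsub>additive_group B\<^esub> a) (scirc B a b)"

definition sb_ideal :: "'a set \<Rightarrow> 'a sbrace \<Rightarrow> bool" where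
  "sb_ideal I B \<longleftrightarrow>
     subgroup I (additive_group B) \<and>
     (\<forall>a \<in> carrier B. lambda_map B a ` I \<subseteq> I) \<and>
     I \<lhd> additive_group B \<and> I \<lhd> multiplicative_group B"

(* For a nonempty carrier, being different from {1} says that it has more than one element;
   unlike a condition on card, this does not exclude infinite carriers. *)
definition simple_skew_brace :: "'a sbrace \<Rightarrow> bool" where
  "simple_skew_brace B \<longleftrightarrow>
     skew_brace B \<and> carrier B \<noteq> {sone B} \<and>
     (\<forall>I. sb_ideal I B \<longrightarrow> I = {sone B} \<or> I = carrier B)"

definition opposite :: "'a sbrace \<Rightarrow> 'a sbrace" where
  "opposite B = B\<lparr>sadd := (\<lambda>a b. sadd B b a)\<rparr>"

definition sb_hom :: "'a sbrace \<Rightarrow> 'b sbrace \<Rightarrow> ('a \<Rightarrow> 'b) set" where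
  "sb_hom B C = hom (additive_group B) (additive_group C) \<inter>
                hom (multiplicative_group B) (multiplicative_group C)"

definition sb_isomorphic :: "'a sbrace \<Rightarrow> 'b sbrace \<Rightarrow> bool" where
  "sb_isomorphic B C \<longleftrightarrow> (\<exists>f \<in> sb_hom B C. bij_betw f (carrier B) (carrier C))"

definition sb_AutoGroup :: "'a sbrace \<Rightarrow> ('a \<Rightarrow> 'a) monoid" where
  "sb_AutoGroup B = BijGroup (carrier B) \<lparr>carrier := sb_hom B B \<inter> Bij (carrier B)\<rparr>"

(* The group N x| H, with normal factor N, for an action \<phi> : H -> Aut(N). *)
definition semidirect_product ::
  "('a, 'c) monoid_scheme \<Rightarrow> ('b, 'd) monoid_scheme \<Rightarrow> ('b \<Rightarrow> 'a \<Rightarrow> 'a) \<Rightarrow> ('a \<times> 'b) monoid" where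
  "semidirect_product N H \<phi> =
     \<lparr>carrier = carrier N \<times> carrier H,
      monoid.mult = (\<lambda>(x, g) (y, h). (x \<otimes>\<^bsub>N\<^esub> \<phi> g y, g \<otimes>\<^bsub>H\<^esub> h)),
      one = (\<one>\<^bsub>N\<^esub>, \<one>\<^bsub>H\<^esub>)\<rparr>"

end

theory Submission
  imports Defs "HOL-Number_Theory.Number_Theory" "HOL-Computational_Algebra.Polynomial" "HOL-Library.Countable"
    "HOL-Algebra.Group_Action" "HOL-Algebra.Sylow"
begin

text \<open>
  Since \<open>q\<close> divides \<open>(p\<^sup>p - 1) / (p - 1)\<close>, the order of \<open>p\<close> modulo \<open>q\<close> is \<open>p\<close>, and the field \<open>F\<close> with \<open>p\<^sup>p\<close>
  elements is generated by a primitive \<open>q\<close>-th root of unity \<open>X\<close>. With the Frobenius map \<open>\<sigma>\<close> and the trace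
  \<open>Tr\<close> to the prime field, the operations
  \<open>(f, i) \<cdot> (g, j) = (f + X\<^sup>i g, i + j)\<close> and \<open>(f, i) \<circ> (g, j) = (f + \<sigma>\<^bsup>Tr f\<^esup> g, i + p\<^bsup>Tr f\<^esup> j)\<close>
  on \<open>F \<times> C\<^sub>q\<close> define a simple skew brace whose automorphisms are the powers of \<open>\<sigma>\<close>; it is not isomorphic to
  its opposite.

  Conversely, in a group of order \<open>p\<^sup>p q\<close> either the Sylow \<open>q\<close>-subgroup is normal, or the Sylow \<open>p\<close>-subgroup \<open>V\<close> is
  normal, elementary abelian and irreducible. Simplicity forces the second case for the additive and the first
  case for the multiplicative group, say with normal subgroup \<open>\<langle>t\<rangle>\<close>. Choosing a complement \<open>\<langle>x\<rangle>\<close> of \<open>V\<close> fixed by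
  \<open>\<lambda>\<^sub>t\<close>, one finds that \<open>\<lambda>\<^sub>t\<close> on \<open>V\<close> is either trivial or inverse to conjugation by \<open>x\<close>, and passing to the opposite
  brace exchanges the two cases. A Fourier coefficient identifies \<open>V\<close> with \<open>F\<close> such that \<open>t\<close> acts as a root of
  unity; then every \<open>\<lambda>\<^sub>u\<close> with \<open>u \<in> V\<close> becomes a power of \<open>\<sigma>\<close>, and by Hilbert's Theorem 90 its exponent is a multiple
  of the trace.
\<close>

hide_const (open) Polynomial.order

text \<open>One count recurs in several variants: a map of period \<open>q\<close> on
  \<open>p ^ j\<close> elements with exactly one fixed point forces \<open>q dvd p ^ j - 1\<close>,
  hence \<open>p dvd j\<close>, because the order of \<open>p\<close> modulo \<open>q\<close> is
  \<open>p\<close>. It determines the size of the field, makes \<open>V\<close> irreducible, and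
  underlies the dichotomy for groups of order \<open>p ^ p * q\<close>. Normal Sylow subgroups are
  cut out by a torsion condition, so lambda maps preserve those of the additive group; such a
  subgroup fails to be an ideal only by not being normal in the multiplicative group. Only two
  braces survive because the other choices can be absorbed: the root of unity by which
  \<open>t\<close> acts, by reindexing the cyclic factor, and the scalar in front of the trace, by
  rescaling the coordinate on \<open>V\<close>. The passage to the opposite remains: in the model,
  left multiplication by \<open>(0, i)\<close> in the multiplicative group is right addition of
  \<open>(0, i)\<close>, in the opposite it is left addition. The field depends on the ideal
  \<open>P\<close>, so it is not a type; computations are congruences between integer polynomials,
  and the classes are numbered so that the model lives on \<open>nat\<close>.\<close>

locale prime_pair =
  fixes p q :: nat
  assumes p: "prime p" and q: "prime q" and q_dvd: "q dvd (p ^ p - 1) div (p - 1)"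
begin

section \<open>Arithmetic of p modulo q\<close>

lemma p_gt_1: "p > 1" and q_gt_1: "q > 1"
  using p q prime_gt_1_nat by auto

lemma geometric_quotient: "(p ^ p - 1) div (p - 1) = (\<Sum>i<p. p ^ i)"
proof -
  have "int (p ^ p - 1) = int ((p - 1) * (\<Sum>i<p. p ^ i))"
    using p_gt_1 power_diff_1_eq[of "int p" p] by (simp add: of_nat_diff)
  then have "p ^ p - 1 = (p - 1) * (\<Sum>i<p. p ^ i)"
    by (simp only: of_nat_eq_iff)
  then show ?thesis using p_gt_1 by simp
qed

lemma q_dvd_sum: "q dvd (\<Sum>i<p. p ^ i)"
  using q_dvd geometric_quotient by simp

lemma p_pow_p_cong: "[p ^ p = 1] (mod q)"
proof -
  have "int (p ^ p) - 1 = (int p - 1) * int (\<Sum>i<p. p ^ i)"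
    using power_diff_1_eq[of "int p" p] by simp
  moreover have "int q dvd int (\<Sum>i<p. p ^ i)"
    using q_dvd_sum by (simp only: int_dvd_int_iff)
  ultimately have "[int (p ^ p) = int 1] (mod int q)"
    by (simp add: cong_iff_dvd_diff)
  then show ?thesis by (simp only: cong_int_iff)
qed

lemma q_neq_p: "q \<noteq> p"
proof
  assume qp: "q = p"
  have "[p ^ p = 1] (mod p)" using p_pow_p_cong unfolding qp .
  then have "(p ^ p) mod p = 1" unfolding cong_def using mod_less[of 1 p] p_gt_1 by simp
  moreover have "p dvd p ^ p" using p_gt_1 dvd_power[of p p] by simp
  ultimately show False by (metis dvd_imp_mod_0 zero_neq_one)
qed

lemma coprime_p_q: "coprime p q" and coprime_q_p: "coprime q p"
  using p q q_neq_p by (simp_all add: primes_coprime)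

text \<open>This is where divisibility of the quotient, and not just of \<open>p ^ p - 1\<close>,
  matters: if \<open>p\<close> were 1 modulo \<open>q\<close>, the geometric sum would be
  \<open>p\<close> modulo \<open>q\<close>, and \<open>q\<close> would divide
  \<open>p\<close>.\<close>

lemma p_not_cong_1: "\<not> [p = 1] (mod q)"
proof
  assume a: "[p = 1] (mod q)"
  have "[(\<Sum>i<p. p ^ i) = (\<Sum>i<p. 1 ^ i)] (mod q)"
    by (intro cong_sum cong_pow a)
  then have "[p = 0] (mod q)"
    using q_dvd_sum by (simp add: cong_def dvd_eq_mod_eq_0)
  then show False using q_neq_p p q primes_dvd_imp_eq[of q p] by (simp add: cong_0_iff)
qed

text \<open>The order divides the prime \<open>p\<close> and is not 1. The later dimension counts
  rest on this.\<close>

lemma ord_p: "ord q p = p"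
proof -
  have "ord q p dvd p" using p_pow_p_cong ord_divides by blast
  moreover have "ord q p \<noteq> 1" using p_not_cong_1 ord_works[of p q] by auto
  ultimately show ?thesis using p by (auto simp: prime_nat_iff)
qed

lemma p_pow_cong_1_iff: "[p ^ k = 1] (mod q) \<longleftrightarrow> p dvd k"
  using ord_divides[of p k q] ord_p by simp

lemma p_pow_cong_iff: "[p ^ i = p ^ j] (mod q) \<longleftrightarrow> [i = j] (mod p)"
  using order_divides_expdiff[of q p i j] ord_p coprime_q_p by simp

text \<open>This form suits the counting arguments, where \<open>p ^ k - 1\<close> is the number of
  elements moved by a map of period \<open>q\<close> with a single fixed point.\<close>

lemma q_dvd_iff: "q dvd p ^ k - 1 \<longleftrightarrow> p dvd k"
proof -
  have "q dvd p ^ k - 1 \<longleftrightarrow> [p ^ k = 1] (mod q)"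
    using cong_altdef_nat[of 1 "p ^ k" q] p_gt_1 by (simp add: cong_sym_eq)
  then show ?thesis using p_pow_cong_1_iff by simp
qed

lemma q_le: "q \<le> p ^ p - 1"
proof -
  have "q \<le> (p ^ p - 1) div (p - 1)"
    using q_dvd geometric_quotient p_gt_1 by (intro dvd_imp_le) (auto intro!: sum_pos)
  also have "\<dots> \<le> p ^ p - 1" by (rule div_le_dividend)
  finally show ?thesis .
qed

text \<open>Needed for a pigeonhole: \<open>p ^ p\<close> elements conjugate a given element into a
  normal subgroup with only \<open>q\<close> elements.\<close>

lemma q_less: "q < p ^ p"
  using q_le p_gt_1 q_gt_1 by linarith

end

section \<open>Finite sets, groups and ideals\<close>

text \<open>As \<open>q\<close> is prime, the moved points form cycles of length exactly
  \<open>q\<close>; the induction removes one cycle. A bare map suffices, so conjugations,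
  translations of cosets, lambda maps and multiplication by \<open>X\<close> are all covered without
  setting up a group action.\<close>

lemma prime_period_card:
  fixes f :: "'a \<Rightarrow> 'a"
  assumes "finite S" "f ` S \<subseteq> S" "prime q" "\<And>x. x \<in> S \<Longrightarrow> (f ^^ q) x = x"
  shows "q dvd card {x \<in> S. f x \<noteq> x}"
  using assms
proof (induction "card S" arbitrary: S rule: less_induct)
  case less
  show ?case
  proof (cases "{x \<in> S. f x \<noteq> x} = {}")
    case True
    then show ?thesis by (simp only: card.empty dvd_0_right)
  next
    case False
    then obtain x where x: "x \<in> S" "f x \<noteq> x" by blast
    have q0: "q > 0" using less.prems(3) prime_gt_0_nat by blast
    have per: "(f ^^ (n mod q)) x = (f ^^ n) x" for n
      using funpow_mod_eq[of q f x] less.prems(4)[OF x(1)] by simp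
    let ?O = "(\<lambda>k. (f ^^ k) x) ` {..<q}"
    have inS: "(f ^^ k) x \<in> S" for k
      by (induction k) (use x less.prems(2) in auto)
    have perO: "(f ^^ q) ((f ^^ k) x) = (f ^^ k) x" for k
      using less.prems(4)[OF inS] .
    \<comment> \<open>A repetition among the first \<open>q\<close> iterates would make
      \<open>f ^^ (j - i)\<close> fix \<open>x\<close>; since \<open>j - i\<close> is invertible
      modulo \<open>q\<close>, \<open>f\<close> itself would fix \<open>x\<close>.\<close>
    have fixall: False if eq: "(f ^^ i) x = (f ^^ j) x" and ij: "i < j" "j < q" for i j
    proof -
      have "coprime (j - i) q"
        using ij less.prems(3) prime_imp_coprime_nat[of q "j - i"] nat_dvd_not_less[of "j - i" q]
        by (auto simp: coprime_commute)
      then obtain a where a: "[(j - i) * a = 1] (mod q)"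
        using cong_solve_coprime_nat by auto
      have step: "(f ^^ (j - i)) ((f ^^ i) x) = (f ^^ i) x"
      proof -
        have "(f ^^ (j - i + i)) x = (f ^^ j) x" using ij by simp
        then show ?thesis using eq by (simp only: funpow_add comp_apply)
      qed
      have st: "(f ^^ (j - i)) x = x"
      proof -
        have "(f ^^ (q - i)) ((f ^^ (j - i)) ((f ^^ i) x)) = (f ^^ (q - i)) ((f ^^ i) x)"
          using step by simp
        then have "(f ^^ (q - i + (j - i) + i)) x = (f ^^ (q - i + i)) x"
          by (simp add: funpow_add)
        moreover have "q - i + (j - i) + i = (j - i) + q" "q - i + i = q" using ij by auto
        ultimately have "(f ^^ ((j - i) + q)) x = (f ^^ q) x" by (simp add: add.commute)
        then show ?thesis using less.prems(4)[OF x(1)] by (simp add: funpow_add)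
      qed
      have "(f ^^ ((j - i) * n)) x = x" for n
        by (induction n) (simp_all add: funpow_add st)
      then have "(f ^^ (((j - i) * a) mod q)) x = x" using per by simp
      moreover have "((j - i) * a) mod q = 1"
        using a less.prems(3) prime_gt_1_nat[of q] by (simp add: cong_def)
      ultimately show False using x(2) by simp
    qed
    have inj: "inj_on (\<lambda>k. (f ^^ k) x) {..<q}"
      by (rule inj_onI) (metis fixall lessThan_iff linorder_neqE_nat)
    have cardO: "card ?O = q" using card_image[OF inj] by simp
    have OS: "?O \<subseteq> S" using inS by auto
    have fO: "f y \<in> ?O" if y: "y \<in> ?O" for y
    proof -
      obtain k where k: "y = (f ^^ k) x" using y by blast
      have "f y = (f ^^ (Suc k mod q)) x" using per[of "Suc k"] k by simp
      then show ?thesis using q0 by auto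
    qed
    have Omv: "f y \<noteq> y" if y: "y \<in> ?O" for y
    proof
      assume fy: "f y = y"
      obtain k where k: "y = (f ^^ k) x" "k < q" using y by blast
      have "(f ^^ n) y = y" for n by (induction n) (simp_all add: fy)
      then have "(f ^^ (q - k)) y = y" by simp
      moreover have "(f ^^ (q - k)) y = x"
      proof -
        have "(f ^^ (q - k + k)) x = x" using k less.prems(4)[OF x(1)] by simp
        then show ?thesis using k by (simp only: funpow_add comp_apply)
      qed
      ultimately show False using fy x by simp
    qed
    \<comment> \<open>On \<open>S\<close>, \<open>f ^^ (q - 1)\<close> undoes \<open>f\<close>, so
      no point outside the cycle is mapped into it and the complement remains stable.\<close>
    have finv: "y \<in> ?O" if "y \<in> S" "f y \<in> ?O" for y
    proof -
      have "(f ^^ n) (f y) \<in> ?O" for n by (induction n) (use that fO in auto)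
      then have "(f ^^ (q - 1)) (f y) \<in> ?O" .
      moreover have "(f ^^ (q - 1)) (f y) = (f ^^ q) y"
        using q0 by (metis Suc_diff_1 comp_apply funpow_Suc_right)
      ultimately show ?thesis using less.prems(4)[OF that(1)] by simp
    qed
    let ?S = "S - ?O"
    have "card ?S < card S"
    proof (rule psubset_card_mono[OF less.prems(1)])
      have "x = (f ^^ 0) x" by simp
      then have "x \<in> ?O" using q0 by blast
      then show "?S \<subset> S" using x(1) by blast
    qed
    moreover have "f ` ?S \<subseteq> ?S"
    proof (rule image_subsetI)
      show "f y \<in> ?S" if "y \<in> ?S" for y
        using that less.prems(2) finv[of y] by (metis DiffD1 DiffD2 DiffI image_subset_iff)
    qed
    ultimately have "q dvd card {x \<in> ?S. f x \<noteq> x}"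
      using less.hyps[of ?S] less.prems by blast
    moreover have "{x \<in> S. f x \<noteq> x} = {x \<in> ?S. f x \<noteq> x} \<union> ?O" using Omv OS by blast
    moreover have "card ({x \<in> ?S. f x \<noteq> x} \<union> ?O) = card {x \<in> ?S. f x \<noteq> x} + card ?O"
      by (rule card_Un_disjoint) (use less.prems(1) in auto)
    ultimately show ?thesis using cardO by (simp add: dvd_add)
  qed
qed

text \<open>Orbits of a \<open>p\<close>-group have \<open>p\<close>-power size, and those of points
  that are not fixed have size greater than 1. The action is a plain function \<open>a\<close>;
  restricting it to \<open>S\<close> gives the extensional bijections that \<open>BijGroup\<close>
  expects.\<close>

lemma p_group_fixed_points:
  fixes G :: "('a, 'b) monoid_scheme"
  assumes "group G" "order G = p ^ k" "prime p" "finite S"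
    and act: "\<And>g x. g \<in> carrier G \<Longrightarrow> x \<in> S \<Longrightarrow> a g x \<in> S"
    and act1: "\<And>x. x \<in> S \<Longrightarrow> a \<one>\<^bsub>G\<^esub> x = x"
    and actm: "\<And>g h x. g \<in> carrier G \<Longrightarrow> h \<in> carrier G \<Longrightarrow> x \<in> S \<Longrightarrow> a (g \<otimes>\<^bsub>G\<^esub> h) x = a g (a h x)"
  shows "[card S = card {x \<in> S. \<forall>g \<in> carrier G. a g x = x}] (mod p)"
proof -
  interpret G: group G by fact
  let ?\<phi> = "\<lambda>g. restrict (a g) S"
  have bij: "?\<phi> g \<in> Bij S" if g: "g \<in> carrier G" for g
  proof -
    have "bij_betw (a g) S S"
    proof (rule bij_betw_byWitness[where f' = "a (inv\<^bsub>G\<^esub> g)"])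
      show "\<forall>x\<in>S. a (inv\<^bsub>G\<^esub> g) (a g x) = x" "\<forall>x\<in>S. a g (a (inv\<^bsub>G\<^esub> g) x) = x"
        using g actm[symmetric] act1 by simp_all
    qed (use act g G.inv_closed in blast)+
    then show ?thesis by (auto simp: Bij_def cong: bij_betw_cong)
  qed
  have "group_hom G (BijGroup S) ?\<phi>"
  proof (rule group_hom.intro[OF G.group_axioms group_BijGroup], unfold_locales, rule homI)
    show "?\<phi> x \<in> carrier (BijGroup S)" if "x \<in> carrier G" for x
      using bij[OF that] by (simp add: BijGroup_def)
    show "?\<phi> (x \<otimes>\<^bsub>G\<^esub> y) = ?\<phi> x \<otimes>\<^bsub>BijGroup S\<^esub> ?\<phi> y" if "x \<in> carrier G" "y \<in> carrier G" for x y
      using that bij actm act by (auto simp: BijGroup_def compose_def)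
  qed
  then interpret A: group_action G S ?\<phi> by (simp add: group_action_def)
  let ?F = "{x \<in> S. \<forall>g \<in> carrier G. a g x = x}"
  have orb: "orbit G ?\<phi> x = (\<lambda>g. a g x) ` carrier G" if "x \<in> S" for x
    using that by (auto simp: orbit_def)
  have finG: "finite (carrier G)"
    using assms(2,3) by (metis G.order_gt_0_iff_finite power_eq_0_iff prime_gt_0_nat neq0_conv)
  have cardO: "p dvd card (orbit G ?\<phi> x)" if x: "x \<in> S - ?F" for x
  proof -
    have "card (orbit G ?\<phi> x) * card (stabilizer G ?\<phi> x) = p ^ k"
      using A.orbit_stabilizer_theorem[of x] x assms(2) by simp
    then have "card (orbit G ?\<phi> x) dvd p ^ k" by (metis dvd_triv_left)
    then obtain i where i: "card (orbit G ?\<phi> x) = p ^ i"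
      using assms(3) divides_primepow_nat by blast
    moreover have "card (orbit G ?\<phi> x) \<noteq> 1"
    proof
      assume "card (orbit G ?\<phi> x) = 1"
      then have "card ((\<lambda>g. a g x) ` carrier G) = 1" using orb[of x] x by simp
      then obtain y where y: "(\<lambda>g. a g x) ` carrier G = {y}" by (rule card_1_singletonE)
      then have "a \<one>\<^bsub>G\<^esub> x = y" by blast
      then have "y = x" using act1 x by simp
      then show False using y x by blast
    qed
    ultimately show ?thesis by (cases i) auto
  qed
  have part: "partition S (orbits G S ?\<phi>)" by (rule A.orbit_partition)
  have orbs: "orbits G S ?\<phi> = orbit G ?\<phi> ` S" by (auto simp: orbits_def)
  have fixorb: "orbit G ?\<phi> x = {x}" if "x \<in> ?F" for x
    using that orb[of x] act1 G.one_closed by auto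
  have sep: "x \<in> S - ?F \<Longrightarrow> y \<in> orbit G ?\<phi> x \<Longrightarrow> y \<in> S - ?F" for x y
  proof (rule ccontr)
    assume x: "x \<in> S - ?F" and y: "y \<in> orbit G ?\<phi> x" and "y \<notin> S - ?F"
    then have yF: "y \<in> ?F" using orb[of x] act by auto
    obtain g where g: "g \<in> carrier G" "y = a g x" using y orb x by auto
    have "a (inv\<^bsub>G\<^esub> g) y = x" using g x actm[of "inv\<^bsub>G\<^esub> g" g x] act1 by simp
    then have "y = x" using yF g by auto
    then show False using yF x by simp
  qed
  let ?O = "orbit G ?\<phi> ` (S - ?F)"
  have un: "\<Union> ?O = S - ?F"
  proof
    show "\<Union> ?O \<subseteq> S - ?F" using sep by blast
    have "x \<in> orbit G ?\<phi> x" if "x \<in> S - ?F" for x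
      using that by (intro A.orbit_refl) simp
    then show "S - ?F \<subseteq> \<Union> ?O" by blast
  qed
  have "card (\<Union> ?O) = sum card ?O"
  proof (rule card_Union_disjoint)
    show "pairwise disjnt ?O"
    proof (rule pairwiseI, rule ccontr)
      fix C D assume CD: "C \<in> ?O" "D \<in> ?O" "C \<noteq> D" "\<not> disjnt C D"
      then have cd: "C \<in> orbits G S ?\<phi>" "D \<in> orbits G S ?\<phi>" using orbs by auto
      obtain z where z: "z \<in> C" "z \<in> D" using CD(4) by (auto simp: disjnt_def)
      then have "z \<in> S" using cd(1) part by (auto simp: partition_def)
      then show False using part cd z CD(3) unfolding partition_def by metis
    qed
    show "finite A" if "A \<in> ?O" for A
      using that orb finG by auto
  qed
  then have "p dvd card (S - ?F)" using un cardO by (auto intro!: dvd_sum)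
  moreover have "card S = card (S - ?F) + card ?F"
    using assms(4) by (simp add: card_Diff_subset card_mono)
  ultimately show ?thesis by (simp add: cong_def dvd_def) (auto simp: mod_mult_self4)
qed

text \<open>Formulated over a type class so that polynomial arithmetic applies directly; negatives
  are products with -1.\<close>

definition ring_ideal :: "'a::comm_ring_1 set \<Rightarrow> bool" where
  "ring_ideal I \<longleftrightarrow> 0 \<in> I \<and> (\<forall>f\<in>I. \<forall>g\<in>I. f + g \<in> I) \<and> (\<forall>f\<in>I. \<forall>g. g * f \<in> I)"

lemma ring_ideal_zero: "ring_ideal I \<Longrightarrow> 0 \<in> I"
  and ring_ideal_add: "ring_ideal I \<Longrightarrow> f \<in> I \<Longrightarrow> g \<in> I \<Longrightarrow> f + g \<in> I"
  and ring_ideal_mult: "ring_ideal I \<Longrightarrow> f \<in> I \<Longrightarrow> g * f \<in> I"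
  unfolding ring_ideal_def by blast+

text \<open>By Zorn's lemma: if \<open>f\<close> lies outside a maximal \<open>M\<close>, the ideal
  generated by \<open>M\<close> and \<open>f\<close> contains 1, which gives an inverse of
  \<open>f\<close> modulo \<open>M\<close>. Maximality is recorded in this form because it expresses
  that the quotient is a field without forming the quotient.\<close>

lemma maximal_ideal_exists:
  fixes I :: "'a::comm_ring_1 set"
  assumes "ring_ideal I" "1 \<notin> I"
  shows "\<exists>M. ring_ideal M \<and> I \<subseteq> M \<and> 1 \<notin> M \<and> (\<forall>f. f \<notin> M \<longrightarrow> (\<exists>g. g * f - 1 \<in> M))"
proof -
  let ?A = "{J. ring_ideal J \<and> I \<subseteq> J \<and> 1 \<notin> J}"
  have "\<exists>M\<in>?A. \<forall>X\<in>?A. M \<subseteq> X \<longrightarrow> X = M"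
  proof (rule subset_Zorn_nonempty)
    show "?A \<noteq> {}" using assms by blast
    fix C assume C: "C \<noteq> {}" "subset.chain ?A C"
    then have CA: "\<And>J. J \<in> C \<Longrightarrow> J \<in> ?A" and tot: "\<And>J K. J \<in> C \<Longrightarrow> K \<in> C \<Longrightarrow> J \<subseteq> K \<or> K \<subseteq> J"
      by (auto simp: subset_chain_def)
    have "ring_ideal (\<Union> C)"
      unfolding ring_ideal_def
    proof (intro conjI ballI allI)
      show "0 \<in> \<Union> C" using C(1) CA ring_ideal_zero by blast
    next
      fix f g assume "f \<in> \<Union> C" "g \<in> \<Union> C"
      then obtain J K where JK: "J \<in> C" "f \<in> J" "K \<in> C" "g \<in> K" by blast
      then obtain L where L: "L \<in> C" "f \<in> L" "g \<in> L" using tot[of J K] by blast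
      then have "f + g \<in> L" using CA[of L] ring_ideal_add by blast
      then show "f + g \<in> \<Union> C" using L by blast
    next
      fix f g assume "f \<in> \<Union> C"
      then obtain J where J: "J \<in> C" "f \<in> J" by blast
      then have "g * f \<in> J" using CA[of J] ring_ideal_mult by blast
      then show "g * f \<in> \<Union> C" using J by blast
    qed
    moreover have "I \<subseteq> \<Union> C" using C(1) CA by blast
    moreover have "1 \<notin> \<Union> C" using CA by blast
    ultimately show "\<Union> C \<in> ?A" by blast
  qed
  then obtain M where "M \<in> ?A" and max': "\<forall>X\<in>?A. M \<subseteq> X \<longrightarrow> X = M" ..
  then have M: "ring_ideal M" "I \<subseteq> M" "1 \<notin> M" by simp_all
  have max: "X = M" if "ring_ideal X" "I \<subseteq> X" "1 \<notin> X" "M \<subseteq> X" for X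
    using max' that by blast
  have "\<exists>g. g * f - 1 \<in> M" if f: "f \<notin> M" for f
  proof -
    let ?J = "{m + a * f | m a. m \<in> M}"
    have id: "ring_ideal ?J"
      unfolding ring_ideal_def
    proof (intro conjI ballI allI)
      have "0 = 0 + 0 * f" "0 \<in> M" using M(1) by (auto simp: ring_ideal_def)
      then show "0 \<in> ?J" by blast
    next
      fix x y assume "x \<in> ?J" "y \<in> ?J"
      then obtain m a n b where "x = m + a * f" "y = n + b * f" "m \<in> M" "n \<in> M" by blast
      then have "x + y = (m + n) + (a + b) * f" "m + n \<in> M"
        using M(1) by (auto simp: ring_ideal_def algebra_simps)
      then show "x + y \<in> ?J" by blast
    next
      fix x y assume "x \<in> ?J"
      then obtain m a where "x = m + a * f" "m \<in> M" by blast
      then have "y * x = y * m + (y * a) * f" "y * m \<in> M"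
        using M(1) by (auto simp: ring_ideal_def algebra_simps)
      then show "y * x \<in> ?J" by blast
    qed
    have MJ: "M \<subseteq> ?J"
    proof
      fix m assume "m \<in> M"
      then have "m = m + 0 * f \<and> m \<in> M" by simp
      then show "m \<in> ?J" by blast
    qed
    have "f = 0 + 1 * f" "0 \<in> M" using M(1) by (auto simp: ring_ideal_def)
    then have "f \<in> ?J" by blast
    then have "?J \<noteq> M" using f by blast
    then have "1 \<in> ?J" using max[of ?J] id MJ M(2) by blast
    then obtain m a where ma: "1 = m + a * f" "m \<in> M" by blast
    have "(-1) * m \<in> M" using ma(2) M(1) unfolding ring_ideal_def by blast
    moreover have "a * f - 1 = (-1) * m" using ma(1) by (simp add: algebra_simps)
    ultimately show ?thesis by metis
  qed
  then show ?thesis using M by blast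
qed

text \<open>The root bound over the domain modulo \<open>I\<close>, expressed by representatives:
  the elements of \<open>S\<close> are pairwise incongruent, and the leading coefficient 1 keeps the
  degree from dropping modulo \<open>I\<close>.\<close>

lemma monic_root_bound_mod_prime_ideal:
  fixes F :: "'a::idom poly"
  assumes I: "ring_ideal I" "1 \<notin> I" "\<And>x y. x * y \<in> I \<Longrightarrow> x \<in> I \<or> y \<in> I"
    and F: "lead_coeff F = 1" and fin: "finite S"
    and roots: "\<And>x. x \<in> S \<Longrightarrow> poly F x \<in> I"
    and sep: "\<And>x y. x \<in> S \<Longrightarrow> y \<in> S \<Longrightarrow> x - y \<in> I \<Longrightarrow> x = y"
  shows "card S \<le> degree F"
  using F fin roots sep
proof (induction "degree F" arbitrary: F S)
  case 0
  then obtain c where "F = [:c:]" using degree_eq_zeroE by metis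
  then have "F = 1" using 0 by (simp add: one_pCons)
  then have "S = {}" using 0 I by auto
  then show ?case by simp
next
  case (Suc d)
  show ?case
  proof (cases "S = {}")
    case True
    then show ?thesis by simp
  next
    case False
    then obtain a where a: "a \<in> S" by blast
    \<comment> \<open>\<open>a\<close> is a root only modulo \<open>I\<close>, so the value
      \<open>poly F a\<close>, an element of \<open>I\<close>, is subtracted before splitting off
      the linear factor.\<close>
    have "poly (F - [:poly F a:]) a = 0" by simp
    then obtain G where G: "F - [:poly F a:] = [:-a, 1:] * G" using poly_eq_0_iff_dvd by blast
    have Fa: "F = [:-a, 1:] * G + [:poly F a:]" using G by (simp add: algebra_simps)
    have dF: "degree F > 0" using Suc.hyps by simp
    have "degree (F - [:poly F a:]) = degree F" and "lead_coeff (F - [:poly F a:]) = 1"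
    proof -
      have "degree (- [:poly F a:]) < degree F" using dF by simp
      then have "degree (F + - [:poly F a:]) = degree F" by (rule degree_add_eq_left)
      then show dd: "degree (F - [:poly F a:]) = degree F" by (simp only: diff_conv_add_uminus)
      then show "lead_coeff (F - [:poly F a:]) = 1" using dF Suc.prems(1)
        by (simp add: coeff_pCons split: nat.splits)
    qed
    then have G1: "degree ([:-a, 1:] * G) = degree F" "lead_coeff ([:-a, 1:] * G) = 1" using G by simp_all
    then have Gn: "G \<noteq> 0" using dF by auto
    have lG: "lead_coeff G = 1" using G1(2) by (simp only: lead_coeff_mult) simp
    have dG: "degree F = Suc (degree G)" using G1(1) Gn by (subst (asm) degree_mult_eq) simp_all
    have "card (S - {a}) \<le> degree G"
    proof (rule Suc.hyps(1))
      show "d = degree G" using dG Suc.hyps by simp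
      show "finite (S - {a})" using Suc.prems by simp
      show "poly G x \<in> I" if x: "x \<in> S - {a}" for x
      proof -
        have "poly F x = (x - a) * poly G x + poly F a" by (subst Fa) (simp add: algebra_simps)
        moreover have "poly F x + (-1) * poly F a \<in> I"
          using Suc.prems(3)[of x] Suc.prems(3)[of a] x a I(1) unfolding ring_ideal_def by blast
        ultimately have "(x - a) * poly G x \<in> I" by simp
        then show ?thesis using I(3) Suc.prems(4)[of x a] x a by blast
      qed
      show "x = y" if "x \<in> S - {a}" "y \<in> S - {a}" "x - y \<in> I" for x y
        using that Suc.prems(4) by blast
    qed (fact lG)
    moreover have "card S = Suc (card (S - {a}))" using a Suc.prems(2) by (metis card.remove)
    ultimately show ?thesis using dG by simp
  qed
qed

text \<open>A prime \<open>r\<close> dividing the order gives, by Sylow, an element of order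
  \<open>r\<close>, and the exponent condition makes \<open>r\<close> divide
  \<open>p ^ e\<close>.\<close>

lemma prime_power_order_if_exponent:
  fixes G (structure)
  assumes "group G" "finite (carrier G)" "prime p" "\<And>x. x \<in> carrier G \<Longrightarrow> x [^]\<^bsub>G\<^esub> (p ^ e :: nat) = \<one>\<^bsub>G\<^esub>"
  shows "\<exists>k. order G = p ^ k"
proof -
  interpret group G by fact
  have "r = p" if r: "prime r" "r dvd order G" for r
  proof -
    have "\<exists>H. subgroup H G \<and> card H = r ^ 1"
      using sylow_thm[of r G 1 "order G div r"] r assms(2) group_axioms by simp
    then obtain H where H: "subgroup H G" "card H = r" by auto
    then have "finite H" using assms(2) subgroup.subset finite_subset by blast
    moreover have "card H > 1" using H r prime_gt_1_nat by simp
    ultimately obtain x where x: "x \<in> H" "x \<noteq> \<one>"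
      by (metis card_le_Suc0_iff_eq leD One_nat_def subgroup.one_closed H(1))
    interpret H: group "G\<lparr>carrier := H\<rparr>" using H(1) subgroup_imp_group by blast
    have xG: "x \<in> carrier G" using x H subgroup.subset by blast
    have "x [^]\<^bsub>G\<lparr>carrier := H\<rparr>\<^esub> order (G\<lparr>carrier := H\<rparr>) = \<one>\<^bsub>G\<lparr>carrier := H\<rparr>\<^esub>"
      using x by (intro H.pow_order_eq_1) simp
    moreover have "order (G\<lparr>carrier := H\<rparr>) = r" using H by (simp add: Coset.order_def)
    ultimately have "x [^]\<^bsub>G\<lparr>carrier := H\<rparr>\<^esub> r = \<one>" by simp
    with nat_pow_consistent[of x r H] have "x [^] r = \<one>" by (rule trans)
    then have "ord x dvd r" "ord x dvd p ^ e" using pow_eq_id xG assms(4) by auto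
    moreover have "ord x \<noteq> 1" using xG x ord_eq_1 by blast
    ultimately have "r dvd p ^ e" using r(1) by (metis prime_nat_iff)
    then show "r = p" using assms(3) r(1) prime_dvd_power primes_dvd_imp_eq by blast
  qed
  then have "prime_factors (order G) \<subseteq> {p}" by (auto simp: in_prime_factors_iff)
  moreover have "order G \<noteq> 0" using assms(2) order_gt_0_iff_finite by simp
  ultimately have "order G = (\<Prod>r\<in>prime_factors (order G). r ^ multiplicity r (order G))"
    by (simp add: prime_factorization_nat)
  also have "\<dots> = (\<Prod>r\<in>{p}. r ^ multiplicity r (order G))"
    using \<open>prime_factors (order G) \<subseteq> {p}\<close>
    by (intro prod.mono_neutral_left) (auto simp: prime_factors_multiplicity assms(3))
  finally show ?thesis by auto
qed

section \<open>The field with \<open>p\<^sup>p\<close> elements\<close>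

definition X :: "int poly" where "X = [:0, 1:]"

text \<open>The field with \<open>p\<^sup>p\<close> elements is represented by integer polynomials modulo a maximal ideal \<open>P\<close>;
  the class of \<open>X\<close> is a primitive \<open>q\<close>-th root of unity.\<close>
locale finite_field_quotient = prime_pair +
  fixes P :: "int poly set"
  assumes P_ideal: "ring_ideal P" and one_notin_P: "1 \<notin> P"
    and P_inverse: "\<And>f. f \<notin> P \<Longrightarrow> \<exists>g. g * f - 1 \<in> P"
    and p_in_P: "of_nat p \<in> P" and cyclotomic_in_P: "(\<Sum>i<q. X ^ i) \<in> P"
begin

text \<open>Equality in the residue field. \<open>P\<close> is a locale parameter, so the field
  cannot be a type; representatives modulo \<open>P\<close> take its place.\<close>

definition cg :: "int poly \<Rightarrow> int poly \<Rightarrow> bool" (infix "\<simeq>" 50) where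
  "f \<simeq> g \<longleftrightarrow> f - g \<in> P"

lemma P_uminus: "f \<in> P \<Longrightarrow> - f \<in> P"
  using ring_ideal_mult[OF P_ideal, of f "-1"] by simp

lemma P_add: "f \<in> P \<Longrightarrow> g \<in> P \<Longrightarrow> f + g \<in> P"
  using ring_ideal_add[OF P_ideal] .

lemma P_mult: "f \<in> P \<Longrightarrow> g * f \<in> P"
  using ring_ideal_mult[OF P_ideal] .

lemma cg_refl [simp, intro]: "f \<simeq> f"
  using ring_ideal_zero[OF P_ideal] by (simp add: cg_def)

lemma cg_sym: "f \<simeq> g \<Longrightarrow> g \<simeq> f"
  using P_uminus[of "f - g"] by (simp add: cg_def)

lemma cg_trans [trans]: "f \<simeq> g \<Longrightarrow> g \<simeq> h \<Longrightarrow> f \<simeq> h"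
  using P_add[of "f - g" "g - h"] by (simp add: cg_def)

lemma cg_eq_trans [trans]: "f = g \<Longrightarrow> g \<simeq> h \<Longrightarrow> f \<simeq> h"
  and eq_cg_trans [trans]: "f \<simeq> g \<Longrightarrow> g = h \<Longrightarrow> f \<simeq> h"
  by simp_all

lemma cg_commute: "f \<simeq> g \<longleftrightarrow> g \<simeq> f"
  using cg_sym by blast

lemma cg_add: "f \<simeq> f' \<Longrightarrow> g \<simeq> g' \<Longrightarrow> f + g \<simeq> f' + g'"
  using P_add[of "f - f'" "g - g'"] by (simp add: cg_def algebra_simps)

lemma cg_uminus: "f \<simeq> f' \<Longrightarrow> - f \<simeq> - f'"
  using P_uminus[of "f - f'"] by (simp add: cg_def algebra_simps)

lemma cg_diff: "f \<simeq> f' \<Longrightarrow> g \<simeq> g' \<Longrightarrow> f - g \<simeq> f' - g'"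
  using cg_add[of f f' "-g" "-g'"] cg_uminus by simp

lemma cg_mult: "f \<simeq> f' \<Longrightarrow> g \<simeq> g' \<Longrightarrow> f * g \<simeq> f' * g'"
  using P_add[OF P_mult[of "f - f'" g] P_mult[of "g - g'" f']] by (simp add: cg_def algebra_simps)

lemma cg_power: "f \<simeq> f' \<Longrightarrow> f ^ n \<simeq> f' ^ n"
  by (induction n) (auto intro: cg_mult)

lemma cg_sum: "(\<And>i. i \<in> A \<Longrightarrow> f i \<simeq> g i) \<Longrightarrow> sum f A \<simeq> sum g A"
  by (induction A rule: infinite_finite_induct) (auto intro: cg_add)

lemma cg_0_iff: "f \<simeq> 0 \<longleftrightarrow> f \<in> P"
  by (simp add: cg_def)

lemma cg_diff_0_iff: "f - g \<simeq> 0 \<longleftrightarrow> f \<simeq> g"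
  by (simp add: cg_def)

lemma cg_inverse: "\<not> f \<simeq> 0 \<Longrightarrow> \<exists>g. g * f \<simeq> 1"
  using P_inverse by (simp add: cg_def)

lemma not_1_cg_0: "\<not> 1 \<simeq> 0"
  using one_notin_P by (simp add: cg_def)

lemma cg_prime: "f * g \<simeq> 0 \<Longrightarrow> f \<simeq> 0 \<or> g \<simeq> 0"
proof (rule ccontr)
  assume fg: "f * g \<simeq> 0" and "\<not> (f \<simeq> 0 \<or> g \<simeq> 0)"
  then obtain f' where f': "f' * f \<simeq> 1" and g: "\<not> g \<simeq> 0" using cg_inverse by blast
  have "g = 1 * g" by simp
  also have "\<dots> \<simeq> (f' * f) * g" by (intro cg_mult cg_sym[OF f'] cg_refl)
  also have "\<dots> = f' * (f * g)" by (simp add: mult.assoc)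
  also have "\<dots> \<simeq> f' * 0" by (intro cg_mult fg cg_refl)
  finally show False using g by simp
qed

lemma cg_mult_cancel: "f * g \<simeq> f * h \<Longrightarrow> \<not> f \<simeq> 0 \<Longrightarrow> g \<simeq> h"
  using cg_prime[of f "g - h"] cg_diff_0_iff[of "f * g" "f * h"] by (simp add: algebra_simps cg_diff_0_iff)

text \<open>If \<open>p\<close> did not divide an integer in \<open>P\<close>, a Bezout combination
  of the two would put 1 into \<open>P\<close>. So the integers map onto a copy of the prime
  field.\<close>

lemma of_int_cg_iff: "of_int a \<simeq> of_int b \<longleftrightarrow> [a = b] (mod int p)"
proof -
  have "of_int c \<in> P \<longleftrightarrow> int p dvd c" for c
  proof
    assume "int p dvd c"
    then obtain d where "c = d * int p" by (metis dvdE mult.commute)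
    then have "of_int c = of_int d * (of_nat p :: int poly)" by simp
    then show "of_int c \<in> P" using P_mult[OF p_in_P] by simp
  next
    assume c: "of_int c \<in> P"
    show "int p dvd c"
    proof (rule ccontr)
      assume "\<not> int p dvd c"
      then have "coprime (int p) c" using p by (simp add: prime_imp_coprime)
      then obtain u v where uv: "u * int p + v * c = 1" using bezout_int[of "int p" c] by auto
      have "of_int u * of_nat p + of_int v * of_int c \<in> P"
        by (intro P_add P_mult p_in_P c)
      also have "of_int u * of_nat p + of_int v * of_int c = (of_int (u * int p + v * c) :: int poly)"
        by simp
      finally show False using one_notin_P uv by simp
    qed
  qed
  from this[of "a - b"] show ?thesis by (simp add: cg_def cong_iff_dvd_diff)
qed

lemma of_nat_cg_iff: "of_nat a \<simeq> of_nat b \<longleftrightarrow> [a = b] (mod p)"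
  using of_int_cg_iff[of "int a" "int b"] by (simp add: cong_int_iff)

lemma p_cg_0: "of_nat p \<simeq> 0"
  using p_in_P by (simp add: cg_0_iff)

lemma X_power_q: "X ^ q \<simeq> 1"
proof -
  have "X ^ q - 1 = (X - 1) * (\<Sum>i<q. X ^ i)" by (rule power_diff_1_eq)
  then show ?thesis using P_mult[OF cyclotomic_in_P, of "X - 1"] by (simp add: cg_def)
qed

text \<open>If \<open>X\<close> were 1 in the field, the cyclotomic sum would be \<open>q\<close>,
  which is not 0 in characteristic \<open>p\<close>.\<close>

lemma not_X_cg_1: "\<not> X \<simeq> 1"
proof
  assume X1: "X \<simeq> 1"
  have "(\<Sum>i<q. X ^ i) \<simeq> (\<Sum>i<q. 1 ^ i)" by (intro cg_sum cg_power X1)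
  then have "of_nat q \<simeq> (\<Sum>i<q. X ^ i)" by (simp add: cg_sym)
  also have "(\<Sum>i<q. X ^ i) \<simeq> of_nat 0" using cyclotomic_in_P cg_0_iff by simp
  finally have "of_nat q \<simeq> of_nat 0" .
  then have "p dvd q" using of_nat_cg_iff cong_0_iff by blast
  then show False using p q q_neq_p primes_dvd_imp_eq by blast
qed

lemma X_power_mod: "X ^ n \<simeq> X ^ (n mod q)"
proof -
  have "X ^ n = X ^ (q * (n div q) + n mod q)" by simp
  also have "\<dots> = (X ^ q) ^ (n div q) * X ^ (n mod q)" by (simp only: power_add power_mult)
  also have "\<dots> \<simeq> 1 ^ (n div q) * X ^ (n mod q)" by (intro cg_mult cg_power X_power_q cg_refl)
  finally show ?thesis by simp
qed

lemma X_power_cong: "[i = j] (mod q) \<Longrightarrow> X ^ i \<simeq> X ^ j"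
  using X_power_mod[of i] X_power_mod[of j] by (metis cg_sym cg_trans cong_def)

lemma not_X_power_cg_0: "\<not> X ^ n \<simeq> 0"
proof
  assume "X ^ n \<simeq> 0"
  then have "X ^ n * X ^ (q * n - n) \<simeq> 0 * X ^ (q * n - n)" by (intro cg_mult cg_refl)
  moreover have "n + (q * n - n) = q * n" using q_gt_1 by simp
  ultimately have "(X ^ q) ^ n \<simeq> 0" by (simp flip: power_add power_mult)
  moreover have "(X ^ q) ^ n \<simeq> 1 ^ n" by (intro cg_power X_power_q)
  ultimately have "1 \<simeq> 0" using cg_sym cg_trans by (metis power_one)
  then show False using not_1_cg_0 by blast
qed

lemma X_power_cg_1_iff: "X ^ n \<simeq> 1 \<longleftrightarrow> q dvd n"
proof
  assume "q dvd n"
  then show "X ^ n \<simeq> 1" using X_power_cong[of n 0] by (simp add: cong_0_iff)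
next
  assume n: "X ^ n \<simeq> 1"
  show "q dvd n"
  proof (rule ccontr)
    assume "\<not> q dvd n"
    then have "coprime n q" using q prime_imp_coprime_nat coprime_commute by metis
    then obtain m where "[n * m = 1] (mod q)" using cong_solve_coprime_nat by auto
    then have "X ^ (n * m) \<simeq> X ^ 1" by (rule X_power_cong)
    moreover have "X ^ (n * m) \<simeq> 1 ^ m" unfolding power_mult by (intro cg_power n)
    ultimately have "X \<simeq> 1" using cg_sym cg_trans by (metis power_one power_one_right)
    then show False using not_X_cg_1 by blast
  qed
qed

lemma X_power_cg_iff: "X ^ i \<simeq> X ^ j \<longleftrightarrow> [i = j] (mod q)"
proof
  assume ij: "X ^ i \<simeq> X ^ j"
  have *: "[i = j] (mod q)" if "X ^ i \<simeq> X ^ j" "i \<le> j" for i j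
  proof -
    have "X ^ i * X ^ (j - i) \<simeq> X ^ i * 1" using that by (simp add: cg_sym flip: power_add)
    then have "X ^ (j - i) \<simeq> 1" using cg_mult_cancel not_X_power_cg_0 by blast
    then show ?thesis using that X_power_cg_1_iff cong_altdef_nat cong_sym by blast
  qed
  show "[i = j] (mod q)" using *[of i j] *[of j i] ij cg_sym cong_sym by (cases "i \<le> j") auto
qed (rule X_power_cong)

lemma frobenius_add: "(f + g) ^ p \<simeq> f ^ p + g ^ p"
proof -
  have "(f + g) ^ p = (\<Sum>k\<le>p. of_nat (p choose k) * f ^ k * g ^ (p - k))"
    by (rule binomial_ring)
  also have "\<dots> \<simeq> (\<Sum>k\<le>p. if k = 0 then g ^ p else if k = p then f ^ p else 0)"
  proof (rule cg_sum)
    fix k assume k: "k \<in> {..p}"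
    show "of_nat (p choose k) * f ^ k * g ^ (p - k) \<simeq> (if k = 0 then g ^ p else if k = p then f ^ p else 0)"
    proof (cases "k = 0 \<or> k = p")
      case True
      then show ?thesis using p_gt_1 by auto
    next
      case False
      then have "p dvd (p choose k)" using k p by (intro dvd_choose_prime) auto
      then have "of_nat (p choose k) \<simeq> of_nat 0" unfolding of_nat_cg_iff by (simp add: cong_0_iff)
      then have "of_nat (p choose k) * (f ^ k * g ^ (p - k)) \<simeq> of_nat 0 * (f ^ k * g ^ (p - k))"
        by (rule cg_mult) simp
      then show ?thesis using False by (simp add: mult.assoc)
    qed
  qed
  also have "\<dots> = g ^ p + f ^ p"
  proof -
    have "(\<Sum>k\<le>p. if k = 0 then g ^ p else if k = p then f ^ p else 0)
      = (\<Sum>k\<le>p. (if k = 0 then g ^ p else 0) + (if k = p then f ^ p else 0))"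
      using p_gt_1 by (intro sum.cong) auto
    then show ?thesis by (simp add: sum.distrib)
  qed
  finally show ?thesis by (simp add: add.commute)
qed

lemma frobenius_pow_add: "(f + g) ^ (p ^ j) \<simeq> f ^ (p ^ j) + g ^ (p ^ j)"
proof (induction j)
  case (Suc j)
  have pw: "h ^ (p ^ Suc j) = (h ^ (p ^ j)) ^ p" for h :: "int poly"
    by (simp only: power_Suc2 power_mult)
  have "(f + g) ^ (p ^ Suc j) = ((f + g) ^ (p ^ j)) ^ p" by (rule pw)
  also have "\<dots> \<simeq> (f ^ (p ^ j) + g ^ (p ^ j)) ^ p" by (intro cg_power Suc)
  also have "\<dots> \<simeq> (f ^ (p ^ j)) ^ p + (g ^ (p ^ j)) ^ p" by (rule frobenius_add)
  finally show ?case by (simp only: pw)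
qed simp

lemma zero_frobenius_pow: "(0 :: int poly) ^ (p ^ j) = 0"
  using p_gt_1 by (intro zero_power) simp

lemma of_nat_frobenius_pow: "of_nat a ^ (p ^ j) \<simeq> of_nat a"
proof (induction a)
  case (Suc a)
  have "(of_nat (Suc a) :: int poly) ^ (p ^ j) = (of_nat a + 1) ^ (p ^ j)" by (simp add: add.commute)
  also have "\<dots> \<simeq> of_nat a ^ (p ^ j) + 1 ^ (p ^ j)" by (rule frobenius_pow_add)
  also have "\<dots> \<simeq> of_nat a + 1" by (intro cg_add Suc) simp
  finally show ?case by (simp add: add.commute)
qed (simp add: zero_frobenius_pow)

lemma of_int_cg_of_nat: "of_int a \<simeq> of_nat (nat (a mod int p))"
proof -
  have "of_int a \<simeq> of_int (a mod int p)" by (simp only: of_int_cg_iff cong_mod_right cong_refl)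
  also have "of_int (a mod int p) = (of_nat (nat (a mod int p)) :: int poly)"
    using p_gt_1 by (subst of_nat_nat) simp_all
  finally show ?thesis .
qed

lemma of_int_frobenius_pow: "of_int a ^ (p ^ j) \<simeq> of_int a"
  using cg_power[OF of_int_cg_of_nat[of a], of "p ^ j"] of_nat_frobenius_pow of_int_cg_of_nat cg_sym cg_trans
  by meson

lemma frobenius_pow_sum: "(\<Sum>i\<in>A. f i) ^ (p ^ j) \<simeq> (\<Sum>i\<in>A. f i ^ (p ^ j))"
proof (induction A rule: infinite_finite_induct)
  case (insert x A)
  have "(\<Sum>i\<in>insert x A. f i) ^ (p ^ j) \<simeq> f x ^ (p ^ j) + (\<Sum>i\<in>A. f i) ^ (p ^ j)"
    using insert frobenius_pow_add by simp
  also have "\<dots> \<simeq> f x ^ (p ^ j) + (\<Sum>i\<in>A. f i ^ (p ^ j))" by (intro cg_add insert cg_refl)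
  finally show ?case using insert by simp
qed (simp_all add: zero_frobenius_pow)

lemma frobenius_pow_uminus: "(- f) ^ (p ^ j) \<simeq> - (f ^ (p ^ j))"
proof -
  have "f ^ (p ^ j) + (- f) ^ (p ^ j) \<simeq> 0"
    using frobenius_pow_add[of f "-f" j] cg_sym by (simp add: zero_frobenius_pow)
  then show ?thesis by (simp add: cg_def add.commute)
qed

lemma frobenius_pow_diff: "(f - g) ^ (p ^ j) \<simeq> f ^ (p ^ j) - g ^ (p ^ j)"
  using cg_trans[OF frobenius_pow_add[of f "-g" j] cg_add[OF cg_refl frobenius_pow_uminus]] by simp

lemma poly_as_X: "pCons a f = of_int a + X * f"
  by (simp add: X_def of_int_poly)

text \<open>Horner's scheme: the field is generated by \<open>X\<close> over the prime field, so an
  additive identity that is compatible with multiplication by \<open>X\<close> propagates to all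
  elements.\<close>

lemma poly_X_induct [case_names step zero]:
  assumes "\<And>a f. Q f \<Longrightarrow> Q (of_int a + X * f)" "Q 0"
  shows "Q f"
  by (induction f) (simp_all add: assms poly_as_X del: pCons_eq_iff)

text \<open>It holds for the generator since \<open>p ^ p\<close> is 1 modulo \<open>q\<close>, and
  iterates of the \<open>p\<close>-power map are additive. This bounds the size of the field before
  the size is known.\<close>

lemma power_p_p: "f ^ (p ^ p) \<simeq> f"
proof (induction f rule: poly_X_induct)
  case (step a f)
  have "(of_int a + X * f) ^ (p ^ p) \<simeq> of_int a ^ (p ^ p) + (X * f) ^ (p ^ p)" by (rule frobenius_pow_add)
  also have "\<dots> = of_int a ^ (p ^ p) + X ^ (p ^ p) * f ^ (p ^ p)" by (simp add: power_mult_distrib)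
  also have "\<dots> \<simeq> of_int a + X ^ 1 * f"
    by (intro cg_add cg_mult of_int_frobenius_pow step X_power_cong p_pow_p_cong)
  finally show ?case by simp
qed (simp add: zero_frobenius_pow)

lemma frobenius_pow_cong: "[i = j] (mod p) \<Longrightarrow> f ^ (p ^ i) \<simeq> f ^ (p ^ j)"
proof -
  have *: "f ^ (p ^ (i + p * k)) \<simeq> f ^ (p ^ i)" for i k
  proof (induction k)
    case (Suc k)
    have "f ^ (p ^ (i + p * Suc k)) = (f ^ (p ^ p)) ^ (p ^ (i + p * k))"
      by (simp add: power_add algebra_simps flip: power_mult)
    also have "\<dots> \<simeq> f ^ (p ^ (i + p * k))" by (intro cg_power power_p_p)
    finally show ?case using Suc cg_trans by blast
  qed simp
  assume "[i = j] (mod p)"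
  then show ?thesis using *[of "i mod p" "i div p"] *[of "j mod p" "j div p"]
    by (metis cg_sym cg_trans cong_def mod_mult_div_eq)
qed

text \<open>A nonzero additive subgroup stable under multiplication by \<open>X\<close> is an ideal
  of the field, hence everything. This forces a brace ideal of the model that meets the first factor
  nontrivially to contain that factor.\<close>

lemma X_module_generates:
  assumes "\<And>f g. f \<in> S \<Longrightarrow> g \<in> S \<Longrightarrow> f + g \<in> S" "\<And>f g. f \<in> S \<Longrightarrow> f \<simeq> g \<Longrightarrow> g \<in> S"
    "\<And>f. f \<in> S \<Longrightarrow> X * f \<in> S" "f \<in> S" "\<not> f \<simeq> 0"
  shows "g \<in> S"
proof -
  have nat: "of_nat n * f \<in> S" if "n > 0" "f \<in> S" for n :: nat and f
    using that by (induction n rule: nat_induct_non_zero) (auto simp: algebra_simps intro: assms(1))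
  \<comment> \<open>Closure under sums alone gives 0 as the \<open>p\<close>-fold sum of
    \<open>f\<close>, and then all integer multiples through their residues modulo
    \<open>p\<close>.\<close>
  have zero: "0 \<in> S"
  proof -
    have "of_nat p * f \<simeq> 0 * f" by (intro cg_mult p_cg_0 cg_refl)
    then show ?thesis using nat[OF _ assms(4), of p] p_gt_1 assms(2) by simp
  qed
  have int: "of_int a * f \<in> S" if "f \<in> S" for a f
  proof -
    have "of_nat (nat (a mod int p)) * f \<in> S"
      using nat[OF _ that, of "nat (a mod int p)"] zero
      by (cases "nat (a mod int p)") (simp_all del: of_nat_nat of_nat_Suc)
    moreover have "of_nat (nat (a mod int p)) * f \<simeq> of_int a * f"
      by (intro cg_mult cg_refl cg_sym[OF of_int_cg_of_nat])
    ultimately show ?thesis by (rule assms(2))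
  qed
  have "h * f \<in> S" for h
  proof (induction h rule: poly_X_induct)
    case (step a h)
    then show ?case using int[OF assms(4), of a] assms(1)[OF _ assms(3)[OF step]]
      by (simp add: algebra_simps)
  qed (use zero in simp)
  moreover obtain f' where "f' * f \<simeq> 1" using cg_inverse assms(5) by blast
  then have "(g * f') * f \<simeq> g" using cg_mult[OF cg_refl, of "f' * f" 1 g] by (simp add: mult.assoc)
  ultimately show ?thesis using assms(2) by blast
qed

lemma power_fixed_card:
  assumes "finite S" "N > 1" "\<And>f. f \<in> S \<Longrightarrow> f ^ N \<simeq> f"
    "\<And>f g. f \<in> S \<Longrightarrow> g \<in> S \<Longrightarrow> f \<simeq> g \<Longrightarrow> f = g"
  shows "card S \<le> N"
proof -
  let ?F = "monom 1 N - monom 1 1 :: int poly poly"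
  have dF: "degree ?F = N"
  proof -
    have "degree (- monom 1 1 :: int poly poly) < degree (monom 1 N :: int poly poly)"
      using assms(2) by (simp add: degree_monom_eq)
    then show ?thesis using degree_add_eq_left[of "- monom 1 1 :: int poly poly" "monom 1 N"]
      by (simp add: degree_monom_eq)
  qed
  have "card S \<le> degree ?F"
  proof (rule monic_root_bound_mod_prime_ideal[OF P_ideal one_notin_P])
    show "x \<in> P \<or> y \<in> P" if "x * y \<in> P" for x y using cg_prime that cg_0_iff by blast
    show "lead_coeff ?F = 1" unfolding dF using assms(2) by simp
    show "poly ?F x \<in> P" if "x \<in> S" for x
      using assms(3)[OF that] by (simp add: poly_monom cg_def)
  qed (use assms cg_def in auto)
  then show ?thesis using dF by simp
qed

text \<open>The residues below \<open>p\<close> already provide \<open>p\<close> incongruent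
  solutions of \<open>g ^ p = g\<close>; \<open>f\<close> would be one more.\<close>

lemma frobenius_fixed:
  assumes "f ^ p \<simeq> f"
  shows "\<exists>c<p. f \<simeq> of_nat c"
proof (rule ccontr)
  assume neg: "\<not> ?thesis"
  let ?S = "insert f (of_nat ` {..<p})"
  have inj: "c = d" if "of_nat c \<simeq> of_nat d" "c < p" "d < p" for c d
    using that of_nat_cg_iff cong_less_modulus_unique_nat by blast
  have "inj_on (of_nat :: nat \<Rightarrow> int poly) {..<p}" by (auto intro: inj_onI)
  then have "card (of_nat ` {..<p} :: int poly set) = p" by (simp add: card_image)
  moreover have "f \<notin> of_nat ` {..<p}" using neg by auto
  ultimately have "card ?S = Suc p" by simp
  moreover have "card ?S \<le> p"
  proof (rule power_fixed_card)
    show "g ^ p \<simeq> g" if "g \<in> ?S" for g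
      using that assms of_nat_frobenius_pow[of _ 1] by auto
    show "g = h" if "g \<in> ?S" "h \<in> ?S" "g \<simeq> h" for g h
      using that inj neg cg_sym by auto
  qed (use p_gt_1 in auto)
  ultimately show False by simp
qed

section \<open>Trace and Frobenius\<close>

definition Tr :: "int poly \<Rightarrow> int poly" where "Tr f = (\<Sum>j<p. f ^ (p ^ j))"

lemma Tr_cong: "f \<simeq> g \<Longrightarrow> Tr f \<simeq> Tr g"
  unfolding Tr_def by (intro cg_sum cg_power)

lemma Tr_add: "Tr (f + g) \<simeq> Tr f + Tr g"
proof -
  have "Tr (f + g) \<simeq> (\<Sum>j<p. f ^ (p ^ j) + g ^ (p ^ j))"
    unfolding Tr_def by (intro cg_sum frobenius_pow_add)
  then show ?thesis by (simp add: Tr_def sum.distrib)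
qed

lemma Tr_of_nat_mult: "Tr (of_nat a * f) \<simeq> of_nat a * Tr f"
proof -
  have "Tr (of_nat a * f) = (\<Sum>j<p. of_nat a ^ (p ^ j) * f ^ (p ^ j))"
    by (simp add: Tr_def power_mult_distrib)
  also have "\<dots> \<simeq> (\<Sum>j<p. of_nat a * f ^ (p ^ j))"
    by (intro cg_sum cg_mult of_nat_frobenius_pow cg_refl)
  finally show ?thesis by (simp add: Tr_def sum_distrib_left)
qed

lemma frobenius_Suc: "(f :: int poly) ^ (p ^ Suc j) = (f ^ (p ^ j)) ^ p"
  by (simp only: power_Suc2 power_mult)

lemma Tr_shift: "(\<Sum>j<p. f ^ (p ^ Suc j)) \<simeq> Tr f"
proof -
  have "f ^ (p ^ 0) + (\<Sum>j<p. f ^ (p ^ Suc j)) = (\<Sum>j<p. f ^ (p ^ j)) + f ^ (p ^ p)"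
    using sum.lessThan_Suc[of "\<lambda>j. f ^ (p ^ j)" p] sum.lessThan_Suc_shift[of "\<lambda>j. f ^ (p ^ j)" p] by (rule trans[OF sym, rotated])
  also have "\<dots> \<simeq> (\<Sum>j<p. f ^ (p ^ j)) + f" by (intro cg_add power_p_p cg_refl)
  finally show ?thesis by (simp add: Tr_def cg_def algebra_simps)
qed

lemma Tr_power_p: "(Tr f) ^ p \<simeq> Tr f"
proof -
  have "(\<Sum>j<p. f ^ (p ^ j)) ^ (p ^ 1) \<simeq> (\<Sum>j<p. (f ^ (p ^ j)) ^ (p ^ 1))"
    by (rule frobenius_pow_sum)
  also have "\<dots> = (\<Sum>j<p. f ^ (p ^ Suc j))" by (simp only: frobenius_Suc power_one_right)
  also have "\<dots> \<simeq> Tr f" by (rule Tr_shift)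
  finally show ?thesis by (simp add: Tr_def)
qed

lemma Tr_frobenius: "Tr (f ^ (p ^ j)) \<simeq> Tr f"
proof (induction j)
  case (Suc j)
  have "Tr (f ^ (p ^ Suc j)) = (\<Sum>i<p. (f ^ (p ^ j)) ^ (p ^ Suc i))"
    unfolding Tr_def by (intro sum.cong refl) (simp add: mult_ac flip: power_mult)
  also have "\<dots> \<simeq> Tr (f ^ (p ^ j))" by (rule Tr_shift)
  finally show ?case using Suc cg_trans by blast
qed simp

text \<open>The trace as a residue below \<open>p\<close>, so that it can serve as an exponent of
  the Frobenius map.\<close>

definition trace_index :: "int poly \<Rightarrow> nat" where
  "trace_index f = (SOME c. c < p \<and> Tr f \<simeq> of_nat c)"

lemma trace_index: "trace_index f < p" "Tr f \<simeq> of_nat (trace_index f)"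
proof -
  have "\<exists>c. c < p \<and> Tr f \<simeq> of_nat c" using frobenius_fixed[OF Tr_power_p] by blast
  from someI_ex[OF this] show "trace_index f < p" "Tr f \<simeq> of_nat (trace_index f)"
    unfolding trace_index_def by blast+
qed

lemma trace_index_cong_iff: "[trace_index f = c] (mod p) \<longleftrightarrow> Tr f \<simeq> of_nat c"
  using trace_index(2)[of f] of_nat_cg_iff cg_sym cg_trans by meson

lemma trace_index_eqI: "Tr f \<simeq> of_nat c \<Longrightarrow> c < p \<Longrightarrow> trace_index f = c"
  using trace_index_cong_iff trace_index(1) cong_less_modulus_unique_nat by blast

lemma trace_index_cong: "f \<simeq> g \<Longrightarrow> trace_index f = trace_index g"
  using trace_index_eqI[OF cg_trans[OF Tr_cong trace_index(2)] trace_index(1)] .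

lemma trace_index_add: "[trace_index (f + g) = trace_index f + trace_index g] (mod p)"
  unfolding trace_index_cong_iff
  using cg_trans[OF Tr_add[of f g] cg_add[OF trace_index(2)[of f] trace_index(2)[of g]]] by simp

lemma trace_index_of_nat_mult: "[trace_index (of_nat a * f) = a * trace_index f] (mod p)"
  unfolding trace_index_cong_iff
  using cg_trans[OF Tr_of_nat_mult[of a f] cg_mult[OF cg_refl trace_index(2)[of f]]] by simp

lemma trace_index_frobenius: "trace_index (f ^ (p ^ j)) = trace_index f"
  using trace_index_eqI[OF cg_trans[OF Tr_frobenius trace_index(2)] trace_index(1)] .

lemma q_not_cg_0: "\<not> of_nat q \<simeq> 0"
proof
  assume "of_nat q \<simeq> 0"
  then have "of_nat q \<simeq> of_nat 0" by simp
  then have "p dvd q" using of_nat_cg_iff cong_0_iff by blast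
  then show False using p q q_neq_p primes_dvd_imp_eq by blast
qed

text \<open>Orthogonality of the characters of the cyclic group of order \<open>q\<close>: for
  \<open>k\<close> prime to \<open>q\<close> this is a geometric series of a \<open>q\<close>-th
  root of unity other than 1.\<close>

lemma X_power_sum: "(\<Sum>i<q. X ^ (i * k)) \<simeq> (if q dvd k then of_nat q else 0)"
proof (cases "q dvd k")
  case True
  have "(\<Sum>i<q. X ^ (i * k)) \<simeq> (\<Sum>i<q. 1)"
    using True by (intro cg_sum) (simp add: X_power_cg_1_iff)
  then show ?thesis using True by simp
next
  case False
  have "(X ^ k - 1) * (\<Sum>i<q. (X ^ k) ^ i) = (X ^ k) ^ q - 1" by (rule power_diff_1_eq[symmetric])
  moreover have "(X ^ k) ^ q \<simeq> 1" by (simp add: X_power_cg_1_iff flip: power_mult)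
  ultimately have "(X ^ k - 1) * (\<Sum>i<q. (X ^ k) ^ i) \<simeq> 0" by (simp add: cg_diff_0_iff)
  moreover have "\<not> X ^ k - 1 \<simeq> 0" using False by (simp add: cg_diff_0_iff X_power_cg_1_iff)
  ultimately have "(\<Sum>i<q. (X ^ k) ^ i) \<simeq> 0" using cg_prime by blast
  then show ?thesis using False by (simp add: mult.commute flip: power_mult)
qed

text \<open>The natural number \<open>q - 1\<close> plays the part of the exponent -1.\<close>

lemma q_dvd_shift_iff: "q dvd q - 1 + m \<longleftrightarrow> [m = 1] (mod q)"
proof -
  have "[m = 1] (mod q) \<longleftrightarrow> [(q - 1) + m = (q - 1) + 1] (mod q)"
    by (simp only: cong_add_lcancel_nat)
  also have "(q - 1) + 1 = q" using q_gt_1 by simp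
  finally show ?thesis by (simp add: cong_def dvd_eq_mod_eq_0)
qed

text \<open>The inner sum is the trace of \<open>X ^ (i * m)\<close>, so the left side is the
  Fourier coefficient of that trace, as a function of \<open>i\<close>, at the character
  \<open>X ^ i\<close>. By orthogonality it counts, with weight \<open>q\<close>, the conjugates of
  \<open>X ^ m\<close> that equal \<open>X\<close>.\<close>

lemma double_sum: 
  "(\<Sum>i<q. X ^ (i * (q - 1)) * (\<Sum>j<p. X ^ (i * (m * p ^ j)))) \<simeq>
   (\<Sum>j<p. if [m * p ^ j = 1] (mod q) then of_nat q else 0)"
proof -
  have "(\<Sum>i<q. X ^ (i * (q - 1)) * (\<Sum>j<p. X ^ (i * (m * p ^ j))))
     = (\<Sum>i<q. \<Sum>j<p. X ^ (i * (q - 1 + m * p ^ j)))"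
    by (simp only: sum_distrib_left power_add[symmetric] distrib_left)
  also have "\<dots> = (\<Sum>j<p. \<Sum>i<q. X ^ (i * (q - 1 + m * p ^ j)))" by (rule sum.swap)
  also have "\<dots> \<simeq> (\<Sum>j<p. if q dvd q - 1 + m * p ^ j then of_nat q else 0)"
    by (intro cg_sum X_power_sum)
  finally show ?thesis by (simp only: q_dvd_shift_iff)
qed

lemma Tr_X_power: "Tr (X ^ i) = (\<Sum>j<p. X ^ (i * p ^ j))"
  by (simp add: Tr_def power_mult)

lemma Tr_X_double_sum: "(\<Sum>i<q. X ^ (i * (q - 1)) * Tr (X ^ i)) \<simeq> of_nat q"
proof -
  have "[1 * p ^ j = 1] (mod q) \<longleftrightarrow> j = 0" if "j < p" for j
    using that p_pow_cong_1_iff[of j] by (auto dest: dvd_imp_le)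
  then have "(\<Sum>j<p. if [1 * p ^ j = 1] (mod q) then of_nat q else 0) = (\<Sum>j<p. if j = 0 then of_nat q else 0)"
    by (intro sum.cong) auto
  also have "\<dots> = of_nat q" using p_gt_1 by simp
  finally have *: "(\<Sum>j<p. if [1 * p ^ j = 1] (mod q) then of_nat q else 0) = (of_nat q :: int poly)" .
  show ?thesis using double_sum[of 1] unfolding * by (simp add: Tr_X_power)
qed

text \<open>If the traces of all powers of \<open>X\<close> vanished, so would their Fourier
  coefficient \<open>q\<close>, which is nonzero in the field. A nonzero trace lies in the prime
  field and can be scaled to 1.\<close>

lemma exists_trace_1: "\<exists>f. Tr f \<simeq> 1"
proof -
  have "\<exists>i. \<not> Tr (X ^ i) \<simeq> 0"
  proof (rule ccontr)
    assume "\<not> ?thesis"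
    then have "Tr (X ^ i) \<simeq> 0" for i by blast
    then have "(\<Sum>i<q. X ^ (i * (q - 1)) * Tr (X ^ i)) \<simeq> (\<Sum>i<q. X ^ (i * (q - 1)) * 0)"
      by (intro cg_sum cg_mult cg_refl)
    then have "(\<Sum>i<q. X ^ (i * (q - 1)) * Tr (X ^ i)) \<simeq> 0" by simp
    then show False using q_not_cg_0 cg_trans[OF cg_sym[OF Tr_X_double_sum]] by blast
  qed
  then obtain i where i: "\<not> Tr (X ^ i) \<simeq> 0" by blast
  let ?c = "trace_index (X ^ i)"
  have "\<not> [?c = 0] (mod p)" using i trace_index_cong_iff[of "X ^ i" 0] by simp
  then have "coprime ?c p" using p prime_imp_coprime_nat coprime_commute cong_0_iff by metis
  then obtain d where d: "[?c * d = 1] (mod p)" using cong_solve_coprime_nat by auto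
  have "Tr (of_nat d * X ^ i) \<simeq> of_nat 1"
    using trace_index_of_nat_mult[of d "X ^ i"] d cong_trans
    unfolding trace_index_cong_iff[symmetric] by (metis mult.commute)
  then show ?thesis by auto
qed

text \<open>Additive form of Hilbert's Theorem 90, with the classical explicit solution.\<close>
lemma trace_0_imp_difference:
  assumes "Tr f \<simeq> 0"
  shows "\<exists>g. f \<simeq> g - g ^ p"
proof -
  obtain t where t: "Tr t \<simeq> 1" using exists_trace_1 by blast
  \<comment> \<open>Partial sums of the trace, with \<open>s 0 = 0\<close> and
    \<open>s p = Tr f\<close>. Since \<open>s i ^ p\<close> is \<open>s (Suc i) - f\<close>, the
    Frobenius map shifts the sum \<open>g\<close> by one index and subtracts
    \<open>f * Tr t\<close>, which is \<open>f\<close>; both boundary terms vanish.\<close>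
  define s where "s i = (\<Sum>l<i. f ^ (p ^ l))" for i
  define g where "g = (\<Sum>i<p. s i * t ^ (p ^ i))"
  have sp: "(s i) ^ p \<simeq> s (Suc i) - f" for i
  proof -
    have "(s i) ^ (p ^ 1) \<simeq> (\<Sum>l<i. (f ^ (p ^ l)) ^ (p ^ 1))" unfolding s_def by (rule frobenius_pow_sum)
    also have "\<dots> = s (Suc i) - f" unfolding s_def
      by (simp only: sum.lessThan_Suc_shift frobenius_Suc power_one_right) simp
    finally show ?thesis by simp
  qed
  have "g ^ p = (\<Sum>i<p. s i * t ^ (p ^ i)) ^ (p ^ 1)" by (simp add: g_def)
  also have "\<dots> \<simeq> (\<Sum>i<p. (s i * t ^ (p ^ i)) ^ (p ^ 1))" by (rule frobenius_pow_sum)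
  also have "\<dots> = (\<Sum>i<p. (s i) ^ p * t ^ (p ^ Suc i))"
    by (simp only: power_mult_distrib frobenius_Suc power_one_right)
  also have "\<dots> \<simeq> (\<Sum>i<p. (s (Suc i) - f) * t ^ (p ^ Suc i))" by (intro cg_sum cg_mult sp cg_refl)
  also have "\<dots> = (\<Sum>i<p. s (Suc i) * t ^ (p ^ Suc i)) - f * (\<Sum>i<p. t ^ (p ^ Suc i))"
    by (simp only: left_diff_distrib sum_subtractf sum_distrib_left)
  also have "(\<Sum>i<p. s (Suc i) * t ^ (p ^ Suc i)) = g + s p * t ^ (p ^ p)"
  proof -
    have "s 0 * t ^ (p ^ 0) + (\<Sum>i<p. s (Suc i) * t ^ (p ^ Suc i)) = (\<Sum>i<p. s i * t ^ (p ^ i)) + s p * t ^ (p ^ p)"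
      using sum.lessThan_Suc[of "\<lambda>i. s i * t ^ (p ^ i)" p] sum.lessThan_Suc_shift[of "\<lambda>i. s i * t ^ (p ^ i)" p]
      by (rule trans[OF sym, rotated])
    moreover have "s 0 = 0" by (simp add: s_def)
    ultimately show ?thesis by (simp add: g_def)
  qed
  also have "g + s p * t ^ (p ^ p) - f * (\<Sum>i<p. t ^ (p ^ Suc i)) \<simeq> g + 0 * t ^ (p ^ p) - f * 1"
  proof (intro cg_diff cg_add cg_mult cg_refl)
    show "s p \<simeq> 0" using assms by (simp add: s_def Tr_def)
    show "(\<Sum>i<p. t ^ (p ^ Suc i)) \<simeq> 1" using Tr_shift t cg_trans by blast
  qed
  finally have "g ^ p \<simeq> g - f" by simp
  then have "f \<simeq> g - g ^ p" by (simp add: cg_def P_uminus) (metis P_uminus minus_diff_eq diff_diff_eq2 add.commute diff_diff_add)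
  then show ?thesis by blast
qed

text \<open>The integer \<open>Tr (X ^ i)\<close> is fixed by \<open>L\<close>, so the character sums \<open>\<Sum>\<^sub>j X ^ (i * p ^ j)\<close> and
  \<open>\<Sum>\<^sub>j X ^ (i * m * p ^ j)\<close> agree for all \<open>i\<close>; orthogonality then forces \<open>m\<close> to be a power of \<open>p\<close>.\<close>
lemma semilinear_is_frobenius:
  assumes cong: "\<And>f g. f \<simeq> g \<Longrightarrow> L f \<simeq> L g" and add: "\<And>f g. L (f + g) \<simeq> L f + L g"
    and mult: "\<And>f. L (X * f) \<simeq> X ^ m * L f" and one: "L 1 \<simeq> 1"
  shows "\<exists>a<p. [m = p ^ a] (mod q) \<and> (\<forall>f. L f \<simeq> f ^ (p ^ a))"
proof -
  have LX: "L (X ^ i) \<simeq> X ^ (m * i)" for i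
  proof (induction i)
    case (Suc i)
    have "L (X ^ Suc i) \<simeq> X ^ m * L (X ^ i)" using mult by simp
    also have "\<dots> \<simeq> X ^ m * X ^ (m * i)" by (intro cg_mult Suc cg_refl)
    finally show ?case by (simp add: power_add)
  qed (use one in simp)
  have L0: "L 0 \<simeq> 0" using add[of 0 0] by (simp add: cg_def P_uminus) (metis P_uminus add.inverse_inverse)
  have Ln: "L (of_nat c) \<simeq> of_nat c" for c
  proof (induction c)
    case (Suc c)
    have "L (of_nat c + 1) \<simeq> L (of_nat c) + L 1" by (rule add)
    also have "\<dots> \<simeq> of_nat c + 1" by (intro cg_add Suc one)
    finally show ?case by (simp add: add.commute)
  qed (use L0 in simp)
  have Ls: "L (sum f A) \<simeq> (\<Sum>i\<in>A. L (f i))" if "finite A" for f and A :: "nat set"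
    using that
  proof induction
    case (insert x A)
    then have "L (sum f (insert x A)) \<simeq> L (f x) + L (sum f A)" using add by simp
    also have "\<dots> \<simeq> L (f x) + (\<Sum>i\<in>A. L (f i))" by (intro cg_add insert cg_refl)
    finally show ?case using insert by simp
  qed (use L0 in simp)
  have TrL: "Tr (X ^ i) \<simeq> (\<Sum>j<p. X ^ (i * (m * p ^ j)))" for i
  proof -
    have "Tr (X ^ i) \<simeq> of_nat (trace_index (X ^ i))" by (rule trace_index)
    also have "\<dots> \<simeq> L (of_nat (trace_index (X ^ i)))" by (rule cg_sym[OF Ln])
    also have "\<dots> \<simeq> L (Tr (X ^ i))" by (intro cong cg_sym[OF trace_index(2)])
    also have "\<dots> \<simeq> (\<Sum>j<p. L (X ^ (i * p ^ j)))" unfolding Tr_X_power by (intro Ls) simp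
    also have "\<dots> \<simeq> (\<Sum>j<p. X ^ (m * (i * p ^ j)))" by (intro cg_sum LX)
    finally show ?thesis by (simp add: mult_ac)
  qed
  have "\<exists>j<p. [m * p ^ j = 1] (mod q)"
  proof (rule ccontr)
    assume neg: "\<not> ?thesis"
    have "of_nat q \<simeq> (\<Sum>i<q. X ^ (i * (q - 1)) * Tr (X ^ i))" by (rule cg_sym[OF Tr_X_double_sum])
    also have "\<dots> \<simeq> (\<Sum>i<q. X ^ (i * (q - 1)) * (\<Sum>j<p. X ^ (i * (m * p ^ j))))"
      by (intro cg_sum cg_mult TrL cg_refl)
    also have "\<dots> \<simeq> (\<Sum>j<p. if [m * p ^ j = 1] (mod q) then of_nat q else 0)" by (rule double_sum)
    also have "\<dots> = 0" using neg by (intro sum.neutral) auto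
    finally show False using q_not_cg_0 by blast
  qed
  then obtain j where j: "j < p" "[m * p ^ j = 1] (mod q)" by blast
  \<comment> \<open>The exponent \<open>- j\<close> modulo \<open>p\<close>; the outer
    \<open>mod p\<close> matters when \<open>j = 0\<close>.\<close>
  define a where "a = (p - j) mod p"
  have "[a + j = 0] (mod p)" using j by (simp add: a_def cong_def mod_add_left_eq)
  then have "[p ^ (a + j) = 1] (mod q)" using p_pow_cong_1_iff cong_0_iff by blast
  then have "[m * p ^ (a + j) = m * 1] (mod q)" by (intro cong_mult cong_refl)
  moreover have "[(m * p ^ j) * p ^ a = 1 * p ^ a] (mod q)" by (intro cong_mult cong_refl j)
  moreover have "m * p ^ (a + j) = (m * p ^ j) * p ^ a" by (simp add: power_add)
  ultimately have m: "[m = p ^ a] (mod q)" by (metis cong_sym cong_trans mult_1 mult.right_neutral)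
  have "L f \<simeq> f ^ (p ^ a)" for f
  proof (induction f rule: poly_X_induct)
    case (step b f)
    have "L (of_int b) \<simeq> L (of_nat (nat (b mod int p)))" by (intro cong of_int_cg_of_nat)
    also have "\<dots> \<simeq> of_nat (nat (b mod int p))" by (rule Ln)
    also have "\<dots> \<simeq> of_int b" by (rule cg_sym[OF of_int_cg_of_nat])
    finally have Lb: "L (of_int b) \<simeq> of_int b" .
    have "L (of_int b + X * f) \<simeq> L (of_int b) + L (X * f)" by (rule add)
    also have "\<dots> \<simeq> of_int b + X ^ m * L f" by (intro cg_add Lb mult)
    also have "\<dots> \<simeq> of_int b ^ (p ^ a) + X ^ (p ^ a) * f ^ (p ^ a)"
      by (intro cg_add cg_mult cg_sym[OF of_int_frobenius_pow] step X_power_cong m)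
    also have "\<dots> = of_int b ^ (p ^ a) + (X * f) ^ (p ^ a)" by (simp add: power_mult_distrib)
    also have "\<dots> \<simeq> (of_int b + X * f) ^ (p ^ a)" by (rule cg_sym[OF frobenius_pow_add])
    finally show ?case .
  qed (simp add: zero_frobenius_pow L0)
  moreover have "a < p" using p_gt_1 by (simp add: a_def)
  ultimately show ?thesis using m by blast
qed

text \<open>The kernel of \<open>j\<close> has index \<open>p\<close> and the Frobenius map acts trivially modulo it, so it contains every
  \<open>g - g\<^sup>p\<close>, that is, every element of trace \<open>0\<close>.\<close>
lemma twisted_hom_is_trace:
  assumes jcong: "\<And>f g. f \<simeq> g \<Longrightarrow> [j f = j g] (mod p)"
    and jhom: "\<And>f g. [j (f + g ^ (p ^ j f)) = j f + j g] (mod p)"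
    and jnz: "\<not> [j f\<^sub>0 = 0] (mod p)"
  shows "\<exists>b. \<not> p dvd b \<and> (\<forall>f. [j f = b * trace_index f] (mod p))"
proof -
  define K where "K f \<longleftrightarrow> [j f = 0] (mod p)" for f
  have Kcong: "f \<simeq> g \<Longrightarrow> K f \<Longrightarrow> K g" for f g
    unfolding K_def using jcong cong_sym cong_trans by blast
  have hom': "[j f + j g = j (f + g ^ (p ^ i))] (mod p)" if "[j f = i] (mod p)" for f g i
  proof -
    have "f + g ^ (p ^ j f) \<simeq> f + g ^ (p ^ i)" by (intro cg_add cg_refl frobenius_pow_cong that)
    then show ?thesis using jhom[of f g] jcong cong_sym cong_trans by blast
  qed
  have j0: "[j 0 = 0] (mod p)"
  proof -
    have "[j 0 + j 0 = j 0 + 0] (mod p)" using jhom[of 0 0] cong_sym by (simp add: zero_frobenius_pow)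
    then show ?thesis by (simp only: cong_add_lcancel_nat)
  qed
  have K0: "K 0" using j0 by (simp add: K_def)
  have Kadd: "[j (k + g) = j g] (mod p)" if "K k" for k g
  proof -
    have "[j k + j g = j (k + g ^ (p ^ 0))] (mod p)" using that hom'[of k 0 g] by (simp add: K_def)
    moreover have "[j k + j g = 0 + j g] (mod p)" using that unfolding K_def by (intro cong_add cong_refl)
    ultimately show ?thesis using cong_sym cong_trans by simp blast
  qed
  obtain u where u: "[j u = 1] (mod p)"
  proof -
    have mult: "\<exists>v. [j v = n * j f\<^sub>0] (mod p)" for n
    proof (induction n)
      case (Suc n)
      then obtain v where "[j v = n * j f\<^sub>0] (mod p)" by blast
      then have "[j f\<^sub>0 + j v = j f\<^sub>0 + n * j f\<^sub>0] (mod p)" by (intro cong_add cong_refl)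
      then have "[j (f\<^sub>0 + v ^ (p ^ j f\<^sub>0)) = Suc n * j f\<^sub>0] (mod p)" using jhom cong_trans by simp blast
      then show ?case by blast
    qed (use j0 in auto)
    have "coprime (j f\<^sub>0) p" using jnz p prime_imp_coprime_nat coprime_commute cong_0_iff by metis
    then obtain n where n: "[j f\<^sub>0 * n = 1] (mod p)" using cong_solve_coprime_nat by auto
    obtain v where "[j v = n * j f\<^sub>0] (mod p)" using mult by blast
    then have "[j v = 1] (mod p)" using n cong_trans by (metis mult.commute)
    then show ?thesis using that by blast
  qed
  \<comment> \<open>The inverse of \<open>u\<close> for the twisted operation: as \<open>j u\<close>
    is 1, the Frobenius image of \<open>u'\<close> must be \<open>- u\<close>, and
    \<open>p - 1\<close> further Frobenius steps invert one.\<close>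
  define u' where "u' = (- u) ^ (p ^ (p - 1))"
  have u'p: "u' ^ (p ^ 1) \<simeq> - u"
  proof -
    have "u' ^ (p ^ 1) = (- u) ^ (p ^ Suc (p - 1))" by (simp only: u'_def frobenius_Suc power_one_right)
    also have "Suc (p - 1) = p" using p_gt_1 by simp
    also have "(- u) ^ (p ^ p) \<simeq> - u" by (rule power_p_p)
    finally show ?thesis .
  qed
  have ju': "[1 + j u' = 0] (mod p)"
  proof -
    have "u + u' ^ (p ^ 1) \<simeq> u + (- u)" by (intro cg_add cg_refl u'p)
    then have "[j (u + u' ^ (p ^ 1)) = 0] (mod p)" using jcong j0 cong_trans by fastforce
    moreover have "[j u + j u' = j (u + u' ^ (p ^ 1))] (mod p)" by (rule hom'[OF u])
    moreover have "[j u + j u' = 1 + j u'] (mod p)" by (intro cong_add u cong_refl)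
    ultimately show ?thesis using cong_sym cong_trans by blast
  qed
  \<comment> \<open>\<open>k ^ p\<close> is the conjugate of \<open>k\<close> by \<open>u\<close>
    for the twisted operation, and the kernel of a homomorphism is closed under conjugation.\<close>
  have Kp: "K (k ^ p)" if k: "K k" for k
  proof -
    let ?w = "u + k ^ (p ^ 1)"
    have "[j u + j k = j ?w] (mod p)" by (rule hom'[OF u])
    moreover have "[j u + j k = 1 + 0] (mod p)" using k unfolding K_def by (intro cong_add u)
    ultimately have w: "[j ?w = 1] (mod p)" using cong_sym cong_trans by simp blast
    have "?w + u' ^ (p ^ 1) \<simeq> ?w + (- u)" by (intro cg_add cg_refl u'p)
    then have "[j (?w + u' ^ (p ^ 1)) = j (k ^ p)] (mod p)" using jcong by simp
    moreover have "[j ?w + j u' = j (?w + u' ^ (p ^ 1))] (mod p)" by (rule hom'[OF w])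
    moreover have "[j ?w + j u' = 1 + j u'] (mod p)" by (intro cong_add w cong_refl)
    ultimately show ?thesis unfolding K_def using ju' cong_sym cong_trans by meson
  qed
  have Kpp: "K (k ^ (p ^ i))" if "K k" for k i
    by (induction i) (use that Kp in \<open>simp_all add: frobenius_Suc del: power_Suc\<close>)
  have Kdiff: "K (g - f)" if "[j f = j g] (mod p)" for f g
  proof -
    define i where "i = j f mod p"
    have i: "[j f = i] (mod p)" "i < p" using p_gt_1 by (simp_all add: i_def)
    let ?g = "(g - f) ^ (p ^ (p - i))"
    have "?g ^ (p ^ i) = (g - f) ^ (p ^ p)" using i(2) by (simp flip: power_mult power_add)
    also have "\<dots> \<simeq> g - f" by (rule power_p_p)
    finally have gi: "?g ^ (p ^ i) \<simeq> g - f" .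
    then have "f + ?g ^ (p ^ i) \<simeq> f + (g - f)" by (intro cg_add cg_refl)
    then have "[j (f + ?g ^ (p ^ i)) = j g] (mod p)" using jcong by simp
    then have "[j f + j ?g = j f + 0] (mod p)"
      using hom'[OF i(1), of ?g] that by (metis add.right_neutral cong_sym cong_trans)
    then have "K ?g" unfolding K_def by (simp only: cong_add_lcancel_nat)
    then have "K (?g ^ (p ^ i))" by (rule Kpp)
    then show ?thesis using gi Kcong by blast
  qed
  have Kplus: "K (f + g)" if "K f" "K g" for f g
    using Kadd[OF that(1), of g] that(2) cong_trans unfolding K_def by blast
  have Kuminus: "K (- f)" if "K f" for f
    using Kadd[OF that, of "- f"] j0 cong_sym cong_trans unfolding K_def by simp blast
  have Kminus: "K (f - g)" if "K f" "K g" for f g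
    using Kplus[OF that(1) Kuminus[OF that(2)]] by simp
  have Knat: "K (of_nat n * f)" if "K f" for n f
    by (induction n) (use that K0 Kplus in \<open>auto simp: algebra_simps\<close>)
  have Kj: "[j f = j g] (mod p)" if "K (f - g)" for f g
    using Kadd[OF that, of g] by simp
  have notKu: "\<not> K u"
  proof
    assume "K u"
    then have "[1 = 0] (mod p)" using u unfolding K_def using cong_sym cong_trans by blast
    then show False using p_gt_1 by (simp add: cong_def)
  qed
  \<comment> \<open>The multiples of \<open>u\<close> by 0 up to \<open>p - 1\<close> have distinct
    \<open>j\<close>-values: a coincidence would put a multiple of \<open>u\<close> by a unit of the
    prime field, hence \<open>u\<close>, into \<open>K\<close>. So they represent all classes modulo
    \<open>K\<close>.\<close>
  have cover: "\<exists>n. K (f - of_nat n * u)" for f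
  proof -
    let ?h = "\<lambda>n. j (of_nat n * u) mod p"
    have inj: "\<not> ?h n = ?h m" if "m < n" "n < p" for n m
    proof
      assume "?h n = ?h m"
      then have "[j (of_nat m * u) = j (of_nat n * u)] (mod p)" by (simp add: cong_def)
      then have "K (of_nat n * u - of_nat m * u)" by (rule Kdiff)
      then have K1: "K (of_nat (n - m) * u)" using that by (simp add: of_nat_diff algebra_simps)
      have "coprime (n - m) p" using that p prime_imp_coprime_nat[of p "n - m"] nat_dvd_not_less[of "n - m" p]
        by (auto simp: coprime_commute)
      then obtain d where d: "[(n - m) * d = 1] (mod p)" using cong_solve_coprime_nat by auto
      have "K (of_nat d * (of_nat (n - m) * u))" by (rule Knat[OF K1])
      moreover have "of_nat ((n - m) * d) * u \<simeq> of_nat 1 * u" using d of_nat_cg_iff by (intro cg_mult cg_refl) blast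
      then have "of_nat d * (of_nat (n - m) * u) \<simeq> u" by (simp only: of_nat_mult mult_ac of_nat_1 mult_1)
      ultimately show False using Kcong notKu by blast
    qed
    have "inj_on ?h {..<p}"
    proof (rule inj_onI, rule ccontr)
      fix n m assume nm: "n \<in> {..<p}" "m \<in> {..<p}" "?h n = ?h m" "n \<noteq> m"
      then show False using inj[of m n] inj[of n m] by (cases "m < n") auto
    qed
    then have "card (?h ` {..<p}) = card {..<p}" by (rule card_image)
    moreover have "?h ` {..<p} \<subseteq> {..<p}" using p_gt_1 by (intro image_subsetI) simp
    ultimately have "?h ` {..<p} = {..<p}" by (intro card_subset_eq) simp_all
    moreover have "j f mod p \<in> {..<p}" using p_gt_1 by simp
    ultimately have "j f mod p \<in> ?h ` {..<p}" by simp
    then obtain n where "j f mod p = ?h n" by (rule imageE)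
    then have "[j (of_nat n * u) = j f] (mod p)" by (simp add: cong_def)
    then show ?thesis using Kdiff by blast
  qed
  \<comment> \<open>Modulo \<open>K\<close>, where \<open>u\<close> spans everything, the Frobenius
    map is multiplication by some \<open>s\<close> of the prime field. Its \<open>p\<close>-th
    iterate is the identity and \<open>s ^ p = s\<close> there, so \<open>s\<close> acts as
    1.\<close>
  have Ku: "K (u ^ p - u)"
  proof -
    obtain s where s: "K (u ^ p - of_nat s * u)" using cover by blast
    have si: "K (u ^ (p ^ i) - of_nat (s ^ i) * u)" for i
    proof (induction i)
      case (Suc i)
      let ?k = "u ^ (p ^ i) - of_nat (s ^ i) * u"
      have "K (?k ^ p + of_nat (s ^ i) * (u ^ p - of_nat s * u))"
        by (intro Kplus Kp Suc Knat s)
      moreover have "?k ^ (p ^ 1) \<simeq> (u ^ (p ^ i)) ^ (p ^ 1) - (of_nat (s ^ i) * u) ^ (p ^ 1)"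
        by (rule frobenius_pow_diff)
      moreover have "(of_nat (s ^ i) * u) ^ (p ^ 1) = of_nat (s ^ i) ^ (p ^ 1) * u ^ (p ^ 1)"
        by (rule power_mult_distrib)
      moreover have "of_nat (s ^ i) ^ (p ^ 1) * u ^ (p ^ 1) \<simeq> of_nat (s ^ i) * u ^ (p ^ 1)"
        by (intro cg_mult cg_refl of_nat_frobenius_pow)
      ultimately have "?k ^ (p ^ 1) \<simeq> (u ^ (p ^ i)) ^ (p ^ 1) - of_nat (s ^ i) * u ^ (p ^ 1)"
        using cg_trans[OF _ cg_diff[OF cg_refl]] by metis
      then have *: "?k ^ p + of_nat (s ^ i) * (u ^ p - of_nat s * u)
          \<simeq> (u ^ (p ^ i)) ^ p - of_nat (s ^ i) * u ^ p + of_nat (s ^ i) * (u ^ p - of_nat s * u)"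
        unfolding power_one_right by (intro cg_add cg_refl)
      have "K ((u ^ (p ^ i)) ^ p - of_nat (s ^ i) * u ^ p + of_nat (s ^ i) * (u ^ p - of_nat s * u))"
        using Kcong[OF *] \<open>K (?k ^ p + of_nat (s ^ i) * (u ^ p - of_nat s * u))\<close> .
      moreover have "(u ^ (p ^ i)) ^ p - of_nat (s ^ i) * u ^ p + of_nat (s ^ i) * (u ^ p - of_nat s * u)
          = u ^ (p ^ Suc i) - of_nat (s ^ Suc i) * u"
        unfolding frobenius_Suc by (simp add: algebra_simps)
      ultimately show ?case by simp
    qed (use K0 in simp)
    have "of_nat s ^ (p ^ 1) \<simeq> of_nat s" by (rule of_nat_frobenius_pow)
    then have "u ^ (p ^ p) - of_nat (s ^ p) * u \<simeq> u - of_nat s * u"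
      by (intro cg_diff power_p_p cg_mult cg_refl) simp
    then have "K (u - of_nat s * u)" using si[of p] Kcong by blast
    with s have "K ((u ^ p - of_nat s * u) - (u - of_nat s * u))" by (rule Kminus)
    then show ?thesis by simp
  qed
  have Kfrob: "K (f ^ p - f)" for f
  proof -
    obtain n where n: "K (f - of_nat n * u)" using cover by blast
    let ?k = "f - of_nat n * u"
    have "K (of_nat n * (u ^ p - u) + (?k ^ p - ?k))" by (intro Kplus Knat Kminus Kp n Ku)
    moreover have "of_nat n * (u ^ p - u) + (?k ^ p - ?k) \<simeq> f ^ p - f"
    proof -
      have "?k ^ (p ^ 1) \<simeq> f ^ (p ^ 1) - (of_nat n * u) ^ (p ^ 1)" by (rule frobenius_pow_diff)
      also have "\<dots> = f ^ (p ^ 1) - of_nat n ^ (p ^ 1) * u ^ (p ^ 1)" by (simp only: power_mult_distrib)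
      also have "\<dots> \<simeq> f ^ (p ^ 1) - of_nat n * u ^ (p ^ 1)"
        by (intro cg_diff cg_mult cg_refl of_nat_frobenius_pow)
      finally have "?k ^ p \<simeq> f ^ p - of_nat n * u ^ p" by simp
      then have "of_nat n * (u ^ p - u) + (?k ^ p - ?k) \<simeq> of_nat n * (u ^ p - u) + ((f ^ p - of_nat n * u ^ p) - ?k)"
        by (intro cg_add cg_diff cg_refl)
      then show ?thesis by (simp add: algebra_simps)
    qed
    ultimately show ?thesis using Kcong by blast
  qed
  have Kfrobs: "K (f ^ (p ^ i) - f)" for f i
  proof (induction i)
    case (Suc i)
    have "K (((f ^ (p ^ i)) ^ p - f ^ (p ^ i)) + (f ^ (p ^ i) - f))" by (intro Kplus Kfrob Suc)
    then show ?case unfolding frobenius_Suc by simp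
  qed (use K0 in simp)
  \<comment> \<open>The Frobenius map is trivial modulo \<open>K\<close>, so twisting the second
    summand does not change its \<open>j\<close>-value, and \<open>j\<close> is additive in the
    ordinary sense.\<close>
  have jadd: "[j (f + g) = j f + j g] (mod p)" for f g
  proof -
    define i where "i = j f mod p"
    have i: "[j f = i] (mod p)" "i < p" using p_gt_1 by (simp_all add: i_def)
    let ?g = "g ^ (p ^ (p - i))"
    have "?g ^ (p ^ i) = g ^ (p ^ p)" using i(2) by (simp flip: power_mult power_add)
    also have "\<dots> \<simeq> g" by (rule power_p_p)
    finally have "f + ?g ^ (p ^ i) \<simeq> f + g" by (intro cg_add cg_refl)
    then have "[j (f + ?g ^ (p ^ i)) = j (f + g)] (mod p)" by (rule jcong)
    moreover have "[j f + j ?g = j (f + ?g ^ (p ^ i))] (mod p)" by (rule hom'[OF i(1)])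
    moreover have "[j f + j ?g = j f + j g] (mod p)" by (intro cong_add cong_refl Kj Kfrobs)
    ultimately show ?thesis using cong_sym cong_trans by meson
  qed
  have jnat: "[j (of_nat n * f) = n * j f] (mod p)" for n f
  proof (induction n)
    case (Suc n)
    have "[j (f + of_nat n * f) = j f + n * j f] (mod p)"
      using cong_trans[OF jadd cong_add[OF cong_refl Suc]] .
    then show ?case by (simp add: algebra_simps)
  qed (use j0 in simp)
  obtain t where t: "Tr t \<simeq> 1" using exists_trace_1 by blast
  have main: "[j f = j t * trace_index f] (mod p)" for f
  proof -
    let ?c = "trace_index f" and ?d = "f - of_nat (trace_index f) * t"
    have "Tr f = Tr (of_nat ?c * t + ?d)" by simp
    also have "\<dots> \<simeq> Tr (of_nat ?c * t) + Tr ?d" by (rule Tr_add)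
    also have "\<dots> \<simeq> of_nat ?c * 1 + Tr ?d"
      by (intro cg_add cg_refl cg_trans[OF Tr_of_nat_mult] cg_mult t)
    finally have "Tr f \<simeq> of_nat ?c + Tr ?d" by simp
    moreover have "Tr f \<simeq> of_nat ?c" by (rule trace_index)
    ultimately have "of_nat ?c \<simeq> of_nat ?c + Tr ?d" using cg_sym cg_trans by blast
    then have "Tr ?d \<simeq> 0" by (simp add: cg_def P_uminus) (metis P_uminus add.inverse_inverse)
    then obtain g where g: "?d \<simeq> g - g ^ p" using trace_0_imp_difference by blast
    have "K (- (g ^ p - g))" by (intro Kuminus Kfrob)
    then have "K ?d" using Kcong[OF cg_sym[OF g]] by simp
    then have "[j f = j (of_nat ?c * t)] (mod p)" by (rule Kj)
    then show ?thesis using jnat[of ?c t] cong_trans by (metis mult.commute)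
  qed
  moreover have "\<not> p dvd j t"
  proof
    assume "p dvd j t"
    then have "[j t * trace_index f\<^sub>0 = 0] (mod p)" by (simp add: cong_0_iff)
    then show False using main[of f\<^sub>0] jnz cong_trans by blast
  qed
  ultimately show ?thesis by blast
qed

text \<open>A canonical natural number for each residue class: field equality becomes equality of
  numbers, and the model can have carrier type \<open>nat\<close>.\<close>

definition code :: "int poly \<Rightarrow> nat" where
  "code f = (LEAST n. Poly (from_nat n) \<simeq> f)"

lemma code_correct: "Poly (from_nat (code f)) \<simeq> f"
proof -
  have "Poly (from_nat (to_nat (coeffs f))) = f" by simp
  then have "\<exists>n. Poly (from_nat n) \<simeq> f" by (metis cg_refl)
  then show ?thesis unfolding code_def by (rule LeastI_ex)
qed

lemma code_eq_iff: "code f = code g \<longleftrightarrow> f \<simeq> g"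
proof
  assume "code f = code g"
  then show "f \<simeq> g" using code_correct[of f] code_correct[of g] cg_sym cg_trans by metis
next
  assume "f \<simeq> g"
  then have "Poly (from_nat n) \<simeq> f \<longleftrightarrow> Poly (from_nat n) \<simeq> g" for n
    using cg_sym cg_trans by blast
  then show "code f = code g" by (simp add: code_def)
qed

definition rep :: "nat \<Rightarrow> int poly" where "rep a = Poly (from_nat a)"

lemma rep_code: "rep (code f) \<simeq> f"
  by (simp add: rep_def code_correct)

lemma code_rep: "a \<in> range code \<Longrightarrow> code (rep a) = a"
  using rep_code code_eq_iff by auto

definition field_additive :: "nat monoid" where
  "field_additive = \<lparr>carrier = range code, monoid.mult = (\<lambda>a b. code (rep a + rep b)), one = code 0\<rparr>"

lemma field_additive_simps [simp]:
  "carrier field_additive = range code"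
  "code f \<otimes>\<^bsub>field_additive\<^esub> code g = code (f + g)"
  "\<one>\<^bsub>field_additive\<^esub> = code 0"
  by (auto simp: field_additive_def code_eq_iff intro: cg_add rep_code)

lemma comm_group_field_additive: "comm_group field_additive"
proof (rule comm_groupI)
  fix x assume "x \<in> carrier field_additive"
  then obtain f where f: "x = code f" by auto
  have "code (- f) \<otimes>\<^bsub>field_additive\<^esub> x = \<one>\<^bsub>field_additive\<^esub>" unfolding f field_additive_simps by simp
  then show "\<exists>y\<in>carrier field_additive. y \<otimes>\<^bsub>field_additive\<^esub> x = \<one>\<^bsub>field_additive\<^esub>"
    by (metis field_additive_simps(1) rangeI)
qed (auto simp: add_ac)

lemma field_additive_pow: "code f [^]\<^bsub>field_additive\<^esub> (n :: nat) = code (of_nat n * f)"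
proof -
  interpret comm_group field_additive by (rule comm_group_field_additive)
  show ?thesis by (induction n) (simp_all add: algebra_simps)
qed

text \<open>Representatives of distinct classes are incongruent solutions of
  \<open>f ^ (p ^ p) = f\<close>. Bounding every finite subset yields finiteness along with the
  bound.\<close>

lemma finite_field_codes: "finite (range code)"
  and field_codes_card_le: "card (range code) \<le> p ^ p"
proof -
  have "card T \<le> p ^ p" if T: "finite T" "T \<subseteq> range code" for T
  proof -
    have "card (rep ` T) = card T"
      using T by (intro card_image inj_onI) (metis code_rep subsetD)
    moreover have "card (rep ` T) \<le> p ^ p"
    proof (rule power_fixed_card)
      show "p ^ p > 1" using q_gt_1 q_less by simp
      show "f = g" if fg: "f \<in> rep ` T" "g \<in> rep ` T" "f \<simeq> g" for f g
      proof -
        obtain a b where ab: "f = rep a" "a \<in> T" "g = rep b" "b \<in> T" using fg by blast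
        then have "code (rep a) = code (rep b)" using fg(3) code_eq_iff by simp
        then show ?thesis using ab T code_rep by (metis subsetD)
      qed
    qed (use T power_p_p in auto)
    ultimately show ?thesis by simp
  qed
  then have *: "finite (range code) \<and> card (range code) \<le> p ^ p"
    using finite_if_finite_subsets_card_bdd[of "range code" "p ^ p"] by blast
  show "finite (range code)" "card (range code) \<le> p ^ p" using * by blast+
qed

text \<open>The additive group has exponent \<open>p\<close>, so there are \<open>p ^ k\<close>
  elements. Multiplication by \<open>X\<close> has period \<open>q\<close> and fixes only 0, so
  \<open>p dvd k\<close>; with \<open>k\<close> nonzero and the bound \<open>p ^ p\<close> this
  leaves \<open>k = p\<close>.\<close>

lemma card_field: "card (range code) = p ^ p"
proof -
  interpret comm_group field_additive by (rule comm_group_field_additive)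
  have pow: "x [^]\<^bsub>field_additive\<^esub> (p ^ 1) = \<one>\<^bsub>field_additive\<^esub>" if x: "x \<in> carrier field_additive" for x
  proof -
    obtain f where "x = code f" using x by auto
    moreover have "of_nat p * f \<simeq> 0 * f" by (intro cg_mult p_cg_0 cg_refl)
    ultimately show ?thesis by (simp add: field_additive_pow code_eq_iff)
  qed
  obtain k where k: "card (range code) = p ^ k"
    using prime_power_order_if_exponent[OF is_group _ p pow] finite_field_codes
    by (auto simp: Coset.order_def)
  define \<mu> where "\<mu> a = code (X * rep a)" for a
  have \<mu>: "\<mu> (code f) = code (X * f)" for f
    by (simp add: \<mu>_def code_eq_iff cg_mult rep_code)
  have \<mu>n: "(\<mu> ^^ n) (code f) = code (X ^ n * f)" for n f
    by (induction n) (simp_all add: \<mu> mult.assoc)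
  have "q dvd card {x \<in> range code. \<mu> x \<noteq> x}"
  proof (rule prime_period_card[OF finite_field_codes _ q])
    show "\<mu> ` range code \<subseteq> range code" by (auto simp: \<mu>)
    show "(\<mu> ^^ q) x = x" if x: "x \<in> range code" for x
    proof -
      obtain f where f: "x = code f" using x by auto
      have "X ^ q * f \<simeq> 1 * f" by (intro cg_mult X_power_q cg_refl)
      then show ?thesis by (simp add: f \<mu>n code_eq_iff)
    qed
  qed
  also have "{x \<in> range code. \<mu> x \<noteq> x} = range code - {code 0}"
  proof -
    have "X * f \<simeq> f \<longleftrightarrow> f \<simeq> 0" for f
    proof
      assume "X * f \<simeq> f"
      then have "(X - 1) * f \<simeq> 0" by (simp add: algebra_simps cg_diff_0_iff)
      then show "f \<simeq> 0" using cg_prime cg_diff_0_iff not_X_cg_1 by blast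
    next
      assume f: "f \<simeq> 0"
      have "X * f \<simeq> X * 0" by (intro cg_mult f cg_refl)
      also have "X * 0 \<simeq> f" using cg_sym[OF f] by simp
      finally show "X * f \<simeq> f" .
    qed
    then show ?thesis by (auto simp: \<mu> code_eq_iff)
  qed
  also have "card (range code - {code 0}) = p ^ k - 1"
    using finite_field_codes k by (simp add: card_Diff_singleton)
  finally have "p dvd k" using q_dvd_iff by simp
  moreover have "k \<noteq> 0"
  proof
    assume "k = 0"
    then obtain x where "range code = {x}" using k card_1_singletonE by auto
    then have "code 0 = code 1" by (metis rangeI singletonD)
    then show False using not_1_cg_0 code_eq_iff cg_sym by blast
  qed
  moreover have "k \<le> p" using field_codes_card_le k p_gt_1 by (auto intro: power_le_imp_le_exp)
  ultimately have "k = p" using dvd_imp_le[of p k] by simp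
  then show ?thesis using k by simp
qed

end

text \<open>Any maximal ideal above the ideal generated by \<open>p\<close> and the cyclotomic sum
  will do; only properness needs an argument. An expression of 1 is multiplied by
  \<open>X - 1\<close>, which turns the cyclotomic sum into \<open>X ^ q - 1\<close>; a linear
  functional then takes the value -1 on one side and a multiple of \<open>p\<close> on the
  other.\<close>

lemma (in prime_pair) finite_field_quotient_exists: "\<exists>P. finite_field_quotient p q P"
proof -
  define S where "S = (\<Sum>i<q. X ^ i)"
  let ?I = "{of_nat p * a + S * b | a b. True}"
  have I: "ring_ideal ?I"
    unfolding ring_ideal_def
  proof (intro conjI ballI allI)
    have "0 = of_nat p * 0 + S * 0" by simp
    then show "0 \<in> ?I" by blast
  next
    fix f g assume "f \<in> ?I" "g \<in> ?I"
    then obtain a b c d where "f = of_nat p * a + S * b" "g = of_nat p * c + S * d" by blast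
    then have "f + g = of_nat p * (a + c) + S * (b + d)" by (simp add: algebra_simps)
    then show "f + g \<in> ?I" by blast
  next
    fix f g assume "f \<in> ?I"
    then obtain a b where "f = of_nat p * a + S * b" by blast
    then have "g * f = of_nat p * (g * a) + S * (g * b)" by (simp add: algebra_simps)
    then show "g * f \<in> ?I" by blast
  qed
  have "1 \<notin> ?I"
  proof
    assume "1 \<in> ?I"
    then obtain a b where ab: "1 = of_nat p * a + S * b" by blast
    have "X - 1 = (X - 1) * (of_nat p * a + S * b)" using ab by simp
    also have "\<dots> = of_nat p * (a * (X - 1)) + ((X - 1) * S) * b" by (simp add: algebra_simps)
    also have "(X - 1) * S = X ^ q - 1" unfolding S_def by (rule power_diff_1_eq[symmetric])
    also have "(X ^ q - 1) * b = monom 1 q * b - b"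
      by (simp add: X_def monom_altdef algebra_simps)
    finally have e: "X - 1 = of_nat p * (a * (X - 1)) + (monom 1 q * b - b)" .
    text \<open>Summing the coefficients at multiples of \<open>q\<close> kills multiples of \<open>X ^ q - 1\<close>.\<close>
    define N where "N = degree b + 1"
    define s where "s f = (\<Sum>i\<le>N. coeff f (q * i))" for f :: "int poly"
    have s1: "s (X - 1) = -1"
    proof -
      have "coeff (X - 1) (q * i) = (if i = 0 then -1 else 0)" for i
      proof (cases i)
        case (Suc m)
        then have "q * i \<noteq> 0" "q * i \<noteq> 1" using q_gt_1 by auto
        then show ?thesis using Suc by (auto simp: X_def coeff_pCons split: nat.splits)
      qed (simp add: X_def)
      then show ?thesis by (simp add: s_def)
    qed
    have s2: "s (monom 1 q * b) = s b"
    proof -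
      have "coeff b (q * N) = 0"
      proof (rule coeff_eq_0)
        have "degree b < N" by (simp add: N_def)
        also have "N \<le> q * N" using q_gt_1 by simp
        finally show "degree b < q * N" .
      qed
      moreover have "s (monom 1 q * b) = (\<Sum>i<N. coeff b (q * i))"
      proof -
        have "s (monom 1 q * b) = coeff (monom 1 q * b) (q * 0) + (\<Sum>i<N. coeff (monom 1 q * b) (q * Suc i))"
          unfolding s_def by (simp only: lessThan_Suc_atMost[symmetric] sum.lessThan_Suc_shift)
        then show ?thesis using q_gt_1 by (simp add: coeff_monom_mult)
      qed
      ultimately show ?thesis by (simp add: s_def flip: lessThan_Suc_atMost)
    qed
    have "s (X - 1) = int p * s (a * (X - 1)) + (s (monom 1 q * b) - s b)"
      by (subst e) (simp add: s_def sum.distrib sum_subtractf sum_distrib_left of_nat_poly)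
    then have "int p dvd 1" using s1 s2 by (metis add.right_neutral cancel_comm_monoid_add_class.diff_cancel dvd_minus_iff dvd_triv_left)
    then show False using p_gt_1 by simp
  qed
  then obtain M where M: "ring_ideal M" "?I \<subseteq> M" "1 \<notin> M" "\<And>f. f \<notin> M \<Longrightarrow> \<exists>g. g * f - 1 \<in> M"
    using maximal_ideal_exists[OF I] by blast
  have "of_nat p = of_nat p * 1 + S * 0" "S = of_nat p * 0 + S * 1" by simp_all
  then have "of_nat p \<in> ?I" "S \<in> ?I" by blast+
  then have "finite_field_quotient p q M"
    using M by unfold_locales (auto simp: S_def)
  then show ?thesis by blast
qed

section \<open>The model brace\<close>

lemma additive_group_simps [simp]:
  "carrier (additive_group B) = carrier B"
  "x \<otimes>\<^bsub>additive_group B\<^esub> y = sadd B x y"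
  "\<one>\<^bsub>additive_group B\<^esub> = sone B"
  by (simp_all add: additive_group_def)

lemma multiplicative_group_simps [simp]:
  "carrier (multiplicative_group B) = carrier B"
  "x \<otimes>\<^bsub>multiplicative_group B\<^esub> y = scirc B x y"
  "\<one>\<^bsub>multiplicative_group B\<^esub> = sunit B"
  by (simp_all add: multiplicative_group_def)

lemma opposite_simps [simp]:
  "carrier (opposite B) = carrier B"
  "sadd (opposite B) x y = sadd B y x"
  "sone (opposite B) = sone B"
  "scirc (opposite B) x y = scirc B x y"
  "sunit (opposite B) = sunit B"
  by (simp_all add: opposite_def)

lemma multiplicative_group_opposite [simp]: "multiplicative_group (opposite B) = multiplicative_group B"
  by (simp add: multiplicative_group_def opposite_def)

lemma opposite_opposite [simp]: "opposite (opposite B) = B"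
  by (simp add: opposite_def)

context finite_field_quotient
begin

text \<open>The arguments are arbitrary representatives, reduced only here; an identity in the model
  thus becomes one congruence modulo \<open>P\<close> and one modulo \<open>q\<close>.\<close>

definition enc :: "int poly \<Rightarrow> int \<Rightarrow> nat" where
  "enc f i = prod_encode (code f, nat (i mod int q))"

lemma enc_eq_iff: "enc f i = enc g j \<longleftrightarrow> f \<simeq> g \<and> [i = j] (mod int q)"
proof -
  have "i mod int q \<ge> 0" "j mod int q \<ge> 0" using q_gt_1 by simp_all
  then have "nat (i mod int q) = nat (j mod int q) \<longleftrightarrow> i mod int q = j mod int q"
    by (rule eq_nat_nat_iff)
  moreover have "enc f i = enc g j \<longleftrightarrow> code f = code g \<and> nat (i mod int q) = nat (j mod int q)"
    unfolding enc_def prod_encode_eq prod.inject ..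
  ultimately show ?thesis unfolding cong_def code_eq_iff by blast
qed

text \<open>Powers of \<open>X\<close> with integer exponents: \<open>X\<close> has order
  \<open>q\<close> in the field, so a negative exponent is read modulo \<open>q\<close>.\<close>

definition Z :: "int \<Rightarrow> int poly" where "Z i = X ^ nat (i mod int q)"

lemma Z_of_nat: "Z (int n) \<simeq> X ^ n"
proof -
  have "nat (int n mod int q) = n mod q" by (metis nat_int of_nat_mod)
  then show ?thesis using cg_sym[OF X_power_mod[of n]] by (simp add: Z_def)
qed

lemma Z_cong_iff: "Z i \<simeq> Z j \<longleftrightarrow> [i = j] (mod int q)"
proof -
  have "Z i \<simeq> Z j \<longleftrightarrow> [int (nat (i mod int q)) = int (nat (j mod int q))] (mod int q)"
    by (simp only: Z_def X_power_cg_iff cong_int_iff)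
  then show ?thesis using q_gt_1 by (simp add: cong_def)
qed

lemma Z_add: "Z (i + j) \<simeq> Z i * Z j"
proof -
  have "[int (nat ((i + j) mod int q)) = int (nat (i mod int q) + nat (j mod int q))] (mod int q)"
    using q_gt_1 by (simp add: cong_def mod_add_eq)
  then show ?thesis unfolding Z_def power_add[symmetric] X_power_cg_iff by (simp only: cong_int_iff)
qed

lemma Z_0 [simp]: "Z 0 = 1" by (simp add: Z_def)

lemma Z_1: "Z 1 = X"
  using q_gt_1 by (simp add: Z_def)

lemma Z_power: "Z i ^ n \<simeq> Z (int n * i)"
proof (induction n)
  case (Suc n)
  have "Z i ^ Suc n = Z i * Z i ^ n" by simp
  also have "\<dots> \<simeq> Z i * Z (int n * i)" by (intro cg_mult cg_refl Suc)
  also have "\<dots> \<simeq> Z (i + int n * i)" by (rule cg_sym[OF Z_add])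
  finally show ?case by (simp add: algebra_simps)
qed simp

lemma Z_minus: "Z (- i) * Z i \<simeq> 1" "Z i * Z (- i) \<simeq> 1"
  using Z_add[of "-i" i] Z_add[of i "-i"] cg_sym by simp_all

definition tw :: "int poly \<Rightarrow> int poly \<Rightarrow> int poly" where
  "tw f g = g ^ (p ^ trace_index f)"

definition pw :: "int poly \<Rightarrow> int" where
  "pw f = int (p ^ trace_index f)"

lemma trace_index_0 [simp]: "trace_index 0 = 0"
  by (rule trace_index_eqI) (use p_gt_1 in \<open>simp_all add: Tr_def zero_frobenius_pow\<close>)

lemma tw_cong: "f \<simeq> f' \<Longrightarrow> g \<simeq> g' \<Longrightarrow> tw f g \<simeq> tw f' g'"
  using trace_index_cong[of f f'] by (simp add: tw_def cg_power)

lemma pw_cong: "f \<simeq> f' \<Longrightarrow> pw f = pw f'"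
  using trace_index_cong[of f f'] by (simp add: pw_def)

lemma tw_add: "tw f (g + k) \<simeq> tw f g + tw f k"
  by (simp add: tw_def frobenius_pow_add)

lemma tw_mult: "tw f (g * k) = tw f g * tw f k"
  by (simp add: tw_def power_mult_distrib)

lemma tw_0 [simp]: "tw 0 g = g" "pw 0 = 1" "tw f 0 = 0"
  by (simp_all add: tw_def pw_def zero_frobenius_pow)

lemma tw_Z: "tw f (Z i) \<simeq> Z (pw f * i)"
  unfolding tw_def pw_def by (rule Z_power)

text \<open>The trace is invariant under the Frobenius map, so it is a homomorphism for the twisted
  sum. This makes both components of the multiplicative operation associative.\<close>

lemma trace_index_star: "[trace_index (f + tw f g) = trace_index f + trace_index g] (mod p)"
  using trace_index_add[of f "tw f g"] by (simp add: tw_def trace_index_frobenius)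

lemma tw_star: "tw (f + tw f g) k \<simeq> tw f (tw g k)"
proof -
  have "tw (f + tw f g) k \<simeq> k ^ (p ^ (trace_index f + trace_index g))"
    unfolding tw_def[of "f + tw f g"] by (intro frobenius_pow_cong trace_index_star)
  then show ?thesis by (simp add: tw_def power_add mult.commute flip: power_mult)
qed

lemma pw_star: "[pw (f + tw f g) = pw f * pw g] (mod int q)"
proof -
  have "[p ^ trace_index (f + tw f g) = p ^ (trace_index f + trace_index g)] (mod q)"
    using trace_index_star p_pow_cong_iff by blast
  then have "[int (p ^ trace_index (f + tw f g)) = int (p ^ (trace_index f + trace_index g))] (mod int q)"
    by (simp only: cong_int_iff)
  then show ?thesis by (simp add: pw_def power_add)
qed

definition model :: "nat sbrace" where
  "model = \<lparr>carrier = range (case_prod enc),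
     sadd = (\<lambda>x y. case (prod_decode x, prod_decode y) of ((a, i), (b, j)) \<Rightarrow>
       enc (rep a + Z (int i) * rep b) (int i + int j)),
     sone = enc 0 0,
     scirc = (\<lambda>x y. case (prod_decode x, prod_decode y) of ((a, i), (b, j)) \<Rightarrow>
       enc (rep a + tw (rep a) (rep b)) (int i + pw (rep a) * int j)),
     sunit = enc 0 0\<rparr>"

lemma model_one [simp]: "sone model = enc 0 0" "sunit model = enc 0 0"
  and carrier_model: "carrier model = range (case_prod enc)"
  by (simp_all add: model_def)

lemma enc_in_model [simp]: "enc f i \<in> carrier model"
  by (auto simp: carrier_model)

lemma model_cases: "x \<in> carrier model \<Longrightarrow> (\<And>f i. x = enc f i \<Longrightarrow> Q) \<Longrightarrow> Q"
  by (auto simp: carrier_model)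

lemma nat_mod_cong: "[int (nat (i mod int q)) = i] (mod int q)"
  using q_gt_1 by (simp add: cong_def)

lemma model_add [simp]: "sadd model (enc f i) (enc g j) = enc (f + Z i * g) (i + j)"
proof -
  have "rep (code f) + Z (int (nat (i mod int q))) * rep (code g) \<simeq> f + Z i * g"
    by (intro cg_add cg_mult rep_code) (simp only: Z_cong_iff nat_mod_cong)
  moreover have "[int (nat (i mod int q)) + int (nat (j mod int q)) = i + j] (mod int q)"
    by (intro cong_add nat_mod_cong)
  ultimately show ?thesis by (simp add: model_def enc_eq_iff enc_def[of f] enc_def[of g])
qed

lemma model_circ [simp]: "scirc model (enc f i) (enc g j) = enc (f + tw f g) (i + pw f * j)"
proof -
  have "rep (code f) + tw (rep (code f)) (rep (code g)) \<simeq> f + tw f g"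
    by (intro cg_add tw_cong rep_code)
  moreover have "[int (nat (i mod int q)) + pw (rep (code f)) * int (nat (j mod int q)) = i + pw f * j] (mod int q)"
    using pw_cong[OF rep_code[of f]] by (intro cong_add cong_mult nat_mod_cong) simp
  ultimately show ?thesis by (simp add: model_def enc_eq_iff enc_def[of f] enc_def[of g])
qed

lemma group_additive_model: "group (additive_group model)"
proof (rule groupI)
  fix x y z assume "x \<in> carrier (additive_group model)" "y \<in> carrier (additive_group model)" "z \<in> carrier (additive_group model)"
  then obtain f i g j k l where xyz: "x = enc f i" "y = enc g j" "z = enc k l"
    by (auto elim!: model_cases)
  show "x \<otimes>\<^bsub>additive_group model\<^esub> y \<in> carrier (additive_group model)" by (simp add: xyz)
  have "f + Z i * g + Z (i + j) * k \<simeq> f + Z i * g + (Z i * Z j) * k"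
    by (intro cg_add cg_mult Z_add cg_refl)
  then show "x \<otimes>\<^bsub>additive_group model\<^esub> y \<otimes>\<^bsub>additive_group model\<^esub> z
      = x \<otimes>\<^bsub>additive_group model\<^esub> (y \<otimes>\<^bsub>additive_group model\<^esub> z)"
    by (simp add: xyz enc_eq_iff algebra_simps)
next
  fix x assume "x \<in> carrier (additive_group model)"
  then obtain f i where x: "x = enc f i" by (auto elim!: model_cases)
  show "\<one>\<^bsub>additive_group model\<^esub> \<otimes>\<^bsub>additive_group model\<^esub> x = x" by (simp add: x)
  have "enc (- (Z (- i) * f)) (- i) \<otimes>\<^bsub>additive_group model\<^esub> x = \<one>\<^bsub>additive_group model\<^esub>"
    by (simp add: x)
  then show "\<exists>y\<in>carrier (additive_group model). y \<otimes>\<^bsub>additive_group model\<^esub> x = \<one>\<^bsub>additive_group model\<^esub>"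
    by (metis additive_group_simps(1) enc_in_model)
qed simp

interpretation model_add: group "additive_group model" by (rule group_additive_model)

lemma model_add_inv [simp]: "inv\<^bsub>additive_group model\<^esub> (enc f i) = enc (- (Z (- i) * f)) (- i)"
  by (rule model_add.inv_equality) simp_all

lemma star_left_inverse: "\<exists>f'. f' + tw f' f \<simeq> 0"
proof -
  \<comment> \<open>The trace index of \<open>f'\<close> is minus that of \<open>f\<close> modulo
    \<open>p\<close>, so \<open>tw f' f\<close> raises \<open>f\<close> to the same Frobenius power
    that occurs in \<open>f'\<close>, and the two cancel.\<close>
  define f' where "f' = (- f) ^ (p ^ (p - trace_index f))"
  have "[trace_index (f + (- f)) = trace_index f + trace_index (- f)] (mod p)" by (rule trace_index_add)
  then have "[trace_index f + (p - trace_index f) = trace_index f + trace_index (- f)] (mod p)"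
    using trace_index(1)[of f] by (simp add: cong_def)
  then have "[p - trace_index f = trace_index f'] (mod p)"
    unfolding f'_def trace_index_frobenius by (simp only: cong_add_lcancel_nat)
  then have "tw f' f \<simeq> f ^ (p ^ (p - trace_index f))"
    unfolding tw_def by (intro frobenius_pow_cong) (rule cong_sym)
  then have "f' + tw f' f \<simeq> - (f ^ (p ^ (p - trace_index f))) + f ^ (p ^ (p - trace_index f))"
    unfolding f'_def by (intro cg_add frobenius_pow_uminus)
  then show ?thesis by auto
qed

lemma group_multiplicative_model: "group (multiplicative_group model)"
proof (rule groupI)
  fix x y z assume "x \<in> carrier (multiplicative_group model)" "y \<in> carrier (multiplicative_group model)" "z \<in> carrier (multiplicative_group model)"
  then obtain f i g j k l where xyz: "x = enc f i" "y = enc g j" "z = enc k l"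
    by (auto elim!: model_cases)
  show "x \<otimes>\<^bsub>multiplicative_group model\<^esub> y \<in> carrier (multiplicative_group model)" by (simp add: xyz)
  have "f + tw f g + tw (f + tw f g) k \<simeq> f + tw f g + tw f (tw g k)"
    by (intro cg_add tw_star cg_refl)
  also have "\<dots> = f + (tw f g + tw f (tw g k))" by (simp add: add.assoc)
  also have "\<dots> \<simeq> f + tw f (g + tw g k)" by (intro cg_add cg_refl cg_sym[OF tw_add])
  finally have 1: "f + tw f g + tw (f + tw f g) k \<simeq> f + tw f (g + tw g k)" .
  have "[i + pw f * j + pw (f + tw f g) * l = i + pw f * j + (pw f * pw g) * l] (mod int q)"
    by (intro cong_add cong_mult pw_star cong_refl)
  then show "x \<otimes>\<^bsub>multiplicative_group model\<^esub> y \<otimes>\<^bsub>multiplicative_group model\<^esub> z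
      = x \<otimes>\<^bsub>multiplicative_group model\<^esub> (y \<otimes>\<^bsub>multiplicative_group model\<^esub> z)"
    using 1 by (simp add: xyz enc_eq_iff algebra_simps)
next
  fix x assume "x \<in> carrier (multiplicative_group model)"
  then obtain f i where x: "x = enc f i" by (auto elim!: model_cases)
  show "\<one>\<^bsub>multiplicative_group model\<^esub> \<otimes>\<^bsub>multiplicative_group model\<^esub> x = x" by (simp add: x)
  obtain f' where "f' + tw f' f \<simeq> 0" using star_left_inverse by blast
  then have "enc f' (- pw f' * i) \<otimes>\<^bsub>multiplicative_group model\<^esub> x = \<one>\<^bsub>multiplicative_group model\<^esub>"
    by (simp add: x enc_eq_iff)
  then show "\<exists>y\<in>carrier (multiplicative_group model). y \<otimes>\<^bsub>multiplicative_group model\<^esub> x = \<one>\<^bsub>multiplicative_group model\<^esub>"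
    by (metis multiplicative_group_simps(1) enc_in_model)
qed simp

interpretation model_mult: group "multiplicative_group model" by (rule group_multiplicative_model)

text \<open>The lambda map at \<open>(f, i)\<close> sends \<open>(g, j)\<close> to
  \<open>(Z (- i) * tw f g, pw f * j)\<close>. It respects the additive operation because the
  Frobenius power \<open>tw f\<close> carries \<open>Z j\<close> to
  \<open>Z (pw f * j)\<close>.\<close>

lemma skew_brace_model: "skew_brace model"
  unfolding skew_brace_def
proof (intro conjI ballI group_additive_model group_multiplicative_model)
  fix a b c assume "a \<in> carrier model" "b \<in> carrier model" "c \<in> carrier model"
  then obtain f i g j k l where abc: "a = enc f i" "b = enc g j" "c = enc k l"
    by (auto elim!: model_cases)
  let ?n = "pw f * j"
  have "tw f (g + Z j * k) \<simeq> tw f g + tw f (Z j) * tw f k" using tw_add tw_mult by metis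
  also have "\<dots> \<simeq> tw f g + Z ?n * tw f k" by (intro cg_add cg_mult cg_refl tw_Z)
  finally have 1: "f + tw f (g + Z j * k) \<simeq> f + (tw f g + Z ?n * tw f k)" by (intro cg_add cg_refl)
  have "Z (i + ?n) * (Z (- i) * f) = (Z (i + ?n) * Z (- i)) * f" by (simp add: mult.assoc)
  also have "\<dots> \<simeq> Z ((i + ?n) + - i) * f" by (intro cg_mult cg_sym[OF Z_add] cg_refl)
  finally have "Z (i + ?n) * (Z (- i) * f) \<simeq> Z ?n * f" by simp
  then have "f + tw f g + Z (i + ?n) * - (Z (- i) * f) + Z (i + ?n + - i) * (f + tw f k)
     \<simeq> f + tw f g + - (Z ?n * f) + Z (i + ?n + - i) * (f + tw f k)"
    unfolding mult_minus_right by (intro cg_add cg_uminus cg_refl)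
  also have "\<dots> = f + (tw f g + Z ?n * tw f k)" by (simp add: algebra_simps)
  finally have 2: "f + tw f g + Z (i + ?n) * - (Z (- i) * f) + Z (i + ?n + - i) * (f + tw f k)
     \<simeq> f + (tw f g + Z ?n * tw f k)" .
  show "scirc model a (sadd model b c) =
        sadd model (sadd model (scirc model a b) (inv\<^bsub>additive_group model\<^esub> a)) (scirc model a c)"
    unfolding abc model_add model_circ model_add_inv enc_eq_iff
    using cg_trans[OF 1 cg_sym[OF 2]] by (simp add: algebra_simps)
qed

lemma card_model: "card (carrier model) = p ^ p * q"
proof -
  have "carrier model = prod_encode ` (range code \<times> {..<q})"
  proof (intro equalityI subsetI)
    fix x assume "x \<in> carrier model"
    then obtain f i where "x = enc f i" by (auto elim!: model_cases)
    moreover have "nat (i mod int q) < q" using q_gt_1 by (simp add: nat_less_iff)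
    ultimately show "x \<in> prod_encode ` (range code \<times> {..<q})" by (auto simp: enc_def)
  next
    fix x assume "x \<in> prod_encode ` (range code \<times> {..<q})"
    then obtain f n where "x = prod_encode (code f, n)" "n < q" by auto
    then have "x = enc f (int n)" by (simp add: enc_def flip: of_nat_mod)
    then show "x \<in> carrier model" by simp
  qed
  then have "card (carrier model) = card (range code \<times> {..<q})"
    using inj_prod_encode by (simp add: card_image)
  then show ?thesis by (simp add: card_cartesian_product card_field)
qed

lemma finite_model: "finite (carrier model)"
  using card_model p_gt_1 q_gt_1 by (intro card_ge_0_finite) simp

lemma Z_cg_1_iff: "Z i \<simeq> 1 \<longleftrightarrow> [i = 0] (mod int q)"
  using Z_cong_iff[of i 0] by simp

text \<open>\<open>1 - p\<close> is the second component that multiplicative conjugation of an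
  element of trace 1 produces; being prime to \<open>q\<close>, it generates the cyclic
  factor.\<close>

lemma p_minus_1_generates: "\<exists>n. [int n * (1 - int p) = j] (mod int q)"
proof -
  have "\<not> q dvd p - 1" using q_dvd_iff[of 1] p_gt_1 by simp
  then have "coprime (int q) (int (p - 1))" using q prime_imp_coprime_nat[of q "p - 1"] by simp
  then have "coprime (1 - int p) (int q)"
    using p_gt_1 coprime_minus_left_iff[of "1 - int p" "int q"] by (simp add: of_nat_diff coprime_commute)
  then obtain m where m: "[(1 - int p) * m = 1] (mod int q)" using cong_solve_coprime_int by blast
  have "[int (nat ((m * j) mod int q)) * (1 - int p) = (m * j) * (1 - int p)] (mod int q)"
    by (intro cong_mult nat_mod_cong cong_refl)
  also have "(m * j) * (1 - int p) = ((1 - int p) * m) * j" by simp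
  also have "[((1 - int p) * m) * j = 1 * j] (mod int q)" by (intro cong_mult m cong_refl)
  finally have "[int (nat ((m * j) mod int q)) * (1 - int p) = j] (mod int q)" by simp
  then show ?thesis by blast
qed

text \<open>An additive commutator with \<open>(1, 0)\<close> turns an element with nonzero second
  component into a nonzero element of the first factor; stability under multiplication by
  \<open>X\<close> then gives the whole first factor. Conjugating an element of trace 1
  multiplicatively by \<open>(0, 1)\<close> yields the second component \<open>1 - p\<close>, a
  generator modulo \<open>q\<close>.\<close>

lemma simple_model: "simple_skew_brace model"
  unfolding simple_skew_brace_def
proof (intro conjI allI impI skew_brace_model)
  have "enc 1 0 \<noteq> sone model" by (simp add: enc_eq_iff not_1_cg_0)
  then show "carrier model \<noteq> {sone model}" using enc_in_model by blast
next
  fix I assume I: "sb_ideal I model"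
  interpret S: subgroup I "additive_group model" using I by (simp add: sb_ideal_def)
  interpret NA: normal I "additive_group model" using I by (simp add: sb_ideal_def)
  interpret NM: normal I "multiplicative_group model" using I by (simp add: sb_ideal_def)
  have add: "enc (f + Z i * g) (i + j) \<in> I" if "enc f i \<in> I" "enc g j \<in> I" for f g i j
    using S.m_closed[OF that] by simp
  show "I = {sone model} \<or> I = carrier model"
  proof (cases "I = {sone model}")
    case False
    then obtain x where x: "x \<in> I" "x \<noteq> sone model" using S.one_closed by auto
    then obtain f i where fi: "x = enc f i" using S.subset model_cases[of x] by (metis additive_group_simps(1) subsetD)
    have "\<exists>g. \<not> g \<simeq> 0 \<and> enc g 0 \<in> I"
    proof (cases "[i = 0] (mod int q)")
      case True
      then have "enc f 0 \<in> I" "\<not> f \<simeq> 0" using x fi by (auto simp: enc_eq_iff elim: back_subst[of "\<lambda>x. x \<in> I"] intro: cong_sym)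
      then show ?thesis by blast
    next
      case False
      have "enc 1 0 \<otimes>\<^bsub>additive_group model\<^esub> x \<otimes>\<^bsub>additive_group model\<^esub> inv\<^bsub>additive_group model\<^esub> (enc 1 0) \<in> I"
        using x by (intro NA.inv_op_closed2) simp_all
      then have "enc (1 + f + Z i * - 1) i \<in> I" by (simp add: fi)
      moreover have "enc (- (Z (- i) * f)) (- i) \<in> I" using S.m_inv_closed[OF x(1)] fi by simp
      ultimately have "enc (1 + f + Z i * - 1 + Z i * - (Z (- i) * f)) (i + - i) \<in> I" by (rule add)
      moreover have "1 + f + Z i * - 1 + Z i * - (Z (- i) * f) \<simeq> 1 - Z i"
      proof -
        have "(Z i * Z (- i)) * f \<simeq> 1 * f" by (intro cg_mult Z_minus cg_refl)
        then have "1 - Z i + (f - (Z i * Z (- i)) * f) \<simeq> 1 - Z i + (f - 1 * f)"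
          by (intro cg_add cg_diff cg_refl)
        then show ?thesis by (simp add: algebra_simps)
      qed
      then have "enc (1 + f + Z i * - 1 + Z i * - (Z (- i) * f)) (i + - i) = enc (1 - Z i) 0"
        by (simp add: enc_eq_iff)
      ultimately have "enc (1 - Z i) 0 \<in> I" by simp
      moreover have "\<not> 1 - Z i \<simeq> 0" using False Z_cg_1_iff cg_sym by (auto simp: cg_diff_0_iff)
      ultimately show ?thesis by blast
    qed
    then obtain g where g: "\<not> g \<simeq> 0" "enc g 0 \<in> I" by blast
    have V: "enc f 0 \<in> I" for f
    proof -
      have "f \<in> {f. enc f 0 \<in> I}"
      proof (rule X_module_generates[of _ g])
        show "f + g \<in> {f. enc f 0 \<in> I}" if "f \<in> {f. enc f 0 \<in> I}" "g \<in> {f. enc f 0 \<in> I}" for f g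
          using that add[of f 0 g 0] by simp
        show "g \<in> {f. enc f 0 \<in> I}" if "f \<in> {f. enc f 0 \<in> I}" "f \<simeq> g" for f g
          using that enc_eq_iff[of f 0 g 0] by simp
        show "X * f \<in> {f. enc f 0 \<in> I}" if "f \<in> {f. enc f 0 \<in> I}" for f
        proof -
          have "enc 0 1 \<otimes>\<^bsub>additive_group model\<^esub> enc f 0 \<otimes>\<^bsub>additive_group model\<^esub> inv\<^bsub>additive_group model\<^esub> (enc 0 1) \<in> I"
            using that by (intro NA.inv_op_closed2) simp_all
          then show ?thesis by (simp add: Z_1)
        qed
      qed (use g in auto)
      then show ?thesis by simp
    qed
    obtain t where t: "Tr t \<simeq> 1" using exists_trace_1 by blast
    have tt: "trace_index t = 1" using t p_gt_1 by (intro trace_index_eqI) simp_all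
    have "enc 0 1 \<otimes>\<^bsub>multiplicative_group model\<^esub> enc t 0 \<otimes>\<^bsub>multiplicative_group model\<^esub> inv\<^bsub>multiplicative_group model\<^esub> (enc 0 1) \<in> I"
      using V by (intro NM.inv_op_closed2) simp_all
    moreover have "inv\<^bsub>multiplicative_group model\<^esub> (enc 0 1) = enc 0 (- 1)"
      by (rule model_mult.inv_equality) simp_all
    ultimately have "enc t (1 - int p) \<in> I" by (simp add: pw_def tt)
    with V[of "- t"] have "enc (- t + Z 0 * t) (0 + (1 - int p)) \<in> I" by (rule add)
    then have base: "enc 0 (1 - int p) \<in> I" by simp
    have "enc 0 (int n * (1 - int p)) \<in> I" for n
    proof (induction n)
      case 0
      then show ?case using S.one_closed by simp
    next
      case (Suc n)
      show ?case using add[OF base Suc] by (simp add: algebra_simps)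
    qed
    then have "enc 0 j \<in> I" for j
      using p_minus_1_generates[of j] enc_eq_iff cg_refl by metis
    then have "enc f j \<in> I" for f j using add[OF V[of f], of 0 j] by simp
    then have "I = carrier model" using S.subset by (auto simp: carrier_model)
    then show ?thesis ..
  qed blast
qed

text \<open>The multiplicative operation on the elements with second component 0; it supplies the
  group \<open>P\<close> of the theorem.\<close>

definition star_group :: "nat monoid" where
  "star_group = \<lparr>carrier = range code, monoid.mult = (\<lambda>a b. code (rep a + tw (rep a) (rep b))), one = code 0\<rparr>"

lemma star_group_simps [simp]:
  "carrier star_group = range code"
  "code f \<otimes>\<^bsub>star_group\<^esub> code g = code (f + tw f g)"
  "\<one>\<^bsub>star_group\<^esub> = code 0"
  by (auto simp: star_group_def code_eq_iff intro!: cg_add tw_cong rep_code)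

lemma group_star_group: "group star_group"
proof (rule groupI)
  fix x y z assume "x \<in> carrier star_group" "y \<in> carrier star_group" "z \<in> carrier star_group"
  then obtain f g k where xyz: "x = code f" "y = code g" "z = code k" by auto
  have "f + tw f g + tw (f + tw f g) k \<simeq> f + tw f g + tw f (tw g k)"
    by (intro cg_add tw_star cg_refl)
  also have "\<dots> = f + (tw f g + tw f (tw g k))" by (simp add: add.assoc)
  also have "\<dots> \<simeq> f + tw f (g + tw g k)" by (intro cg_add cg_refl cg_sym[OF tw_add])
  finally show "x \<otimes>\<^bsub>star_group\<^esub> y \<otimes>\<^bsub>star_group\<^esub> z = x \<otimes>\<^bsub>star_group\<^esub> (y \<otimes>\<^bsub>star_group\<^esub> z)"
    by (simp add: xyz code_eq_iff)
next
  fix x assume "x \<in> carrier star_group"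
  then obtain f where x: "x = code f" by auto
  obtain f' where "f' + tw f' f \<simeq> 0" using star_left_inverse by blast
  then have "code f' \<otimes>\<^bsub>star_group\<^esub> x = \<one>\<^bsub>star_group\<^esub>" by (simp add: x code_eq_iff)
  then show "\<exists>y\<in>carrier star_group. y \<otimes>\<^bsub>star_group\<^esub> x = \<one>\<^bsub>star_group\<^esub>"
    by (metis star_group_simps(1) rangeI)
qed auto

lemma order_star_group: "order star_group = p ^ p"
  by (simp add: Coset.order_def card_field)

text \<open>The first component multiplies as in \<open>star_group\<close>, whose order
  \<open>p ^ p\<close> is prime to \<open>q\<close>, so it must be trivial. Hence multiplicative
  homomorphisms send \<open>(0, 1)\<close> to some \<open>(0, k)\<close>.\<close>

lemma q_torsion_model:
  assumes "x \<in> carrier model" "x [^]\<^bsub>multiplicative_group model\<^esub> q = enc 0 0"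
  shows "\<exists>i. x = enc 0 i"
proof -
  interpret P: group star_group by (rule group_star_group)
  obtain f i where fi: "x = enc f i" using assms(1) by (auto elim!: model_cases)
  have pow: "\<exists>j. enc f i [^]\<^bsub>multiplicative_group model\<^esub> n = enc (rep (code f [^]\<^bsub>star_group\<^esub> n)) j" for n :: nat
  proof (induction n)
    case 0
    have "rep (code 0) \<simeq> 0" by (rule rep_code)
    then have "enc 0 0 = enc (rep (code 0)) 0" by (simp add: enc_eq_iff cg_sym)
    then show ?case by auto
  next
    case (Suc n)
    then obtain j where j: "enc f i [^]\<^bsub>multiplicative_group model\<^esub> n = enc (rep (code f [^]\<^bsub>star_group\<^esub> n)) j" by blast
    obtain g where g: "code f [^]\<^bsub>star_group\<^esub> n = code g"
      using P.nat_pow_closed[of "code f" n] by auto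
    have "rep (code g) + tw (rep (code g)) f \<simeq> g + tw g f" by (intro cg_add tw_cong rep_code cg_refl)
    also have "\<dots> \<simeq> rep (code (g + tw g f))" by (rule cg_sym[OF rep_code])
    finally have "enc (rep (code g) + tw (rep (code g)) f) (j + pw (rep (code g)) * i)
       = enc (rep (code (g + tw g f))) (j + pw (rep (code g)) * i)" by (simp add: enc_eq_iff)
    then show ?case using j g by auto
  qed
  obtain j where "enc 0 0 = enc (rep (code f [^]\<^bsub>star_group\<^esub> q)) j" using pow[of q] assms(2) fi by auto
  then have "rep (code f [^]\<^bsub>star_group\<^esub> q) \<simeq> 0" by (simp add: enc_eq_iff cg_sym)
  moreover obtain g where g: "code f [^]\<^bsub>star_group\<^esub> q = code g"
    using P.nat_pow_closed[of "code f" q] by auto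
  ultimately have "code f [^]\<^bsub>star_group\<^esub> q = \<one>\<^bsub>star_group\<^esub>"
    using cg_trans[OF cg_sym[OF rep_code[of g]]] by (simp add: code_eq_iff)
  then have "P.ord (code f) dvd q" using P.pow_eq_id[of "code f" q] by simp
  moreover have "P.ord (code f) dvd p ^ p" using P.ord_dvd_group_order[of "code f"] order_star_group by simp
  ultimately have "P.ord (code f) = 1" using coprime_p_q by (meson coprime_common_divisor_nat coprime_power_left_iff)
  then have "code f = code 0" using P.ord_eq_1[of "code f"] by simp
  then have "f \<simeq> 0" using code_eq_iff by simp
  then have "x = enc 0 i" by (simp add: fi enc_eq_iff)
  then show ?thesis by blast
qed

lemma model_mult_pow: "enc 0 i [^]\<^bsub>multiplicative_group model\<^esub> (n :: nat) = enc 0 (int n * i)"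
  by (induction n) (simp_all add: algebra_simps)

lemma model_add_pow: "\<exists>g. enc f i [^]\<^bsub>additive_group model\<^esub> (n :: nat) = enc g (int n * i)"
proof (induction n)
  case (Suc n)
  then obtain g where "enc f i [^]\<^bsub>additive_group model\<^esub> n = enc g (int n * i)" by blast
  then have "enc f i [^]\<^bsub>additive_group model\<^esub> Suc n = enc (g + Z (int n * i) * f) (int (Suc n) * i)"
    by (simp add: algebra_simps)
  then show ?case by blast
qed auto

lemma model_add_pow_0: "enc f 0 [^]\<^bsub>additive_group model\<^esub> (n :: nat) = enc (of_nat n * f) 0"
  by (induction n) (simp_all add: algebra_simps)

lemma hom_q_torsion:
  assumes f: "f \<in> hom (multiplicative_group model) (multiplicative_group model)"
  shows "\<exists>k. f (enc 0 1) = enc 0 k"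
proof (rule q_torsion_model)
  show "f (enc 0 1) \<in> carrier model" using hom_in_carrier[OF f, of "enc 0 1"] by simp
  interpret h: group_hom "multiplicative_group model" "multiplicative_group model" f
    using f by unfold_locales
  have "enc 0 1 [^]\<^bsub>multiplicative_group model\<^esub> q = enc 0 0"
    by (simp add: model_mult_pow enc_eq_iff cong_def)
  then show "f (enc 0 1) [^]\<^bsub>multiplicative_group model\<^esub> q = enc 0 0"
    using h.hom_nat_pow[of "enc 0 1" q] h.hom_one by simp
qed

text \<open>In the model, multiplying by \<open>(0, k)\<close> from the left is adding
  \<open>(0, k)\<close> on the right. An isomorphism to the opposite sends \<open>(0, 1)\<close> to
  such an element, so it would identify the multiplicative product of \<open>(0, 1)\<close> and
  \<open>(1, 0)\<close> with their additive product; these are \<open>(1, 1)\<close> and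
  \<open>(X, 1)\<close>.\<close>

lemma not_isomorphic_opposite_model: "\<not> sb_isomorphic model (opposite model)"
proof
  assume "sb_isomorphic model (opposite model)"
  then obtain f where f: "f \<in> sb_hom model (opposite model)" "bij_betw f (carrier model) (carrier model)"
    by (auto simp: sb_isomorphic_def)
  then have fm: "f \<in> hom (multiplicative_group model) (multiplicative_group model)"
    by (simp add: sb_hom_def)
  obtain k where k: "f (enc 0 1) = enc 0 k" using hom_q_torsion[OF fm] by blast
  have "f (enc 1 0) \<in> carrier model" using hom_in_carrier[OF fm, of "enc 1 0"] by simp
  then obtain w l where w: "f (enc 1 0) = enc w l" by (auto elim!: model_cases)
  have "f (scirc model (enc 0 1) (enc 1 0)) = scirc model (f (enc 0 1)) (f (enc 1 0))"
    using hom_mult[OF fm, of "enc 0 1" "enc 1 0"] by simp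
  moreover have "f (sadd model (enc 0 1) (enc 1 0)) = sadd model (f (enc 1 0)) (f (enc 0 1))"
    using f(1) hom_mult[of f "additive_group model" "additive_group (opposite model)" "enc 0 1" "enc 1 0"]
    by (simp add: sb_hom_def)
  ultimately have "f (enc 1 1) = f (enc X 1)" by (simp add: k w Z_1 add.commute)
  then have "enc 1 1 = enc X 1" using f(2) by (auto simp: bij_betw_def dest: inj_onD)
  then show False using not_X_cg_1 cg_sym by (simp add: enc_eq_iff)
qed

section \<open>Automorphisms of the model: powers of the Frobenius map\<close>

definition frob :: "nat \<Rightarrow> nat \<Rightarrow> nat" where
  "frob j x = (case prod_decode x of (a, i) \<Rightarrow> enc (rep a ^ (p ^ j)) (int (p ^ j) * int i))"

lemma frob_enc [simp]: "frob j (enc f i) = enc (f ^ (p ^ j)) (int (p ^ j) * i)"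
proof -
  have "[int (p ^ j) * int (nat (i mod int q)) = int (p ^ j) * i] (mod int q)"
    by (intro cong_mult nat_mod_cong cong_refl)
  then show ?thesis
    unfolding frob_def enc_def[of f] by (simp add: enc_eq_iff cg_power rep_code)
qed

lemma frob_in_model: "x \<in> carrier model \<Longrightarrow> frob j x \<in> carrier model"
  by (auto elim!: model_cases)

lemma frob_frob: "x \<in> carrier model \<Longrightarrow> frob i (frob j x) = frob (i + j) x"
  by (auto elim!: model_cases simp: power_add mult_ac simp flip: power_mult)

lemma frob_cong_iff: "(\<forall>x\<in>carrier model. frob i x = frob j x) \<longleftrightarrow> [i = j] (mod p)"
proof
  assume "\<forall>x\<in>carrier model. frob i x = frob j x"
  then have "frob i (enc 0 1) = frob j (enc 0 1)" using enc_in_model by blast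
  then have "[int (p ^ i) = int (p ^ j)] (mod int q)" by (simp add: enc_eq_iff)
  then show "[i = j] (mod p)" by (simp only: cong_int_iff p_pow_cong_iff)
next
  assume ij: "[i = j] (mod p)"
  then have "[p ^ i = p ^ j] (mod q)" using p_pow_cong_iff by blast
  then have "[int (p ^ i) = int (p ^ j)] (mod int q)" by (simp only: cong_int_iff)
  then have "[int (p ^ i) * k = int (p ^ j) * k] (mod int q)" for k by (intro cong_mult cong_refl)
  then show "\<forall>x\<in>carrier model. frob i x = frob j x"
    using frobenius_pow_cong[OF ij] by (auto elim!: model_cases simp: enc_eq_iff)
qed

lemma frob_0: "x \<in> carrier model \<Longrightarrow> frob 0 x = x"
  by (auto elim!: model_cases)

lemma frob_hom: "frob j \<in> sb_hom model model"
  unfolding sb_hom_def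
proof (rule IntI; rule homI)
  fix x y assume "x \<in> carrier (additive_group model)" "y \<in> carrier (additive_group model)"
  then obtain f i g k where xy: "x = enc f i" "y = enc g k" by (auto elim!: model_cases)
  have "(f + Z i * g) ^ (p ^ j) \<simeq> f ^ (p ^ j) + (Z i * g) ^ (p ^ j)" by (rule frobenius_pow_add)
  also have "\<dots> = f ^ (p ^ j) + Z i ^ (p ^ j) * g ^ (p ^ j)" by (simp add: power_mult_distrib)
  also have "\<dots> \<simeq> f ^ (p ^ j) + Z (int (p ^ j) * i) * g ^ (p ^ j)"
    by (intro cg_add cg_mult cg_refl Z_power)
  finally show "frob j (x \<otimes>\<^bsub>additive_group model\<^esub> y) = frob j x \<otimes>\<^bsub>additive_group model\<^esub> frob j y"
    by (simp add: xy enc_eq_iff algebra_simps)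
next
  fix x y assume "x \<in> carrier (multiplicative_group model)" "y \<in> carrier (multiplicative_group model)"
  then obtain f i g k where xy: "x = enc f i" "y = enc g k" by (auto elim!: model_cases)
  have "(f + tw f g) ^ (p ^ j) \<simeq> f ^ (p ^ j) + tw f g ^ (p ^ j)" by (rule frobenius_pow_add)
  also have "\<dots> = f ^ (p ^ j) + tw (f ^ (p ^ j)) (g ^ (p ^ j))"
    by (simp add: tw_def trace_index_frobenius mult.commute flip: power_mult)
  finally show "frob j (x \<otimes>\<^bsub>multiplicative_group model\<^esub> y) = frob j x \<otimes>\<^bsub>multiplicative_group model\<^esub> frob j y"
    by (simp add: xy enc_eq_iff pw_def trace_index_frobenius algebra_simps)
qed (simp_all add: frob_in_model)

definition frob_aut :: "nat \<Rightarrow> nat \<Rightarrow> nat" where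
  "frob_aut j = restrict (frob j) (carrier model)"

lemma frob_aut_eq_iff: "frob_aut i = frob_aut j \<longleftrightarrow> [i = j] (mod p)"
proof -
  have "frob_aut i = frob_aut j \<longleftrightarrow> (\<forall>x\<in>carrier model. frob i x = frob j x)"
    unfolding frob_aut_def fun_eq_iff restrict_def by auto
  then show ?thesis by (simp only: frob_cong_iff)
qed

lemma frob_bij: "bij_betw (frob j) (carrier model) (carrier model)"
proof -
  \<comment> \<open>\<open>j * (p - 1)\<close> is \<open>- j\<close> modulo \<open>p\<close>, the
    exponent of the inverse map.\<close>
  have *: "[j * (p - 1) + j = 0] (mod p)"
    using p_gt_1 by (simp add: cong_0_iff algebra_simps)
  have "frob (j * (p - 1)) (frob j x) = x" "frob j (frob (j * (p - 1)) x) = x" if x: "x \<in> carrier model" for x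
    using frob_cong_iff[of "j * (p - 1) + j" 0] * frob_0 x by (auto simp: frob_frob add.commute)
  then show ?thesis
    by (intro bij_betw_byWitness[where f' = "frob (j * (p - 1))"]) (auto simp: frob_in_model)
qed

lemma frob_aut_carrier: "frob_aut j \<in> sb_hom model model \<inter> Bij (carrier model)"
proof
  have "frob_aut j x = frob j x" if "x \<in> carrier model" for x
    using that by (simp add: frob_aut_def)
  then show "frob_aut j \<in> sb_hom model model"
    using frob_hom[of j] model_add.m_closed model_mult.m_closed unfolding sb_hom_def hom_def by auto
  show "frob_aut j \<in> Bij (carrier model)"
    using frob_bij by (simp add: frob_aut_def Bij_def cong: bij_betw_cong)
qed

text \<open>On the first factor an automorphism is an additive map \<open>g\<close> that turns
  multiplication by \<open>X\<close> into multiplication by \<open>X ^ k\<close>. Its value at 1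
  lies in the prime field, say \<open>d\<close>, so \<open>g\<close> is \<open>d\<close> times a
  power of the Frobenius map; compatibility with the twisting by the trace forces
  \<open>d = 1\<close>.\<close>

lemma automorphism_is_frob:
  assumes f: "f \<in> sb_hom model model" and bij: "bij_betw f (carrier model) (carrier model)"
  shows "\<exists>j. \<forall>x\<in>carrier model. f x = frob j x"
proof -
  have fa: "f \<in> hom (additive_group model) (additive_group model)"
    and fm: "f \<in> hom (multiplicative_group model) (multiplicative_group model)"
    using f by (simp_all add: sb_hom_def)
  interpret a: group_hom "additive_group model" "additive_group model" f using fa by unfold_locales
  have fadd: "f (sadd model x y) = sadd model (f x) (f y)" if "x \<in> carrier model" "y \<in> carrier model" for x y
    using hom_mult[OF fa] that by simp
  have fcirc: "f (scirc model x y) = scirc model (f x) (f y)" if "x \<in> carrier model" "y \<in> carrier model" for x y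
    using hom_mult[OF fm] that by simp
  have inj: "f x = f y \<Longrightarrow> x = y" if "x \<in> carrier model" "y \<in> carrier model" for x y
    using bij that by (auto simp: bij_betw_def dest: inj_onD)
  obtain k\<^sub>0 where "f (enc 0 1) = enc 0 k\<^sub>0" using hom_q_torsion[OF fm] by blast
  moreover define k where "k = nat (k\<^sub>0 mod int q)"
  ultimately have k: "f (enc 0 1) = enc 0 (int k)"
    by (simp only: k_def enc_eq_iff cg_refl cong_sym[OF nat_mod_cong] simp_thms)
  \<comment> \<open>Elements of the first factor have additive order dividing \<open>p\<close>, and
    \<open>p\<close> is invertible modulo \<open>q\<close>, so the image has second component
    0.\<close>
  have V: "\<exists>g. f (enc u 0) = enc g 0" for u
  proof -
    obtain g i where gi: "f (enc u 0) = enc g i"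
      using a.hom_closed[of "enc u 0"] by (auto elim!: model_cases)
    have "f (enc (of_nat p * u) 0) = f (enc u 0) [^]\<^bsub>additive_group model\<^esub> p"
      using a.hom_nat_pow[of "enc u 0" p] by (simp add: model_add_pow_0)
    moreover have "enc (of_nat p * u) 0 = enc 0 0"
      using cg_mult[OF p_cg_0 cg_refl, of u] by (simp add: enc_eq_iff)
    moreover have "f (enc 0 0) = enc 0 0" using a.hom_one by simp
    moreover obtain g' where "enc g i [^]\<^bsub>additive_group model\<^esub> p = enc g' (int p * i)"
      using model_add_pow by blast
    ultimately have "enc 0 0 = enc g' (int p * i)" using gi by simp
    then have "[int p * i = int p * 0] (mod int q)" by (simp add: enc_eq_iff cong_sym)
    moreover have "coprime (int p) (int q)" using coprime_p_q by simp
    ultimately have "[i = 0] (mod int q)" using cong_mult_lcancel by blast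
    then have "enc g i = enc g 0" by (simp add: enc_eq_iff)
    then show ?thesis using gi by auto
  qed
  define g where "g u = (SOME w. f (enc u 0) = enc w 0)" for u
  have g: "f (enc u 0) = enc (g u) 0" for u unfolding g_def by (rule someI_ex[OF V])
  have gcong: "g u \<simeq> g v" if "u \<simeq> v" for u v
  proof -
    have "enc u 0 = enc v 0" using that by (simp add: enc_eq_iff)
    then have "enc (g u) 0 = enc (g v) 0" using g[of u] g[of v] by simp
    then show ?thesis by (simp add: enc_eq_iff)
  qed
  have ginj: "u \<simeq> v" if "g u \<simeq> g v" for u v
  proof -
    have "enc (g u) 0 = enc (g v) 0" using that by (simp add: enc_eq_iff)
    then have "f (enc u 0) = f (enc v 0)" by (simp only: g)
    then have "enc u 0 = enc v 0" by (rule inj[rotated 2]) simp_all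
    then show ?thesis by (simp add: enc_eq_iff)
  qed
  have gadd: "g (u + v) \<simeq> g u + g v" for u v
    using fadd[of "enc u 0" "enc v 0"] by (simp add: g enc_eq_iff)
  have gX: "g (X * u) \<simeq> X ^ k * g u" for u
  proof -
    have "f (sadd model (enc 0 1) (enc u 0)) = enc (Z (int k) * g u) (int k)"
      by (subst fadd) (simp_all add: k g)
    moreover have "f (sadd model (enc (X * u) 0) (enc 0 1)) = enc (g (X * u)) (int k)"
      by (subst fadd) (simp_all add: k g)
    ultimately have "g (X * u) \<simeq> Z (int k) * g u" by (simp add: Z_1 enc_eq_iff cg_commute)
    also have "\<dots> \<simeq> X ^ k * g u" by (intro cg_mult cg_refl Z_of_nat)
    finally show ?thesis .
  qed
  have gcirc: "g (u + tw u v) \<simeq> g u + tw (g u) (g v)" for u v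
    using fcirc[of "enc u 0" "enc v 0"] by (simp add: g enc_eq_iff)
  have gtw: "g (tw u v) \<simeq> tw (g u) (g v)" for u v
  proof -
    have "g u + g (tw u v) \<simeq> g u + tw (g u) (g v)"
      using cg_trans[OF cg_sym[OF gadd] gcirc] .
    then show ?thesis by (simp add: cg_def)
  qed
  have g0: "g 0 \<simeq> 0" using gadd[of 0 0] by (simp add: cg_def) (metis P_uminus minus_minus)
  obtain t where t: "Tr t \<simeq> 1" using exists_trace_1 by blast
  have tt: "trace_index t = 1" using t p_gt_1 by (intro trace_index_eqI) simp_all
  define c where "c = trace_index (g t)"
  have c: "c < p" by (simp add: c_def trace_index)
  \<comment> \<open>As \<open>t\<close> has trace 1, \<open>tw t\<close> is the Frobenius map
    itself; \<open>g\<close> carries it to its \<open>c\<close>-th power.\<close>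
  have gp: "g (v ^ p) \<simeq> g v ^ (p ^ c)" for v
    using gtw[of t v] by (simp add: tw_def tt c_def)
  have Xp: "\<not> X ^ p \<simeq> X"
    using X_power_cg_iff[of p 1] p_not_cong_1 by simp
  have "c \<noteq> 0"
  proof
    assume "c = 0"
    then have "g (X ^ p) \<simeq> g X" using gp[of X] by simp
    then show False using ginj Xp by blast
  qed
  have "\<not> p dvd c" using c \<open>c \<noteq> 0\<close> by (auto dest: dvd_imp_le)
  then have "coprime c p" using p prime_imp_coprime_nat coprime_commute by metis
  then obtain m where m: "[c * m = 1] (mod p)" using cong_solve_coprime_nat by auto
  \<comment> \<open>\<open>g 1\<close> is fixed by the \<open>c\<close>-th Frobenius power. Since
    \<open>c\<close> is invertible modulo \<open>p\<close>, it is fixed by the Frobenius map and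
    lies in the prime field.\<close>
  have g1: "g 1 ^ (p ^ c) \<simeq> g 1" using gp[of 1] cg_sym by simp
  have "g 1 ^ (p ^ (c * i)) \<simeq> g 1" for i
  proof (induction i)
    case (Suc i)
    have "g 1 ^ (p ^ (c * Suc i)) = (g 1 ^ (p ^ c)) ^ (p ^ (c * i))"
      by (simp add: power_add flip: power_mult)
    also have "\<dots> \<simeq> g 1 ^ (p ^ (c * i))" by (intro cg_power g1)
    finally show ?case using Suc cg_trans by blast
  qed simp
  then have "g 1 ^ (p ^ 1) \<simeq> g 1"
    using cg_trans[OF frobenius_pow_cong[OF cong_sym[OF m]]] by blast
  then obtain d where d: "d < p" "g 1 \<simeq> of_nat d" using frobenius_fixed by auto
  have "\<not> [d = 0] (mod p)"
  proof
    assume "[d = 0] (mod p)"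
    then have "g 1 \<simeq> g 0" using of_nat_cg_iff[of d 0] cg_trans[OF d(2)] cg_sym[OF g0] cg_trans by (metis of_nat_0)
    then show False using ginj not_1_cg_0 by blast
  qed
  then have "coprime d p" using p prime_imp_coprime_nat coprime_commute cong_0_iff by metis
  then obtain e where e: "[d * e = 1] (mod p)" using cong_solve_coprime_nat by auto
  then have ed: "of_nat e * of_nat d \<simeq> 1" "of_nat d * of_nat e \<simeq> 1"
    using of_nat_cg_iff[of "d * e" 1] by (simp_all add: mult.commute)
  have "\<exists>a<p. [k = p ^ a] (mod q) \<and> (\<forall>f. of_nat e * g f \<simeq> f ^ (p ^ a))"
  proof (rule semilinear_is_frobenius)
    show "of_nat e * g u \<simeq> of_nat e * g v" if "u \<simeq> v" for u v
      using that gcong by (intro cg_mult cg_refl)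
    show "of_nat e * g (u + v) \<simeq> of_nat e * g u + of_nat e * g v" for u v
      using cg_mult[OF cg_refl gadd[of u v], of "of_nat e"] by (simp add: distrib_left)
    show "of_nat e * g (X * u) \<simeq> X ^ k * (of_nat e * g u)" for u
      using cg_mult[OF cg_refl gX[of u], of "of_nat e"] by (simp add: mult_ac)
    show "of_nat e * g 1 \<simeq> 1" using cg_trans[OF cg_mult[OF cg_refl d(2)] ed(1)] .
  qed
  then obtain a where a: "[k = p ^ a] (mod q)" "\<And>f. of_nat e * g f \<simeq> f ^ (p ^ a)" by blast
  have gd: "g u \<simeq> of_nat d * u ^ (p ^ a)" for u
  proof -
    have "g u = 1 * g u" by simp
    also have "\<dots> \<simeq> (of_nat d * of_nat e) * g u" by (intro cg_mult cg_refl cg_sym[OF ed(2)])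
    also have "\<dots> = of_nat d * (of_nat e * g u)" by (simp add: mult.assoc)
    also have "\<dots> \<simeq> of_nat d * u ^ (p ^ a)" by (intro cg_mult cg_refl a)
    finally show ?thesis .
  qed
  have cd: "[c = d] (mod p)"
  proof -
    have "c = trace_index (of_nat d * t ^ (p ^ a))" unfolding c_def by (intro trace_index_cong gd)
    then have "[c = d * trace_index (t ^ (p ^ a))] (mod p)" using trace_index_of_nat_mult by simp
    then show ?thesis by (simp add: trace_index_frobenius tt)
  qed
  have dfix: "of_nat d ^ (p ^ c) \<simeq> of_nat d" by (rule of_nat_frobenius_pow)
  \<comment> \<open>Two evaluations of \<open>g (X ^ p)\<close>: comparing the exponents of
    \<open>X\<close> gives \<open>1 + a = c + a\<close> modulo \<open>p\<close>, so \<open>c\<close>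
    is 1, and \<open>c = d\<close> modulo \<open>p\<close> by linearity of the trace.\<close>
  have "of_nat d * (X ^ p) ^ (p ^ a) \<simeq> g (X ^ p)" by (rule cg_sym[OF gd])
  also have "\<dots> \<simeq> g X ^ (p ^ c)" by (rule gp)
  also have "\<dots> \<simeq> (of_nat d * X ^ (p ^ a)) ^ (p ^ c)" by (intro cg_power gd)
  also have "\<dots> = of_nat d ^ (p ^ c) * (X ^ (p ^ a)) ^ (p ^ c)" by (simp add: power_mult_distrib)
  also have "\<dots> \<simeq> of_nat d * (X ^ (p ^ a)) ^ (p ^ c)" by (intro cg_mult cg_refl dfix)
  finally have "of_nat d * (X ^ p) ^ (p ^ a) \<simeq> of_nat d * (X ^ (p ^ a)) ^ (p ^ c)" .
  moreover have "\<not> of_nat d \<simeq> 0" using \<open>\<not> [d = 0] (mod p)\<close> of_nat_cg_iff[of d 0] by simp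
  ultimately have "(X ^ p) ^ (p ^ a) \<simeq> (X ^ (p ^ a)) ^ (p ^ c)" by (rule cg_mult_cancel)
  then have "X ^ (p ^ (1 + a)) \<simeq> X ^ (p ^ (c + a))"
    by (simp add: power_add mult_ac flip: power_mult)
  then have "[1 + a = c + a] (mod p)" unfolding X_power_cg_iff p_pow_cong_iff .
  then have "[1 = c] (mod p)" by (simp only: cong_add_rcancel_nat)
  then have "[d = 1] (mod p)" using cd cong_sym cong_trans by blast
  then have d1: "of_nat d \<simeq> 1" using of_nat_cg_iff[of d 1] by simp
  have gf: "g u \<simeq> u ^ (p ^ a)" for u
    using cg_trans[OF gd[of u] cg_mult[OF d1 cg_refl, of "u ^ (p ^ a)"]] by simp
  have fn: "f (enc 0 (int n)) = enc 0 (int n * int k)" for n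
  proof (induction n)
    case 0
    then show ?case using a.hom_one by simp
  next
    case (Suc n)
    have "f (sadd model (enc 0 1) (enc 0 (int n))) = enc 0 (int k + int n * int k)"
      by (subst fadd) (simp_all add: k Suc)
    then show ?case by (simp add: algebra_simps)
  qed
  have "f x = frob a x" if "x \<in> carrier model" for x
  proof -
    obtain u i where x: "x = enc u i" using \<open>x \<in> carrier model\<close> by (auto elim!: model_cases)
    define n where "n = nat (i mod int q)"
    have n: "[int n = i] (mod int q)" unfolding n_def by (rule nat_mod_cong)
    then have xn: "x = enc u (int n)" by (simp add: x enc_eq_iff cong_sym)
    have "f x = f (sadd model (enc u 0) (enc 0 (int n)))" by (simp add: xn)
    also have "\<dots> = enc (g u) (int n * int k)" by (subst fadd) (simp_all add: g fn)
    also have "\<dots> = enc (u ^ (p ^ a)) (int (p ^ a) * int n)"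
    proof -
      have "[int k = int (p ^ a)] (mod int q)" using a(1) by (simp only: cong_int_iff)
      then have "[int n * int k = int n * int (p ^ a)] (mod int q)" by (intro cong_mult cong_refl)
      then show ?thesis using gf by (simp add: enc_eq_iff mult.commute)
    qed
    finally show ?thesis by (simp add: xn)
  qed
  then show ?thesis by blast
qed

lemma sb_AutoGroup_model_carrier: "carrier (sb_AutoGroup model) = frob_aut ` {..<p}"
proof
  show "frob_aut ` {..<p} \<subseteq> carrier (sb_AutoGroup model)"
    using frob_aut_carrier by (auto simp: sb_AutoGroup_def)
  show "carrier (sb_AutoGroup model) \<subseteq> frob_aut ` {..<p}"
  proof
    fix f assume "f \<in> carrier (sb_AutoGroup model)"
    then have f: "f \<in> sb_hom model model" "f \<in> Bij (carrier model)" by (simp_all add: sb_AutoGroup_def)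
    then have "bij_betw f (carrier model) (carrier model)" "f \<in> extensional (carrier model)" by (simp_all add: Bij_def)
    moreover obtain j where "\<forall>x\<in>carrier model. f x = frob j x"
      using automorphism_is_frob[OF f(1) calculation(1)] by blast
    ultimately have "f = frob_aut j" unfolding frob_aut_def
      by (intro extensionalityI[of f "carrier model"]) simp_all
    also have "\<dots> = frob_aut (j mod p)" by (simp add: frob_aut_eq_iff cong_def)
    finally show "f \<in> frob_aut ` {..<p}" using p_gt_1 by auto
  qed
qed

lemma sb_AutoGroup_model_mult: "frob_aut i \<otimes>\<^bsub>sb_AutoGroup model\<^esub> frob_aut j = frob_aut (i + j)"
proof -
  have "frob_aut i \<otimes>\<^bsub>sb_AutoGroup model\<^esub> frob_aut j = compose (carrier model) (frob_aut i) (frob_aut j)"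
    using frob_aut_carrier[of i] frob_aut_carrier[of j] by (simp add: sb_AutoGroup_def BijGroup_def)
  also have "\<dots> = frob_aut (i + j)"
    by (rule ext) (simp add: compose_def frob_aut_def frob_in_model frob_frob)
  finally show ?thesis .
qed

lemma sb_AutoGroup_model_one: "\<one>\<^bsub>sb_AutoGroup model\<^esub> = frob_aut 0"
  by (rule ext) (simp add: sb_AutoGroup_def BijGroup_def frob_aut_def frob_0)

lemma frob_aut_in_AutoGroup: "frob_aut j \<in> carrier (sb_AutoGroup model)"
  using frob_aut_carrier by (simp add: sb_AutoGroup_def)

lemma group_sb_AutoGroup_model: "group (sb_AutoGroup model)"
proof (rule groupI)
  fix x y z assume "x \<in> carrier (sb_AutoGroup model)" "y \<in> carrier (sb_AutoGroup model)" "z \<in> carrier (sb_AutoGroup model)"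
  then obtain i j k where "x = frob_aut i" "y = frob_aut j" "z = frob_aut k"
    by (auto simp: sb_AutoGroup_model_carrier)
  then show "x \<otimes>\<^bsub>sb_AutoGroup model\<^esub> y \<in> carrier (sb_AutoGroup model)"
    "x \<otimes>\<^bsub>sb_AutoGroup model\<^esub> y \<otimes>\<^bsub>sb_AutoGroup model\<^esub> z = x \<otimes>\<^bsub>sb_AutoGroup model\<^esub> (y \<otimes>\<^bsub>sb_AutoGroup model\<^esub> z)"
    by (simp_all add: sb_AutoGroup_model_mult frob_aut_in_AutoGroup add.assoc)
next
  fix x assume "x \<in> carrier (sb_AutoGroup model)"
  then obtain i where x: "x = frob_aut i" by (auto simp: sb_AutoGroup_model_carrier)
  show "\<one>\<^bsub>sb_AutoGroup model\<^esub> \<otimes>\<^bsub>sb_AutoGroup model\<^esub> x = x"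
    by (simp add: x sb_AutoGroup_model_one sb_AutoGroup_model_mult)
  have "[i * (p - 1) + i = 0] (mod p)" using p_gt_1 by (simp add: cong_0_iff algebra_simps)
  then have "frob_aut (i * (p - 1)) \<otimes>\<^bsub>sb_AutoGroup model\<^esub> x = \<one>\<^bsub>sb_AutoGroup model\<^esub>"
    by (simp add: x sb_AutoGroup_model_one sb_AutoGroup_model_mult frob_aut_eq_iff)
  then show "\<exists>y\<in>carrier (sb_AutoGroup model). y \<otimes>\<^bsub>sb_AutoGroup model\<^esub> x = \<one>\<^bsub>sb_AutoGroup model\<^esub>"
    using frob_aut_in_AutoGroup by blast
qed (simp add: sb_AutoGroup_model_one frob_aut_in_AutoGroup)

lemma order_sb_AutoGroup_model: "order (sb_AutoGroup model) = p"
proof -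
  have "inj_on frob_aut {..<p}"
    by (rule inj_onI) (simp add: frob_aut_eq_iff cong_less_modulus_unique_nat)
  then show ?thesis by (simp add: Coset.order_def sb_AutoGroup_model_carrier card_image)
qed

lemma cyclic_sb_AutoGroup_model: "cyclic_group (sb_AutoGroup model)"
proof -
  interpret A: group "sb_AutoGroup model" by (rule group_sb_AutoGroup_model)
  have pow: "frob_aut 1 [^]\<^bsub>sb_AutoGroup model\<^esub> n = frob_aut n" for n :: nat
    by (induction n) (simp_all add: sb_AutoGroup_model_one sb_AutoGroup_model_mult)
  have "carrier (sb_AutoGroup model) = range (\<lambda>n::int. frob_aut 1 [^]\<^bsub>sb_AutoGroup model\<^esub> n)"
  proof
    show "carrier (sb_AutoGroup model) \<subseteq> range (\<lambda>n::int. frob_aut 1 [^]\<^bsub>sb_AutoGroup model\<^esub> n)"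
    proof
      fix x assume "x \<in> carrier (sb_AutoGroup model)"
      then obtain i where "x = frob_aut i" by (auto simp: sb_AutoGroup_model_carrier)
      then have "x = frob_aut 1 [^]\<^bsub>sb_AutoGroup model\<^esub> int i" by (simp only: int_pow_int pow)
      then show "x \<in> range (\<lambda>n::int. frob_aut 1 [^]\<^bsub>sb_AutoGroup model\<^esub> n)" by blast
    qed
    show "range (\<lambda>n::int. frob_aut 1 [^]\<^bsub>sb_AutoGroup model\<^esub> n) \<subseteq> carrier (sb_AutoGroup model)"
      using A.int_pow_closed[OF frob_aut_in_AutoGroup] by blast
  qed
  then show ?thesis using A.cyclic_group frob_aut_in_AutoGroup by blast
qed

end

lemma sb_AutoGroup_opposite: "sb_AutoGroup (opposite B) = sb_AutoGroup B"
proof -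
  have "hom (additive_group (opposite B)) (additive_group (opposite B)) = hom (additive_group B) (additive_group B)"
    by (auto simp: hom_def)
  then show ?thesis by (simp add: sb_AutoGroup_def sb_hom_def)
qed

text \<open>A basis is built step by step: while \<open>j < k\<close>, an embedding of the
  \<open>j\<close>-fold product is extended by an element outside its image; for
  \<open>j = k\<close> cardinality makes the embedding onto.\<close>

lemma elementary_abelian_iso_product:
  fixes G (structure)
  assumes "comm_group G" "prime p" "\<And>x. x \<in> carrier G \<Longrightarrow> x [^] (p :: nat) = \<one>" "order G = p ^ k"
  shows "product_group {..<k} (\<lambda>_. integer_mod_group p) \<cong> G"
proof -
  interpret comm_group G by fact
  let ?Z = "integer_mod_group p" and ?P = "\<lambda>j :: nat. product_group {..<j} (\<lambda>_. integer_mod_group p)"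
  have p0: "p > 0" using assms(2) prime_gt_0_nat by blast
  have grpP: "group (?P j)" for j by simp
  have carP: "carrier (?P j) = {..<j} \<rightarrow>\<^sub>E {0..<int p}" for j
    using p0 by (simp add: carrier_integer_mod_group)
  have cardP: "card (carrier (?P j)) = p ^ j" for j
    unfolding carP by (simp add: card_PiE)
  have finP: "finite (carrier (?P j))" for j unfolding carP by (intro finite_PiE) simp_all
  have finG: "finite (carrier G)" using assms(2,4) p0 order_gt_0_iff_finite by simp
  have powmod: "a [^] (i mod int p) = a [^] i" if a: "a \<in> carrier G" for a and i :: int
  proof -
    have "ord a dvd p" using assms(3)[OF a] pow_eq_id[OF a] by simp
    then have "int (ord a) dvd int p" by (simp only: int_dvd_int_iff)
    moreover have "int p dvd i - i mod int p" by (simp add: minus_mod_eq_mult_div)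
    ultimately show ?thesis using int_pow_eq[OF a] dvd_trans by blast
  qed
  have "\<exists>f \<in> hom (?P j) G. inj_on f (carrier (?P j))" if "j \<le> k" for j
    using that
  proof (induction j)
    case 0
    have "(\<lambda>_. \<one>) \<in> hom (?P 0) G" by (simp add: hom_def)
    moreover have "inj_on (\<lambda>_. \<one>) (carrier (?P 0))" unfolding carP by (auto simp: inj_on_def)
    ultimately show ?case by blast
  next
    case (Suc j)
    then obtain f where f: "f \<in> hom (?P j) G" and inj: "inj_on f (carrier (?P j))" by auto
    interpret f: group_hom "?P j" G f
      by (rule group_hom.intro[OF grpP is_group group_hom_axioms.intro[OF f]])
    have "card (f ` carrier (?P j)) = p ^ j" using card_image[OF inj] cardP by simp
    moreover have "p ^ j < p ^ k" using Suc.prems prime_gt_1_nat[OF assms(2)] by simp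
    ultimately have "f ` carrier (?P j) \<noteq> carrier G" using assms(4) by (auto simp: Coset.order_def)
    moreover have "f ` carrier (?P j) \<subseteq> carrier G" using f by (auto simp: hom_def)
    ultimately obtain a where a: "a \<in> carrier G" "a \<notin> f ` carrier (?P j)" by blast
    have sub: "subgroup (f ` carrier (?P j)) G" by (rule f.img_is_subgroup)
    \<comment> \<open>Exponents prime to \<open>p\<close> are invertible modulo \<open>p\<close>, so
      such a power of \<open>a\<close> in the image would bring \<open>a\<close> itself into the
      image.\<close>
    have apow: "p dvd n" if "a [^] n \<in> f ` carrier (?P j)" for n :: nat
    proof (rule ccontr)
      assume "\<not> p dvd n"
      then have "coprime n p" using assms(2) prime_imp_coprime_nat coprime_commute by metis
      then obtain m where "[n * m = 1] (mod p)" using cong_solve_coprime_nat by auto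
      then have "[int (n * m) = int 1] (mod int p)" by (simp only: cong_int_iff)
      then have "int (n * m) mod int p = 1 mod int p" by (simp add: cong_def)
      then have "a [^] int (n * m) = a [^] (1::int)" using powmod[OF a(1)] by metis
      then have "a [^] (n * m) = a" using a(1) by (simp only: int_pow_int int_pow_1)
      moreover have "(a [^] n) [^] m \<in> f ` carrier (?P j)"
      proof (induction m)
        case 0
        show ?case using subgroup.one_closed[OF sub] by simp
      next
        case (Suc m)
        show ?case using subgroup.m_closed[OF sub Suc that] by simp
      qed
      ultimately show False using a by (simp add: nat_pow_pow)
    qed
    define f' where "f' c = f (restrict c {..<j}) \<otimes> a [^] (c j)" for c :: "nat \<Rightarrow> int"
    have restr: "restrict c {..<j} \<in> carrier (?P j)" if "c \<in> carrier (?P (Suc j))" for c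
      using that unfolding carP by (auto simp: PiE_iff)
    have hom': "f' \<in> hom (?P (Suc j)) G"
    proof (rule homI)
      fix c assume "c \<in> carrier (?P (Suc j))"
      then show "f' c \<in> carrier G" unfolding f'_def using a(1) restr f.hom_closed by blast
    next
      fix c d assume cd: "c \<in> carrier (?P (Suc j))" "d \<in> carrier (?P (Suc j))"
      have 1: "restrict (c \<otimes>\<^bsub>?P (Suc j)\<^esub> d) {..<j} = restrict c {..<j} \<otimes>\<^bsub>?P j\<^esub> restrict d {..<j}"
        by (rule ext) simp
      have 2: "a [^] ((c \<otimes>\<^bsub>?P (Suc j)\<^esub> d) j) = a [^] (c j) \<otimes> a [^] (d j)"
        using powmod[OF a(1), of "c j + d j"] a(1) by (simp add: int_pow_mult)
      have 3: "f (restrict (c \<otimes>\<^bsub>?P (Suc j)\<^esub> d) {..<j}) = f (restrict c {..<j}) \<otimes> f (restrict d {..<j})"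
        unfolding 1 by (rule f.hom_mult[OF restr restr]) (fact cd)+
      show "f' (c \<otimes>\<^bsub>?P (Suc j)\<^esub> d) = f' c \<otimes> f' d"
        unfolding f'_def 2 3
        using f.hom_closed[OF restr[OF cd(1)]] f.hom_closed[OF restr[OF cd(2)]] a(1) by (simp add: m_ac)
    qed
    interpret f': group_hom "?P (Suc j)" G f'
      by (rule group_hom.intro[OF grpP is_group group_hom_axioms.intro[OF hom']])
    have "inj_on f' (carrier (?P (Suc j)))"
      unfolding f'.inj_on_one_iff
    proof (intro allI impI)
      fix c assume c: "c \<in> carrier (?P (Suc j))" and one: "f' c = \<one>"
      have cj: "c j \<in> {0..<int p}" using PiE_mem[OF c[unfolded carP], of j] by blast
      then have cjn: "int (nat (c j)) = c j" by simp
      have fr: "f (restrict c {..<j}) \<in> carrier G" using f.hom_closed[OF restr[OF c]] .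
      have "a [^] (c j) = inv (f (restrict c {..<j}))"
        using one fr a(1) unfolding f'_def by (simp add: inv_equality m_comm)
      moreover have "inv (f (restrict c {..<j})) \<in> f ` carrier (?P j)"
        by (rule subgroup.m_inv_closed[OF sub]) (rule imageI[OF restr[OF c]])
      ultimately have "a [^] nat (c j) \<in> f ` carrier (?P j)" using cjn by (metis int_pow_int)
      then have "p dvd nat (c j)" by (rule apow)
      then have c0: "c j = 0" using cj by (auto dest: dvd_imp_le)
      then have "f (restrict c {..<j}) = \<one>" using one fr by (simp add: f'_def)
      then have "restrict c {..<j} = \<one>\<^bsub>?P j\<^esub>"
        using f.inj_on_one_iff inj restr[OF c] by blast
      then have "c i = 0" if "i < j" for i using that by (metis lessThan_iff one_integer_mod_group one_product_group restrict_apply')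
      then have "c i = 0" if "i < Suc j" for i using that c0 less_Suc_eq by blast
      moreover have "c \<in> extensional {..<Suc j}" using c unfolding carP by (simp add: PiE_iff)
      ultimately show "c = \<one>\<^bsub>?P (Suc j)\<^esub>"
        by (intro extensionalityI[of c "{..<Suc j}"]) simp_all
    qed
    then show ?case using hom' by blast
  qed
  then obtain f where f: "f \<in> hom (?P k) G" "inj_on f (carrier (?P k))" by blast
  have "f ` carrier (?P k) = carrier G"
  proof (rule card_subset_eq[OF finG])
    show "f ` carrier (?P k) \<subseteq> carrier G" using f(1) by (auto simp: hom_def)
    show "card (f ` carrier (?P k)) = card (carrier G)"
      using card_image[OF f(2)] cardP assms(4) by (simp add: Coset.order_def)
  qed
  then have "f \<in> iso (?P k) G" using f by (simp add: iso_def bij_betw_def)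
  then show ?thesis by (auto simp: is_iso_def)
qed

text \<open>A nonzero linear functional to the prime field, obtained as one coordinate of an
  isomorphism with the product of cyclic groups.\<close>

lemma elementary_abelian_functional:
  fixes G (structure)
  assumes "comm_group G" "prime p" "\<And>x. x \<in> carrier G \<Longrightarrow> x [^] (p :: nat) = \<one>" "order G = p ^ k" "k > 0"
  shows "\<exists>h :: 'a \<Rightarrow> int. (\<forall>x\<in>carrier G. \<forall>y\<in>carrier G. [h (x \<otimes> y) = h x + h y] (mod int p)) \<and>
     (\<exists>x\<in>carrier G. \<not> [h x = 0] (mod int p))"
proof -
  interpret comm_group G by fact
  let ?P = "product_group {..<k} (\<lambda>_. integer_mod_group p)"
  have p1: "p > 1" using assms(2) prime_gt_1_nat by blast
  have "G \<cong> ?P"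
    by (rule group.iso_sym[OF _ elementary_abelian_iso_product[OF assms(1-4)]]) simp
  then obtain f where f: "f \<in> iso G ?P" by (auto simp: is_iso_def)
  then have hom: "f \<in> hom G ?P" and bij: "bij_betw f (carrier G) (carrier ?P)" by (auto simp: iso_def)
  let ?e = "\<lambda>i\<in>{..<k}. 1 :: int"
  have "?e \<in> carrier ?P" using p1 by (simp add: carrier_integer_mod_group)
  then obtain x where x: "x \<in> carrier G" "f x = ?e" using bij by (metis bij_betw_def imageE)
  show ?thesis
  proof (intro exI[of _ "\<lambda>x. f x 0"] conjI ballI bexI[of _ x])
    fix x y assume "x \<in> carrier G" "y \<in> carrier G"
    then have "f (x \<otimes> y) = f x \<otimes>\<^bsub>?P\<^esub> f y" using hom by (simp add: hom_def)
    then have "f (x \<otimes> y) 0 = (f x 0 + f y 0) mod int p" using assms(5) by simp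
    then show "[f (x \<otimes> y) 0 = f x 0 + f y 0] (mod int p)" by simp
  next
    show "\<not> [f x 0 = 0] (mod int p)" using x assms(5) p1 by (simp add: cong_def)
  qed (fact x)
qed

lemma additive_group_opposite_iso:
  assumes "group (additive_group B)"
  shows "additive_group (opposite B) \<cong> additive_group B"
proof -
  interpret group "additive_group B" by fact
  have "(\<lambda>x. inv\<^bsub>additive_group B\<^esub> x) \<in> iso (additive_group (opposite B)) (additive_group B)"
  proof (rule isoI)
    show "(\<lambda>x. inv\<^bsub>additive_group B\<^esub> x) \<in> hom (additive_group (opposite B)) (additive_group B)"
      using inv_mult_group inv_closed by (intro homI) simp_all
    show "bij_betw (\<lambda>x. inv\<^bsub>additive_group B\<^esub> x) (carrier (additive_group (opposite B))) (carrier (additive_group B))"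
      using inv_closed inv_inv by (intro bij_betw_byWitness[where f' = "\<lambda>x. inv\<^bsub>additive_group B\<^esub> x"]) auto
  qed
  then show ?thesis by (auto simp: is_iso_def)
qed

context finite_field_quotient
begin

lemma carrier_Zq: "carrier (integer_mod_group q) = {0..<int q}"
  using q_gt_1 by (simp add: carrier_integer_mod_group)

lemma mod_q_in: "i mod int q \<in> {0..<int q}"
  using q_gt_1 by simp

text \<open>Stated for any copy \<open>V\<close> of the additive group of the field, so that it
  applies to the product of cyclic groups in the theorem. The action is multiplication by powers of
  \<open>X\<close>, transported along \<open>\<theta>\<close>.\<close>

lemma additive_model_semidirect:
  fixes V :: "'v monoid"
  assumes V: "group V" and th: "\<theta> \<in> iso field_additive V"
  shows "\<exists>\<phi> \<in> hom (integer_mod_group q) (AutoGroup V).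
     (\<exists>c \<in> carrier (integer_mod_group q). \<phi> c \<noteq> \<one>\<^bsub>AutoGroup V\<^esub>) \<and>
     additive_group model \<cong> semidirect_product V (integer_mod_group q) \<phi>"
proof -
  have hom: "\<theta> \<in> hom field_additive V" and bij: "bij_betw \<theta> (range code) (carrier V)"
    using th by (simp_all add: iso_def)
  have th_add: "\<theta> (code (f + g)) = \<theta> (code f) \<otimes>\<^bsub>V\<^esub> \<theta> (code g)" for f g
    using hom_mult[OF hom, of "code f" "code g"] by simp
  have th_closed: "\<theta> (code f) \<in> carrier V" for f using bij by (auto simp: bij_betw_def)
  have th_eq: "\<theta> (code f) = \<theta> (code g) \<longleftrightarrow> f \<simeq> g" for f g
    using bij by (auto simp: bij_betw_def code_eq_iff[symmetric] dest: inj_onD)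
  have V_cases: "\<exists>f. v = \<theta> (code f)" if "v \<in> carrier V" for v
    using that bij by (auto simp: bij_betw_def)
  define \<phi> where "\<phi> i = (\<lambda>v\<in>carrier V. \<theta> (code (Z i * rep (inv_into (range code) \<theta> v))))" for i
  have \<phi>: "\<phi> i (\<theta> (code f)) = \<theta> (code (Z i * f))" for i f
  proof -
    have "inv_into (range code) \<theta> (\<theta> (code f)) = code f"
      using bij by (intro inv_into_f_f) (auto simp: bij_betw_def)
    moreover have "Z i * rep (code f) \<simeq> Z i * f" by (intro cg_mult cg_refl rep_code)
    ultimately show ?thesis by (simp add: \<phi>_def th_closed th_eq)
  qed
  have \<phi>_auto: "\<phi> i \<in> auto V" for i
    unfolding auto_def
  proof
    show "\<phi> i \<in> hom V V"
    proof (rule homI)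
      fix u v assume "u \<in> carrier V" "v \<in> carrier V"
      then obtain f g where uv: "u = \<theta> (code f)" "v = \<theta> (code g)" using V_cases by blast
      show "\<phi> i (u \<otimes>\<^bsub>V\<^esub> v) = \<phi> i u \<otimes>\<^bsub>V\<^esub> \<phi> i v"
        by (simp only: uv \<phi> th_add[symmetric] distrib_left)
    next
      fix v assume "v \<in> carrier V"
      then obtain f where "v = \<theta> (code f)" using V_cases by blast
      then show "\<phi> i v \<in> carrier V" by (simp add: \<phi> th_closed)
    qed
    have inv: "Z (- i) * (Z i * f) \<simeq> f" "Z i * (Z (- i) * f) \<simeq> f" for f
      using cg_mult[OF Z_minus(1) cg_refl, of i f] cg_mult[OF Z_minus(2) cg_refl, of i f]
      by (simp_all add: mult.assoc)
    have "bij_betw (\<phi> i) (carrier V) (carrier V)"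
    proof (rule bij_betw_byWitness[where f' = "\<phi> (- i)"])
      have cl: "\<phi> j v \<in> carrier V" if v: "v \<in> carrier V" for j v
        using V_cases[OF v] by (auto simp: \<phi> th_closed)
      show "\<phi> i ` carrier V \<subseteq> carrier V" "\<phi> (- i) ` carrier V \<subseteq> carrier V"
        using cl by blast+
      show "\<forall>v\<in>carrier V. \<phi> (- i) (\<phi> i v) = v" "\<forall>v\<in>carrier V. \<phi> i (\<phi> (- i) v) = v"
      proof (safe)
        fix v assume v: "v \<in> carrier V"
        obtain f where "v = \<theta> (code f)" using V_cases[OF v] by blast
        then show "\<phi> (- i) (\<phi> i v) = v" "\<phi> i (\<phi> (- i) v) = v" by (simp_all add: \<phi> th_eq inv)
      qed
    qed
    then show "\<phi> i \<in> Bij (carrier V)" by (simp add: Bij_def \<phi>_def)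
  qed
  have "\<phi> \<in> hom (integer_mod_group q) (AutoGroup V)"
  proof (rule homI)
    fix i j assume "i \<in> carrier (integer_mod_group q)" "j \<in> carrier (integer_mod_group q)"
    have "\<phi> ((i + j) mod int q) = compose (carrier V) (\<phi> i) (\<phi> j)"
    proof (rule extensionalityI[of _ "carrier V"])
      fix v assume v: "v \<in> carrier V"
      then obtain f where f: "v = \<theta> (code f)" using V_cases by blast
      have "Z ((i + j) mod int q) \<simeq> Z (i + j)" by (simp add: Z_cong_iff)
      also have "\<dots> \<simeq> Z i * Z j" by (rule Z_add)
      finally have "Z ((i + j) mod int q) * f \<simeq> Z i * (Z j * f)"
        using cg_mult[OF _ cg_refl] by (simp only: mult.assoc[symmetric])
      then show "\<phi> ((i + j) mod int q) v = compose (carrier V) (\<phi> i) (\<phi> j) v"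
        using v by (simp add: compose_def f \<phi> th_eq)
    qed (simp_all add: \<phi>_def compose_def)
    then show "\<phi> (i \<otimes>\<^bsub>integer_mod_group q\<^esub> j) = \<phi> i \<otimes>\<^bsub>AutoGroup V\<^esub> \<phi> j"
      using \<phi>_auto[of i] \<phi>_auto[of j] by (simp add: AutoGroup_def BijGroup_def auto_def)
  qed (simp add: AutoGroup_def \<phi>_auto)
  moreover have "\<exists>c \<in> carrier (integer_mod_group q). \<phi> c \<noteq> \<one>\<^bsub>AutoGroup V\<^esub>"
  proof
    show "\<phi> 1 \<noteq> \<one>\<^bsub>AutoGroup V\<^esub>"
    proof
      assume "\<phi> 1 = \<one>\<^bsub>AutoGroup V\<^esub>"
      then have "\<phi> 1 (\<theta> (code 1)) = \<theta> (code 1)" by (simp add: AutoGroup_def BijGroup_def th_closed)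
      then show False using not_X_cg_1 by (simp add: \<phi> th_eq Z_1)
    qed
    show "1 \<in> carrier (integer_mod_group q)" using q_gt_1 by (simp add: carrier_Zq)
  qed
  moreover have "additive_group model \<cong> semidirect_product V (integer_mod_group q) \<phi>"
  proof -
    define F where "F x = (case prod_decode x of (a, n) \<Rightarrow> (\<theta> a, int n))" for x
    have F: "F (enc f i) = (\<theta> (code f), i mod int q)" for f i
      using q_gt_1 by (simp add: F_def enc_def)
    have "F \<in> iso (additive_group model) (semidirect_product V (integer_mod_group q) \<phi>)"
    proof (rule isoI)
      show "F \<in> hom (additive_group model) (semidirect_product V (integer_mod_group q) \<phi>)"
      proof (rule homI)
        fix x assume "x \<in> carrier (additive_group model)"
        then show "F x \<in> carrier (semidirect_product V (integer_mod_group q) \<phi>)"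
          using mod_q_in by (auto elim!: model_cases simp: F semidirect_product_def carrier_Zq th_closed)
      next
        fix x y assume "x \<in> carrier (additive_group model)" "y \<in> carrier (additive_group model)"
        then obtain f i g j where xy: "x = enc f i" "y = enc g j" by (auto elim!: model_cases)
        have "Z (i mod int q) * g \<simeq> Z i * g" by (intro cg_mult cg_refl) (simp add: Z_cong_iff)
        then have "\<theta> (code (Z (i mod int q) * g)) = \<theta> (code (Z i * g))" by (simp add: th_eq)
        then show "F (x \<otimes>\<^bsub>additive_group model\<^esub> y) = F x \<otimes>\<^bsub>semidirect_product V (integer_mod_group q) \<phi>\<^esub> F y"
          by (simp add: xy F semidirect_product_def \<phi> th_add mod_add_eq)
      qed
      show "bij_betw F (carrier (additive_group model)) (carrier (semidirect_product V (integer_mod_group q) \<phi>))"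
        unfolding bij_betw_def
      proof
        show "inj_on F (carrier (additive_group model))"
          by (rule inj_onI) (auto elim!: model_cases simp: F th_eq enc_eq_iff cong_def)
        show "F ` carrier (additive_group model) = carrier (semidirect_product V (integer_mod_group q) \<phi>)"
        proof
          show "F ` carrier (additive_group model) \<subseteq> carrier (semidirect_product V (integer_mod_group q) \<phi>)"
            using mod_q_in by (auto elim!: model_cases simp: F semidirect_product_def carrier_Zq th_closed)
          show "carrier (semidirect_product V (integer_mod_group q) \<phi>) \<subseteq> F ` carrier (additive_group model)"
          proof
            fix z assume "z \<in> carrier (semidirect_product V (integer_mod_group q) \<phi>)"
            then obtain v i where z: "z = (v, i)" "v \<in> carrier V" "i \<in> {0..<int q}"
              by (auto simp: semidirect_product_def carrier_Zq)
            then obtain f where "v = \<theta> (code f)" using V_cases by blast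
            then have "z = F (enc f i)" using z by (simp add: F)
            then show "z \<in> F ` carrier (additive_group model)" by simp
          qed
        qed
      qed
    qed
    then show ?thesis by (auto simp: is_iso_def)
  qed
  ultimately show ?thesis by blast
qed

text \<open>A field element \<open>f\<close> acts on the cyclic factor as multiplication by
  \<open>p ^ trace_index f\<close>. Multiplication by \<open>p\<close> has order \<open>p\<close>,
  the order of \<open>p\<close> modulo \<open>q\<close>, and all its powers occur because the trace
  is onto the prime field.\<close>

lemma multiplicative_model_semidirect:
  "\<exists>\<psi> \<in> hom star_group (AutoGroup (integer_mod_group q)).
     (\<exists>\<alpha> \<in> carrier (AutoGroup (integer_mod_group q)).
        group.ord (AutoGroup (integer_mod_group q)) \<alpha> = p \<and>
        \<psi> ` carrier star_group = generate (AutoGroup (integer_mod_group q)) {\<alpha>}) \<and>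
     multiplicative_group model \<cong> semidirect_product (integer_mod_group q) star_group \<psi>"
proof -
  let ?Z = "integer_mod_group q" and ?A = "AutoGroup (integer_mod_group q)"
  interpret A: group ?A by (rule group.AutoGroup) simp
  define \<alpha> where "\<alpha> n = (\<lambda>i\<in>{0..<int q}. (int (p ^ n) * i) mod int q)" for n
  have \<alpha>_cong: "\<alpha> n = \<alpha> m \<longleftrightarrow> [n = m] (mod p)" for n m
  proof
    assume "\<alpha> n = \<alpha> m"
    then have "\<alpha> n 1 = \<alpha> m 1" by simp
    then have "[int (p ^ n) = int (p ^ m)] (mod int q)" using q_gt_1 by (simp add: \<alpha>_def cong_def)
    then show "[n = m] (mod p)" by (simp only: cong_int_iff p_pow_cong_iff)
  next
    assume "[n = m] (mod p)"
    then have "[int (p ^ n) = int (p ^ m)] (mod int q)" by (simp only: cong_int_iff p_pow_cong_iff)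
    then have "[int (p ^ n) * i = int (p ^ m) * i] (mod int q)" for i by (intro cong_mult cong_refl)
    then show "\<alpha> n = \<alpha> m" by (simp add: \<alpha>_def cong_def)
  qed
  have \<alpha>_comp: "compose {0..<int q} (\<alpha> n) (\<alpha> m) = \<alpha> (n + m)" for n m
    by (rule ext) (use q_gt_1 in \<open>simp add: compose_def \<alpha>_def power_add mod_mult_right_eq mult.assoc\<close>)
  have \<alpha>0: "\<alpha> 0 = (\<lambda>i\<in>{0..<int q}. i)" by (rule ext) (simp add: \<alpha>_def)
  have \<alpha>_in: "\<alpha> n \<in> carrier ?A" for n
  proof -
    have "\<alpha> n \<in> hom ?Z ?Z"
      by (rule homI) (use q_gt_1 in \<open>simp_all add: carrier_Zq \<alpha>_def mod_add_eq mod_mult_right_eq distrib_left\<close>)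
    moreover have "bij_betw (\<alpha> n) {0..<int q} {0..<int q}"
    proof -
      have "[n * (p - 1) + n = 0] (mod p)" "[n + n * (p - 1) = 0] (mod p)"
        using p_gt_1 by (simp_all add: cong_0_iff algebra_simps)
      then have "compose {0..<int q} (\<alpha> (n * (p - 1))) (\<alpha> n) = \<alpha> 0" "compose {0..<int q} (\<alpha> n) (\<alpha> (n * (p - 1))) = \<alpha> 0"
        by (simp_all only: \<alpha>_comp \<alpha>_cong)
      then have inv: "\<alpha> (n * (p - 1)) (\<alpha> n i) = i" "\<alpha> n (\<alpha> (n * (p - 1)) i) = i" if "i \<in> {0..<int q}" for i
        using that unfolding \<alpha>0 by (metis compose_eq restrict_apply')+
      have "\<alpha> m i \<in> {0..<int q}" if "i \<in> {0..<int q}" for m i using that q_gt_1 by (simp add: \<alpha>_def)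
      then show ?thesis using inv by (intro bij_betw_byWitness[where f' = "\<alpha> (n * (p - 1))"]) blast+
    qed
    ultimately show ?thesis by (simp add: AutoGroup_def auto_def Bij_def carrier_Zq \<alpha>_def)
  qed
  have \<alpha>_mult: "\<alpha> n \<otimes>\<^bsub>?A\<^esub> \<alpha> m = \<alpha> (n + m)" for n m
    using \<alpha>_in[of n] \<alpha>_in[of m] \<alpha>_comp by (simp add: AutoGroup_def auto_def BijGroup_def carrier_Zq)
  have \<alpha>_one: "\<one>\<^bsub>?A\<^esub> = \<alpha> 0" by (simp add: AutoGroup_def BijGroup_def carrier_Zq \<alpha>0)
  have \<alpha>_pow: "\<alpha> 1 [^]\<^bsub>?A\<^esub> n = \<alpha> n" for n :: nat
    by (induction n) (simp_all add: \<alpha>_one \<alpha>_mult)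
  have ord: "A.ord (\<alpha> 1) = p"
    unfolding A.ord_unique[OF \<alpha>_in] \<alpha>_pow \<alpha>_one \<alpha>_cong by (simp add: cong_0_iff)
  have gen: "generate ?A {\<alpha> 1} = range \<alpha>"
  proof -
    have "A.ord (\<alpha> 1) \<noteq> 0" using ord p_gt_1 by simp
    then have "generate ?A {\<alpha> 1} = {\<alpha> 1 [^]\<^bsub>?A\<^esub> k |k. k \<in> (UNIV :: nat set)}"
      by (intro A.generate_pow_nat \<alpha>_in)
    then show ?thesis unfolding \<alpha>_pow by blast
  qed
  define \<psi> where "\<psi> a = \<alpha> (trace_index (rep a))" for a
  have \<psi>: "\<psi> (code f) = \<alpha> (trace_index f)" for f
    using trace_index_cong[OF rep_code[of f]] by (simp add: \<psi>_def)
  have "\<psi> \<in> hom star_group ?A"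
  proof (rule homI)
    fix a b assume "a \<in> carrier star_group" "b \<in> carrier star_group"
    then obtain f g where "a = code f" "b = code g" by auto
    then show "\<psi> (a \<otimes>\<^bsub>star_group\<^esub> b) = \<psi> a \<otimes>\<^bsub>?A\<^esub> \<psi> b"
      using trace_index_star by (simp add: \<psi> \<alpha>_mult \<alpha>_cong)
  qed (simp add: \<psi>_def \<alpha>_in)
  moreover have "\<psi> ` carrier star_group = generate ?A {\<alpha> 1}"
  proof -
    have "\<alpha> n \<in> \<psi> ` range code" for n
    proof -
      obtain t where t: "Tr t \<simeq> 1" using exists_trace_1 by blast
      then have "trace_index t = 1" using p_gt_1 by (intro trace_index_eqI) simp_all
      then have "[trace_index (of_nat n * t) = n] (mod p)" using trace_index_of_nat_mult[of n t] by simp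
      then have "\<alpha> n = \<psi> (code (of_nat n * t))" unfolding \<psi> \<alpha>_cong by (rule cong_sym)
      then show ?thesis by blast
    qed
    moreover have "\<psi> a \<in> range \<alpha>" for a by (simp add: \<psi>_def)
    ultimately show ?thesis unfolding gen star_group_simps by blast
  qed
  moreover have "multiplicative_group model \<cong> semidirect_product ?Z star_group \<psi>"
  proof -
    define F where "F x = (case prod_decode x of (a, n) \<Rightarrow> (int n, a))" for x
    have F: "F (enc f i) = (i mod int q, code f)" for f i
      using q_gt_1 by (simp add: F_def enc_def)
    have "F \<in> iso (multiplicative_group model) (semidirect_product ?Z star_group \<psi>)"
    proof (rule isoI)
      show "F \<in> hom (multiplicative_group model) (semidirect_product ?Z star_group \<psi>)"
      proof (rule homI)
        fix x assume "x \<in> carrier (multiplicative_group model)"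
        then show "F x \<in> carrier (semidirect_product ?Z star_group \<psi>)"
          using mod_q_in by (auto elim!: model_cases simp: F semidirect_product_def carrier_Zq)
      next
        fix x y assume "x \<in> carrier (multiplicative_group model)" "y \<in> carrier (multiplicative_group model)"
        then obtain f i g j where xy: "x = enc f i" "y = enc g j" by (auto elim!: model_cases)
        have "\<psi> (code f) (j mod int q) = (pw f * j) mod int q"
          using q_gt_1 by (simp add: \<psi> \<alpha>_def pw_def mod_mult_right_eq)
        then show "F (x \<otimes>\<^bsub>multiplicative_group model\<^esub> y) = F x \<otimes>\<^bsub>semidirect_product ?Z star_group \<psi>\<^esub> F y"
          by (simp add: xy F semidirect_product_def mod_add_eq)
      qed
      show "bij_betw F (carrier (multiplicative_group model)) (carrier (semidirect_product ?Z star_group \<psi>))"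
        unfolding bij_betw_def
      proof
        show "inj_on F (carrier (multiplicative_group model))"
          by (rule inj_onI) (auto elim!: model_cases simp: F code_eq_iff enc_eq_iff cong_def)
        show "F ` carrier (multiplicative_group model) = carrier (semidirect_product ?Z star_group \<psi>)"
        proof
          show "F ` carrier (multiplicative_group model) \<subseteq> carrier (semidirect_product ?Z star_group \<psi>)"
            using mod_q_in by (auto elim!: model_cases simp: F semidirect_product_def carrier_Zq)
          show "carrier (semidirect_product ?Z star_group \<psi>) \<subseteq> F ` carrier (multiplicative_group model)"
          proof
            fix z assume "z \<in> carrier (semidirect_product ?Z star_group \<psi>)"
            then obtain f i where z: "z = (i, code f)" "i \<in> {0..<int q}"
              by (auto simp: semidirect_product_def carrier_Zq)
            then have "z = F (enc f i)" by (simp add: F)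
            then show "z \<in> F ` carrier (multiplicative_group model)" by simp
          qed
        qed
      qed
    qed
    then show ?thesis by (auto simp: is_iso_def)
  qed
  ultimately show ?thesis using ord \<alpha>_in by blast
qed

lemma field_additive_iso_product:
  "field_additive \<cong> product_group {..<p} (\<lambda>_. integer_mod_group p)"
proof -
  interpret comm_group field_additive by (rule comm_group_field_additive)
  have "x [^]\<^bsub>field_additive\<^esub> p = \<one>\<^bsub>field_additive\<^esub>" if "x \<in> carrier field_additive" for x
  proof -
    have "of_nat p * f \<simeq> 0" for f using cg_mult[OF p_cg_0 cg_refl, of f] by simp
    then show ?thesis using that by (auto simp: field_additive_pow code_eq_iff)
  qed
  then show ?thesis
    using card_field
    by (intro group.iso_sym[OF _ elementary_abelian_iso_product[OF comm_group_field_additive p]])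
      (simp_all add: Coset.order_def)
qed

end

section \<open>Groups of order \<open>p\<^sup>p q\<close>\<close>

context group
begin

lemma subgroup_if_finite_closed:
  assumes "finite (carrier G)" "H \<subseteq> carrier G" "\<one> \<in> H" "\<And>x y. x \<in> H \<Longrightarrow> y \<in> H \<Longrightarrow> x \<otimes> y \<in> H"
  shows "subgroup H G"
proof (rule subgroupI)
  fix a assume a: "a \<in> H"
  then have aG: "a \<in> carrier G" using assms(2) by blast
  have pow: "a [^] n \<in> H" for n :: nat
    by (induction n) (use assms(3,4) a in simp_all)
  have "order G > 0" using assms(1) order_gt_0_iff_finite by simp
  then have "a [^] (order G - 1) \<otimes> a = \<one>"
    using pow_order_eq_1[OF aG] nat_pow_Suc[of a "order G - 1"] by simp
  then have "inv a = a [^] (order G - 1)" using aG by (intro inv_equality) simp_all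
  then show "inv a \<in> H" using pow by simp
qed (use assms in auto)

lemma subgroup_pow_card:
  assumes "subgroup H G" "a \<in> H"
  shows "a [^] card H = \<one>"
proof -
  interpret H: group "G\<lparr>carrier := H\<rparr>" using assms(1) subgroup_imp_group by blast
  have "a [^]\<^bsub>G\<lparr>carrier := H\<rparr>\<^esub> order (G\<lparr>carrier := H\<rparr>) = \<one>\<^bsub>G\<lparr>carrier := H\<rparr>\<^esub>"
    using assms(2) by (intro H.pow_order_eq_1) simp
  then have "a [^]\<^bsub>G\<lparr>carrier := H\<rparr>\<^esub> card H = \<one>" by (simp add: Coset.order_def)
  with nat_pow_consistent[of a "card H" H] show ?thesis by (rule trans)
qed

lemma subgroup_card_dvd:
  assumes "finite (carrier G)" "subgroup H G" "subgroup K G" "H \<subseteq> K"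
  shows "card H dvd card K"
proof -
  interpret K: group "G\<lparr>carrier := K\<rparr>" using assms(3) subgroup_imp_group by blast
  have "subgroup H (G\<lparr>carrier := K\<rparr>)" using assms(2-4) subgroup_incl by blast
  then have "card (rcosets\<^bsub>G\<lparr>carrier := K\<rparr>\<^esub> H) * card H = order (G\<lparr>carrier := K\<rparr>)"
    by (rule K.lagrange)
  then show ?thesis by (simp add: Coset.order_def) (metis dvd_triv_right)
qed

text \<open>An element whose \<open>m\<close>-th power is trivial has trivial image in the quotient,
  whose order is prime to \<open>m\<close>. The description by torsion makes \<open>N\<close> unique
  among normal subgroups of its order and stable under automorphisms, in particular under lambda
  maps.\<close>

lemma normal_hall_torsion:
  assumes fin: "finite (carrier G)" and N: "N \<lhd> G" and card: "card N = m" "order G = m * k" "coprime m k"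
  shows "N = {a \<in> carrier G. a [^] m = \<one>}"
proof
  interpret N: normal N G by fact
  show "N \<subseteq> {a \<in> carrier G. a [^] m = \<one>}"
    using subgroup_pow_card[OF N.subgroup_axioms] card(1) N.subset by auto
  interpret Q: group "G Mod N" by (rule N.factorgroup_is_group)
  interpret h: group_hom G "G Mod N" "\<lambda>a. N #> a"
    using N.r_coset_hom_Mod by unfold_locales
  have m0: "m > 0" using fin card(2) order_gt_0_iff_finite by (cases m) auto
  show "{a \<in> carrier G. a [^] m = \<one>} \<subseteq> N"
  proof
    fix a assume "a \<in> {a \<in> carrier G. a [^] m = \<one>}"
    then have a: "a \<in> carrier G" "a [^] m = \<one>" by simp_all
    have na: "N #> a \<in> carrier (G Mod N)" using a by (intro h.hom_closed)
    have "order (G Mod N) = k"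
      using lagrange[OF N.subgroup_axioms] card(1,2) m0
      by (simp add: Coset.order_def FactGroup_def mult.commute)
    then have "Q.ord (N #> a) dvd k" using Q.ord_dvd_group_order[OF na] by simp
    moreover have "(N #> a) [^]\<^bsub>G Mod N\<^esub> m = \<one>\<^bsub>G Mod N\<^esub>"
      using h.hom_nat_pow[OF a(1), of m] a(2) h.hom_one by simp
    then have "Q.ord (N #> a) dvd m" using Q.pow_eq_id[OF na] by simp
    ultimately have "Q.ord (N #> a) = 1" using card(3) by (meson coprime_common_divisor_nat)
    then have "N #> a = \<one>\<^bsub>G Mod N\<^esub>" using Q.ord_eq_1[OF na] by simp
    then have "N #> a = N" by (simp add: FactGroup_def)
    then show "a \<in> N" using rcos_self[OF a(1) N.subgroup_axioms] by simp
  qed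
qed

text \<open>The projection to \<open>G Mod N\<close>, written as an exponent of \<open>y\<close>;
  any element outside \<open>N\<close> generates the quotient because the index is prime.\<close>

lemma prime_index_coordinate:
  assumes fin: "finite (carrier G)" and N: "N \<lhd> G" and ord: "order G = card N * q" and q: "prime q"
    and y: "y \<in> carrier G" "y \<notin> N"
  shows "\<exists>ix. (\<forall>a\<in>carrier G. ix a < q \<and> (\<exists>v\<in>N. a = v \<otimes> y [^] ix a)) \<and>
    (\<forall>a\<in>carrier G. \<forall>b\<in>carrier G. [ix (a \<otimes> b) = ix a + ix b] (mod q)) \<and>
    (\<forall>a\<in>carrier G. ix a = 0 \<longleftrightarrow> a \<in> N) \<and> ix y = 1"
proof -
  interpret N: normal N G by fact
  interpret Q: group "G Mod N" by (rule N.factorgroup_is_group)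
  interpret h: group_hom G "G Mod N" "\<lambda>a. N #> a"
    using N.r_coset_hom_Mod by unfold_locales
  have one: "N #> a = \<one>\<^bsub>G Mod N\<^esub> \<longleftrightarrow> a \<in> N" if a: "a \<in> carrier G" for a
    using a rcos_self[OF a N.subgroup_axioms] coset_join2[OF a N.subgroup_axioms] by (auto simp: FactGroup_def)
  have "card N > 0" using fin ord order_gt_0_iff_finite by (cases "card N") auto
  then have oQ: "order (G Mod N) = q"
    using lagrange[OF N.subgroup_axioms] ord by (simp add: Coset.order_def FactGroup_def mult.commute)
  let ?y = "N #> y"
  have yQ: "?y \<in> carrier (G Mod N)" using y by (intro h.hom_closed)
  have "Q.ord ?y dvd q" using Q.ord_dvd_group_order[OF yQ] oQ by simp
  moreover have "Q.ord ?y \<noteq> 1" using Q.ord_eq_1[OF yQ] one[OF y(1)] y(2) by simp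
  ultimately have oy: "Q.ord ?y = q" using q by (auto simp: prime_nat_iff)
  have pow_eq: "?y [^]\<^bsub>G Mod N\<^esub> i = ?y [^]\<^bsub>G Mod N\<^esub> j \<longleftrightarrow> [i = j] (mod q)" for i j :: nat
  proof -
    have "?y [^]\<^bsub>G Mod N\<^esub> int i = ?y [^]\<^bsub>G Mod N\<^esub> int j \<longleftrightarrow> int q dvd int j - int i"
      using Q.int_pow_eq[OF yQ, of "int i" "int j"] oy by simp
    also have "\<dots> \<longleftrightarrow> [int j = int i] (mod int q)" by (simp add: cong_iff_dvd_diff)
    also have "\<dots> \<longleftrightarrow> [i = j] (mod q)" using cong_int_iff cong_sym_eq by blast
    finally show ?thesis by (simp add: int_pow_int)
  qed
  have "(\<lambda>i::nat. ?y [^]\<^bsub>G Mod N\<^esub> i) ` {..<q} = carrier (G Mod N)"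
  proof (rule card_subset_eq)
    show "finite (carrier (G Mod N))" using oQ q Q.order_gt_0_iff_finite prime_gt_0_nat by simp
    have "inj_on (\<lambda>i::nat. ?y [^]\<^bsub>G Mod N\<^esub> i) {..<q}"
      by (rule inj_onI) (use pow_eq cong_less_modulus_unique_nat in blast)
    then show "card ((\<lambda>i::nat. ?y [^]\<^bsub>G Mod N\<^esub> i) ` {..<q}) = card (carrier (G Mod N))"
      using oQ by (simp add: card_image Coset.order_def)
  qed (use yQ in auto)
  then have "\<exists>i<q. N #> a = ?y [^]\<^bsub>G Mod N\<^esub> i" if "a \<in> carrier G" for a
    using h.hom_closed[OF that] by (metis imageE lessThan_iff)
  then obtain ix where ix: "\<And>a. a \<in> carrier G \<Longrightarrow> ix a < q \<and> N #> a = ?y [^]\<^bsub>G Mod N\<^esub> (ix a :: nat)"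
    by metis
  show ?thesis
  proof (intro exI[of _ ix] conjI ballI)
    fix a assume a: "a \<in> carrier G"
    show "ix a < q" using ix[OF a] by simp
    have "N #> a = N #> (y [^] ix a)" using ix[OF a] h.hom_nat_pow[OF y(1), of "ix a"] by simp
    then have "a \<in> N #> (y [^] ix a)" using rcos_self[OF a N.subgroup_axioms] by simp
    then show "\<exists>v\<in>N. a = v \<otimes> y [^] ix a" by (auto simp: r_coset_def)
    show "ix a = 0 \<longleftrightarrow> a \<in> N"
    proof
      assume "ix a = 0"
      then show "a \<in> N" using ix[OF a] one[OF a] by simp
    next
      assume "a \<in> N"
      then have "?y [^]\<^bsub>G Mod N\<^esub> (ix a) = ?y [^]\<^bsub>G Mod N\<^esub> (0::nat)" using ix[OF a] one[OF a] by simp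
      then show "ix a = 0" using pow_eq ix[OF a] q prime_gt_0_nat cong_less_modulus_unique_nat by blast
    qed
  next
    fix a b assume ab: "a \<in> carrier G" "b \<in> carrier G"
    have "N #> (a \<otimes> b) = (N #> a) \<otimes>\<^bsub>G Mod N\<^esub> (N #> b)" using ab by (rule h.hom_mult)
    then have "?y [^]\<^bsub>G Mod N\<^esub> ix (a \<otimes> b) = ?y [^]\<^bsub>G Mod N\<^esub> (ix a + ix b)"
      using ix ab m_closed Q.nat_pow_mult[OF yQ] by metis
    then show "[ix (a \<otimes> b) = ix a + ix b] (mod q)" by (simp only: pow_eq)
  next
    have "?y [^]\<^bsub>G Mod N\<^esub> ix y = ?y [^]\<^bsub>G Mod N\<^esub> (1::nat)" using ix[OF y(1)] Q.nat_pow_eone[OF yQ] by metis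
    then show "ix y = 1" using pow_eq ix[OF y(1)] prime_gt_1_nat[OF q] cong_less_modulus_unique_nat by blast
  qed
qed

lemma exists_prime_order_element:
  assumes "finite (carrier G)" "subgroup H G" "prime r" "r dvd card H"
  shows "\<exists>a\<in>H. a \<noteq> \<one> \<and> a [^] r = \<one>"
proof -
  interpret H: group "G\<lparr>carrier := H\<rparr>" using assms(2) subgroup_imp_group by blast
  have finH: "finite H" using assms(1,2) subgroup.subset finite_subset by metis
  have "order (G\<lparr>carrier := H\<rparr>) = r ^ 1 * (card H div r)" using assms(4) by (simp add: Coset.order_def)
  then obtain K where K: "subgroup K (G\<lparr>carrier := H\<rparr>)" "card K = r ^ 1"
    using sylow_thm[of r "G\<lparr>carrier := H\<rparr>" 1 "card H div r"] assms(3) H.group_axioms finH by auto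
  have KG: "subgroup K G" using K(1) assms(2) incl_subgroup by blast
  have "K \<noteq> {\<one>}" using K(2) assms(3) by auto
  then obtain a where a: "a \<in> K" "a \<noteq> \<one>" using subgroup.one_closed[OF KG] by blast
  moreover have "a [^] r = \<one>" using subgroup_pow_card[OF KG a(1)] K(2) by simp
  moreover have "a \<in> H" using subgroup.subset[OF K(1)] a by auto
  ultimately show ?thesis by blast
qed

lemma coprime_torsion:
  assumes "a \<in> carrier G" "a [^] (m::nat) = \<one>" "a [^] (n::nat) = \<one>" "coprime m n"
  shows "a = \<one>"
proof -
  have "ord a dvd m" "ord a dvd n" using assms pow_eq_id by auto
  then have "ord a = 1" using assms(4) by (meson coprime_common_divisor_nat)
  then show ?thesis using ord_eq_1[OF assms(1)] by simp
qed

lemma conj_mult: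
  "x \<in> carrier G \<Longrightarrow> u \<in> carrier G \<Longrightarrow> v \<in> carrier G \<Longrightarrow>
    x \<otimes> (u \<otimes> v) \<otimes> inv x = (x \<otimes> u \<otimes> inv x) \<otimes> (x \<otimes> v \<otimes> inv x)"
  by (simp add: m_assoc inv_solve_left)

lemma conj_conj:
  "x \<in> carrier G \<Longrightarrow> y \<in> carrier G \<Longrightarrow> v \<in> carrier G \<Longrightarrow>
    x \<otimes> (y \<otimes> v \<otimes> inv y) \<otimes> inv x = (x \<otimes> y) \<otimes> v \<otimes> inv (x \<otimes> y)"
  by (simp add: m_assoc inv_mult_group)

lemma conj_pow:
  "x \<in> carrier G \<Longrightarrow> v \<in> carrier G \<Longrightarrow> x \<otimes> v [^] (n::nat) \<otimes> inv x = (x \<otimes> v \<otimes> inv x) [^] n"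
  by (induction n) (simp_all add: conj_mult)

lemma conj_funpow:
  "x \<in> carrier G \<Longrightarrow> v \<in> carrier G \<Longrightarrow> ((\<lambda>v. x \<otimes> v \<otimes> inv x) ^^ n) v = x [^] n \<otimes> v \<otimes> inv (x [^] n)"
proof (induction n)
  case (Suc n)
  have "x [^] Suc n = x \<otimes> x [^] n" using Suc.prems(1) nat_pow_Suc2 by simp
  then show ?case using Suc by (simp add: conj_conj)
qed simp

lemma conj_eq_iff: "x \<in> carrier G \<Longrightarrow> v \<in> carrier G \<Longrightarrow> w \<in> carrier G \<Longrightarrow>
    x \<otimes> v \<otimes> inv x = w \<longleftrightarrow> x \<otimes> v = w \<otimes> x"
  by (metis inv_solve_right m_closed)

end

context prime_pair
begin

text \<open>Let \<open>W\<close> have \<open>p ^ j\<close> elements. Conjugation by \<open>x\<close>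
  permutes \<open>W\<close> with period \<open>q\<close> and fixes only the identity, so
  \<open>q dvd p ^ j - 1\<close> and \<open>p dvd j\<close>; as \<open>W\<close> is nontrivial,
  \<open>j = p\<close>.\<close>

lemma frobenius_irreducible:
  fixes G (structure)
  assumes G: "group G" "finite (carrier G)" and V: "subgroup V G" "card V = p ^ p"
    and x: "x \<in> carrier G" "\<And>v. v \<in> V \<Longrightarrow> x [^] q \<otimes> v = v \<otimes> x [^] q"
    and fpf: "\<And>v. v \<in> V \<Longrightarrow> x \<otimes> v = v \<otimes> x \<Longrightarrow> v = \<one>"
    and W: "subgroup W G" "W \<subseteq> V" "\<And>w. w \<in> W \<Longrightarrow> x \<otimes> w \<otimes> inv x \<in> W" "w \<in> W" "w \<noteq> \<one>"
  shows "W = V"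
proof -
  interpret group G by fact
  have VG: "V \<subseteq> carrier G" using V(1) subgroup.subset by blast
  have finV: "finite V" using VG G(2) by (rule finite_subset)
  then have finW: "finite W" by (rule finite_subset[OF W(2)])
  have "card W dvd p ^ p" using subgroup_card_dvd[OF G(2) W(1) V(1) W(2)] V(2) by simp
  then obtain j where j: "card W = p ^ j" "j \<le> p" using divides_primepow_nat[OF p] by blast
  have "q dvd card {v \<in> W. x \<otimes> v \<otimes> inv x \<noteq> v}"
  proof (rule prime_period_card[OF finW _ q])
    show "(\<lambda>v. x \<otimes> v \<otimes> inv x) ` W \<subseteq> W" using W(3) by blast
    fix v assume "v \<in> W"
    then have v: "v \<in> V" "v \<in> carrier G" using W(2) VG by auto
    have "((\<lambda>v. x \<otimes> v \<otimes> inv x) ^^ q) v = x [^] q \<otimes> v \<otimes> inv (x [^] q)" using conj_funpow x(1) v by blast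
    also have "\<dots> = v" using conj_eq_iff[of "x [^] q" v v] x v by simp
    finally show "((\<lambda>v. x \<otimes> v \<otimes> inv x) ^^ q) v = v" .
  qed
  also have "{v \<in> W. x \<otimes> v \<otimes> inv x \<noteq> v} = W - {\<one>}"
  proof -
    have "x \<otimes> v \<otimes> inv x = v \<longleftrightarrow> v = \<one>" if "v \<in> W" for v
      using that W(2) VG fpf[of v] x(1) conj_eq_iff[of x v v] by auto
    then show ?thesis by blast
  qed
  also have "card (W - {\<one>}) = p ^ j - 1" using subgroup.one_closed[OF W(1)] finW j by simp
  finally have "p dvd j" using q_dvd_iff by simp
  moreover have "j \<noteq> 0"
  proof
    assume "j = 0"
    then obtain c where "W = {c}" using j card_1_singletonE by auto
    then show False using W(4,5) subgroup.one_closed[OF W(1)] by auto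
  qed
  ultimately have "j = p" using j(2) dvd_imp_le[of p j] by simp
  then show ?thesis using j V(2) W(2) finV card_subset_eq by metis
qed

text \<open>A generator \<open>x\<close> of a Sylow \<open>q\<close>-subgroup \<open>Q\<close>
  permutes the \<open>p ^ p\<close> cosets of \<open>Q\<close>, and the fixed ones correspond to the
  normalizer of \<open>Q\<close> within a Sylow \<open>p\<close>-subgroup \<open>P\<close>. If that
  has order \<open>p ^ j\<close>, then \<open>q dvd p ^ p - p ^ j\<close>, so \<open>j\<close> is
  \<open>p\<close> or 0. The first case makes \<open>Q\<close> normal; in the second, counting
  elements of order \<open>q\<close> makes \<open>P\<close> normal, and irreducibility under
  \<open>x\<close> gives the remaining properties.\<close>

lemma sylow_dichotomy:
  fixes G (structure)
  assumes "group G" and ord: "order G = p ^ p * q"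
  shows "(\<exists>Q. Q \<lhd> G \<and> card Q = q) \<or>
    (\<exists>V. V \<lhd> G \<and> card V = p ^ p \<and> (\<forall>u\<in>V. \<forall>v\<in>V. u \<otimes> v = v \<otimes> u) \<and> (\<forall>v\<in>V. v [^] p = \<one>) \<and>
      (\<forall>x\<in>carrier G - V. \<forall>v\<in>V. x \<otimes> v = v \<otimes> x \<longrightarrow> v = \<one>))"
proof -
  interpret group G by fact
  have fin: "finite (carrier G)" using ord p_gt_1 q_gt_1 order_gt_0_iff_finite by simp
  have "\<exists>H. subgroup H G \<and> card H = q ^ 1"
    using sylow_thm[of q G 1 "p ^ p"] q ord fin group_axioms by (simp add: mult.commute)
  then obtain Q where Q: "subgroup Q G" "card Q = q" by auto
  have "\<exists>H. subgroup H G \<and> card H = p ^ p"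
    using sylow_thm[of p G p q] p ord fin group_axioms by simp
  then obtain P where P: "subgroup P G" "card P = p ^ p" by auto
  have QG: "Q \<subseteq> carrier G" and PG: "P \<subseteq> carrier G" using P Q subgroup.subset by blast+
  have finQ: "finite Q" and finP: "finite P" using QG PG fin finite_subset by blast+
  have copr: "coprime (p ^ p) q" using coprime_p_q by simp
  have Ppow: "v [^] (p ^ p) = \<one>" if "v \<in> P" for v using subgroup_pow_card[OF P(1) that] P(2) by simp
  have Qpow: "v [^] q = \<one>" if "v \<in> Q" for v using subgroup_pow_card[OF Q(1) that] Q(2) by simp
  have PQ: "v = \<one>" if "v \<in> P" "v \<in> Q" for v
    using coprime_torsion[of v "p ^ p" q] that PG Ppow Qpow copr by blast
  obtain x where x: "x \<in> Q" "x \<noteq> \<one>"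
    using exists_prime_order_element[OF fin Q(1) q] Q(2) by auto
  have xG: "x \<in> carrier G" using x QG by blast
  have xq: "x [^] q = \<one>" using Qpow x by blast
  have ordx: "ord x = q"
  proof -
    have "ord x dvd q" using xq pow_eq_id[OF xG] by simp
    moreover have "ord x \<noteq> 1" using ord_eq_1[OF xG] x(2) by simp
    ultimately show ?thesis using q by (auto simp: prime_nat_iff)
  qed
  have xpow_eq: "x [^] (i::nat) = x [^] (j::nat) \<longleftrightarrow> [i = j] (mod q)" for i j
  proof -
    have "x [^] int i = x [^] int j \<longleftrightarrow> int q dvd int j - int i"
      using int_pow_eq[OF xG, of "int i" "int j"] ordx by simp
    also have "\<dots> \<longleftrightarrow> [int j = int i] (mod int q)" by (simp add: cong_iff_dvd_diff)
    also have "\<dots> \<longleftrightarrow> [i = j] (mod q)" using cong_int_iff cong_sym_eq by blast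
    finally show ?thesis by (simp add: int_pow_int)
  qed
  have xpowQ: "x [^] (i::nat) \<in> Q" for i
    by (induction i) (use x subgroup.one_closed[OF Q(1)] subgroup.m_closed[OF Q(1)] in auto)
  have Qx: "Q = (\<lambda>i::nat. x [^] i) ` {..<q}"
  proof (rule card_subset_eq[OF finQ, symmetric])
    show "(\<lambda>i::nat. x [^] i) ` {..<q} \<subseteq> Q" using xpowQ by blast
    have "inj_on (\<lambda>i::nat. x [^] i) {..<q}"
      by (rule inj_onI) (use xpow_eq cong_less_modulus_unique_nat in blast)
    then show "card ((\<lambda>i::nat. x [^] i) ` {..<q}) = card Q" using Q(2) by (simp add: card_image)
  qed
  define N where "N = {g \<in> carrier G. g \<otimes> x \<otimes> inv g \<in> Q}"
  have NQ: "g \<otimes> y \<otimes> inv g \<in> Q" if g: "g \<in> N" and y: "y \<in> Q" for g y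
  proof -
    obtain i :: nat where i: "y = x [^] i" using y Qx by blast
    have gG: "g \<in> carrier G" and gx: "g \<otimes> x \<otimes> inv g \<in> Q" using g by (simp_all add: N_def)
    have "g \<otimes> y \<otimes> inv g = (g \<otimes> x \<otimes> inv g) [^] i" unfolding i using conj_pow[OF gG xG] .
    also have "(g \<otimes> x \<otimes> inv g) [^] i \<in> Q"
      by (induction i) (use gx subgroup.one_closed[OF Q(1)] subgroup.m_closed[OF Q(1)] in auto)
    finally show ?thesis .
  qed
  have N1: "\<one> \<in> N" using xG x by (simp add: N_def)
  have Nm: "g \<otimes> h \<in> N" if "g \<in> N" "h \<in> N" for g h
  proof -
    have gh: "g \<in> carrier G" "h \<in> carrier G" "h \<otimes> x \<otimes> inv h \<in> Q" using that by (simp_all add: N_def)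
    then have "g \<otimes> (h \<otimes> x \<otimes> inv h) \<otimes> inv g \<in> Q" using NQ that by blast
    then show ?thesis using gh xG by (simp add: N_def conj_conj)
  qed
  let ?K = "N \<inter> P"
  have Ksub: "subgroup ?K G"
  proof (rule subgroup_if_finite_closed[OF fin])
    show "?K \<subseteq> carrier G" using PG by blast
    show "\<one> \<in> ?K" using N1 subgroup.one_closed[OF P(1)] by blast
    show "g \<otimes> h \<in> ?K" if "g \<in> ?K" "h \<in> ?K" for g h
      using that Nm subgroup.m_closed[OF P(1)] by blast
  qed
  then have "card ?K dvd p ^ p" using subgroup_card_dvd[OF fin Ksub P(1)] P(2) by simp
  then obtain j where j: "card ?K = p ^ j" "j \<le> p" using divides_primepow_nat[OF p] by blast
  have inj: "g = h" if "g \<in> P" "h \<in> P" "Q #> g = Q #> h" for g h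
  proof -
    have gh: "g \<in> carrier G" "h \<in> carrier G" using that PG by auto
    have "g \<in> Q #> h" using rcos_self[OF gh(1) Q(1)] that(3) by simp
    then obtain y where y: "y \<in> Q" "g = y \<otimes> h" by (auto simp: r_coset_def)
    then have "g \<otimes> inv h = y" using gh QG by (simp add: m_assoc subsetD)
    then have "y \<in> P" using that subgroup.m_closed[OF P(1)] subgroup.m_inv_closed[OF P(1)] by metis
    then have "y = \<one>" using PQ y by blast
    then show "g = h" using y gh by simp
  qed
  have cardR: "card (rcosets Q) = p ^ p"
    using lagrange[OF Q(1)] Q(2) ord q_gt_1 by simp
  have finR: "finite (rcosets Q)" using cardR p_gt_1 by (intro card_ge_0_finite) simp
  have RP: "rcosets Q = (\<lambda>g. Q #> g) ` P"
  proof (rule card_subset_eq[OF finR, symmetric])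
    show "(\<lambda>g. Q #> g) ` P \<subseteq> rcosets Q" using PG QG by (auto intro: rcosetsI)
    have "inj_on (\<lambda>g. Q #> g) P" by (rule inj_onI) (rule inj)
    then show "card ((\<lambda>g. Q #> g) ` P) = card (rcosets Q)" using cardR P(2) by (simp add: card_image)
  qed
  have GQP: "\<exists>y\<in>Q. \<exists>g\<in>P. a = y \<otimes> g" if a: "a \<in> carrier G" for a
  proof -
    have "Q #> a \<in> rcosets Q" using a QG by (intro rcosetsI)
    then obtain g where g: "g \<in> P" "Q #> a = Q #> g" using RP by blast
    then have "a \<in> Q #> g" using rcos_self[OF a Q(1)] by simp
    then show ?thesis using g by (auto simp: r_coset_def)
  qed
  \<comment> \<open>Translation by \<open>x\<close> fixes exactly the cosets represented by the
    normalizer part \<open>?K\<close>, so \<open>p ^ p - p ^ j\<close> cosets are moved.\<close>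
  have fixed: "(Q #> g) #> x = Q #> g \<longleftrightarrow> g \<in> N" if g: "g \<in> P" for g
  proof -
    have gG: "g \<in> carrier G" using g PG by blast
    have "(Q #> g) #> x = Q #> (g \<otimes> x)" using coset_mult_assoc QG gG xG by blast
    moreover have "Q #> (g \<otimes> x) = Q #> g \<longleftrightarrow> (g \<otimes> x) \<otimes> inv g \<in> Q"
    proof
      assume "Q #> (g \<otimes> x) = Q #> g"
      then have "g \<otimes> x \<in> Q #> g" using rcos_self[of "g \<otimes> x", OF _ Q(1)] gG xG by simp
      then obtain y where "y \<in> Q" "g \<otimes> x = y \<otimes> g" by (auto simp: r_coset_def)
      then show "(g \<otimes> x) \<otimes> inv g \<in> Q" using gG QG by (simp add: m_assoc subsetD)
    next
      assume a: "(g \<otimes> x) \<otimes> inv g \<in> Q"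
      have "g \<otimes> x = ((g \<otimes> x) \<otimes> inv g) \<otimes> g" using gG xG by (simp add: m_assoc)
      then have "g \<otimes> x \<in> Q #> g" using a unfolding r_coset_def by blast
      then show "Q #> (g \<otimes> x) = Q #> g" using repr_independence[OF _ gG Q(1)] by simp
    qed
    ultimately show ?thesis using gG by (simp add: N_def)
  qed
  have "q dvd card {C \<in> rcosets Q. C #> x \<noteq> C}"
  proof (rule prime_period_card[OF finR _ q])
    show "(\<lambda>C. C #> x) ` (rcosets Q) \<subseteq> rcosets Q"
    proof (rule image_subsetI)
      fix C assume "C \<in> rcosets Q"
      then obtain g where g: "g \<in> P" "C = Q #> g" using RP by blast
      then have "C #> x = Q #> (g \<otimes> x)" using coset_mult_assoc QG PG xG by blast
      then show "C #> x \<in> rcosets Q" using g PG xG QG by (auto intro!: rcosetsI)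
    qed
    fix C assume C: "C \<in> rcosets Q"
    then have CG: "C \<subseteq> carrier G" by (rule subgroup.rcosets_carrier[OF Q(1) group_axioms])
    have "((\<lambda>C. C #> x) ^^ n) C = C #> (x [^] n)" for n
      by (induction n) (use CG xG in \<open>simp_all add: coset_mult_assoc coset_mult_one\<close>)
    then show "((\<lambda>C. C #> x) ^^ q) C = C" using xq CG coset_mult_one by simp
  qed
  moreover have "card {C \<in> rcosets Q. C #> x \<noteq> C} = p ^ p - p ^ j"
  proof -
    have "{C \<in> rcosets Q. C #> x \<noteq> C} = (\<lambda>g. Q #> g) ` (P - ?K)"
      unfolding RP using fixed by blast
    moreover have "inj_on (\<lambda>g. Q #> g) (P - ?K)" by (rule inj_onI) (use inj in blast)
    ultimately have "card {C \<in> rcosets Q. C #> x \<noteq> C} = card (P - ?K)" by (simp add: card_image)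
    also have "\<dots> = card P - card ?K" using finP by (intro card_Diff_subset) auto
    finally show ?thesis using P(2) j by simp
  qed
  ultimately have "q dvd p ^ p - p ^ j" by simp
  then have "[p ^ p = p ^ j] (mod q)" using j(2) p_gt_1 cong_altdef_nat[of "p ^ j" "p ^ p" q] cong_sym
    by (simp add: power_increasing)
  then have "[p = j] (mod p)" using p_pow_cong_iff by blast
  then have "p dvd j" by (simp add: cong_def dvd_eq_mod_eq_0)
  then have "j = p \<or> j = 0" using j(2) dvd_imp_le[of p j] by auto
  then consider "j = p" | "j = 0" by blast
  then show ?thesis
  proof cases
    case 1
    then have "?K = P" using j P(2) finP by (intro card_subset_eq) auto
    moreover have "Q \<subseteq> N"
      using QG x(1) subgroup.m_closed[OF Q(1)] subgroup.m_inv_closed[OF Q(1)] by (auto simp: N_def)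
    ultimately have "carrier G \<subseteq> N" using GQP Nm by blast
    then have "Q \<lhd> G" unfolding normal_inv_iff using Q(1) NQ by blast
    then show ?thesis using Q(2) by blast
  next
    case 2
    then obtain c where c: "?K = {c}" using j card_1_singletonE by auto
    then have "?K = {\<one>}" using subgroup.one_closed[OF Ksub] by (metis singletonD)
    then have K1: "g = \<one>" if "g \<in> N" "g \<in> P" for g using that by blast
    \<comment> \<open>Since no nontrivial element of \<open>P\<close> normalizes \<open>Q\<close>,
      the conjugates under \<open>P\<close> of the nontrivial powers of \<open>x\<close> are
      pairwise distinct. These \<open>p ^ p * (q - 1)\<close> elements of order \<open>q\<close>
      leave room for only \<open>p ^ p\<close> others, which are the elements of
      \<open>P\<close>.\<close>
    define M where "M = (\<lambda>(g, i::nat). g \<otimes> x [^] i \<otimes> inv g) ` (P \<times> {1..<q})"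
    have "inj_on (\<lambda>(g, i::nat). g \<otimes> x [^] i \<otimes> inv g) (P \<times> {1..<q})"
    proof (rule inj_onI, clarify)
      fix g i h k
      assume as: "g \<in> P" "i \<in> {1..<q}" "h \<in> P" "k \<in> {1..<q}"
        and eq: "g \<otimes> x [^] i \<otimes> inv g = h \<otimes> x [^] k \<otimes> inv h"
      have gh: "g \<in> carrier G" "h \<in> carrier G" using as PG by auto
      let ?g = "inv h \<otimes> g"
      have g: "?g \<in> P" "?g \<in> carrier G"
        using as subgroup.m_closed[OF P(1)] subgroup.m_inv_closed[OF P(1)] gh by auto
      have "?g \<otimes> x [^] i \<otimes> inv ?g = inv h \<otimes> (g \<otimes> x [^] i \<otimes> inv g) \<otimes> inv (inv h)"
        using conj_conj[of "inv h" g "x [^] i"] gh xG by simp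
      also have "\<dots> = inv h \<otimes> (h \<otimes> x [^] k \<otimes> inv h) \<otimes> inv (inv h)" using eq by simp
      also have "\<dots> = x [^] k" using conj_conj[of "inv h" h "x [^] k"] gh xG by simp
      finally have gx: "?g \<otimes> x [^] i \<otimes> inv ?g = x [^] k" .
      have "coprime i q" using as q prime_imp_coprime_nat[of q i] nat_dvd_not_less[of i q]
        by (auto simp: coprime_commute)
      then obtain m where m: "[i * m = 1] (mod q)" using cong_solve_coprime_nat by auto
      have "x = x [^] (i * m)" using m xpow_eq[of "i * m" 1] xG by simp
      also have "\<dots> = (x [^] i) [^] m" using xG by (simp add: nat_pow_pow)
      finally have "?g \<otimes> x \<otimes> inv ?g = ?g \<otimes> (x [^] i) [^] m \<otimes> inv ?g" by simp
      also have "\<dots> = (?g \<otimes> x [^] i \<otimes> inv ?g) [^] m" using g xG by (intro conj_pow) simp_all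
      also have "\<dots> = x [^] (k * m)" using gx xG by (simp add: nat_pow_pow)
      finally have "?g \<in> N" using g xpowQ by (simp add: N_def)
      then have "?g = \<one>" using K1 g by blast
      then have gh': "g = h" using gh by (metis inv_equality inv_inv inv_closed)
      then have "x [^] i = x [^] k" using gx \<open>?g = \<one>\<close> xG by simp
      then have "i = k" using xpow_eq as cong_less_modulus_unique_nat by auto
      then show "g = h \<and> i = k" using gh' by simp
    qed
    then have cM: "card M = p ^ p * (q - 1)" unfolding M_def
      using P(2) by (simp add: card_image card_cartesian_product)
    have Mtor: "a \<in> carrier G \<and> a [^] q = \<one> \<and> a \<noteq> \<one>" if a: "a \<in> M" for a
    proof -
      obtain g and i :: nat where gi: "g \<in> P" "i \<in> {1..<q}" "a = g \<otimes> x [^] i \<otimes> inv g"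
        using a by (auto simp: M_def)
      have gG: "g \<in> carrier G" using gi PG by blast
      have "a [^] q = g \<otimes> (x [^] i) [^] q \<otimes> inv g" unfolding gi(3) using gG xG by (simp add: conj_pow)
      also have "(x [^] i) [^] q = (x [^] q) [^] i" using xG by (simp add: nat_pow_pow mult.commute)
      finally have "a [^] q = \<one>" using xq gG by simp
      moreover have "a \<noteq> \<one>"
      proof
        assume "a = \<one>"
        then have "g \<otimes> x [^] i = \<one> \<otimes> g" using gi(3) conj_eq_iff[of g "x [^] i" \<one>] gG xG by simp
        then have "g \<otimes> x [^] i = g" using gG by simp
        then have "x [^] i = \<one>" using gG xG by simp
        then have "[i = 0] (mod q)" using xpow_eq[of i 0] by simp
        then show False using gi(2) by (auto simp: cong_def)
      qed
      ultimately show ?thesis using gi gG xG by simp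
    qed
    have disj: "M \<inter> P = {}"
      using Mtor Ppow coprime_torsion[of _ q "p ^ p"] copr coprime_commute by blast
    have finM: "finite M" unfolding M_def using finP by simp
    have "M \<union> P = carrier G"
    proof (rule card_subset_eq[OF fin])
      show "M \<union> P \<subseteq> carrier G" using Mtor PG by blast
      have "card (M \<union> P) = p ^ p * (q - 1) + p ^ p"
        using card_Un_disjoint[OF finM finP disj] cM P(2) by simp
      also have "\<dots> = p ^ p * (q - 1 + 1)" by (simp only: distrib_left mult_1_right)
      also have "\<dots> = card (carrier G)" using ord q_gt_1 by (simp add: Coset.order_def)
      finally show "card (M \<union> P) = card (carrier G)" .
    qed
    then have torP: "a \<in> P" if "a \<in> carrier G" "a [^] (p ^ p) = \<one>" for a
      using that Mtor[of a] coprime_torsion[of a "p ^ p" q] copr by blast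
    have Pconj: "h \<otimes> v \<otimes> inv h \<in> P" if "h \<in> carrier G" "v \<in> P" for h v
    proof (rule torP)
      have v: "v \<in> carrier G" using that PG by blast
      show "h \<otimes> v \<otimes> inv h \<in> carrier G" using that v by simp
      show "(h \<otimes> v \<otimes> inv h) [^] (p ^ p) = \<one>"
        using conj_pow[OF that(1) v, of "p ^ p"] Ppow that by simp
    qed
    then have normP: "P \<lhd> G" unfolding normal_inv_iff using P(1) by blast
    have fpf: "v = \<one>" if "v \<in> P" "x \<otimes> v = v \<otimes> x" for v
    proof -
      have v: "v \<in> carrier G" using that PG by blast
      have "v \<otimes> x \<otimes> inv v = x" using conj_eq_iff[of v x x] v xG that by simp
      then have "v \<in> N" using v x by (simp add: N_def)
      then show ?thesis using K1 that by blast
    qed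
    have irr: "W = P" if "subgroup W G" "W \<subseteq> P" "\<And>w. w \<in> W \<Longrightarrow> x \<otimes> w \<otimes> inv x \<in> W" "w \<in> W" "w \<noteq> \<one>" for W w
    proof (rule frobenius_irreducible[OF group_axioms fin P xG])
      show "x [^] q \<otimes> v = v \<otimes> x [^] q" if "v \<in> P" for v using xq that PG by auto
    qed (use fpf that in blast)+
    \<comment> \<open>The center of \<open>P\<close>, and later the set \<open>E\<close> of elements
      with trivial \<open>p\<close>-th power, are nontrivial and stable under conjugation by
      \<open>x\<close>, so irreducibility makes each of them all of \<open>P\<close>.\<close>
    define Z where "Z = {z \<in> P. \<forall>v\<in>P. v \<otimes> z \<otimes> inv v = z}"
    have Zcomm: "z \<otimes> v = v \<otimes> z" if "z \<in> Z" "v \<in> P" for z v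
    proof -
      have "z \<in> carrier G" "v \<in> carrier G" "v \<otimes> z \<otimes> inv v = z" using that PG by (auto simp: Z_def)
      then show ?thesis using conj_eq_iff[of v z z] by simp
    qed
    have ZI: "z \<in> Z" if "z \<in> P" "\<And>v. v \<in> P \<Longrightarrow> v \<otimes> z = z \<otimes> v" for z
    proof -
      have "v \<otimes> z \<otimes> inv v = z" if v: "v \<in> P" for v
        using conj_eq_iff[of v z z] PG \<open>z \<in> P\<close> v \<open>\<And>v. v \<in> P \<Longrightarrow> v \<otimes> z = z \<otimes> v\<close>[OF v] by blast
      then show ?thesis using that by (simp add: Z_def)
    qed
    have Zsub: "subgroup Z G"
    proof (rule subgroup_if_finite_closed[OF fin])
      show "Z \<subseteq> carrier G" using PG by (auto simp: Z_def)
      show "\<one> \<in> Z" using subgroup.one_closed[OF P(1)] PG by (intro ZI) auto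
      fix a b assume ab: "a \<in> Z" "b \<in> Z"
      then have abP: "a \<in> P" "b \<in> P" "a \<in> carrier G" "b \<in> carrier G" using PG by (auto simp: Z_def)
      show "a \<otimes> b \<in> Z"
      proof (rule ZI)
        show "a \<otimes> b \<in> P" using abP subgroup.m_closed[OF P(1)] by blast
        fix v assume v: "v \<in> P"
        then have "v \<in> carrier G" using PG by blast
        then show "v \<otimes> (a \<otimes> b) = a \<otimes> b \<otimes> v"
          using Zcomm[OF ab(1) v] Zcomm[OF ab(2) v] abP by (metis m_assoc)
      qed
    qed
    interpret GP: group "G\<lparr>carrier := P\<rparr>" using P(1) subgroup_imp_group by blast
    have "[card P = card {z \<in> P. \<forall>v \<in> carrier (G\<lparr>carrier := P\<rparr>). v \<otimes> z \<otimes> inv v = z}] (mod p)"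
    proof (rule p_group_fixed_points[OF GP.group_axioms _ p finP])
      show "order (G\<lparr>carrier := P\<rparr>) = p ^ p" using P(2) by (simp add: Coset.order_def)
    next
      fix g h z assume "g \<in> carrier (G\<lparr>carrier := P\<rparr>)" "h \<in> carrier (G\<lparr>carrier := P\<rparr>)" "z \<in> P"
      then show "(g \<otimes>\<^bsub>G\<lparr>carrier := P\<rparr>\<^esub> h) \<otimes> z \<otimes> inv (g \<otimes>\<^bsub>G\<lparr>carrier := P\<rparr>\<^esub> h) = g \<otimes> (h \<otimes> z \<otimes> inv h) \<otimes> inv g"
        using PG conj_conj[of g h z] by (simp add: subsetD)
    qed (use PG Pconj in auto)
    then have "[p ^ p = card Z] (mod p)" using P(2) by (simp add: Z_def)
    moreover have "[p ^ p = 0] (mod p)" using p_gt_1 by (simp add: cong_0_iff)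
    ultimately have "p dvd card Z" using cong_sym cong_trans cong_0_iff by meson
    then obtain z where z: "z \<in> Z" "z \<noteq> \<one>" using exists_prime_order_element[OF fin Zsub p] by blast
    have ZP: "Z = P"
    proof (rule irr[OF Zsub _ _ z])
      show "Z \<subseteq> P" by (auto simp: Z_def)
      fix w assume w: "w \<in> Z"
      then have wP: "w \<in> P" "w \<in> carrier G" using PG by (auto simp: Z_def)
      show "x \<otimes> w \<otimes> inv x \<in> Z"
      proof (rule ZI)
        show "x \<otimes> w \<otimes> inv x \<in> P" using Pconj xG wP by blast
        fix v assume v: "v \<in> P"
        then have vG: "v \<in> carrier G" using PG by blast
        let ?v = "inv x \<otimes> v \<otimes> inv (inv x)"
        have v': "?v \<in> P" using Pconj[of "inv x" v] xG v by blast
        then have v'G: "?v \<in> carrier G" using PG by blast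
        have e: "v = x \<otimes> ?v \<otimes> inv x" using conj_conj[of x "inv x" v] xG vG by simp
        have "v \<otimes> (x \<otimes> w \<otimes> inv x) = x \<otimes> (?v \<otimes> w) \<otimes> inv x"
          by (subst e) (rule conj_mult[OF xG v'G wP(2), symmetric])
        also have "?v \<otimes> w = w \<otimes> ?v" using Zcomm[OF w v'] by simp
        also have "x \<otimes> (w \<otimes> ?v) \<otimes> inv x = (x \<otimes> w \<otimes> inv x) \<otimes> v"
          using conj_mult[OF xG wP(2) v'G] e by simp
        finally show "v \<otimes> (x \<otimes> w \<otimes> inv x) = (x \<otimes> w \<otimes> inv x) \<otimes> v" .
      qed
    qed
    then have comm: "u \<otimes> v = v \<otimes> u" if "u \<in> P" "v \<in> P" for u v using that Zcomm by blast
    define E where "E = {v \<in> P. v [^] p = \<one>}"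
    have Esub: "subgroup E G"
    proof (rule subgroup_if_finite_closed[OF fin])
      fix a b assume ab: "a \<in> E" "b \<in> E"
      then have abG: "a \<in> carrier G" "b \<in> carrier G" using PG by (auto simp: E_def)
      have "(a \<otimes> b) [^] p = a [^] p \<otimes> b [^] p" using comm ab abG by (intro pow_mult_distrib) (auto simp: E_def)
      then show "a \<otimes> b \<in> E" using ab subgroup.m_closed[OF P(1)] by (auto simp: E_def)
    qed (use PG subgroup.one_closed[OF P(1)] in \<open>auto simp: E_def\<close>)
    have "p dvd card P" using P(2) p_gt_1 by simp
    then obtain e where e: "e \<in> P" "e \<noteq> \<one>" "e [^] p = \<one>" using exists_prime_order_element[OF fin P(1) p] by blast
    have EP: "E = P"
    proof (rule irr[OF Esub])
      show "x \<otimes> w \<otimes> inv x \<in> E" if "w \<in> E" for w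
      proof -
        have w: "w \<in> P" "w \<in> carrier G" "w [^] p = \<one>" using that PG by (auto simp: E_def)
        then show ?thesis using Pconj[OF xG w(1)] conj_pow[OF xG w(2), of p] xG by (simp add: E_def)
      qed
      show "e \<in> E" using e by (simp add: E_def)
    qed (use e in \<open>auto simp: E_def\<close>)
    \<comment> \<open>The centralizer of \<open>v\<close> contains the abelian group
      \<open>P\<close> and also \<open>y\<close>; as \<open>P\<close> has prime index, it is all of
      \<open>G\<close> and contains \<open>x\<close>, which fixes only the identity of
      \<open>P\<close>.\<close>
    have "v = \<one>" if y: "y \<in> carrier G - P" and v: "v \<in> P" and yv: "y \<otimes> v = v \<otimes> y" for y v
    proof -
      have vG: "v \<in> carrier G" using v PG by blast
      define C where "C = {a \<in> carrier G. a \<otimes> v = v \<otimes> a}"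
      have Csub: "subgroup C G"
      proof (rule subgroup_if_finite_closed[OF fin])
        fix a b assume "a \<in> C" "b \<in> C"
        then show "a \<otimes> b \<in> C" using vG by (auto simp: C_def) (metis m_assoc)
      qed (use vG in \<open>auto simp: C_def\<close>)
      have PC: "P \<subseteq> C" using comm v PG by (auto simp: C_def)
      have "card P dvd card C" using subgroup_card_dvd[OF fin P(1) Csub PC] .
      then obtain m where m: "card C = p ^ p * m" using P(2) by auto
      have "card C dvd p ^ p * q"
        using subgroup_card_dvd[OF fin Csub subgroup_self] subgroup.subset[OF Csub] ord by (simp add: Coset.order_def)
      then have "m dvd q" using m p_gt_1 by simp
      moreover have "m \<noteq> 1"
      proof
        assume "m = 1"
        moreover have "finite C" using subgroup.subset[OF Csub] fin by (rule finite_subset)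
        ultimately have "P = C" using m P(2) PC by (intro card_subset_eq) auto
        then show False using y yv by (auto simp: C_def)
      qed
      ultimately have "m = q" using q by (auto simp: prime_nat_iff)
      then have "C = carrier G" using m ord fin subgroup.subset[OF Csub]
        by (intro card_subset_eq) (auto simp: Coset.order_def)
      then have "x \<otimes> v = v \<otimes> x" using xG by (auto simp: C_def)
      then show ?thesis using fpf v by blast
    qed
    moreover have "v [^] p = \<one>" if "v \<in> P" for v using that EP by (auto simp: E_def)
    ultimately show ?thesis using normP P(2) comm by blast
  qed
qed

end

section \<open>Simple skew braces of order \<open>p\<^sup>p q\<close>\<close>

declare additive_group_simps(2,3)[simp del] multiplicative_group_simps(2,3)[simp del]

section \<open>Lambda maps of a general skew brace\<close>

locale skew_brace_structure =
  fixes B :: "'a sbrace"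
  assumes skew_brace: "skew_brace B"
begin

sublocale A: group "additive_group B"
  using skew_brace by (simp add: skew_brace_def)

sublocale M: group "multiplicative_group B"
  using skew_brace by (simp add: skew_brace_def)

abbreviation add (infixl "\<cdot>" 70) where "x \<cdot> y \<equiv> x \<otimes>\<^bsub>additive_group B\<^esub> y"
abbreviation circ (infixl "\<bullet>" 70) where "x \<bullet> y \<equiv> x \<otimes>\<^bsub>multiplicative_group B\<^esub> y"
abbreviation neg where "neg x \<equiv> inv\<^bsub>additive_group B\<^esub> x"
abbreviation bar where "bar x \<equiv> inv\<^bsub>multiplicative_group B\<^esub> x"
abbreviation e where "e \<equiv> \<one>\<^bsub>additive_group B\<^esub>"
abbreviation lam where "lam \<equiv> lambda_map B"

lemma closed [simp]:
  "x \<in> carrier B \<Longrightarrow> y \<in> carrier B \<Longrightarrow> x \<cdot> y \<in> carrier B"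
  "x \<in> carrier B \<Longrightarrow> y \<in> carrier B \<Longrightarrow> x \<bullet> y \<in> carrier B"
  "x \<in> carrier B \<Longrightarrow> neg x \<in> carrier B" "x \<in> carrier B \<Longrightarrow> bar x \<in> carrier B" "e \<in> carrier B"
  "x \<in> carrier B \<Longrightarrow> x [^]\<^bsub>additive_group B\<^esub> (n::nat) \<in> carrier B"
  "x \<in> carrier B \<Longrightarrow> x [^]\<^bsub>multiplicative_group B\<^esub> (n::nat) \<in> carrier B"
  using A.m_closed M.m_closed A.inv_closed M.inv_closed A.one_closed A.nat_pow_closed M.nat_pow_closed
  by simp_all

lemma distrib:
  "a \<in> carrier B \<Longrightarrow> b \<in> carrier B \<Longrightarrow> c \<in> carrier B \<Longrightarrow> a \<bullet> (b \<cdot> c) = (a \<bullet> b) \<cdot> neg a \<cdot> (a \<bullet> c)"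
  using skew_brace by (simp add: skew_brace_def additive_group_simps multiplicative_group_simps)

lemma lam_def: "lam a b = neg a \<cdot> (a \<bullet> b)"
  by (simp add: lambda_map_def additive_group_simps multiplicative_group_simps)

lemma lam_closed [simp]: "a \<in> carrier B \<Longrightarrow> b \<in> carrier B \<Longrightarrow> lam a b \<in> carrier B"
  by (simp add: lam_def)

lemma circ_eq: "a \<in> carrier B \<Longrightarrow> b \<in> carrier B \<Longrightarrow> a \<bullet> b = a \<cdot> lam a b"
  by (simp add: lam_def A.m_assoc[symmetric])

lemma lam_add: "a \<in> carrier B \<Longrightarrow> b \<in> carrier B \<Longrightarrow> c \<in> carrier B \<Longrightarrow> lam a (b \<cdot> c) = lam a b \<cdot> lam a c"
  by (simp add: lam_def distrib A.m_assoc)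

lemma circ_e: "a \<in> carrier B \<Longrightarrow> a \<bullet> e = a"
proof -
  assume a: "a \<in> carrier B"
  have "a \<bullet> e = (a \<bullet> e) \<cdot> neg a \<cdot> (a \<bullet> e)" using distrib[OF a, of e e] by simp
  then have "(a \<bullet> e) \<cdot> (neg a \<cdot> (a \<bullet> e)) = (a \<bullet> e)" using a by (simp add: A.m_assoc)
  then have "neg a \<cdot> (a \<bullet> e) = e" using a by simp
  then show ?thesis using a by (metis A.inv_equality A.inv_inv closed(2,3,5) additive_group_simps(1))
qed

lemma one_eq: "\<one>\<^bsub>multiplicative_group B\<^esub> = e"
proof -
  have "\<one>\<^bsub>multiplicative_group B\<^esub> \<in> carrier B" using M.one_closed by simp
  then show ?thesis using circ_e[of "\<one>\<^bsub>multiplicative_group B\<^esub>"] M.l_one[of e] by simp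
qed

lemma e_circ: "a \<in> carrier B \<Longrightarrow> e \<bullet> a = a"
  using M.l_one[of a] one_eq by simp

lemma bar_circ: "a \<in> carrier B \<Longrightarrow> bar a \<bullet> a = e" "a \<in> carrier B \<Longrightarrow> a \<bullet> bar a = e"
  using M.l_inv[of a] M.r_inv[of a] one_eq by simp_all

lemma lam_circ: "a \<in> carrier B \<Longrightarrow> b \<in> carrier B \<Longrightarrow> c \<in> carrier B \<Longrightarrow> lam (a \<bullet> b) c = lam a (lam b c)"
proof -
  assume abc: "a \<in> carrier B" "b \<in> carrier B" "c \<in> carrier B"
  have "(a \<bullet> b) \<cdot> lam (a \<bullet> b) c = a \<bullet> (b \<bullet> c)"
    using abc by (simp add: circ_eq[symmetric] M.m_assoc)
  also have "\<dots> = a \<bullet> (b \<cdot> lam b c)" using abc by (simp only: circ_eq)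
  also have "\<dots> = (a \<bullet> b) \<cdot> lam a (lam b c)" using abc by (simp add: distrib lam_def[of a] A.m_assoc)
  finally show ?thesis using abc by simp
qed

lemma lam_by_e: "a \<in> carrier B \<Longrightarrow> lam e a = a"
  by (simp add: lam_def e_circ)

lemma lam_e [simp]: "a \<in> carrier B \<Longrightarrow> lam a e = e"
  by (simp add: lam_def circ_e)

lemma lam_hom: "a \<in> carrier B \<Longrightarrow> lam a \<in> hom (additive_group B) (additive_group B)"
  by (rule homI) (simp_all add: lam_add)

lemma lam_group_hom: "a \<in> carrier B \<Longrightarrow> group_hom (additive_group B) (additive_group B) (lam a)"
  by (intro group_hom.intro group_hom_axioms.intro lam_hom A.group_axioms)

lemma lam_pow: "a \<in> carrier B \<Longrightarrow> b \<in> carrier B \<Longrightarrow>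
    lam a (b [^]\<^bsub>additive_group B\<^esub> (n::nat)) = (lam a b) [^]\<^bsub>additive_group B\<^esub> n"
  using group_hom.hom_nat_pow[OF lam_group_hom] by simp

lemma lam_neg: "a \<in> carrier B \<Longrightarrow> b \<in> carrier B \<Longrightarrow> lam a (neg b) = neg (lam a b)"
  using group_hom.hom_inv[OF lam_group_hom] by simp

lemma lam_bar: "a \<in> carrier B \<Longrightarrow> b \<in> carrier B \<Longrightarrow> lam (bar a) (lam a b) = b"
  "a \<in> carrier B \<Longrightarrow> b \<in> carrier B \<Longrightarrow> lam a (lam (bar a) b) = b"
  using lam_circ[of "bar a" a b] lam_circ[of a "bar a" b] lam_by_e bar_circ by simp_all

lemma lam_funpow: "a \<in> carrier B \<Longrightarrow> b \<in> carrier B \<Longrightarrow>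
    (lam a ^^ n) b = lam (a [^]\<^bsub>multiplicative_group B\<^esub> n) b"
proof (induction n)
  case 0
  then show ?case using lam_by_e one_eq by simp
next
  case (Suc n)
  have "a [^]\<^bsub>multiplicative_group B\<^esub> Suc n = a \<bullet> a [^]\<^bsub>multiplicative_group B\<^esub> n"
    using Suc.prems M.nat_pow_Suc2 by simp
  then show ?case using Suc by (simp add: lam_circ)
qed

lemma torsion_lam_closed:
  assumes "a \<in> carrier B" "b \<in> {b \<in> carrier (additive_group B). b [^]\<^bsub>additive_group B\<^esub> (m::nat) = e}"
  shows "lam a b \<in> {b \<in> carrier (additive_group B). b [^]\<^bsub>additive_group B\<^esub> (m::nat) = e}"
  using assms lam_pow[of a b m] by simp

text \<open>The multiplicative inverse of \<open>a\<close> is \<open>lam (bar a) (neg a)\<close> and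
  \<open>a \<bullet> b\<close> is \<open>a \<cdot> lam a b\<close>, so stability under lambda maps
  carries closure over from the additive group.\<close>

lemma left_ideal_subgroup:
  assumes I: "subgroup I (additive_group B)" and lamI: "\<And>a i. a \<in> carrier B \<Longrightarrow> i \<in> I \<Longrightarrow> lam a i \<in> I"
  shows "subgroup I (multiplicative_group B)"
proof (rule M.subgroupI)
  have IB: "I \<subseteq> carrier B" using subgroup.subset[OF I] by simp
  then show "I \<subseteq> carrier (multiplicative_group B)" by simp
  show "I \<noteq> {}" using subgroup.one_closed[OF I] by blast
  fix a assume a: "a \<in> I"
  then have aB: "a \<in> carrier B" using IB by blast
  have "a \<cdot> lam a (bar a) = e" using aB bar_circ by (simp add: circ_eq[symmetric])
  then have "lam a (bar a) = neg a"
    using aB by (metis A.inv_comm A.inv_equality additive_group_simps(1) closed(4) lam_closed)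
  then have "bar a = lam (bar a) (neg a)" using lam_bar(1)[of a "bar a"] aB by simp
  moreover have "neg a \<in> I" using subgroup.m_inv_closed[OF I a] .
  ultimately show "bar a \<in> I" using lamI aB by (metis closed(4))
  fix b assume b: "b \<in> I"
  then have "a \<bullet> b = a \<cdot> lam a b" using aB IB by (intro circ_eq) auto
  then show "a \<bullet> b \<in> I" using subgroup.m_closed[OF I a lamI[OF aB b]] by simp
qed

end

section \<open>The additive group of a simple brace has no normal subgroup of order q\<close>

locale simple_brace_pq = prime_pair + skew_brace_structure +
  assumes simple: "simple_skew_brace B" and card_B: "card (carrier B) = p ^ p * q"
begin

lemma finite_B: "finite (carrier B)"
  using card_B p_gt_1 q_gt_1 by (intro card_ge_0_finite) simp

lemma finite_AM: "finite (carrier (additive_group B))" "finite (carrier (multiplicative_group B))"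
  using finite_B by simp_all

lemma order_AM: "order (additive_group B) = p ^ p * q" "order (multiplicative_group B) = p ^ p * q"
  using card_B by (simp_all add: Coset.order_def)

lemma ideal_trivial:
  assumes "I \<lhd> additive_group B" "I \<lhd> multiplicative_group B" "\<And>a i. a \<in> carrier B \<Longrightarrow> i \<in> I \<Longrightarrow> lam a i \<in> I"
  shows "card I = 1 \<or> card I = p ^ p * q"
proof -
  have "sb_ideal I B" unfolding sb_ideal_def
    using assms normal_imp_subgroup[OF assms(1)] by blast
  then have "I = {sone B} \<or> I = carrier B" using simple by (simp add: simple_skew_brace_def)
  then show ?thesis using card_B by auto
qed

lemma card_q_not_trivial: "q \<noteq> 1" "q \<noteq> p ^ p * q" "p ^ p \<noteq> 1" "p ^ p \<noteq> p ^ p * q"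
  using q_gt_1 p_gt_1 q_less by auto

lemma coprime_pp_q: "coprime (p ^ p) q" "coprime q (p ^ p)"
  using coprime_p_q coprime_q_p by simp_all

lemma normal_q_torsion:
  assumes "Q \<lhd> G" "card Q = q" "order G = p ^ p * q" "finite (carrier G)" "group G"
  shows "Q = {a \<in> carrier G. a [^]\<^bsub>G\<^esub> q = \<one>\<^bsub>G\<^esub>}"
  using group.normal_hall_torsion[OF assms(5,4,1,2), of "p ^ p"] assms(3) coprime_pp_q by (simp add: mult.commute)

lemma normal_pp_torsion:
  assumes "V \<lhd> G" "card V = p ^ p" "order G = p ^ p * q" "finite (carrier G)" "group G"
  shows "V = {a \<in> carrier G. a [^]\<^bsub>G\<^esub> (p ^ p) = \<one>\<^bsub>G\<^esub>}"
  using group.normal_hall_torsion[OF assms(5,4,1,2), of q] assms(3) coprime_pp_q by simp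

text \<open>Unless \<open>Q\<close> is also normal in the multiplicative group, the additive centralizer of \<open>Q\<close>
  contains a nontrivial \<open>p\<close>-element because \<open>q < p\<^sup>p\<close>, and irreducibility of \<open>V\<close> makes it all of \<open>B\<close>;
  then the additive Sylow \<open>p\<close>-subgroup is an ideal.\<close>
lemma no_additive_normal_q:
  assumes Q: "Q \<lhd> additive_group B" "card Q = q"
  shows False
proof -
  have tor: "Q = {a \<in> carrier (additive_group B). a [^]\<^bsub>additive_group B\<^esub> q = e}"
    by (rule normal_q_torsion[OF Q order_AM(1) finite_AM(1) A.group_axioms])
  have lamQ: "lam a y \<in> Q" if "a \<in> carrier B" "y \<in> Q" for a y
    using torsion_lam_closed[of a y q] that tor by blast
  have QA: "subgroup Q (additive_group B)" using Q(1) by (rule normal_imp_subgroup)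
  have QM: "subgroup Q (multiplicative_group B)" by (rule left_ideal_subgroup[OF QA lamQ])
  have QB: "Q \<subseteq> carrier B" using subgroup.subset[OF QA] by simp
  have finQ: "finite Q" using QB finite_B by (rule finite_subset)
  consider Q' where "Q' \<lhd> multiplicative_group B" "card Q' = q"
    | V where "V \<lhd> multiplicative_group B" "card V = p ^ p"
      "\<And>u v. u \<in> V \<Longrightarrow> v \<in> V \<Longrightarrow> u \<bullet> v = v \<bullet> u"
      "\<And>x v. x \<in> carrier B - V \<Longrightarrow> v \<in> V \<Longrightarrow> x \<bullet> v = v \<bullet> x \<Longrightarrow> v = \<one>\<^bsub>multiplicative_group B\<^esub>"
    using sylow_dichotomy[OF M.group_axioms order_AM(2)] unfolding multiplicative_group_simps(1) by blast
  then show False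
  proof cases
    case 1
    then have tor': "Q' = {a \<in> carrier (multiplicative_group B). a [^]\<^bsub>multiplicative_group B\<^esub> q = \<one>\<^bsub>multiplicative_group B\<^esub>}"
      by (intro normal_q_torsion order_AM finite_AM M.group_axioms)
    have "Q \<subseteq> Q'" unfolding tor' using M.subgroup_pow_card[OF QM] Q(2) QB by auto
    moreover have "finite Q'" using tor' finite_AM(2) by simp
    ultimately have "Q = Q'" using Q(2) 1(2) by (intro card_subset_eq) auto
    with 1(1) have "Q \<lhd> multiplicative_group B" by simp
    then have "card Q = 1 \<or> card Q = p ^ p * q" by (rule ideal_trivial[OF Q(1) _ lamQ])
    then show False unfolding Q(2) using card_q_not_trivial(1,2) by blast
  next
    case 2
    have torV: "V = {a \<in> carrier (multiplicative_group B). a [^]\<^bsub>multiplicative_group B\<^esub> (p ^ p) = \<one>\<^bsub>multiplicative_group B\<^esub>}"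
      using 2 by (intro normal_pp_torsion order_AM finite_AM M.group_axioms)
    have VM: "subgroup V (multiplicative_group B)" using 2(1) by (rule normal_imp_subgroup)
    have VB: "V \<subseteq> carrier B" using torV by auto
    have finV: "finite V" using VB finite_B by (rule finite_subset)
    \<comment> \<open>The additive centralizer of \<open>Q\<close>. Lambda maps preserve
      \<open>Q\<close>, hence also \<open>C\<close>, so \<open>C\<close> is a subgroup of both
      groups and facts about its order pass from one to the other.\<close>
    define C where "C = {a \<in> carrier B. \<forall>z\<in>Q. a \<cdot> z = z \<cdot> a}"
    have CB: "C \<subseteq> carrier B" by (auto simp: C_def)
    have CA: "subgroup C (additive_group B)"
    proof (rule A.subgroup_if_finite_closed[OF finite_AM(1)])
      fix a b assume ab: "a \<in> C" "b \<in> C"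
      have "a \<cdot> b \<cdot> z = z \<cdot> (a \<cdot> b)" if z: "z \<in> Q" for z
      proof -
        have "a \<cdot> z = z \<cdot> a" "b \<cdot> z = z \<cdot> b" "a \<in> carrier B" "b \<in> carrier B" "z \<in> carrier B"
          using ab z QB by (auto simp: C_def)
        then show ?thesis by (metis A.m_assoc additive_group_simps(1))
      qed
      then show "a \<cdot> b \<in> C" using ab by (simp add: C_def)
    qed (use QB in \<open>auto simp: C_def subsetD\<close>)
    have lamC: "lam a c \<in> C" if a: "a \<in> carrier B" and c: "c \<in> C" for a c
    proof -
      have cB: "c \<in> carrier B" using c CB by blast
      have "lam a c \<cdot> z = z \<cdot> lam a c" if z: "z \<in> Q" for z
      proof -
        have zB: "z \<in> carrier B" using z QB by blast
        have z': "lam (bar a) z \<in> Q" using lamQ[of "bar a" z] a z by simp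
        then have "c \<cdot> lam (bar a) z = lam (bar a) z \<cdot> c" using c by (simp add: C_def)
        then have "lam a (c \<cdot> lam (bar a) z) = lam a (lam (bar a) z \<cdot> c)" by simp
        then show ?thesis using a cB zB by (simp add: lam_add lam_bar)
      qed
      then show ?thesis using a cB by (simp add: C_def)
    qed
    have CM: "subgroup C (multiplicative_group B)" by (rule left_ideal_subgroup[OF CA lamC])
    have finC: "finite C" using CB finite_B by (rule finite_subset)
    obtain y where y: "y \<in> Q" "y \<noteq> e"
      using A.exists_prime_order_element[OF finite_AM(1) QA q] Q(2) by auto
    have yB: "y \<in> carrier B" using y QB by blast
    have Qconj: "g \<cdot> z \<cdot> neg g \<in> Q" if "g \<in> carrier B" "z \<in> Q" for g z
      using Q(1) that unfolding A.normal_inv_iff by simp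
    \<comment> \<open>\<open>Q\<close> has prime order, so commuting with the single nontrivial
      element \<open>y\<close> suffices.\<close>
    have CI: "c \<in> C" if c: "c \<in> carrier B" "c \<cdot> y = y \<cdot> c" for c
    proof -
      define D where "D = {z \<in> Q. c \<cdot> z = z \<cdot> c}"
      have DA: "subgroup D (additive_group B)"
      proof (rule A.subgroup_if_finite_closed[OF finite_AM(1)])
        fix a b assume ab: "a \<in> D" "b \<in> D"
        then have abQ: "a \<in> Q" "b \<in> Q" "c \<cdot> a = a \<cdot> c" "c \<cdot> b = b \<cdot> c" by (simp_all add: D_def)
        then have abB: "a \<in> carrier B" "b \<in> carrier B" using QB by auto
        have "c \<cdot> (a \<cdot> b) = a \<cdot> b \<cdot> c" using abQ abB c(1) by (metis A.m_assoc additive_group_simps(1))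
        then show "a \<cdot> b \<in> D" using subgroup.m_closed[OF QA abQ(1,2)] by (simp add: D_def)
      qed (use QB c subgroup.one_closed[OF QA] in \<open>auto simp: D_def\<close>)
      have "card D dvd q" using A.subgroup_card_dvd[OF finite_AM(1) DA QA] Q(2) by (auto simp: D_def)
      moreover have "card D \<noteq> 1"
      proof
        assume "card D = 1"
        then obtain d where "D = {d}" by (rule card_1_singletonE)
        then show False using y c subgroup.one_closed[OF DA] by (auto simp: D_def)
      qed
      ultimately have "card D = q" using q by (auto simp: prime_nat_iff)
      then have "D = Q" using Q(2) finQ by (intro card_subset_eq) (auto simp: D_def)
      then show ?thesis using c(1) by (auto simp: C_def D_def)
    qed
    have QC: "Q \<subseteq> C"
    proof -
      have "card (Q \<inter> C) dvd q"
        using A.subgroup_card_dvd[OF finite_AM(1) subgroup_Int[OF QA CA] QA] Q(2) by auto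
      have "y \<in> C" using CI[OF yB] by simp
      then have "card (Q \<inter> C) \<noteq> 1" using y subgroup.one_closed[OF CA] subgroup.one_closed[OF QA]
        by (metis IntI card_1_singletonE singletonD)
      then have "card (Q \<inter> C) = q" using \<open>card (Q \<inter> C) dvd q\<close> q by (auto simp: prime_nat_iff)
      then have "Q \<inter> C = Q" using Q(2) finQ by (intro card_subset_eq) auto
      then show ?thesis by blast
    qed
    have "\<exists>H. subgroup H (additive_group B) \<and> card H = p ^ p"
      using sylow_thm[of p "additive_group B" p q] p order_AM(1) finite_AM(1) A.group_axioms by simp
    then obtain P where P: "subgroup P (additive_group B)" "card P = p ^ p" by auto
    have PB: "P \<subseteq> carrier B" using subgroup.subset[OF P(1)] by simp
    have finP: "finite P" using PB finite_B by (rule finite_subset)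
    \<comment> \<open>At most \<open>q\<close> values are available for \<open>p ^ p\<close>
      arguments, so two elements of \<open>P\<close> conjugate \<open>y\<close> alike and their
      quotient centralizes \<open>y\<close>.\<close>
    have "\<not> inj_on (\<lambda>g. g \<cdot> y \<cdot> neg g) P"
    proof (rule pigeonhole)
      have "(\<lambda>g. g \<cdot> y \<cdot> neg g) ` P \<subseteq> Q" using Qconj y PB by blast
      then have "card ((\<lambda>g. g \<cdot> y \<cdot> neg g) ` P) \<le> q" using Q(2) finQ card_mono by metis
      then show "card ((\<lambda>g. g \<cdot> y \<cdot> neg g) ` P) < card P" using P(2) q_less by simp
    qed
    then obtain g h where gh: "g \<in> P" "h \<in> P" "g \<noteq> h" "g \<cdot> y \<cdot> neg g = h \<cdot> y \<cdot> neg h"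
      by (auto simp: inj_on_def)
    define c where "c = neg h \<cdot> g"
    have ghB: "g \<in> carrier B" "h \<in> carrier B" using gh PB by auto
    have cP: "c \<in> P" unfolding c_def
      using gh subgroup.m_closed[OF P(1)] subgroup.m_inv_closed[OF P(1)] by blast
    have cB: "c \<in> carrier B" using cP PB by blast
    have ce: "c \<noteq> e"
    proof
      assume "c = e"
      then have "neg (neg h) = g" using ghB c_def by (intro A.inv_equality) (simp_all add: A.inv_comm)
      then show False using gh ghB by simp
    qed
    have "c \<cdot> y \<cdot> neg c = neg h \<cdot> (g \<cdot> y \<cdot> neg g) \<cdot> neg (neg h)"
      unfolding c_def using A.conj_conj[of "neg h" g y] ghB yB by simp
    also have "\<dots> = y" using A.conj_conj[of "neg h" h y] ghB yB gh(4) by simp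
    finally have "c \<cdot> y = y \<cdot> c" using A.conj_eq_iff[of c y y] cB yB by simp
    then have cC: "c \<in> C" by (rule CI[OF cB])
    have "c [^]\<^bsub>additive_group B\<^esub> (p ^ p) = e" using A.subgroup_pow_card[OF P(1) cP] P(2) by simp
    then have "A.ord c dvd p ^ p" using A.pow_eq_id[of c] cB by simp
    then obtain i where i: "A.ord c = p ^ i" using divides_primepow_nat[OF p] by blast
    have "i \<noteq> 0"
    proof
      assume "i = 0"
      then show False using i A.ord_eq_1[of c] cB ce by simp
    qed
    moreover have "A.ord c dvd card C"
      using A.subgroup_pow_card[OF CA cC] A.pow_eq_id[of c "card C"] cB by simp
    \<comment> \<open>An additive element of \<open>p\<close>-power order shows that
      \<open>p\<close> divides \<open>card C\<close>; as \<open>C\<close> is also a multiplicative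
      subgroup, Cauchy's theorem yields a multiplicative element of order \<open>p\<close> in
      it.\<close>
    ultimately have "p dvd card C" using i by (metis dvd_power dvd_trans neq0_conv)
    then obtain w where w: "w \<in> C" "w \<noteq> \<one>\<^bsub>multiplicative_group B\<^esub>" "w [^]\<^bsub>multiplicative_group B\<^esub> p = \<one>\<^bsub>multiplicative_group B\<^esub>"
      using M.exists_prime_order_element[OF finite_AM(2) CM p] by blast
    have wB: "w \<in> carrier B" using w CB by blast
    have wV: "w \<in> V"
    proof -
      have "p dvd p ^ p" using p_gt_1 by (intro dvd_power) simp
      then have "w [^]\<^bsub>multiplicative_group B\<^esub> (p ^ p) = \<one>\<^bsub>multiplicative_group B\<^esub>"
        using w(3) M.pow_eq_id[of w] wB dvd_trans by auto
      then show ?thesis using torV wB by simp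
    qed
    obtain x where x: "x \<in> Q" "x \<noteq> \<one>\<^bsub>multiplicative_group B\<^esub>"
      using M.exists_prime_order_element[OF finite_AM(2) QM q] Q(2) by auto
    have xB: "x \<in> carrier B" using x QB by blast
    have xq: "x [^]\<^bsub>multiplicative_group B\<^esub> q = \<one>\<^bsub>multiplicative_group B\<^esub>"
      using M.subgroup_pow_card[OF QM x(1)] Q(2) by simp
    have xV: "x \<notin> V"
    proof
      assume "x \<in> V"
      then have "x [^]\<^bsub>multiplicative_group B\<^esub> (p ^ p) = \<one>\<^bsub>multiplicative_group B\<^esub>" using torV by blast
      then show False using M.coprime_torsion[of x "p ^ p" q] xq xB x(2) coprime_pp_q by simp
    qed
    have "C \<inter> V = V"
    proof (rule frobenius_irreducible[OF M.group_axioms finite_AM(2) VM 2(2)])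
      show "x \<in> carrier (multiplicative_group B)" using xB by simp
      show "x [^]\<^bsub>multiplicative_group B\<^esub> q \<bullet> v = v \<bullet> x [^]\<^bsub>multiplicative_group B\<^esub> q" if "v \<in> V" for v
        using xq that VB by auto
      show "v = \<one>\<^bsub>multiplicative_group B\<^esub>" if "v \<in> V" "x \<bullet> v = v \<bullet> x" for v
        using 2(4)[of x v] that xB xV by blast
      show "subgroup (C \<inter> V) (multiplicative_group B)" by (rule subgroup_Int[OF CM VM])
      show "x \<bullet> v \<bullet> bar x \<in> C \<inter> V" if "v \<in> C \<inter> V" for v
        using that 2(1) xB QC x(1) subgroup.m_closed[OF CM] subgroup.m_inv_closed[OF CM]
        unfolding M.normal_inv_iff by auto
      show "w \<in> C \<inter> V" "w \<noteq> \<one>\<^bsub>multiplicative_group B\<^esub>" using w wV by auto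
    qed auto
    then have "V \<subseteq> C" by blast
    then have "p ^ p dvd card C" using M.subgroup_card_dvd[OF finite_AM(2) VM CM] 2(2) by simp
    moreover have "q dvd card C" using A.subgroup_card_dvd[OF finite_AM(1) QA CA QC] Q(2) by simp
    ultimately have "p ^ p * q dvd card C" using coprime_pp_q by (intro divides_mult)
    moreover have "card C > 0" using finC subgroup.one_closed[OF CA] card_gt_0_iff by blast
    ultimately have "card C \<ge> card (carrier B)" using card_B dvd_imp_le by simp
    then have CB: "C = carrier B" using CB finite_B by (intro card_seteq) auto
    have PQ: "a = e" if "a \<in> P" "a \<in> Q" for a
    proof (rule A.coprime_torsion[of a "p ^ p" q])
      show "a [^]\<^bsub>additive_group B\<^esub> (p ^ p) = e" using A.subgroup_pow_card[OF P(1) that(1)] P(2) by simp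
      show "a [^]\<^bsub>additive_group B\<^esub> q = e" using that(2) tor by blast
    qed (use that PB coprime_pp_q in auto)
    \<comment> \<open>Now \<open>Q\<close> is central in the additive group, and a count writes
      every element as a product from \<open>P\<close> and \<open>Q\<close>; hence \<open>P\<close>
      is normal.\<close>
    have "inj_on (\<lambda>(a, z). a \<cdot> z) (P \<times> Q)"
    proof (rule inj_onI, clarify)
      fix a z b w assume as: "a \<in> P" "z \<in> Q" "b \<in> P" "w \<in> Q" "a \<cdot> z = b \<cdot> w"
      then have B: "a \<in> carrier B" "z \<in> carrier B" "b \<in> carrier B" "w \<in> carrier B" using PB QB by auto
      have "neg b \<cdot> a = neg b \<cdot> (a \<cdot> z) \<cdot> neg z" using B by (simp add: A.m_assoc)
      also have "\<dots> = w \<cdot> neg z" using B as(5) by (simp add: A.m_assoc[symmetric])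
      finally have ba: "neg b \<cdot> a = w \<cdot> neg z" .
      moreover have "neg b \<cdot> a \<in> P" using as subgroup.m_closed[OF P(1)] subgroup.m_inv_closed[OF P(1)] by blast
      moreover have "w \<cdot> neg z \<in> Q" using as subgroup.m_closed[OF QA] subgroup.m_inv_closed[OF QA] by blast
      ultimately have "neg b \<cdot> a = e" using PQ by simp
      then have "neg (neg b) = a" using B by (intro A.inv_equality) (simp_all add: A.inv_comm)
      then have ab: "a = b" using B by simp
      then show "a = b \<and> z = w" using as(5) B by simp
    qed
    then have "card ((\<lambda>(a, z). a \<cdot> z) ` (P \<times> Q)) = card (carrier B)"
      using P(2) Q(2) card_B by (simp add: card_image card_cartesian_product)
    moreover have "(\<lambda>(a, z). a \<cdot> z) ` (P \<times> Q) \<subseteq> carrier B" using PB QB by (auto intro!: closed(1))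
    ultimately have img: "(\<lambda>(a, z). a \<cdot> z) ` (P \<times> Q) = carrier B" using finite_B by (intro card_subset_eq)
    have "g \<cdot> b \<cdot> neg g \<in> P" if g: "g \<in> carrier B" and b: "b \<in> P" for g b
    proof -
      have "g \<in> (\<lambda>(a, z). a \<cdot> z) ` (P \<times> Q)" using g img by simp
      then obtain a z where az: "a \<in> P" "z \<in> Q" "g = a \<cdot> z" by auto
      have B: "a \<in> carrier B" "b \<in> carrier B" "z \<in> carrier B" using az b PB QB by auto
      have "b \<in> C" using B CB by simp
      then have "z \<cdot> b = b \<cdot> z" using az(2) by (simp add: C_def)
      then have "z \<cdot> b \<cdot> neg z = b" using A.conj_eq_iff[of z b b] B by simp
      then have "g \<cdot> b \<cdot> neg g = a \<cdot> b \<cdot> neg a" using A.conj_conj[of a z b] B az(3) by simp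
      then show ?thesis using az b subgroup.m_closed[OF P(1)] subgroup.m_inv_closed[OF P(1)] by simp
    qed
    then have PN: "P \<lhd> additive_group B" unfolding A.normal_inv_iff using P(1) by simp
    have torP: "P = {a \<in> carrier (additive_group B). a [^]\<^bsub>additive_group B\<^esub> (p ^ p) = e}"
      by (intro normal_pp_torsion PN P(2) order_AM finite_AM A.group_axioms)
    have lamP: "lam a b \<in> P" if "a \<in> carrier B" "b \<in> P" for a b
      using torsion_lam_closed[of a b "p ^ p"] that torP by blast
    have PM: "subgroup P (multiplicative_group B)" by (rule left_ideal_subgroup[OF P(1) lamP])
    have "P \<subseteq> V" unfolding torV using M.subgroup_pow_card[OF PM] P(2) PB by auto
    then have "P = V" using P(2) 2(2) finV by (intro card_subset_eq) auto
    with 2(1) have "P \<lhd> multiplicative_group B" by simp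
    then have "card P = 1 \<or> card P = p ^ p * q" by (rule ideal_trivial[OF PN _ lamP])
    then show False unfolding P(2) using card_q_not_trivial(3,4) by blast
  qed
qed

end

text \<open>The shape of a brace isomorphic to the model: \<open>V\<close> becomes the additive group of the field and
  conjugation by \<open>t\<close> the multiplication by a primitive \<open>q\<close>-th root of unity.\<close>
definition (in prime_pair) normal_form :: "'a sbrace \<Rightarrow> 'a set \<Rightarrow> 'a \<Rightarrow> bool" where
  "normal_form B V t \<longleftrightarrow> skew_brace B \<and> card (carrier B) = p ^ p * q \<and>
    V \<lhd> additive_group B \<and> card V = p ^ p \<and>
    (\<forall>u\<in>V. \<forall>v\<in>V. sadd B u v = sadd B v u) \<and>
    (\<forall>v\<in>V. v [^]\<^bsub>additive_group B\<^esub> p = sone B) \<and>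
    t \<in> carrier B \<and> t \<notin> V \<and> (\<forall>v\<in>V. sadd B t v = sadd B v t \<longrightarrow> v = sone B) \<and>
    subgroup V (multiplicative_group B) \<and>
    (\<forall>v\<in>V. scirc B t v = sadd B v t) \<and> scirc B t t = sadd B t t \<and>
    (\<forall>u\<in>V. \<exists>m::nat. scirc B u t = sadd B u (t [^]\<^bsub>additive_group B\<^esub> m)) \<and>
    (\<exists>u\<in>V. scirc B u t \<noteq> scirc B t u)"

text \<open>What simplicity supplies: in the application \<open>t\<close> generates the normal Sylow
  \<open>q\<close>-subgroup of the multiplicative group, which \<open>t_normal\<close> records
  through exponents prime to \<open>q\<close>, and \<open>t_noncentral\<close> reflects that
  \<open>V\<close> is not multiplicatively normal.\<close>

locale split_brace = prime_pair + skew_brace_structure +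
  fixes V :: "'a set" and t :: 'a
  assumes card_B: "card (carrier B) = p ^ p * q"
    and V_normal: "V \<lhd> additive_group B" and card_V: "card V = p ^ p"
    and V_comm: "\<And>u v. u \<in> V \<Longrightarrow> v \<in> V \<Longrightarrow> u \<cdot> v = v \<cdot> u"
    and V_exp: "\<And>v. v \<in> V \<Longrightarrow> v [^]\<^bsub>additive_group B\<^esub> p = e"
    and V_fpf: "\<And>x v. x \<in> carrier B - V \<Longrightarrow> v \<in> V \<Longrightarrow> x \<cdot> v = v \<cdot> x \<Longrightarrow> v = e"
    and V_lam: "\<And>a v. a \<in> carrier B \<Longrightarrow> v \<in> V \<Longrightarrow> lam a v \<in> V"
    and t: "t \<in> carrier B" "t \<notin> V" "t [^]\<^bsub>multiplicative_group B\<^esub> q = e"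
    and t_normal: "\<And>u. u \<in> V \<Longrightarrow> \<exists>m::nat. u \<bullet> t = (t [^]\<^bsub>multiplicative_group B\<^esub> m) \<bullet> u \<and> \<not> q dvd m"
    and t_noncentral: "\<exists>u\<in>V. u \<bullet> t \<noteq> t \<bullet> u"
begin

lemma finite_B: "finite (carrier B)"
  using card_B p_gt_1 q_gt_1 by (intro card_ge_0_finite) simp

lemma V_subgroup: "subgroup V (additive_group B)"
  using V_normal by (rule normal_imp_subgroup)

lemma V_subset: "V \<subseteq> carrier B"
  using subgroup.subset[OF V_subgroup] by simp

lemma V_B [simp]: "v \<in> V \<Longrightarrow> v \<in> carrier B"
  using V_subset by blast

lemma V_closed [simp]: "e \<in> V" "u \<in> V \<Longrightarrow> v \<in> V \<Longrightarrow> u \<cdot> v \<in> V" "u \<in> V \<Longrightarrow> neg u \<in> V"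
  using subgroup.one_closed[OF V_subgroup] subgroup.m_closed[OF V_subgroup] subgroup.m_inv_closed[OF V_subgroup]
  by auto

lemma V_conj: "x \<in> carrier B \<Longrightarrow> v \<in> V \<Longrightarrow> x \<cdot> v \<cdot> neg x \<in> V"
  using V_normal unfolding A.normal_inv_iff by simp

lemma finite_V: "finite V"
  using V_subset finite_B by (rule finite_subset)

lemma V_nontrivial: "\<exists>v\<in>V. v \<noteq> e"
proof (rule ccontr)
  assume "\<not> ?thesis"
  then have "V = {e}" using V_closed(1) by blast
  then have "card V = 1" by simp
  then show False using card_V p_gt_1 by simp
qed

lemma V_mult_subgroup: "subgroup V (multiplicative_group B)"
  using V_subgroup V_lam by (rule left_ideal_subgroup)

lemma coordinate_exists:
  "\<exists>ix. (\<forall>a\<in>carrier B. ix a < q \<and> (\<exists>v\<in>V. a = v \<cdot> t [^]\<^bsub>additive_group B\<^esub> ix a)) \<and>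
    (\<forall>a\<in>carrier B. \<forall>b\<in>carrier B. [ix (a \<cdot> b) = ix a + ix b] (mod q)) \<and>
    (\<forall>a\<in>carrier B. ix a = (0::nat) \<longleftrightarrow> a \<in> V) \<and> ix t = 1"
  using A.prime_index_coordinate[OF _ V_normal _ q, of t] finite_B card_B card_V t by (simp add: Coset.order_def)

definition ix :: "'a \<Rightarrow> nat" where
  "ix = (SOME ix. (\<forall>a\<in>carrier B. ix a < q \<and> (\<exists>v\<in>V. a = v \<cdot> t [^]\<^bsub>additive_group B\<^esub> ix a)) \<and>
    (\<forall>a\<in>carrier B. \<forall>b\<in>carrier B. [ix (a \<cdot> b) = ix a + ix b] (mod q)) \<and>
    (\<forall>a\<in>carrier B. ix a = (0::nat) \<longleftrightarrow> a \<in> V) \<and> ix t = 1)"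

lemma ix_less: "a \<in> carrier B \<Longrightarrow> ix a < q"
  and ix_decomp: "a \<in> carrier B \<Longrightarrow> \<exists>v\<in>V. a = v \<cdot> t [^]\<^bsub>additive_group B\<^esub> ix a"
  and ix_add: "a \<in> carrier B \<Longrightarrow> b \<in> carrier B \<Longrightarrow> [ix (a \<cdot> b) = ix a + ix b] (mod q)"
  and ix_0_iff: "a \<in> carrier B \<Longrightarrow> ix a = 0 \<longleftrightarrow> a \<in> V"
  and ix_t: "ix t = 1"
  using someI_ex[OF coordinate_exists] unfolding ix_def by blast+

lemma ix_pow: "a \<in> carrier B \<Longrightarrow> [ix (a [^]\<^bsub>additive_group B\<^esub> (n::nat)) = n * ix a] (mod q)"
proof (induction n)
  case 0
  then show ?case using ix_0_iff[of e] by simp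
next
  case (Suc n)
  have "[ix (a [^]\<^bsub>additive_group B\<^esub> n \<cdot> a) = ix (a [^]\<^bsub>additive_group B\<^esub> n) + ix a] (mod q)"
    using Suc.prems by (intro ix_add) simp_all
  also have "[ix (a [^]\<^bsub>additive_group B\<^esub> n) + ix a = n * ix a + ix a] (mod q)"
    using Suc by (intro cong_add cong_refl)
  finally show ?case by (simp add: add.commute)
qed

lemma ix_V_mult: "v \<in> V \<Longrightarrow> a \<in> carrier B \<Longrightarrow> ix (v \<cdot> a) = ix a"
  using ix_add[of v a] ix_0_iff[of v] ix_less[of a] ix_less[of "v \<cdot> a"] by (simp add: cong_less_modulus_unique_nat)

lemma ix_mult_V: "v \<in> V \<Longrightarrow> a \<in> carrier B \<Longrightarrow> ix (a \<cdot> v) = ix a"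
  using ix_add[of a v] ix_0_iff[of v] ix_less[of a] ix_less[of "a \<cdot> v"] by (simp add: cong_less_modulus_unique_nat)

text \<open>\<open>lam g\<close> preserves \<open>V\<close>, so it acts on the additive quotient of
  order \<open>q\<close> by a scalar, which is read off at \<open>t\<close>.\<close>

lemma ix_lam: "g \<in> carrier B \<Longrightarrow> a \<in> carrier B \<Longrightarrow> [ix (lam g a) = ix a * ix (lam g t)] (mod q)"
proof -
  assume g: "g \<in> carrier B" and a: "a \<in> carrier B"
  obtain v where v: "v \<in> V" "a = v \<cdot> t [^]\<^bsub>additive_group B\<^esub> ix a" using ix_decomp[OF a] by blast
  have "lam g a = lam g v \<cdot> (lam g t) [^]\<^bsub>additive_group B\<^esub> ix a"
    using g t(1) v(1) by (subst v(2)) (simp add: lam_add lam_pow)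
  then have "ix (lam g a) = ix ((lam g t) [^]\<^bsub>additive_group B\<^esub> ix a)"
    using g t(1) v(1) V_lam by (simp add: ix_V_mult)
  then show ?thesis using ix_pow[of "lam g t" "ix a"] g t(1) by simp
qed

text \<open>The scalar by which \<open>lam t\<close> acts on the quotient has trivial
  \<open>q\<close>-th power because \<open>t\<close> has multiplicative order dividing
  \<open>q\<close>; by Fermat its \<open>(q - 1)\<close>-th power is trivial as well.\<close>

lemma ix_lam_t_t: "ix (lam t t) = 1"
proof -
  let ?m = "ix (lam t t)"
  have step: "[ix ((lam t ^^ n) t) = ?m ^ n] (mod q)" for n
  proof (induction n)
    case 0
    then show ?case using ix_t by simp
  next
    case (Suc n)
    have c: "(lam t ^^ n) t \<in> carrier B" using t(1) by (induction n) simp_all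
    have "[ix (lam t ((lam t ^^ n) t)) = ix ((lam t ^^ n) t) * ?m] (mod q)" by (rule ix_lam[OF t(1) c])
    also have "[ix ((lam t ^^ n) t) * ?m = ?m ^ n * ?m] (mod q)" by (intro cong_mult Suc cong_refl)
    finally show ?case by (simp add: mult.commute)
  qed
  have "(lam t ^^ q) t = t" using lam_funpow[OF t(1) t(1)] t lam_by_e by simp
  then have mq: "[?m ^ q = 1] (mod q)" using step[of q] ix_t cong_sym by simp
  have "\<not> q dvd ?m"
  proof
    assume "q dvd ?m"
    then have "q dvd ?m ^ q" using q_gt_1 by (metis dvd_power dvd_trans gr0I not_one_less_zero)
    then have "[?m ^ q = 0] (mod q)" by (simp add: cong_0_iff)
    then have "[1 = 0] (mod q)" using mq cong_sym cong_trans by blast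
    then show False using q_gt_1 by (simp add: cong_def)
  qed
  then have "[?m ^ (q - 1) = 1] (mod q)" using fermat_theorem[OF q] by blast
  then have "[?m ^ (q - 1) * ?m = 1 * ?m] (mod q)" by (intro cong_mult cong_refl)
  moreover have "?m ^ (q - 1) * ?m = ?m ^ q" using q_gt_1 by (simp flip: power_Suc2)
  ultimately have "[?m = 1] (mod q)" using mq cong_sym cong_trans by (metis mult_1)
  then show ?thesis using ix_less[of "lam t t"] t(1) q_gt_1 by (simp add: cong_less_modulus_unique_nat)
qed

text \<open>\<open>lam t\<close> permutes, with period \<open>q\<close>, the \<open>p ^ p\<close>
  elements of the additive coset of \<open>V\<close> containing \<open>t\<close>. Since
  \<open>q\<close> does not divide \<open>p ^ p\<close>, some element is fixed.\<close>

lemma exists_fixed_complement: "\<exists>x\<in>carrier B. ix x = 1 \<and> lam t x = x"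
proof -
  let ?S = "{a \<in> carrier B. ix a = 1}"
  have finS: "finite ?S" using finite_B by simp
  have "?S = (\<lambda>v. v \<cdot> t) ` V"
  proof
    show "(\<lambda>v. v \<cdot> t) ` V \<subseteq> ?S" using t(1) ix_V_mult ix_t by auto
    show "?S \<subseteq> (\<lambda>v. v \<cdot> t) ` V"
    proof
      fix a assume a: "a \<in> ?S"
      then obtain v where "v \<in> V" "a = v \<cdot> t [^]\<^bsub>additive_group B\<^esub> ix a" using ix_decomp by blast
      then show "a \<in> (\<lambda>v. v \<cdot> t) ` V" using a t(1) by simp
    qed
  qed
  moreover have "inj_on (\<lambda>v. v \<cdot> t) V" by (rule inj_onI) (use t(1) in simp)
  ultimately have cardS: "card ?S = p ^ p" using card_V by (simp add: card_image)
  have "q dvd card {a \<in> ?S. lam t a \<noteq> a}"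
  proof (rule prime_period_card[OF finS _ q])
    show "lam t ` ?S \<subseteq> ?S"
    proof (rule image_subsetI)
      fix a assume a: "a \<in> ?S"
      then have "[ix (lam t a) = 1] (mod q)" using ix_lam[OF t(1), of a] ix_lam_t_t by simp
      then have "ix (lam t a) = 1" using a ix_less[of "lam t a"] t(1) q_gt_1
        by (simp add: cong_less_modulus_unique_nat)
      then show "lam t a \<in> ?S" using a t(1) by simp
    qed
    show "(lam t ^^ q) a = a" if "a \<in> ?S" for a
      using that lam_funpow[OF t(1), of a q] t lam_by_e by simp
  qed
  moreover have "\<not> q dvd p ^ p"
  proof
    assume "q dvd p ^ p"
    then have "q dvd p" using q prime_dvd_power by blast
    then show False using q p q_neq_p primes_dvd_imp_eq by blast
  qed
  ultimately have "{a \<in> ?S. lam t a \<noteq> a} \<noteq> ?S" using cardS by metis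
  then show ?thesis by blast
qed

end

lemma (in group) prime_order_powers:
  assumes "finite (carrier G)" "subgroup Q G" "card Q = q" "prime q" "t \<in> Q" "t \<noteq> \<one>" "z \<in> Q"
  shows "\<exists>m::nat. z = t [^] m"
proof -
  have QG: "Q \<subseteq> carrier G" using subgroup.subset[OF assms(2)] .
  have tG: "t \<in> carrier G" using assms(5) QG by blast
  let ?T = "generate G {t}"
  have sub: "subgroup ?T G" using tG by (intro generate_is_subgroup) simp
  have TQ: "?T \<subseteq> Q" using assms(2,5) by (intro generate_subgroup_incl) simp_all
  have "card ?T dvd q" using subgroup_card_dvd[OF assms(1) sub assms(2) TQ] assms(3) by simp
  moreover have "card ?T \<noteq> 1"
  proof
    assume "card ?T = 1"
    then obtain c where "?T = {c}" by (rule card_1_singletonE)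
    moreover have "t \<in> ?T" by (rule generate.incl) simp
    ultimately show False using subgroup.one_closed[OF sub] assms(6) by auto
  qed
  ultimately have "card ?T = q" using assms(4) by (auto simp: prime_nat_iff)
  moreover have "finite Q" using QG assms(1) by (rule finite_subset)
  ultimately have "?T = Q" using TQ assms(3) by (intro card_subset_eq) auto
  then have "z \<in> {t [^] k | k. k \<in> (UNIV :: nat set)}"
    using assms(7) generate_pow_on_finite_carrier[OF assms(1) tG] by simp
  then show ?thesis by blast
qed

lemma (in group) pow_mod:
  assumes "a \<in> carrier G" "a [^] (q::nat) = \<one>" "[i = j] (mod q)"
  shows "a [^] i = a [^] (j::nat)"
proof -
  have *: "a [^] n = a [^] (n mod q)" for n
  proof -
    have "a [^] n = a [^] (q * (n div q) + n mod q)" by simp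
    also have "\<dots> = (a [^] q) [^] (n div q) \<otimes> a [^] (n mod q)"
      using assms(1) by (simp only: nat_pow_mult nat_pow_pow)
    finally show ?thesis using assms(1,2) by simp
  qed
  show ?thesis using *[of i] *[of j] assms(3) by (simp add: cong_def)
qed

context skew_brace_structure
begin

lemma cancel [simp]:
  "a \<in> carrier B \<Longrightarrow> b \<in> carrier B \<Longrightarrow> neg a \<cdot> (a \<cdot> b) = b"
  "a \<in> carrier B \<Longrightarrow> b \<in> carrier B \<Longrightarrow> a \<cdot> (neg a \<cdot> b) = b"
  by (simp_all add: A.m_assoc[symmetric])

lemma one_M_closed [simp]: "\<one>\<^bsub>multiplicative_group B\<^esub> \<in> carrier B"
  using M.one_closed by simp

lemma add_neg_eq_e: "a \<in> carrier B \<Longrightarrow> b \<in> carrier B \<Longrightarrow> a \<cdot> neg b = e \<Longrightarrow> a = b"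
proof -
  assume ab: "a \<in> carrier B" "b \<in> carrier B" and "a \<cdot> neg b = e"
  then have "a \<cdot> neg b \<cdot> b = b" by simp
  then show "a = b" using ab by (simp add: A.m_assoc)
qed

end

lemma skew_brace_opposite:
  assumes "skew_brace B"
  shows "skew_brace (opposite B)" "x \<in> carrier B \<Longrightarrow> inv\<^bsub>additive_group (opposite B)\<^esub> x = inv\<^bsub>additive_group B\<^esub> x"
    "x \<in> carrier B \<Longrightarrow> x [^]\<^bsub>additive_group (opposite B)\<^esub> (n::nat) = x [^]\<^bsub>additive_group B\<^esub> n"
proof -
  interpret skew_brace_structure B by unfold_locales fact
  let ?A = "additive_group (opposite B)"
  have mult: "x \<otimes>\<^bsub>?A\<^esub> y = y \<cdot> x" for x y by (simp add: additive_group_simps)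
  have one: "\<one>\<^bsub>?A\<^esub> = e" by (simp add: additive_group_simps)
  have grp: "group ?A"
  proof (rule groupI)
    fix x assume "x \<in> carrier ?A"
    then show "\<exists>y\<in>carrier ?A. y \<otimes>\<^bsub>?A\<^esub> x = \<one>\<^bsub>?A\<^esub>"
      by (intro bexI[of _ "neg x"]) (simp_all add: mult one)
  qed (simp_all add: mult one A.m_assoc)
  interpret O: group ?A by (rule grp)
  have inv: "inv\<^bsub>?A\<^esub> x = neg x" if "x \<in> carrier B" for x
    using that by (intro O.inv_equality) (simp_all add: mult one)
  then show "x \<in> carrier B \<Longrightarrow> inv\<^bsub>?A\<^esub> x = inv\<^bsub>additive_group B\<^esub> x" .
  show "x \<in> carrier B \<Longrightarrow> x [^]\<^bsub>?A\<^esub> n = x [^]\<^bsub>additive_group B\<^esub> n"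
  proof (induction n)
    case 0
    then show ?case by (simp add: one)
  next
    case (Suc n)
    then show ?case using A.nat_pow_Suc2[of x n] by (simp add: mult)
  qed
  show "skew_brace (opposite B)"
    unfolding skew_brace_def
  proof (intro conjI ballI grp)
    show "group (multiplicative_group (opposite B))" using M.group_axioms by simp
    fix a b c assume "a \<in> carrier (opposite B)" "b \<in> carrier (opposite B)" "c \<in> carrier (opposite B)"
    then have abc: "a \<in> carrier B" "b \<in> carrier B" "c \<in> carrier B" by simp_all
    have "a \<bullet> (c \<cdot> b) = (a \<bullet> c) \<cdot> (neg a \<cdot> (a \<bullet> b))" using distrib[of a c b] abc by (simp add: A.m_assoc)
    then show "scirc (opposite B) a (sadd (opposite B) b c) =
        sadd (opposite B) (sadd (opposite B) (scirc (opposite B) a b) (inv\<^bsub>?A\<^esub> a)) (scirc (opposite B) a c)"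
      using inv[OF abc(1)] by (simp add: additive_group_simps multiplicative_group_simps)
  qed
qed

section \<open>Comparison of lambda of t with conjugation by a fixed complement\<close>

locale split_brace_base = split_brace +
  fixes x
  assumes x: "x \<in> carrier B" "ix x = 1" "lam t x = x"
begin

abbreviation apow (infixr "\<up>" 80) where "a \<up> n \<equiv> a [^]\<^bsub>additive_group B\<^esub> (n::nat)"
abbreviation mpow (infixr "\<Up>" 80) where "a \<Up> n \<equiv> a [^]\<^bsub>multiplicative_group B\<^esub> (n::nat)"

lemma x_notin_V: "x \<notin> V"
  using ix_0_iff[OF x(1)] x(2) by simp

lemma x_fpf: "v \<in> V \<Longrightarrow> x \<cdot> v = v \<cdot> x \<Longrightarrow> v = e"
  using V_fpf x x_notin_V by blast

lemma ix_x_pow: "[ix (x \<up> n) = n] (mod q)"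
  using ix_pow[OF x(1), of n] x(2) by simp

text \<open>This power lies in \<open>V\<close> and commutes with \<open>x\<close>, which
  centralizes only the identity of \<open>V\<close>.\<close>

lemma x_pow_q: "x \<up> q = e"
proof (rule x_fpf)
  have "ix (x \<up> q) = 0" using ix_x_pow[of q] ix_less[of "x \<up> q"] x(1) by (simp add: cong_def)
  then show "x \<up> q \<in> V" using ix_0_iff x(1) by simp
  show "x \<cdot> x \<up> q = x \<up> q \<cdot> x" using x(1) A.nat_pow_Suc2[of x q] by simp
qed

lemma x_pow_cong: "[i = j] (mod q) \<Longrightarrow> x \<up> i = x \<up> j"
  using A.pow_mod[of x q i j] x(1) x_pow_q by simp

lemma t_pow_cong: "[i = j] (mod q) \<Longrightarrow> t \<Up> i = t \<Up> j"
  using M.pow_mod[of t q i j] t one_eq by simp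

lemma x_decomp: "a \<in> carrier B \<Longrightarrow> \<exists>c\<in>V. a = c \<cdot> x \<up> ix a"
proof -
  assume a: "a \<in> carrier B"
  let ?c = "a \<cdot> neg (x \<up> ix a)"
  have c: "?c \<in> carrier B" "a = ?c \<cdot> x \<up> ix a" using a x(1) by (simp_all add: A.m_assoc)
  have "[ix (?c \<cdot> x \<up> ix a) = ix ?c + ix (x \<up> ix a)] (mod q)" using c x(1) by (intro ix_add) simp_all
  moreover have "[ix ?c + ix (x \<up> ix a) = ix ?c + ix a] (mod q)" by (intro cong_add ix_x_pow cong_refl)
  ultimately have "[0 + ix a = ix ?c + ix a] (mod q)" using c(2) cong_trans by simp
  then have "[0 = ix ?c] (mod q)" by (simp only: cong_add_rcancel_nat)
  then have "ix ?c = 0" using ix_less[OF c(1)] by (simp add: cong_def)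
  then show ?thesis using c ix_0_iff by blast
qed

text \<open>A form of Schur's lemma: the fixed points of an endomorphism of \<open>V\<close> that
  commutes with conjugation by \<open>x\<close> are stable under \<open>x\<close>, hence trivial or
  everything.\<close>

lemma fixed_points_trivial:
  assumes cl: "\<And>u. u \<in> V \<Longrightarrow> \<gamma> u \<in> V" and hom: "\<And>u v. u \<in> V \<Longrightarrow> v \<in> V \<Longrightarrow> \<gamma> (u \<cdot> v) = \<gamma> u \<cdot> \<gamma> v"
    and conj: "\<And>u. u \<in> V \<Longrightarrow> \<gamma> (x \<cdot> u \<cdot> neg x) = x \<cdot> \<gamma> u \<cdot> neg x"
    and ne: "u\<^sub>0 \<in> V" "\<gamma> u\<^sub>0 \<noteq> u\<^sub>0" and u: "u \<in> V" "\<gamma> u = u"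
  shows "u = e"
proof (rule ccontr)
  assume "u \<noteq> e"
  let ?W = "{u \<in> V. \<gamma> u = u}"
  have "?W = V"
  proof (rule frobenius_irreducible[OF A.group_axioms _ V_subgroup card_V, of x])
    show "finite (carrier (additive_group B))" using finite_B by simp
    show "x \<up> q \<cdot> v = v \<cdot> x \<up> q" if "v \<in> V" for v using that x_pow_q by simp
    show "subgroup ?W (additive_group B)"
    proof (rule A.subgroup_if_finite_closed)
      have "\<gamma> e \<cdot> \<gamma> e = \<gamma> e" using hom[of e e] by simp
      then have "\<gamma> e = e" using cl[of e] by simp
      then show "e \<in> ?W" by simp
    qed (use finite_B hom in auto)
    show "x \<cdot> w \<cdot> neg x \<in> ?W" if "w \<in> ?W" for w using that conj V_conj x(1) by simp
    show "u \<in> ?W" using u by simp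
  qed (use x x_fpf \<open>u \<noteq> e\<close> in auto)
  then show False using ne by blast
qed

lemma lam_t_pow_x: "lam (t \<Up> n) x = x"
proof -
  have "(lam t ^^ n) x = x" by (induction n) (simp_all add: x)
  then show ?thesis using lam_funpow[OF t(1) x(1)] by simp
qed

lemma lam_t_pow_x_pow: "lam (t \<Up> n) (x \<up> k) = x \<up> k"
  using lam_pow[of "t \<Up> n" x k] t(1) x(1) lam_t_pow_x by simp

text \<open>The \<open>n\<close>-th power of \<open>b 1\<close>, which is \<open>lam t\<close>
  followed by conjugation by \<open>x\<close>: the two maps commute because
  \<open>lam t x = x\<close>.\<close>

definition b :: "nat \<Rightarrow> 'a \<Rightarrow> 'a" where
  "b n u = x \<up> n \<cdot> lam (t \<Up> n) u \<cdot> neg (x \<up> n)"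

lemma b_V: "u \<in> V \<Longrightarrow> b n u \<in> V"
  unfolding b_def using x(1) t(1) by (intro V_conj V_lam) simp_all

lemma b_mult: "u \<in> V \<Longrightarrow> v \<in> V \<Longrightarrow> b n (u \<cdot> v) = b n u \<cdot> b n v"
  unfolding b_def using x(1) t(1) A.conj_mult[of "x \<up> n"] by (simp add: lam_add)

lemma b_neg: "u \<in> V \<Longrightarrow> b n (neg u) = neg (b n u)"
proof -
  assume u: "u \<in> V"
  have "b n (neg u) \<cdot> b n u = b n (neg u \<cdot> u)" by (rule b_mult[symmetric]) (use u in simp_all)
  also have "\<dots> = e" using u x(1) t(1) by (simp add: b_def)
  finally show ?thesis using u b_V[OF u, of n] b_V[of "neg u" n] A.inv_equality[of "b n (neg u)" "b n u"] by simp
qed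

lemma b_add: "u \<in> V \<Longrightarrow> b (n + m) u = b n (b m u)"
proof -
  assume u: "u \<in> V"
  have "b n (b m u) = x \<up> n \<cdot> (x \<up> m \<cdot> lam (t \<Up> n) (lam (t \<Up> m) u) \<cdot> neg (x \<up> m)) \<cdot> neg (x \<up> n)"
    using u x(1) t(1) by (simp add: b_def lam_add lam_neg lam_t_pow_x_pow)
  also have "\<dots> = x \<up> (n + m) \<cdot> lam (t \<Up> n) (lam (t \<Up> m) u) \<cdot> neg (x \<up> (n + m))"
    using u x(1) t(1) A.conj_conj[of "x \<up> n" "x \<up> m"] by (simp add: A.nat_pow_mult)
  also have "lam (t \<Up> n) (lam (t \<Up> m) u) = lam (t \<Up> (n + m)) u"
    using u t(1) lam_circ[of "t \<Up> n" "t \<Up> m" u] by (simp add: M.nat_pow_mult)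
  finally show ?thesis by (simp add: b_def)
qed

lemma b_cong: "[n = m] (mod q) \<Longrightarrow> b n u = b m u"
  using x_pow_cong t_pow_cong by (simp add: b_def)

lemma b_conj: "u \<in> V \<Longrightarrow> b n (x \<cdot> u \<cdot> neg x) = x \<cdot> b n u \<cdot> neg x"
proof -
  assume u: "u \<in> V"
  have "b n (x \<cdot> u \<cdot> neg x) = x \<up> n \<cdot> (x \<cdot> lam (t \<Up> n) u \<cdot> neg x) \<cdot> neg (x \<up> n)"
    using u x(1) t(1) by (simp add: b_def lam_add lam_neg lam_t_pow_x)
  also have "\<dots> = x \<up> Suc n \<cdot> lam (t \<Up> n) u \<cdot> neg (x \<up> Suc n)"
    using u x(1) t(1) A.conj_conj[of "x \<up> n" x] by simp
  also have "x \<up> Suc n = x \<cdot> x \<up> n" using x(1) A.nat_pow_Suc2 by simp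
  also have "x \<cdot> x \<up> n \<cdot> lam (t \<Up> n) u \<cdot> neg (x \<cdot> x \<up> n) = x \<cdot> b n u \<cdot> neg x"
    using u x(1) t(1) A.conj_conj[of x "x \<up> n"] by (simp add: b_def)
  finally show ?thesis .
qed

lemma lam_t_conj: "u \<in> V \<Longrightarrow> lam (t \<Up> n) (x \<cdot> u \<cdot> neg x) = x \<cdot> lam (t \<Up> n) u \<cdot> neg x"
  using x(1) t(1) by (simp add: lam_add lam_neg lam_t_pow_x)

text \<open>With \<open>m\<close> invertible modulo \<open>q\<close>, a fixed point of the
  \<open>m\<close>-th power of \<open>lam t\<close> is fixed by \<open>lam t\<close>, which commutes
  with conjugation by \<open>x\<close>.\<close>

lemma lam_t_fixed:
  assumes ne: "u\<^sub>0 \<in> V" "lam t u\<^sub>0 \<noteq> u\<^sub>0" and m: "\<not> q dvd m" and u: "u \<in> V" "lam (t \<Up> m) u = u"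
  shows "u = e"
proof -
  have "coprime m q" using m q prime_imp_coprime_nat coprime_commute by metis
  then obtain k where k: "[m * k = 1] (mod q)" using cong_solve_coprime_nat by auto
  have "lam (t \<Up> (m * i)) u = u" for i
  proof (induction i)
    case (Suc i)
    have "t \<Up> (m * Suc i) = t \<Up> m \<bullet> t \<Up> (m * i)" using t(1) by (simp add: M.nat_pow_mult)
    then show ?case using Suc u t(1) by (simp add: lam_circ)
  qed (use u lam_by_e one_eq in simp)
  then have "lam t u = u" using t_pow_cong[OF k] t(1) by (metis M.nat_pow_eone multiplicative_group_simps(1))
  then show ?thesis
    using fixed_points_trivial[of "lam t" u\<^sub>0 u] ne u V_lam t(1) x lam_t_conj[of _ 1]
    by (simp add: lam_add)
qed

lemma b_fixed:
  assumes ne: "u\<^sub>0 \<in> V" "b 1 u\<^sub>0 \<noteq> u\<^sub>0" and m: "\<not> q dvd m" and u: "u \<in> V" "b m u = u"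
  shows "u = e"
proof -
  have "coprime m q" using m q prime_imp_coprime_nat coprime_commute by metis
  then obtain k where k: "[m * k = 1] (mod q)" using cong_solve_coprime_nat by auto
  have "b (m * i) u = u" for i
  proof (induction i)
    case (Suc i)
    have "b (m * Suc i) u = b m (b (m * i) u)" using u b_add[of u m "m * i"] by simp
    then show ?case using Suc u by simp
  qed (use u lam_by_e one_eq in \<open>simp add: b_def\<close>)
  then have "b 1 u = u" using b_cong[OF k] by metis
  then show ?thesis
    using fixed_points_trivial[of "b 1" u\<^sub>0 u] ne u b_V b_mult b_conj by simp
qed

lemma t_decomp: "\<exists>v\<in>V. t = v \<cdot> x"
  using x_decomp[OF t(1)] ix_t x(1) by simp

lemma lam_normal:
  assumes u: "u \<in> V" and m: "u \<bullet> t = t \<Up> m \<bullet> u" and a: "a \<in> carrier B"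
  shows "lam u (lam t a) = lam (t \<Up> m) (lam u a)"
  using lam_circ[of u t a] lam_circ[of "t \<Up> m" u a] m u a t(1) by simp

lemma ix_lam_u:
  assumes u: "u \<in> V" and m: "u \<bullet> t = t \<Up> m \<bullet> u"
  shows "[ix (lam u x) = ix (t \<Up> m)] (mod q)"
proof -
  have "u \<cdot> lam u t = t \<Up> m \<cdot> lam (t \<Up> m) u" using u m t(1) by (simp add: circ_eq)
  then have "ix (lam u t) = ix (t \<Up> m)" using u t(1) V_lam ix_V_mult ix_mult_V by (metis V_B closed(7) lam_closed)
  then show ?thesis using ix_lam[of u x] u x by simp
qed

text \<open>\<open>lam u x\<close> is fixed by \<open>lam (t \<Up> m)\<close>, because
  \<open>x\<close> is fixed by \<open>lam t\<close>. The powers of \<open>x\<close> are fixed too,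
  so the \<open>V\<close>-part of \<open>lam u x\<close> is fixed and therefore trivial.\<close>

lemma lam_u_x:
  assumes ne: "u\<^sub>0 \<in> V" "lam t u\<^sub>0 \<noteq> u\<^sub>0"
    and u: "u \<in> V" and m: "u \<bullet> t = t \<Up> m \<bullet> u" "\<not> q dvd m"
  shows "lam u x = x \<up> ix (lam u x)"
proof -
  obtain c where c: "c \<in> V" "lam u x = c \<cdot> x \<up> ix (lam u x)" using x_decomp[of "lam u x"] u x(1) by auto
  have "lam u x = lam (t \<Up> m) (lam u x)" using lam_normal[OF u m(1) x(1)] x(3) by simp
  then have "c \<cdot> x \<up> ix (lam u x) = lam (t \<Up> m) c \<cdot> x \<up> ix (lam u x)"
    using c x(1) t(1) by (metis V_B closed(6,7) lam_add lam_t_pow_x_pow)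
  then have "lam (t \<Up> m) c = c" using c(1) x(1) t(1) by simp
  then have "c = e" using lam_t_fixed[OF ne m(2) c(1)] by blast
  then show ?thesis using c x(1) by simp
qed

text \<open>Otherwise \<open>t = w b(w)\<^sup>-\<^sup>1 x\<close> for some \<open>w \<in> V\<close>, where \<open>b\<close> is \<open>\<lambda>\<^sub>t\<close> followed by conjugation by \<open>x\<close>, and
  comparing the \<open>V\<close>-components of \<open>u \<bullet> t = t\<^sup>m \<bullet> u\<close> gives \<open>u \<bullet> w = w\<close> for every \<open>u \<in> V\<close>.\<close>
lemma lam_t_alternative: "(\<forall>u\<in>V. lam t u = u) \<or> (\<forall>u\<in>V. b 1 u = u)"
proof (rule ccontr)
  assume "\<not> ?thesis"
  then obtain u\<^sub>1 u\<^sub>2 where ne: "u\<^sub>1 \<in> V" "lam t u\<^sub>1 \<noteq> u\<^sub>1" "u\<^sub>2 \<in> V" "b 1 u\<^sub>2 \<noteq> u\<^sub>2" by blast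
  have b1: "u = e" if "u \<in> V" "b 1 u = u" for u
    using b_fixed[OF ne(3,4) _ that] q_gt_1 by simp
  have bB: "b n u \<in> carrier B" if "u \<in> V" for n u using b_V[OF that] by simp
  \<comment> \<open>\<open>b 1\<close> has no nontrivial fixed points, so dividing \<open>w\<close>
    by \<open>b 1 w\<close> is an injective map on the finite set \<open>V\<close>, hence onto; the
    \<open>V\<close>-part of \<open>t\<close> is then of this form.\<close>
  have inj: "inj_on (\<lambda>w. w \<cdot> neg (b 1 w)) V"
  proof (rule inj_onI)
    fix w z assume wz: "w \<in> V" "z \<in> V" "w \<cdot> neg (b 1 w) = z \<cdot> neg (b 1 z)"
    have V: "b 1 w \<in> V" "b 1 z \<in> V" "neg z \<cdot> w \<in> V" using wz b_V by simp_all
    have "neg z \<cdot> w = neg z \<cdot> (w \<cdot> neg (b 1 w)) \<cdot> b 1 w" using wz(1,2) bB by (simp add: A.m_assoc)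
    also have "\<dots> = neg (b 1 z) \<cdot> b 1 w" unfolding wz(3) using wz(1,2) bB by (simp add: A.m_assoc)
    also have "\<dots> = b 1 (neg z \<cdot> w)" using wz(1,2) by (simp add: b_mult b_neg)
    finally have "neg z \<cdot> w = e" using b1 V by metis
    then have "z \<cdot> (neg z \<cdot> w) = z" using wz(2) by simp
    then show "w = z" using wz(1,2) by simp
  qed
  have "(\<lambda>w. w \<cdot> neg (b 1 w)) ` V = V"
    using inj b_V by (intro endo_inj_surj[OF finite_V]) auto
  moreover obtain v where v: "v \<in> V" "t = v \<cdot> x" using t_decomp by blast
  ultimately have "v \<in> (\<lambda>w. w \<cdot> neg (b 1 w)) ` V" by blast
  then obtain w where w: "w \<in> V" "v = w \<cdot> neg (b 1 w)" by (rule imageE)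
  \<comment> \<open>With this shape of \<open>t\<close> the \<open>V\<close>-parts of its
    multiplicative powers telescope.\<close>
  have tpow: "t \<Up> k = w \<cdot> neg (b k w) \<cdot> x \<up> k" for k
  proof (induction k)
    case 0
    then show ?case using w lam_by_e one_eq by (simp add: b_def)
  next
    case (Suc k)
    let ?c = "w \<cdot> neg (b k w)"
    have c: "?c \<in> V" using w b_V by simp
    have "t \<Up> Suc k = t \<bullet> t \<Up> k" using t(1) M.nat_pow_Suc2 by simp
    also have "\<dots> = t \<cdot> lam t (?c \<cdot> x \<up> k)" unfolding Suc using c x(1) t(1) by (intro circ_eq) simp_all
    also have "\<dots> = v \<cdot> x \<cdot> (lam t ?c \<cdot> x \<up> k)"
      using v c x t(1) lam_t_pow_x_pow[of 1 k] by (simp add: lam_add)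
    also have "\<dots> = v \<cdot> (x \<cdot> lam t ?c \<cdot> neg x) \<cdot> (x \<cdot> x \<up> k)"
      using v(1) c x t(1) by (simp add: A.m_assoc)
    also have "x \<cdot> lam t ?c \<cdot> neg x = b 1 ?c" using x t(1) by (simp add: b_def)
    also have "b 1 ?c = b 1 w \<cdot> neg (b (Suc k) w)"
      using w b_V b_add[of w 1 k] by (simp add: b_mult b_neg)
    also have "v \<cdot> (b 1 w \<cdot> neg (b (Suc k) w)) = w \<cdot> neg (b (Suc k) w)"
      using w(1) bB unfolding w(2) by (simp add: A.m_assoc)
    also have "x \<cdot> x \<up> k = x \<up> Suc k" using x A.nat_pow_Suc2 by simp
    finally show ?case .
  qed
  obtain u where u: "u \<in> V" "u \<noteq> e" using V_nontrivial by blast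
  obtain m where m: "u \<bullet> t = t \<Up> m \<bullet> u" "\<not> q dvd m" using t_normal[OF u(1)] by blast
  define L where "L = lam u w"
  have L: "L \<in> V" unfolding L_def using V_lam u w by simp
  have "ix (t \<Up> m) = ix (x \<up> m)" unfolding tpow using w b_V x(1) by (intro ix_V_mult) simp_all
  then have "[ix (lam u x) = m] (mod q)" using ix_lam_u[OF u(1) m(1)] ix_x_pow cong_trans by metis
  then have ux: "lam u x = x \<up> m" using lam_u_x[OF ne(1,2) u(1) m] x_pow_cong by metis
  have lw: "lam t w \<in> carrier B" using w t(1) by simp
  have "lam u (b 1 w) = x \<up> m \<cdot> lam u (lam t w) \<cdot> neg (x \<up> m)"
    using u x(1) lw t(1) by (simp add: b_def lam_add lam_neg ux)
  also have "\<dots> = b m L" using lam_normal[OF u(1) m(1), of w] w by (simp add: b_def L_def)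
  finally have "lam u v = L \<cdot> neg (b m L)"
    using w u bB by (simp add: lam_add lam_neg L_def)
  then have lhs: "u \<bullet> t = u \<cdot> (L \<cdot> neg (b m L)) \<cdot> x \<up> m"
  proof -
    have "lam u t = lam u v \<cdot> x \<up> m" by (subst v(2)) (use u(1) v(1) x(1) in \<open>simp add: lam_add ux\<close>)
    then have "u \<bullet> t = u \<cdot> (lam u v \<cdot> x \<up> m)" using u(1) t(1) by (simp add: circ_eq)
    then show ?thesis unfolding \<open>lam u v = L \<cdot> neg (b m L)\<close>
      using u(1) L x(1) bB by (simp add: A.m_assoc)
  qed
  have "t \<Up> m \<bullet> u = w \<cdot> neg (b m w) \<cdot> x \<up> m \<cdot> lam (t \<Up> m) u"
    using t(1) u by (simp add: circ_eq) (simp add: tpow)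
  also have "\<dots> = w \<cdot> neg (b m w) \<cdot> b m u \<cdot> x \<up> m"
    using w u x(1) t(1) bB by (simp add: b_def A.m_assoc)
  finally have "u \<cdot> (L \<cdot> neg (b m L)) \<cdot> x \<up> m = w \<cdot> neg (b m w) \<cdot> b m u \<cdot> x \<up> m" using lhs m(1) by simp
  then have eq: "u \<cdot> (L \<cdot> neg (b m L)) = w \<cdot> neg (b m w) \<cdot> b m u"
    using u L w bB x(1) by simp
  \<comment> \<open>The equation says that \<open>b m\<close> fixes \<open>?y\<close>; as
    \<open>m\<close> is prime to \<open>q\<close>, \<open>?y\<close> is trivial, so
    \<open>u \<bullet> w = w\<close> although \<open>u\<close> is not the identity.\<close>
  let ?y = "u \<cdot> L \<cdot> neg w"
  have "u \<cdot> L = w \<cdot> neg (b m w) \<cdot> b m u \<cdot> b m L"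
    using eq[symmetric] u(1) L bB by (simp add: A.m_assoc)
  also have "\<dots> = b m u \<cdot> b m L \<cdot> neg (b m w) \<cdot> w"
    using w u(1) L b_V V_comm[of "w \<cdot> neg (b m w)" "b m u \<cdot> b m L"] V_comm[of w "neg (b m w)"] by (simp add: A.m_assoc bB)
  also have "b m u \<cdot> b m L \<cdot> neg (b m w) = b m ?y"
    using u(1) L w by (simp add: b_mult b_neg)
  finally have uL: "u \<cdot> L = b m ?y \<cdot> w" .
  have y: "?y \<in> V" using u(1) L w(1) by simp
  have "b m ?y = b m ?y \<cdot> w \<cdot> neg w" using bB[OF y] w(1) by (simp add: A.m_assoc)
  also have "\<dots> = ?y" using uL by simp
  finally have "b m ?y = ?y" .
  then have "?y = e" using b_fixed[OF ne(3,4) m(2) y] by blast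
  moreover have "u \<cdot> L \<in> carrier B" "w \<in> carrier B" using u(1) L w(1) by simp_all
  ultimately have "u \<cdot> L = w" using add_neg_eq_e by blast
  then have "u \<bullet> w = e \<bullet> w" using u(1) w by (simp add: circ_eq[symmetric] L_def e_circ)
  then show False using u w M.right_cancel by simp
qed

text \<open>If \<open>lam t\<close> undoes conjugation by \<open>x\<close> on \<open>V\<close>, then
  \<open>t \<Up> k = v \<up> k \<cdot> x \<up> k\<close> for the \<open>V\<close>-part
  \<open>v\<close> of \<open>t\<close>. Taking \<open>k = q\<close> shows that \<open>v\<close> is
  trivial, its order dividing both \<open>q\<close> and \<open>p\<close>. So \<open>t = x\<close>,
  and \<open>t \<bullet> u = u \<cdot> t\<close> for \<open>u\<close> in \<open>V\<close>.\<close>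

lemma normal_form_if_b_trivial:
  assumes b1: "\<forall>u\<in>V. b 1 u = u"
  shows "normal_form B V t"
proof -
  obtain v where v: "v \<in> V" "t = v \<cdot> x" using t_decomp by blast
  have x_lam: "x \<cdot> lam t u = u \<cdot> x" if "u \<in> V" for u
    using b1 that x(1) t(1) A.conj_eq_iff[of x "lam t u" u] by (simp add: b_def)
  have tpow: "t \<Up> k = v \<up> k \<cdot> x \<up> k" for k
  proof (induction k)
    case 0
    then show ?case using one_eq by simp
  next
    case (Suc k)
    have vk: "v \<up> k \<in> V" by (induction k) (use v in simp_all)
    have "t \<Up> Suc k = t \<bullet> t \<Up> k" using t(1) M.nat_pow_Suc2 by simp
    also have "\<dots> = v \<cdot> x \<cdot> (lam t (v \<up> k) \<cdot> x \<up> k)"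
      using Suc t(1) v vk x lam_t_pow_x_pow[of 1 k] by (simp add: circ_eq lam_add)
    also have "\<dots> = v \<cdot> (x \<cdot> lam t (v \<up> k)) \<cdot> x \<up> k" using v(1) vk x t(1) by (simp add: A.m_assoc)
    also have "\<dots> = v \<cdot> (v \<up> k) \<cdot> (x \<cdot> x \<up> k)" using x_lam[OF vk] v(1) vk x by (simp add: A.m_assoc)
    also have "v \<cdot> v \<up> k = v \<up> Suc k" using v A.nat_pow_Suc2 by simp
    also have "x \<cdot> x \<up> k = x \<up> Suc k" using x A.nat_pow_Suc2 by simp
    finally show ?case .
  qed
  have "v \<up> q = e" using tpow[of q] t(3) x_pow_q v x(1) by simp
  then have "v = e" using A.coprime_torsion[of v q p] v V_exp coprime_q_p by simp
  then have tx: "t = x" using v x by simp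
  have lamtt: "lam t t = t" using x(3) tx by simp
  obtain w where w: "w \<in> V" "w \<noteq> e" using V_nontrivial by blast
  have "lam t w \<noteq> w"
  proof
    assume "lam t w = w"
    then have "x \<cdot> w = w \<cdot> x" using x_lam[OF w(1)] by simp
    then show False using x_fpf w by blast
  qed
  then have lux: "lam u t = t \<up> ix (lam u t)" if "u \<in> V" for u
    using lam_u_x[OF w(1)] t_normal[OF that] that tx by blast
  show ?thesis unfolding normal_form_def
  proof (intro conjI ballI impI)
    show "scirc B t u = sadd B u t" if "u \<in> V" for u
      using that x_lam[OF that] t(1) tx circ_eq[of t u] by (simp add: additive_group_simps multiplicative_group_simps)
    show "scirc B t t = sadd B t t"
      using circ_eq[of t t] t(1) lamtt by (simp add: additive_group_simps multiplicative_group_simps)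
    show "\<exists>m::nat. scirc B u t = sadd B u (t \<up> m)" if "u \<in> V" for u
      using circ_eq[of u t] that t(1) lux[OF that] by (simp add: additive_group_simps multiplicative_group_simps) metis
    show "\<exists>u\<in>V. scirc B u t \<noteq> scirc B t u" using t_noncentral by (simp add: multiplicative_group_simps)
    show "sadd B u v = sadd B v u" if "u \<in> V" "v \<in> V" for u v
      using V_comm[OF that] by (simp add: additive_group_simps)
    show "v \<up> p = sone B" if "v \<in> V" for v using V_exp[OF that] by (simp add: additive_group_simps)
    show "v = sone B" if "v \<in> V" "sadd B t v = sadd B v t" for v
      using V_fpf[of t v] t that by (simp add: additive_group_simps)
  qed (use skew_brace card_B V_normal card_V t V_mult_subgroup in auto)
qed

text \<open>Here \<open>lam t\<close> fixes \<open>V\<close> and \<open>x\<close>, hence everything,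
  so left multiplication by \<open>t\<close> is the same in both groups; with the opposite addition
  this is the relation that the normal form demands.\<close>

lemma normal_form_opposite_if_lam_t_trivial:
  assumes lam1: "\<forall>u\<in>V. lam t u = u"
  shows "normal_form (opposite B) V t"
proof -
  have lamt: "lam t a = a" if a: "a \<in> carrier B" for a
  proof -
    obtain c where c: "c \<in> V" "a = c \<cdot> x \<up> ix a" using x_decomp[OF a] by blast
    have "lam t (c \<cdot> x \<up> ix a) = c \<cdot> x \<up> ix a"
      using c(1) lam1 x t(1) lam_t_pow_x_pow[of 1 "ix a"] by (simp add: lam_add)
    then show ?thesis using c(2) by simp
  qed
  have tc: "t \<bullet> a = t \<cdot> a" if "a \<in> carrier B" for a using that t(1) lamt by (simp add: circ_eq)
  have lamtn: "t \<Up> n \<bullet> a = t \<up> n \<cdot> a" if "a \<in> carrier B" for n a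
  proof (induction n)
    case 0
    then show ?case using that one_eq e_circ by simp
  next
    case (Suc n)
    have "t \<Up> Suc n \<bullet> a = t \<bullet> (t \<Up> n \<bullet> a)" using that t(1) M.nat_pow_Suc2[of t n] by (simp add: M.m_assoc)
    also have "\<dots> = t \<cdot> (t \<up> n \<cdot> a)" using Suc that t(1) tc by simp
    also have "\<dots> = t \<up> Suc n \<cdot> a" using that t(1) A.nat_pow_Suc2[of t n] by (simp add: A.m_assoc)
    finally show ?case .
  qed
  show ?thesis unfolding normal_form_def
  proof (intro conjI ballI impI)
    show "skew_brace (opposite B)" using skew_brace by (rule skew_brace_opposite)
    have os: "group (additive_group (opposite B))" using \<open>skew_brace (opposite B)\<close> by (simp add: skew_brace_def)
    have subo: "subgroup V (additive_group (opposite B))"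
    proof (rule group.subgroupI[OF os])
      show "inv\<^bsub>additive_group (opposite B)\<^esub> a \<in> V" if "a \<in> V" for a
        using that skew_brace_opposite(2)[OF skew_brace] by simp
      show "a \<otimes>\<^bsub>additive_group (opposite B)\<^esub> b \<in> V" if "a \<in> V" "b \<in> V" for a b
        using that V_closed(2)[of b a] by (simp add: additive_group_simps)
      show "V \<subseteq> carrier (additive_group (opposite B))" using V_subset by simp
      show "V \<noteq> {}" using V_closed(1) by blast
    qed
    show "V \<lhd> additive_group (opposite B)"
      unfolding group.normal_inv_iff[OF os]
    proof (intro conjI ballI subo)
      fix g v assume g: "g \<in> carrier (additive_group (opposite B))" and v: "v \<in> V"
      then have gB: "g \<in> carrier B" by simp
      have "neg g \<cdot> v \<cdot> neg (neg g) \<in> V" using V_conj[of "neg g" v] gB v by simp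
      then have "neg g \<cdot> (v \<cdot> g) \<in> V" using gB v by (simp add: A.m_assoc)
      then show "g \<otimes>\<^bsub>additive_group (opposite B)\<^esub> v \<otimes>\<^bsub>additive_group (opposite B)\<^esub> inv\<^bsub>additive_group (opposite B)\<^esub> g \<in> V"
        using gB skew_brace_opposite(2)[OF skew_brace] by (simp add: additive_group_simps)
    qed
    show "scirc (opposite B) t u = sadd (opposite B) u t" if "u \<in> V" for u
      using tc[of u] that by (simp add: additive_group_simps multiplicative_group_simps)
    show "scirc (opposite B) t t = sadd (opposite B) t t"
      using tc[of t] t(1) by (simp add: additive_group_simps multiplicative_group_simps)
    show "\<exists>m::nat. scirc (opposite B) u t = sadd (opposite B) u (t [^]\<^bsub>additive_group (opposite B)\<^esub> m)" if u: "u \<in> V" for u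
    proof -
      obtain m where "u \<bullet> t = t \<Up> m \<bullet> u" using t_normal[OF u] by blast
      then have "u \<bullet> t = t \<up> m \<cdot> u" using lamtn[of u m] u by simp
      then show ?thesis using skew_brace_opposite(3)[OF skew_brace t(1), of m]
        by (intro exI[of _ m]) (simp add: additive_group_simps multiplicative_group_simps)
    qed
    show "\<exists>u\<in>V. scirc (opposite B) u t \<noteq> scirc (opposite B) t u" using t_noncentral by (simp add: multiplicative_group_simps)
    show "sadd (opposite B) u v = sadd (opposite B) v u" if "u \<in> V" "v \<in> V" for u v
      using V_comm[OF that] by (simp add: additive_group_simps)
    show "v [^]\<^bsub>additive_group (opposite B)\<^esub> p = sone (opposite B)" if "v \<in> V" for v
      using V_exp[OF that] skew_brace_opposite(3)[OF skew_brace, of v p] that by (simp add: additive_group_simps)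
    show "v = sone (opposite B)" if "v \<in> V" "sadd (opposite B) t v = sadd (opposite B) v t" for v
      using V_fpf[of t v] t that by (simp add: additive_group_simps)
  qed (use card_B card_V t V_mult_subgroup in auto)
qed

end

lemma (in split_brace) normal_form_or_opposite: "normal_form B V t \<or> normal_form (opposite B) V t"
proof -
  obtain x where x: "x \<in> carrier B" "ix x = 1" "lam t x = x" using exists_fixed_complement by blast
  interpret split_brace_base p q B V t x using x by unfold_locales
  show ?thesis
    using lam_t_alternative normal_form_if_b_trivial normal_form_opposite_if_lam_t_trivial by blast
qed

text \<open>\<open>no_additive_normal_q\<close> leaves a normal additive \<open>V\<close>, which
  lambda maps preserve by its torsion description. If \<open>V\<close> were also multiplicatively
  normal, it would be a proper nontrivial ideal; so the multiplicative dichotomy yields a normal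
  subgroup of order \<open>q\<close>, which provides \<open>t\<close>.\<close>

lemma (in simple_brace_pq) normal_form_exists: "\<exists>V t. normal_form B V t \<or> normal_form (opposite B) V t"
proof -
  obtain V where V: "V \<lhd> additive_group B" "card V = p ^ p"
    "\<And>u v. u \<in> V \<Longrightarrow> v \<in> V \<Longrightarrow> u \<cdot> v = v \<cdot> u" "\<And>v. v \<in> V \<Longrightarrow> v [^]\<^bsub>additive_group B\<^esub> p = e"
    "\<And>x v. x \<in> carrier B - V \<Longrightarrow> v \<in> V \<Longrightarrow> x \<cdot> v = v \<cdot> x \<Longrightarrow> v = e"
    using sylow_dichotomy[OF A.group_axioms order_AM(1)] no_additive_normal_q
    unfolding additive_group_simps(1) by blast
  have tor: "V = {a \<in> carrier (additive_group B). a [^]\<^bsub>additive_group B\<^esub> (p ^ p) = e}"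
    using V by (intro normal_pp_torsion order_AM finite_AM A.group_axioms)
  have lamV: "lam a v \<in> V" if "a \<in> carrier B" "v \<in> V" for a v
    using torsion_lam_closed[of a v "p ^ p"] that tor by blast
  have VA: "subgroup V (additive_group B)" using V(1) by (rule normal_imp_subgroup)
  have VM: "subgroup V (multiplicative_group B)" by (rule left_ideal_subgroup[OF VA lamV])
  have VB: "V \<subseteq> carrier B" using tor by auto
  have not_normal: "\<not> V \<lhd> multiplicative_group B"
    using ideal_trivial[OF V(1) _ lamV] V(2) card_q_not_trivial(3,4) by metis
  have Vtor: "v [^]\<^bsub>multiplicative_group B\<^esub> (p ^ p) = \<one>\<^bsub>multiplicative_group B\<^esub>" if "v \<in> V" for v
    using M.subgroup_pow_card[OF VM that] V(2) by simp
  have "V' = V" if "V' \<lhd> multiplicative_group B" "card V' = p ^ p" for V'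
  proof -
    have "V' = {a \<in> carrier (multiplicative_group B). a [^]\<^bsub>multiplicative_group B\<^esub> (p ^ p) = \<one>\<^bsub>multiplicative_group B\<^esub>}"
      using that by (intro normal_pp_torsion order_AM finite_AM M.group_axioms)
    then have "V \<subseteq> V'" "finite V'" using Vtor VB finite_B by auto
    then show ?thesis using V(2) that(2) by (intro card_subset_eq[symmetric]) auto
  qed
  then obtain Q where Q: "Q \<lhd> multiplicative_group B" "card Q = q"
    using sylow_dichotomy[OF M.group_axioms order_AM(2)] not_normal by blast
  have QM: "subgroup Q (multiplicative_group B)" using Q(1) by (rule normal_imp_subgroup)
  obtain t where t: "t \<in> Q" "t \<noteq> \<one>\<^bsub>multiplicative_group B\<^esub>"
    using M.exists_prime_order_element[OF finite_AM(2) QM q] Q(2) by auto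
  have QB: "Q \<subseteq> carrier B" using subgroup.subset[OF QM] by simp
  have tB: "t \<in> carrier B" using t QB by blast
  have tq: "t [^]\<^bsub>multiplicative_group B\<^esub> q = \<one>\<^bsub>multiplicative_group B\<^esub>"
    using M.subgroup_pow_card[OF QM t(1)] Q(2) by simp
  have tV: "t \<notin> V"
    using M.coprime_torsion[of t "p ^ p" q] Vtor tq tB t(2) coprime_pp_q by auto
  have powers: "\<exists>m::nat. z = t [^]\<^bsub>multiplicative_group B\<^esub> m" if "z \<in> Q" for z
    by (rule M.prime_order_powers[OF finite_AM(2) QM Q(2) q t that])
  have t_normal: "\<exists>m::nat. u \<bullet> t = (t [^]\<^bsub>multiplicative_group B\<^esub> m) \<bullet> u \<and> \<not> q dvd m" if u: "u \<in> V" for u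
  proof -
    have uB: "u \<in> carrier B" using u VB by blast
    have "u \<bullet> t \<bullet> bar u \<in> Q" using Q(1) t(1) uB unfolding M.normal_inv_iff by simp
    then obtain m :: nat where "u \<bullet> t \<bullet> bar u = t [^]\<^bsub>multiplicative_group B\<^esub> m" using powers by blast
    then have m: "u \<bullet> t = (t [^]\<^bsub>multiplicative_group B\<^esub> m) \<bullet> u"
      using M.conj_eq_iff[of u t "t [^]\<^bsub>multiplicative_group B\<^esub> m"] uB tB by simp
    moreover have "\<not> q dvd m"
    proof
      assume "q dvd m"
      then have "t [^]\<^bsub>multiplicative_group B\<^esub> m = \<one>\<^bsub>multiplicative_group B\<^esub>"
        using tq M.pow_eq_id[of t] tB dvd_trans by auto
      then show False using m uB tB t(2) by simp
    qed
    ultimately show ?thesis by blast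
  qed
  \<comment> \<open>If \<open>t\<close> commuted with \<open>V\<close>, the multiplicative
    normalizer of \<open>V\<close> would contain \<open>V\<close> and \<open>Q\<close>; its order
    would be divisible by \<open>p ^ p * q\<close>, and \<open>V\<close> would be normal.\<close>
  have "\<exists>u\<in>V. u \<bullet> t \<noteq> t \<bullet> u"
  proof (rule ccontr)
    assume "\<not> ?thesis"
    then have comm: "t \<bullet> u = u \<bullet> t" if "u \<in> V" for u using that by metis
    define N where "N = {g \<in> carrier B. \<forall>v\<in>V. g \<bullet> v \<bullet> bar g \<in> V}"
    have NM: "subgroup N (multiplicative_group B)"
    proof (rule M.subgroup_if_finite_closed[OF finite_AM(2)])
      fix g h assume gh: "g \<in> N" "h \<in> N"
      have "(g \<bullet> h) \<bullet> v \<bullet> bar (g \<bullet> h) \<in> V" if v: "v \<in> V" for v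
      proof -
        have "g \<bullet> (h \<bullet> v \<bullet> bar h) \<bullet> bar g \<in> V" using gh v by (simp add: N_def)
        moreover have "g \<in> carrier B" "h \<in> carrier B" "v \<in> carrier B" using gh v VB by (auto simp: N_def)
        ultimately show ?thesis using M.conj_conj[of g h v] by simp
      qed
      then show "g \<bullet> h \<in> N" using gh by (simp add: N_def)
    qed (use VB in \<open>auto simp: N_def subsetD\<close>)
    have "V \<subseteq> N" using VB subgroup.m_closed[OF VM] subgroup.m_inv_closed[OF VM] by (auto simp: N_def)
    then have 1: "p ^ p dvd card N" using M.subgroup_card_dvd[OF finite_AM(2) VM NM] V(2) by simp
    have "t \<bullet> v \<bullet> bar t = v" if "v \<in> V" for v
      using M.conj_eq_iff[of t v v] comm[OF that] tB VB that by auto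
    then have tN: "t \<in> N" using tB by (simp add: N_def)
    have tmN: "t [^]\<^bsub>multiplicative_group B\<^esub> (m::nat) \<in> N" for m
      by (induction m) (use tN subgroup.one_closed[OF NM] subgroup.m_closed[OF NM] in auto)
    then have "Q \<subseteq> N" using powers by blast
    then have "q dvd card N" using M.subgroup_card_dvd[OF finite_AM(2) QM NM] Q(2) by simp
    then have "p ^ p * q dvd card N" using 1 coprime_pp_q by (intro divides_mult)
    moreover have NB: "N \<subseteq> carrier B" by (auto simp: N_def)
    moreover have "card N > 0" using subgroup.one_closed[OF NM] finite_subset[OF NB finite_B] card_gt_0_iff by blast
    ultimately have "card N \<ge> card (carrier B)" using card_B dvd_imp_le by simp
    then have "N = carrier B" using NB finite_B by (intro card_seteq) auto
    then have "V \<lhd> multiplicative_group B" unfolding M.normal_inv_iff using VM by (auto simp: N_def)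
    then show False using not_normal by blast
  qed
  then interpret split_brace p q B V t
    using card_B V lamV tB tV tq one_eq t_normal
    by (intro split_brace.intro split_brace_axioms.intro prime_pair_axioms skew_brace_structure_axioms) simp_all
  show ?thesis using normal_form_or_opposite by blast
qed

section \<open>Classification\<close>

lemma opposite_subgroup:
  assumes "skew_brace B" "subgroup I (additive_group (opposite B))"
  shows "subgroup I (additive_group B)"
proof -
  interpret skew_brace_structure B by unfold_locales fact
  have IB: "I \<subseteq> carrier B" using subgroup.subset[OF assms(2)] by simp
  show ?thesis
  proof (rule A.subgroupI)
    show "I \<subseteq> carrier (additive_group B)" using IB by simp
    show "I \<noteq> {}" using subgroup.one_closed[OF assms(2)] by blast
    show "neg a \<in> I" if "a \<in> I" for a
      using subgroup.m_inv_closed[OF assms(2) that] skew_brace_opposite(2)[OF assms(1)] IB that by auto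
    show "a \<cdot> b \<in> I" if "a \<in> I" "b \<in> I" for a b
      using subgroup.m_closed[OF assms(2) that(2,1)] by (simp add: additive_group_simps)
  qed
qed

lemma opposite_normal:
  assumes "skew_brace B" "I \<lhd> additive_group (opposite B)"
  shows "I \<lhd> additive_group B"
proof -
  interpret skew_brace_structure B by unfold_locales fact
  interpret O: skew_brace_structure "opposite B"
    by unfold_locales (rule skew_brace_opposite(1)[OF assms(1)])
  have sub: "subgroup I (additive_group B)"
    using opposite_subgroup[OF assms(1) normal_imp_subgroup[OF assms(2)]] .
  have IB: "I \<subseteq> carrier B" using subgroup.subset[OF sub] by simp
  show ?thesis unfolding A.normal_inv_iff
  proof (intro conjI ballI sub)
    fix g i assume "g \<in> carrier (additive_group B)" "i \<in> I"
    then have gi: "g \<in> carrier B" "i \<in> I" "i \<in> carrier B" using IB by auto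
    have "neg g \<otimes>\<^bsub>additive_group (opposite B)\<^esub> i \<otimes>\<^bsub>additive_group (opposite B)\<^esub> inv\<^bsub>additive_group (opposite B)\<^esub> (neg g) \<in> I"
      using assms(2) gi unfolding O.A.normal_inv_iff by simp
    then have "g \<cdot> (i \<cdot> neg g) \<in> I"
      using gi skew_brace_opposite(2)[OF assms(1), of "neg g"] by (simp add: additive_group_simps)
    then show "g \<cdot> i \<cdot> neg g \<in> I" using gi by (simp add: A.m_assoc)
  qed
qed

text \<open>The lambda map of the opposite brace sends \<open>i\<close> to
  \<open>(a \<bullet> i) \<cdot> neg a\<close>, the additive conjugate of \<open>lam a i\<close> by
  \<open>a\<close>. By additive normality an ideal of the opposite brace is therefore an ideal of
  \<open>B\<close>.\<close>

lemma simple_opposite: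
  assumes "simple_skew_brace B"
  shows "simple_skew_brace (opposite B)"
proof -
  have sb: "skew_brace B" using assms by (simp add: simple_skew_brace_def)
  interpret skew_brace_structure B by unfold_locales (fact sb)
  have "sb_ideal I B" if I: "sb_ideal I (opposite B)" for I
  proof -
    have N: "I \<lhd> additive_group B" using opposite_normal[OF sb] I by (simp add: sb_ideal_def)
    then have sub: "subgroup I (additive_group B)" by (rule normal_imp_subgroup)
    have IB: "I \<subseteq> carrier B" using subgroup.subset[OF sub] by simp
    have "lam a i \<in> I" if a: "a \<in> carrier B" and i: "i \<in> I" for a i
    proof -
      have iB: "i \<in> carrier B" using i IB by blast
      have "lambda_map (opposite B) a i \<in> I" using I a i by (auto simp: sb_ideal_def)
      then have "(a \<bullet> i) \<cdot> neg a \<in> I"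
        using skew_brace_opposite(2)[OF sb a] by (simp add: lambda_map_def additive_group_simps multiplicative_group_simps)
      then have "neg a \<cdot> ((a \<bullet> i) \<cdot> neg a) \<cdot> neg (neg a) \<in> I"
        using N closed(3)[OF a] unfolding A.normal_inv_iff additive_group_simps(1) by blast
      then show ?thesis using a iB by (simp add: lam_def A.m_assoc)
    qed
    then show ?thesis using I N sub by (auto simp: sb_ideal_def)
  qed
  then show ?thesis
    using assms skew_brace_opposite(1)[OF sb] by (simp add: simple_skew_brace_def)
qed

lemma sb_isomorphic_opposite:
  assumes "sb_isomorphic (opposite B) C"
  shows "sb_isomorphic B (opposite C)"
proof -
  obtain f where f: "f \<in> sb_hom (opposite B) C" "bij_betw f (carrier B) (carrier C)"
    using assms by (auto simp: sb_isomorphic_def)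
  have "f \<in> sb_hom B (opposite C)"
    using f(1) by (auto simp: sb_hom_def hom_def additive_group_simps)
  then show ?thesis using f(2) by (auto simp: sb_isomorphic_def)
qed

lemma sb_isomorphic_refl: "sb_isomorphic B B"
proof -
  have "(\<lambda>x. x) \<in> sb_hom B B" by (auto simp: sb_hom_def hom_def)
  moreover have "bij_betw (\<lambda>x. x) (carrier B) (carrier B)" by (simp add: bij_betw_def)
  ultimately show ?thesis unfolding sb_isomorphic_def by blast
qed

section \<open>Coordinates for a brace in normal form\<close>

locale normal_form_brace = finite_field_quotient + skew_brace_structure +
  fixes V and t
  assumes nf: "normal_form B V t"
begin

abbreviation apow (infixr "\<up>" 80) where "a \<up> n \<equiv> a [^]\<^bsub>additive_group B\<^esub> (n::nat)"
abbreviation mpow (infixr "\<Up>" 80) where "a \<Up> n \<equiv> a [^]\<^bsub>multiplicative_group B\<^esub> (n::nat)"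

lemma card_B: "card (carrier B) = p ^ p * q"
  and V_normal: "V \<lhd> additive_group B" and card_V: "card V = p ^ p"
  and t: "t \<in> carrier B" "t \<notin> V"
  and V_mult: "subgroup V (multiplicative_group B)"
  using nf by (auto simp: normal_form_def)

lemma V_comm: "u \<in> V \<Longrightarrow> v \<in> V \<Longrightarrow> u \<cdot> v = v \<cdot> u"
  and V_exp: "v \<in> V \<Longrightarrow> v \<up> p = e"
  and t_fpf: "v \<in> V \<Longrightarrow> t \<cdot> v = v \<cdot> t \<Longrightarrow> v = e"
  and t_circ: "v \<in> V \<Longrightarrow> t \<bullet> v = v \<cdot> t"
  and t_circ_t: "t \<bullet> t = t \<cdot> t"
  and V_circ_t: "u \<in> V \<Longrightarrow> \<exists>m. u \<bullet> t = u \<cdot> t \<up> m"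
  and noncentral: "\<exists>u\<in>V. u \<bullet> t \<noteq> t \<bullet> u"
  using nf unfolding normal_form_def additive_group_simps multiplicative_group_simps by blast+

lemma finite_B: "finite (carrier B)"
  using card_B p_gt_1 q_gt_1 by (intro card_ge_0_finite) simp

lemma V_subgroup: "subgroup V (additive_group B)"
  using V_normal by (rule normal_imp_subgroup)

lemma V_subset: "V \<subseteq> carrier B"
  using subgroup.subset[OF V_subgroup] by simp

lemma V_B [simp]: "v \<in> V \<Longrightarrow> v \<in> carrier B"
  using V_subset by blast

lemma V_closed [simp]: "e \<in> V" "u \<in> V \<Longrightarrow> v \<in> V \<Longrightarrow> u \<cdot> v \<in> V" "u \<in> V \<Longrightarrow> neg u \<in> V"
    "u \<in> V \<Longrightarrow> v \<in> V \<Longrightarrow> u \<bullet> v \<in> V"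
  using subgroup.one_closed[OF V_subgroup] subgroup.m_closed[OF V_subgroup] subgroup.m_inv_closed[OF V_subgroup]
    subgroup.m_closed[OF V_mult]
  by auto

lemma V_conj: "x \<in> carrier B \<Longrightarrow> v \<in> V \<Longrightarrow> x \<cdot> v \<cdot> neg x \<in> V"
  using V_normal unfolding A.normal_inv_iff by simp

lemma finite_V: "finite V"
  using V_subset finite_B by (rule finite_subset)

lemma V_lam: "u \<in> V \<Longrightarrow> v \<in> V \<Longrightarrow> lam u v \<in> V"
  by (simp add: lam_def)

lemma coordinate:
  obtains ix where "\<And>a. a \<in> carrier B \<Longrightarrow> \<exists>v\<in>V. a = v \<cdot> t \<up> ix a"
    "\<And>a b. a \<in> carrier B \<Longrightarrow> b \<in> carrier B \<Longrightarrow> [ix (a \<cdot> b) = ix a + ix b] (mod q)"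
    "\<And>a. a \<in> carrier B \<Longrightarrow> ix a = (0::nat) \<longleftrightarrow> a \<in> V" "ix t = 1" "\<And>a. a \<in> carrier B \<Longrightarrow> ix a < q"
proof -
  have "\<exists>ix. (\<forall>a\<in>carrier B. ix a < q \<and> (\<exists>v\<in>V. a = v \<cdot> t \<up> ix a)) \<and>
    (\<forall>a\<in>carrier B. \<forall>b\<in>carrier B. [ix (a \<cdot> b) = ix a + ix b] (mod q)) \<and>
    (\<forall>a\<in>carrier B. ix a = (0::nat) \<longleftrightarrow> a \<in> V) \<and> ix t = 1"
    using A.prime_index_coordinate[OF _ V_normal _ q, of t] finite_B card_B card_V t by (simp add: Coset.order_def)
  then obtain ix where "\<forall>a\<in>carrier B. ix a < q \<and> (\<exists>v\<in>V. a = v \<cdot> t \<up> ix a)"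
    "\<forall>a\<in>carrier B. \<forall>b\<in>carrier B. [ix (a \<cdot> b) = ix a + ix b] (mod q)"
    "\<forall>a\<in>carrier B. ix a = (0::nat) \<longleftrightarrow> a \<in> V" "ix t = 1" by blast
  then show thesis by (intro that[of ix]) blast+
qed

lemma t_pow_index:
  assumes "u \<in> V" "v \<in> V" "u \<cdot> t \<up> i = v \<cdot> t \<up> j"
  shows "[i = j] (mod q)"
proof -
  obtain ix where ix: "\<And>a b. a \<in> carrier B \<Longrightarrow> b \<in> carrier B \<Longrightarrow> [ix (a \<cdot> b) = ix a + ix b] (mod q)"
    "\<And>a. a \<in> carrier B \<Longrightarrow> ix a = (0::nat) \<longleftrightarrow> a \<in> V" "ix t = 1"
    using coordinate by metis
  have tp: "[ix (t \<up> n) = n] (mod q)" for n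
  proof (induction n)
    case 0
    then show ?case using ix(2)[of e] by simp
  next
    case (Suc n)
    have "[ix (t \<up> n \<cdot> t) = ix (t \<up> n) + ix t] (mod q)" using t(1) by (intro ix) simp_all
    also have "[ix (t \<up> n) + ix t = n + 1] (mod q)" using ix(3) by (intro cong_add Suc) simp
    finally show ?case by simp
  qed
  have "[ix (w \<cdot> t \<up> n) = n] (mod q)" if "w \<in> V" for w n
  proof -
    have "[ix (w \<cdot> t \<up> n) = ix w + ix (t \<up> n)] (mod q)" using that t(1) by (intro ix) simp_all
    also have "[ix w + ix (t \<up> n) = 0 + n] (mod q)" using ix(2)[of w] that by (intro cong_add tp) simp
    finally show ?thesis by simp
  qed
  then show ?thesis using assms cong_sym cong_trans by metis
qed

lemma t_pow_q: "t \<up> q = e"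
proof (rule t_fpf)
  obtain ix where ix: "\<And>a. a \<in> carrier B \<Longrightarrow> \<exists>v\<in>V. a = v \<cdot> t \<up> ix a"
    "\<And>a. a \<in> carrier B \<Longrightarrow> ix a = (0::nat) \<longleftrightarrow> a \<in> V" "\<And>a. a \<in> carrier B \<Longrightarrow> ix a < q"
    using coordinate by metis
  obtain v where v: "v \<in> V" "t \<up> q = v \<cdot> t \<up> ix (t \<up> q)" using ix(1)[of "t \<up> q"] t(1) by auto
  have "e \<cdot> t \<up> q = v \<cdot> t \<up> ix (t \<up> q)" using t(1) v by simp
  then have "[q = ix (t \<up> q)] (mod q)" using v(1) by (intro t_pow_index[of e v]) simp_all
  then have "ix (t \<up> q) = 0" using ix(3)[of "t \<up> q"] t(1) by (simp add: cong_def)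
  then show "t \<up> q \<in> V" using ix(2) t(1) by simp
  show "t \<cdot> t \<up> q = t \<up> q \<cdot> t" using t(1) A.nat_pow_Suc2[of t q] by simp
qed

lemma t_pow_eq_iff: "t \<up> i = t \<up> j \<longleftrightarrow> [i = j] (mod q)"
  using t_pow_index[of e e i j] A.pow_mod[of t q i j] t_pow_q t(1) by auto

lemma decomp: "a \<in> carrier B \<Longrightarrow> \<exists>v\<in>V. \<exists>i. a = v \<cdot> t \<up> i"
  using coordinate by metis

lemma decomp_unique: "u \<in> V \<Longrightarrow> v \<in> V \<Longrightarrow> u \<cdot> t \<up> i = v \<cdot> t \<up> j \<Longrightarrow> u = v \<and> [i = j] (mod q)"
  using t_pow_index[of u v i j] t_pow_eq_iff[of i j] t(1) by auto

lemma t_circ_decomp: "v \<in> V \<Longrightarrow> t \<bullet> (v \<cdot> t \<up> j) = v \<cdot> t \<up> Suc j"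
proof -
  assume v: "v \<in> V"
  have "t \<cdot> lam t t = t \<cdot> t" using t(1) t_circ_t by (simp add: circ_eq[symmetric])
  then have "lam t t = t" using t(1) by simp
  then have "lam t (t \<up> j) = t \<up> j" using t(1) by (simp add: lam_pow)
  then have "t \<bullet> (v \<cdot> t \<up> j) = t \<cdot> lam t v \<cdot> t \<up> j" using t(1) v by (simp add: circ_eq lam_add A.m_assoc)
  also have "t \<cdot> lam t v = v \<cdot> t" using t(1) v t_circ by (simp add: circ_eq[symmetric])
  finally show ?thesis using v t(1) A.nat_pow_Suc2[of t j] by (simp add: A.m_assoc)
qed

lemma t_mpow_decomp: "v \<in> V \<Longrightarrow> t \<Up> i \<bullet> (v \<cdot> t \<up> j) = v \<cdot> t \<up> (i + j)"
proof (induction i)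
  case 0
  then show ?case using t(1) one_eq e_circ by simp
next
  case (Suc i)
  have "t \<Up> Suc i \<bullet> (v \<cdot> t \<up> j) = t \<bullet> (t \<Up> i \<bullet> (v \<cdot> t \<up> j))"
    using Suc.prems t(1) M.nat_pow_Suc2[of t i] by (simp add: M.m_assoc)
  then show ?case using Suc t_circ_decomp by simp
qed

lemma lam_V_t: "u \<in> V \<Longrightarrow> \<exists>m. lam u t = t \<up> m"
proof -
  assume u: "u \<in> V"
  then obtain m where "u \<bullet> t = u \<cdot> t \<up> m" using V_circ_t by blast
  then have "u \<cdot> lam u t = u \<cdot> t \<up> m" using u t(1) by (simp add: circ_eq)
  then show ?thesis using u t(1) by auto
qed

definition mu :: "'a \<Rightarrow> nat" where "mu u = (SOME m. lam u t = t \<up> m)"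

lemma lam_t: "u \<in> V \<Longrightarrow> lam u t = t \<up> mu u"
  unfolding mu_def using someI_ex[OF lam_V_t] .

lemma lam_t_pow: "u \<in> V \<Longrightarrow> lam u (t \<up> i) = t \<up> (mu u * i)"
  using lam_pow[of u t i] t(1) lam_t by (simp add: A.nat_pow_pow)

text \<open>Left multiplication by \<open>t\<close> raises the exponent by one, so
  \<open>u \<cdot> t \<up> i\<close> is also \<open>t \<Up> i \<bullet> u\<close>; this reduces the
  multiplicative operation to \<open>V\<close> and the scalars \<open>mu\<close>.\<close>

lemma circ_decomp: "u \<in> V \<Longrightarrow> v \<in> V \<Longrightarrow>
   (u \<cdot> t \<up> i) \<bullet> (v \<cdot> t \<up> j) = (u \<bullet> v) \<cdot> t \<up> (i + mu u * j)"
proof -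
  assume uv: "u \<in> V" "v \<in> V"
  have "u \<cdot> t \<up> i = t \<Up> i \<bullet> u" using t_mpow_decomp[OF uv(1), of i 0] uv by simp
  then have "(u \<cdot> t \<up> i) \<bullet> (v \<cdot> t \<up> j) = t \<Up> i \<bullet> (u \<bullet> (v \<cdot> t \<up> j))" using uv t(1) by (simp add: M.m_assoc)
  also have "u \<bullet> (v \<cdot> t \<up> j) = u \<cdot> (lam u v \<cdot> t \<up> (mu u * j))" using uv t(1) by (simp add: circ_eq lam_add lam_t_pow)
  also have "\<dots> = (u \<bullet> v) \<cdot> t \<up> (mu u * j)" using uv t(1) by (simp add: circ_eq A.m_assoc)
  finally show ?thesis using t_mpow_decomp uv by simp
qed

lemma mu_circ: "u \<in> V \<Longrightarrow> v \<in> V \<Longrightarrow> [mu (u \<bullet> v) = mu u * mu v] (mod q)"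
proof -
  assume uv: "u \<in> V" "v \<in> V"
  have "t \<up> mu (u \<bullet> v) = lam (u \<bullet> v) t" using uv lam_t[of "u \<bullet> v"] by simp
  also have "\<dots> = lam u (lam v t)" using uv t(1) by (intro lam_circ) simp_all
  also have "\<dots> = lam u (t \<up> mu v)" using lam_t[OF uv(2)] by simp
  also have "\<dots> = t \<up> (mu u * mu v)" using uv by (simp add: lam_t_pow)
  finally show ?thesis by (simp add: t_pow_eq_iff)
qed

definition ze :: "nat \<Rightarrow> 'a \<Rightarrow> 'a" where "ze n v = t \<up> n \<cdot> v \<cdot> neg (t \<up> n)"

lemma ze_V: "v \<in> V \<Longrightarrow> ze n v \<in> V"
  unfolding ze_def using t(1) by (intro V_conj) simp_all

lemma ze_mult: "u \<in> V \<Longrightarrow> v \<in> V \<Longrightarrow> ze n (u \<cdot> v) = ze n u \<cdot> ze n v"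
  unfolding ze_def using t(1) A.conj_mult[of "t \<up> n" u v] by simp

lemma ze_ze: "v \<in> V \<Longrightarrow> ze n (ze m v) = ze (n + m) v"
  unfolding ze_def using t(1) A.conj_conj[of "t \<up> n" "t \<up> m" v] by (simp add: A.nat_pow_mult)

lemma ze_cong: "[n = m] (mod q) \<Longrightarrow> ze n v = ze m v"
  using t_pow_eq_iff[of n m] by (simp add: ze_def)

lemma ze_0: "v \<in> V \<Longrightarrow> ze 0 v = v"
  by (simp add: ze_def)

text \<open>Semilinearity: once conjugation by \<open>t\<close> has become multiplication by a root
  of unity, this is the hypothesis of \<open>semilinear_is_frobenius\<close>.\<close>

lemma lam_ze: "u \<in> V \<Longrightarrow> v \<in> V \<Longrightarrow> lam u (ze n v) = ze (mu u * n) (lam u v)"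
  unfolding ze_def using t(1) by (simp add: lam_add lam_neg lam_t_pow)

lemma pow_decomp: "v \<in> V \<Longrightarrow> t \<up> i \<cdot> v = ze i v \<cdot> t \<up> i"
  unfolding ze_def using t(1) by (simp add: A.m_assoc)

lemma add_decomp: "u \<in> V \<Longrightarrow> v \<in> V \<Longrightarrow> (u \<cdot> t \<up> i) \<cdot> (v \<cdot> t \<up> j) = (u \<cdot> ze i v) \<cdot> t \<up> (i + j)"
proof -
  assume uv: "u \<in> V" "v \<in> V"
  have "(u \<cdot> t \<up> i) \<cdot> (v \<cdot> t \<up> j) = u \<cdot> (t \<up> i \<cdot> v) \<cdot> t \<up> j" using uv t(1) by (simp add: A.m_assoc)
  also have "\<dots> = u \<cdot> ze i v \<cdot> (t \<up> i \<cdot> t \<up> j)" using uv t(1) ze_V[of v i] by (simp add: pow_decomp A.m_assoc)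
  finally show ?thesis using t(1) by (simp add: A.nat_pow_mult)
qed

lemma irreducible:
  assumes "W \<subseteq> V" "e \<in> W" "\<And>u v. u \<in> W \<Longrightarrow> v \<in> W \<Longrightarrow> u \<cdot> v \<in> W" "\<And>v. v \<in> W \<Longrightarrow> ze 1 v \<in> W" "w \<in> W" "w \<noteq> e"
  shows "W = V"
proof (rule frobenius_irreducible[OF A.group_axioms _ V_subgroup card_V, of t])
  show "subgroup W (additive_group B)"
    using assms V_subset finite_B by (intro A.subgroup_if_finite_closed) auto
  show "t \<up> q \<cdot> v = v \<cdot> t \<up> q" if "v \<in> V" for v using that t_pow_q by simp
  show "t \<cdot> w \<cdot> neg t \<in> W" if "w \<in> W" for w using assms(4)[OF that] t(1) by (simp add: ze_def)
qed (use assms finite_B t t_fpf in auto)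

lemma functional: "\<exists>h :: 'a \<Rightarrow> int. (\<forall>u\<in>V. \<forall>v\<in>V. [h (u \<cdot> v) = h u + h v] (mod int p)) \<and> (\<exists>v\<in>V. \<not> [h v = 0] (mod int p))"
proof -
  let ?G = "(additive_group B)\<lparr>carrier := V\<rparr>"
  have "comm_group ?G"
    using A.subgroup_imp_group[OF V_subgroup] V_comm by (intro group.group_comm_groupI) simp_all
  moreover have "v [^]\<^bsub>?G\<^esub> p = \<one>\<^bsub>?G\<^esub>" if "v \<in> carrier ?G" for v
    using A.nat_pow_consistent[of v p V] V_exp that by simp
  moreover have "order ?G = p ^ p" using card_V by (simp add: Coset.order_def)
  ultimately show ?thesis
    using elementary_abelian_functional[of ?G p p] p p_gt_1 by simp
qed

text \<open>The coordinate \<open>V \<rightarrow> F\<close> is a Fourier coefficient of the orbit \<open>i \<mapsto> h (t\<^sup>i v t\<^sup>-\<^sup>i)\<close> of a functional \<open>h\<close>.\<close>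
lemma fourier_coordinate:
  "\<exists>\<Psi> K. (\<forall>u\<in>V. \<forall>v\<in>V. \<Psi> (u \<cdot> v) \<simeq> \<Psi> u + \<Psi> v) \<and> (\<forall>v\<in>V. \<Psi> (ze 1 v) \<simeq> X ^ K * \<Psi> v) \<and>
    (\<forall>v\<in>V. \<Psi> v \<simeq> 0 \<longrightarrow> v = e) \<and> \<not> q dvd K"
proof -
  obtain h :: "'a \<Rightarrow> int" where h: "\<And>u v. u \<in> V \<Longrightarrow> v \<in> V \<Longrightarrow> [h (u \<cdot> v) = h u + h v] (mod int p)"
    and "\<exists>v\<in>V. \<not> [h v = 0] (mod int p)" using functional by blast
  then obtain v\<^sub>0 where v0: "v\<^sub>0 \<in> V" "\<not> [h v\<^sub>0 = 0] (mod int p)" by blast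
  define F where "F k v = (\<Sum>i<q. of_int (h (ze i v)) * X ^ (i * k))" for k v
  have add: "F k (u \<cdot> v) \<simeq> F k u + F k v" if "u \<in> V" "v \<in> V" for k u v
  proof -
    have "F k (u \<cdot> v) \<simeq> (\<Sum>i<q. of_int (h (ze i u) + h (ze i v)) * X ^ (i * k))"
      unfolding F_def
    proof (intro cg_sum cg_mult cg_refl)
      fix i show "of_int (h (ze i (u \<cdot> v))) \<simeq> of_int (h (ze i u) + h (ze i v))"
        using h[OF ze_V ze_V] that of_int_cg_iff by (simp only: ze_mult)
    qed
    then show ?thesis by (simp add: F_def sum.distrib distrib_right)
  qed
  \<comment> \<open>Conjugating \<open>v\<close> by \<open>t\<close> shifts the orbit by one index,
    and the sum is cyclic because \<open>ze q\<close> agrees with \<open>ze 0\<close>; so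
    \<open>F k\<close> is an eigenfunction of the conjugation.\<close>
  have shift: "X ^ k * F k (ze 1 v) \<simeq> F k v" if v: "v \<in> V" for k v
  proof -
    have "X ^ k * F k (ze 1 v) = (\<Sum>i<q. of_int (h (ze (Suc i) v)) * X ^ (Suc i * k))"
      using v by (simp add: F_def sum_distrib_left ze_ze power_add mult_ac)
    moreover have "of_int (h (ze 0 v)) * X ^ (0 * k) + (\<Sum>i<q. of_int (h (ze (Suc i) v)) * X ^ (Suc i * k))
       = F k v + of_int (h (ze q v)) * X ^ (q * k)"
      unfolding F_def
      using sum.lessThan_Suc[of "\<lambda>i. of_int (h (ze i v)) * X ^ (i * k)" q]
        sum.lessThan_Suc_shift[of "\<lambda>i. of_int (h (ze i v)) * X ^ (i * k)" q] by (rule trans[OF sym, rotated])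
    moreover have "ze q v = ze 0 v" by (intro ze_cong) (simp add: cong_def)
    ultimately have *: "X ^ k * F k (ze 1 v)
        = F k v + of_int (h (ze 0 v)) * X ^ (q * k) - of_int (h (ze 0 v)) * X ^ (0 * k)"
      by (simp only: eq_diff_eq add.commute)
    have "of_int (h (ze 0 v)) * X ^ (q * k) \<simeq> of_int (h (ze 0 v)) * X ^ (0 * k)"
      by (intro cg_mult cg_refl X_power_cong) (simp add: cong_def)
    then show ?thesis unfolding * cg_def by simp
  qed
  \<comment> \<open>Fourier inversion at index 0: the coefficients add up to \<open>q\<close> times
    the value of \<open>h\<close>, so not all of them vanish where \<open>h\<close> is
    nonzero.\<close>
  have total: "(\<Sum>k<q. F k v) \<simeq> of_nat q * of_int (h v)" if v: "v \<in> V" for v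
  proof -
    have "(\<Sum>k<q. F k v) = (\<Sum>i<q. of_int (h (ze i v)) * (\<Sum>k<q. X ^ (k * i)))"
      unfolding F_def sum_distrib_left by (subst sum.swap) (simp add: mult.commute)
    also have "\<dots> \<simeq> (\<Sum>i<q. of_int (h (ze i v)) * (if q dvd i then of_nat q else 0))"
      by (intro cg_sum cg_mult cg_refl X_power_sum)
    also have "\<dots> = (\<Sum>i<q. if i = 0 then of_int (h v) * of_nat q else 0)"
      using v by (intro sum.cong) (auto simp: ze_0 dest: dvd_imp_le)
    also have "\<dots> = of_nat q * of_int (h v)" using q_gt_1 by simp
    finally show ?thesis .
  qed
  have "\<exists>k. \<not> F k v\<^sub>0 \<simeq> 0"
  proof (rule ccontr)
    assume "\<not> ?thesis"
    then have "(\<Sum>k<q. F k v\<^sub>0) \<simeq> (\<Sum>k<q. 0)" by (intro cg_sum) blast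
    then have "of_nat q * of_int (h v\<^sub>0) \<simeq> 0" using cg_trans[OF cg_sym[OF total[OF v0(1)]]] by simp
    then have "of_int (h v\<^sub>0) \<simeq> of_int 0" using cg_prime q_not_cg_0 by auto
    then show False using v0(2) of_int_cg_iff by blast
  qed
  then obtain k where k: "\<not> F k v\<^sub>0 \<simeq> 0" by blast
  \<comment> \<open>The natural number \<open>(q - 1) * k\<close> stands for \<open>- k\<close>
    modulo \<open>q\<close>.\<close>
  let ?K = "(q - 1) * k"
  have K: "F k (ze 1 v) \<simeq> X ^ ?K * F k v" if v: "v \<in> V" for v
  proof -
    have "X ^ ?K * F k v \<simeq> X ^ ?K * (X ^ k * F k (ze 1 v))" by (intro cg_mult cg_refl cg_sym[OF shift[OF v]])
    also have "\<dots> = X ^ (?K + k) * F k (ze 1 v)" by (simp add: power_add mult_ac)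
    also have "?K + k = q * k" using q_gt_1 by (cases q) simp_all
    also have "X ^ (q * k) * F k (ze 1 v) \<simeq> 1 * F k (ze 1 v)" by (intro cg_mult cg_refl) (simp add: X_power_cg_1_iff)
    finally show ?thesis by (simp add: cg_sym)
  qed
  have Fe: "F k e \<simeq> 0"
  proof -
    have "F k e \<simeq> F k e + F k e" using add[of e e] by simp
    then have "F k e - (F k e + F k e) \<in> P" by (simp add: cg_def)
    then show ?thesis using P_uminus[of "F k e - (F k e + F k e)"] by (simp add: cg_0_iff)
  qed
  \<comment> \<open>The kernel of \<open>F k\<close> is stable under conjugation by \<open>t\<close>
    and is not all of \<open>V\<close>, hence trivial by irreducibility.\<close>
  have inj: "v = e" if v: "v \<in> V" "F k v \<simeq> 0" for v
  proof (rule ccontr)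
    assume "v \<noteq> e"
    have "{v \<in> V. F k v \<simeq> 0} = V"
    proof (rule irreducible[of _ v])
      show "u \<cdot> w \<in> {v \<in> V. F k v \<simeq> 0}" if "u \<in> {v \<in> V. F k v \<simeq> 0}" "w \<in> {v \<in> V. F k v \<simeq> 0}" for u w
        using that cg_trans[OF add cg_add[of "F k u" 0 "F k w" 0]] by simp
      show "ze 1 u \<in> {v \<in> V. F k v \<simeq> 0}" if "u \<in> {v \<in> V. F k v \<simeq> 0}" for u
        using that cg_trans[OF K cg_mult[OF cg_refl, of "F k u" 0]] ze_V by simp
    qed (use v \<open>v \<noteq> e\<close> Fe in auto)
    then show False using k v0(1) by blast
  qed
  \<comment> \<open>Otherwise \<open>F k\<close> would not distinguish \<open>v\<^sub>0\<close> from
    its conjugate by \<open>t\<close>, and \<open>t\<close> would commute with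
    \<open>v\<^sub>0\<close>.\<close>
  have "\<not> q dvd ?K"
  proof
    assume "q dvd ?K"
    then have X1: "X ^ ?K \<simeq> 1" by (simp only: X_power_cg_1_iff)
    have v0e: "v\<^sub>0 \<noteq> e" using k Fe by blast
    have "F k (ze 1 v\<^sub>0) \<simeq> 1 * F k v\<^sub>0" by (rule cg_trans[OF K[OF v0(1)] cg_mult[OF X1 cg_refl]])
    moreover have "F k (neg v\<^sub>0) + F k v\<^sub>0 \<simeq> 0" using cg_trans[OF cg_sym[OF add[of "neg v\<^sub>0" "v\<^sub>0"]]] v0(1) Fe by simp
    ultimately have "F k (neg v\<^sub>0) + F k (ze 1 v\<^sub>0) \<simeq> 0"
      using cg_trans[OF cg_add[OF cg_refl]] by (metis mult_1)
    then have "F k (neg v\<^sub>0 \<cdot> ze 1 v\<^sub>0) \<simeq> 0" using cg_trans[OF add] v0(1) ze_V by simp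
    then have "neg v\<^sub>0 \<cdot> ze 1 v\<^sub>0 = e" using inj v0(1) ze_V by simp
    then have "v\<^sub>0 \<cdot> (neg v\<^sub>0 \<cdot> ze 1 v\<^sub>0) = v\<^sub>0" using v0(1) by simp
    then have "ze 1 v\<^sub>0 = v\<^sub>0" using v0(1) ze_V[OF v0(1), of 1] by simp
    then have "t \<cdot> v\<^sub>0 = v\<^sub>0 \<cdot> t" using A.conj_eq_iff[of t v\<^sub>0 v\<^sub>0] t(1) v0(1) by (simp add: ze_def)
    then show False using t_fpf v0(1) v0e by blast
  qed
  then show ?thesis using add K inj by blast
qed

text \<open>The group of order \<open>p ^ p\<close> formed by \<open>V\<close> under the
  multiplicative operation acts on \<open>V\<close> through \<open>lam\<close>, so the number of
  fixed points is divisible by \<open>p\<close>. Such a vector serves to normalize the coordinate at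
  1.\<close>

lemma exists_lam_fixed: "\<exists>w\<in>V. w \<noteq> e \<and> (\<forall>u\<in>V. lam u w = w)"
proof -
  let ?G = "(multiplicative_group B)\<lparr>carrier := V\<rparr>"
  have "[card V = card {v \<in> V. \<forall>u\<in>carrier ?G. lam u v = v}] (mod p)"
  proof (rule p_group_fixed_points[OF M.subgroup_imp_group[OF V_mult] _ p finite_V])
    show "order ?G = p ^ p" using card_V by (simp add: Coset.order_def)
    show "lam (u \<otimes>\<^bsub>?G\<^esub> v) w = lam u (lam v w)" if "u \<in> carrier ?G" "v \<in> carrier ?G" "w \<in> V" for u v w
      using that by (simp add: lam_circ)
  qed (use V_lam lam_by_e one_eq in simp_all)
  then have "[p ^ p = card {v \<in> V. \<forall>u\<in>V. lam u v = v}] (mod p)" using card_V by simp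
  moreover have "[p ^ p = 0] (mod p)" using p_gt_1 by (simp add: cong_0_iff)
  ultimately have dvd: "p dvd card {v \<in> V. \<forall>u\<in>V. lam u v = v}" using cong_sym cong_trans cong_0_iff by meson
  have e: "e \<in> {v \<in> V. \<forall>u\<in>V. lam u v = v}" by simp
  have "{v \<in> V. \<forall>u\<in>V. lam u v = v} \<noteq> {e}"
  proof
    assume "{v \<in> V. \<forall>u\<in>V. lam u v = v} = {e}"
    then have "p dvd 1" using dvd by simp
    then show False using p_gt_1 by simp
  qed
  then show ?thesis using e by blast
qed

text \<open>Dividing the Fourier coordinate by its value at a vector fixed by all
  \<open>lam u\<close> sends that vector to 1. Each transported \<open>lam u\<close> then fixes 1
  and is semilinear, hence a power of the Frobenius map. Surjectivity is a count, both sides having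
  \<open>p ^ p\<close> elements.\<close>

lemma frobenius_coordinate:
  "\<exists>\<Psi> K a. (\<forall>u\<in>V. \<forall>v\<in>V. \<Psi> (u \<cdot> v) \<simeq> \<Psi> u + \<Psi> v) \<and> (\<forall>v\<in>V. \<Psi> (ze 1 v) \<simeq> X ^ K * \<Psi> v) \<and>
    (\<forall>u\<in>V. \<forall>v\<in>V. \<Psi> u \<simeq> \<Psi> v \<longrightarrow> u = v) \<and> (\<forall>f. \<exists>v\<in>V. \<Psi> v \<simeq> f) \<and> \<not> q dvd K \<and>
    (\<forall>u\<in>V. [mu u = p ^ a u] (mod q) \<and> (\<forall>v\<in>V. \<Psi> (lam u v) \<simeq> \<Psi> v ^ (p ^ a u)))"
proof -
  obtain \<Phi> K where \<Phi>: "\<And>u v. u \<in> V \<Longrightarrow> v \<in> V \<Longrightarrow> \<Phi> (u \<cdot> v) \<simeq> \<Phi> u + \<Phi> v"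
    "\<And>v. v \<in> V \<Longrightarrow> \<Phi> (ze 1 v) \<simeq> X ^ K * \<Phi> v" "\<And>v. v \<in> V \<Longrightarrow> \<Phi> v \<simeq> 0 \<Longrightarrow> v = e" and K: "\<not> q dvd K"
    using fourier_coordinate by blast
  obtain w where w: "w \<in> V" "w \<noteq> e" "\<And>u. u \<in> V \<Longrightarrow> lam u w = w" using exists_lam_fixed by blast
  obtain y where y: "y * \<Phi> w \<simeq> 1" using cg_inverse \<Phi>(3) w by blast
  have y0: "\<not> y \<simeq> 0"
  proof
    assume "y \<simeq> 0"
    then have "y * \<Phi> w \<simeq> 0 * \<Phi> w" by (intro cg_mult cg_refl)
    then show False using y not_1_cg_0 cg_sym cg_trans by (metis mult_zero_left)
  qed
  define \<Psi> where "\<Psi> v = y * \<Phi> v" for v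
  have add: "\<Psi> (u \<cdot> v) \<simeq> \<Psi> u + \<Psi> v" if "u \<in> V" "v \<in> V" for u v
    using cg_mult[OF cg_refl \<Phi>(1)[OF that], of y] by (simp add: \<Psi>_def distrib_left)
  have ze1: "\<Psi> (ze 1 v) \<simeq> X ^ K * \<Psi> v" if "v \<in> V" for v
    using cg_mult[OF cg_refl \<Phi>(2)[OF that], of y] by (simp add: \<Psi>_def mult_ac)
  have ker: "v = e" if "v \<in> V" "\<Psi> v \<simeq> 0" for v
    using cg_prime[of y "\<Phi> v"] that y0 \<Phi>(3) by (auto simp: \<Psi>_def)
  have \<Psi>w: "\<Psi> w \<simeq> 1" using y by (simp add: \<Psi>_def)
  have \<Psi>e: "\<Psi> e \<simeq> 0"
  proof -
    have "\<Psi> e \<simeq> \<Psi> e + \<Psi> e" using add[of e e] by simp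
    then have "\<Psi> e - (\<Psi> e + \<Psi> e) \<in> P" by (simp add: cg_def)
    then show ?thesis using P_uminus[of "\<Psi> e - (\<Psi> e + \<Psi> e)"] by (simp add: cg_0_iff)
  qed
  have inj: "u = v" if "u \<in> V" "v \<in> V" "\<Psi> u \<simeq> \<Psi> v" for u v
  proof -
    have "\<Psi> (u \<cdot> neg v) \<simeq> \<Psi> u + \<Psi> (neg v)" using that by (intro add) simp_all
    also have "\<dots> \<simeq> \<Psi> v + \<Psi> (neg v)" by (intro cg_add that cg_refl)
    also have "\<dots> \<simeq> \<Psi> (v \<cdot> neg v)" using that by (intro cg_sym[OF add]) simp_all
    also have "\<dots> \<simeq> 0" using that \<Psi>e by simp
    finally have "u \<cdot> neg v = e" using ker that by simp
    then show ?thesis using add_neg_eq_e that by simp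
  qed
  have surj: "\<exists>v\<in>V. \<Psi> v \<simeq> f" for f
  proof -
    have "inj_on (\<lambda>v. code (\<Psi> v)) V" by (rule inj_onI) (simp add: code_eq_iff inj)
    then have "card ((\<lambda>v. code (\<Psi> v)) ` V) = card (range code)" using card_V card_field by (simp add: card_image)
    then have "(\<lambda>v. code (\<Psi> v)) ` V = range code"
      using finite_field_codes by (intro card_subset_eq) auto
    then have "code f \<in> (\<lambda>v. code (\<Psi> v)) ` V" by blast
    then show ?thesis by (auto simp: code_eq_iff cg_commute)
  qed
  have zen: "\<Psi> (ze n v) \<simeq> X ^ (K * n) * \<Psi> v" if v: "v \<in> V" for n v
  proof (induction n)
    case 0
    then show ?case using v by (simp add: ze_0)
  next
    case (Suc n)
    have "\<Psi> (ze (Suc n) v) = \<Psi> (ze 1 (ze n v))" using v by (simp add: ze_ze)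
    also have "\<dots> \<simeq> X ^ K * \<Psi> (ze n v)" using v by (intro ze1 ze_V)
    also have "\<dots> \<simeq> X ^ K * (X ^ (K * n) * \<Psi> v)" by (intro cg_mult cg_refl Suc)
    finally show ?case by (simp add: power_add mult_ac)
  qed
  define J where "J f = (SOME v. v \<in> V \<and> \<Psi> v \<simeq> f)" for f
  have J: "J f \<in> V \<and> \<Psi> (J f) \<simeq> f" for f unfolding J_def by (rule someI_ex) (use surj in blast)
  have JI: "J f = v" if "v \<in> V" "\<Psi> v \<simeq> f" for f v
    using inj[of "J f" v] J[of f] that cg_trans[OF _ cg_sym] by blast
  have "coprime K q" using K q prime_imp_coprime_nat coprime_commute by metis
  \<comment> \<open>The inverse of \<open>K\<close> modulo \<open>q\<close>: conjugation by
    \<open>t \<up> K'\<close> becomes multiplication by \<open>X\<close> itself.\<close>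
  then obtain K' where K': "[K * K' = 1] (mod q)" using cong_solve_coprime_nat by auto
  have "\<exists>a. [mu u = p ^ a] (mod q) \<and> (\<forall>v\<in>V. \<Psi> (lam u v) \<simeq> \<Psi> v ^ (p ^ a))" if u: "u \<in> V" for u
  proof -
    define L where "L f = \<Psi> (lam u (J f))" for f
    have "\<exists>a<p. [mu u = p ^ a] (mod q) \<and> (\<forall>f. L f \<simeq> f ^ (p ^ a))"
    proof (rule semilinear_is_frobenius)
      show "L f \<simeq> L g" if "f \<simeq> g" for f g
      proof -
        have "J f = J g" using JI[of "J g" f] J[of g] cg_trans[OF _ cg_sym[OF that]] by blast
        then show ?thesis by (simp add: L_def)
      qed
      show "L (f + g) \<simeq> L f + L g" for f g
      proof -
        have "\<Psi> (J f \<cdot> J g) \<simeq> \<Psi> (J f) + \<Psi> (J g)" using J by (intro add) simp_all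
        also have "\<dots> \<simeq> f + g" using J by (intro cg_add) simp_all
        finally have "J (f + g) = J f \<cdot> J g" using J by (intro JI) simp_all
        then show ?thesis unfolding L_def using u J V_lam add by (simp add: lam_add)
      qed
      show "L 1 \<simeq> 1" unfolding L_def using JI[OF w(1) \<Psi>w] w(3)[OF u] \<Psi>w by simp
      show "L (X * f) \<simeq> X ^ mu u * L f" for f
      proof -
        have "\<Psi> (ze K' (J f)) \<simeq> X ^ (K * K') * \<Psi> (J f)" using J by (intro zen) simp
        also have "\<dots> \<simeq> X ^ 1 * f" using J K' by (intro cg_mult X_power_cong) simp_all
        finally have "J (X * f) = ze K' (J f)" using J ze_V by (intro JI) simp_all
        then have "L (X * f) = \<Psi> (ze (mu u * K') (lam u (J f)))" unfolding L_def using u J by (simp add: lam_ze)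
        also have "\<dots> \<simeq> X ^ (K * (mu u * K')) * L f" unfolding L_def using u J V_lam by (intro zen) simp
        also have "\<dots> \<simeq> X ^ mu u * L f"
        proof (intro cg_mult cg_refl X_power_cong)
          have "[mu u * (K * K') = mu u * 1] (mod q)" by (intro cong_mult cong_refl K')
          then show "[K * (mu u * K') = mu u] (mod q)" by (simp add: mult_ac)
        qed
        finally show ?thesis .
      qed
    qed
    then obtain a where a: "[mu u = p ^ a] (mod q)" "\<And>f. L f \<simeq> f ^ (p ^ a)" by blast
    have "\<Psi> (lam u v) \<simeq> \<Psi> v ^ (p ^ a)" if "v \<in> V" for v
      using a(2)[of "\<Psi> v"] JI[OF that cg_refl] by (simp add: L_def)
    then show ?thesis using a(1) by blast
  qed
  then obtain a where "\<And>u. u \<in> V \<Longrightarrow> [mu u = p ^ a u] (mod q) \<and> (\<forall>v\<in>V. \<Psi> (lam u v) \<simeq> \<Psi> v ^ (p ^ a u))"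
    by metis
  then show ?thesis using add ze1 inj surj K by blast
qed

text \<open>By \<open>twisted_hom_is_trace\<close> the Frobenius exponent \<open>a\<close> is
  \<open>b\<close> times the trace of \<open>\<Psi>\<close>. Since \<open>b\<close> lies in the
  prime field, it commutes with the trace and the Frobenius map, so the rescaled coordinate
  \<open>\<Theta>\<close> has trace exactly \<open>a\<close>. The factor \<open>K\<close> on
  exponents of \<open>t\<close> accounts for \<open>t\<close> acting as
  \<open>X ^ K\<close>.\<close>

lemma isomorphic_model: "sb_isomorphic B model"
proof -
  obtain \<Psi> K a where add: "\<And>u v. u \<in> V \<Longrightarrow> v \<in> V \<Longrightarrow> \<Psi> (u \<cdot> v) \<simeq> \<Psi> u + \<Psi> v"
    and ze1: "\<And>v. v \<in> V \<Longrightarrow> \<Psi> (ze 1 v) \<simeq> X ^ K * \<Psi> v"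
    and inj: "\<And>u v. u \<in> V \<Longrightarrow> v \<in> V \<Longrightarrow> \<Psi> u \<simeq> \<Psi> v \<Longrightarrow> u = v"
    and surj: "\<And>f. \<exists>v\<in>V. \<Psi> v \<simeq> f" and K: "\<not> q dvd K"
    and mu: "\<And>u. u \<in> V \<Longrightarrow> [mu u = p ^ a u] (mod q)"
    and lamP: "\<And>u v. u \<in> V \<Longrightarrow> v \<in> V \<Longrightarrow> \<Psi> (lam u v) \<simeq> \<Psi> v ^ (p ^ a u)"
    using frobenius_coordinate by blast
  have circP: "\<Psi> (u \<bullet> v) \<simeq> \<Psi> u + \<Psi> v ^ (p ^ a u)" if "u \<in> V" "v \<in> V" for u v
    using cg_trans[OF add cg_add[OF cg_refl lamP]] V_lam that by (simp add: circ_eq)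
  have a_circ: "[a (u \<bullet> v) = a u + a v] (mod p)" if uv: "u \<in> V" "v \<in> V" for u v
  proof -
    have "[p ^ a (u \<bullet> v) = mu (u \<bullet> v)] (mod q)" using mu uv by (intro cong_sym[OF mu]) simp
    also have "[mu (u \<bullet> v) = mu u * mu v] (mod q)" using uv by (rule mu_circ)
    also have "[mu u * mu v = p ^ a u * p ^ a v] (mod q)" using uv by (intro cong_mult mu)
    finally show ?thesis by (simp only: p_pow_cong_iff power_add[symmetric])
  qed
  define J where "J f = (SOME v. v \<in> V \<and> \<Psi> v \<simeq> f)" for f
  have J: "J f \<in> V \<and> \<Psi> (J f) \<simeq> f" for f unfolding J_def by (rule someI_ex) (use surj in blast)
  have JI: "J f = v" if "v \<in> V" "\<Psi> v \<simeq> f" for f v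
    using inj[of "J f" v] J[of f] that cg_trans[OF _ cg_sym] by blast
  have Jcong: "J f = J g" if "f \<simeq> g" for f g
    using JI[of "J g" f] J[of g] cg_trans[OF _ cg_sym[OF that]] by blast
  obtain u\<^sub>0 where u0: "u\<^sub>0 \<in> V" "u\<^sub>0 \<bullet> t \<noteq> t \<bullet> u\<^sub>0" using noncentral by blast
  have a0: "\<not> [a u\<^sub>0 = 0] (mod p)"
  proof
    assume "[a u\<^sub>0 = 0] (mod p)"
    then have "[p ^ a u\<^sub>0 = p ^ 0] (mod q)" by (simp only: p_pow_cong_iff)
    then have "[mu u\<^sub>0 = 1] (mod q)" using mu[OF u0(1)] cong_trans by simp blast
    then have "t \<up> mu u\<^sub>0 = t \<up> 1" by (simp only: t_pow_eq_iff)
    then have "lam u\<^sub>0 t = t" using lam_t[OF u0(1)] t(1) by simp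
    then have "u\<^sub>0 \<bullet> t = u\<^sub>0 \<cdot> t" using u0(1) t(1) by (simp add: circ_eq)
    then show False using u0 t_circ by simp
  qed
  have "\<exists>b. \<not> p dvd b \<and> (\<forall>f. [a (J f) = b * trace_index f] (mod p))"
  proof (rule twisted_hom_is_trace[of "\<lambda>f. a (J f)" "\<Psi> u\<^sub>0"])
    show "[a (J f) = a (J g)] (mod p)" if "f \<simeq> g" for f g using Jcong[OF that] by simp
    show "\<not> [a (J (\<Psi> u\<^sub>0)) = 0] (mod p)" using JI[OF u0(1) cg_refl] a0 by simp
    fix f g
    have "\<Psi> (J f \<bullet> J g) \<simeq> \<Psi> (J f) + \<Psi> (J g) ^ (p ^ a (J f))" using J by (intro circP) simp_all
    also have "\<dots> \<simeq> f + g ^ (p ^ a (J f))" using J by (intro cg_add cg_power) simp_all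
    finally have "J (f + g ^ (p ^ a (J f))) = J f \<bullet> J g" using J by (intro JI) simp_all
    then show "[a (J (f + g ^ (p ^ a (J f)))) = a (J f) + a (J g)] (mod p)"
      using a_circ J by simp
  qed
  then obtain b where b: "\<not> p dvd b" "\<And>f. [a (J f) = b * trace_index f] (mod p)" by blast
  have b0: "\<not> of_nat b \<simeq> 0" using b(1) of_nat_cg_iff[of b 0] by (simp add: cong_0_iff)
  define \<Theta> where "\<Theta> v = of_nat b * \<Psi> v" for v
  have tr: "[trace_index (\<Theta> v) = a v] (mod p)" if "v \<in> V" for v
  proof -
    have "[trace_index (\<Theta> v) = b * trace_index (\<Psi> v)] (mod p)" unfolding \<Theta>_def by (rule trace_index_of_nat_mult)
    moreover have "[a v = b * trace_index (\<Psi> v)] (mod p)" using b(2)[of "\<Psi> v"] JI[OF that cg_refl] by simp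
    ultimately show ?thesis using cong_sym cong_trans by blast
  qed
  have \<Theta>_add: "\<Theta> (u \<cdot> v) \<simeq> \<Theta> u + \<Theta> v" if "u \<in> V" "v \<in> V" for u v
    using cg_mult[OF cg_refl add[OF that], of "of_nat b"] by (simp add: \<Theta>_def distrib_left)
  have \<Theta>_ze: "\<Theta> (ze n v) \<simeq> X ^ (K * n) * \<Theta> v" if v: "v \<in> V" for n v
  proof (induction n)
    case 0
    then show ?case using v by (simp add: ze_0)
  next
    case (Suc n)
    have "\<Theta> (ze (Suc n) v) = of_nat b * \<Psi> (ze 1 (ze n v))" using v by (simp add: ze_ze \<Theta>_def)
    also have "\<dots> \<simeq> of_nat b * (X ^ K * \<Psi> (ze n v))" using v by (intro cg_mult cg_refl ze1 ze_V)
    also have "\<dots> = X ^ K * \<Theta> (ze n v)" by (simp add: \<Theta>_def mult_ac)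
    also have "\<dots> \<simeq> X ^ K * (X ^ (K * n) * \<Theta> v)" by (intro cg_mult cg_refl Suc)
    finally show ?case by (simp add: power_add mult_ac)
  qed
  have \<Theta>_circ: "\<Theta> (u \<bullet> v) \<simeq> \<Theta> u + tw (\<Theta> u) (\<Theta> v)" if uv: "u \<in> V" "v \<in> V" for u v
  proof -
    have "\<Theta> (u \<bullet> v) \<simeq> of_nat b * (\<Psi> u + \<Psi> v ^ (p ^ a u))" unfolding \<Theta>_def using uv by (intro cg_mult cg_refl circP)
    also have "\<dots> = \<Theta> u + of_nat b * \<Psi> v ^ (p ^ a u)" by (simp add: \<Theta>_def distrib_left)
    also have "\<dots> \<simeq> \<Theta> u + of_nat b ^ (p ^ a u) * \<Psi> v ^ (p ^ a u)"
      by (intro cg_add cg_mult cg_refl cg_sym[OF of_nat_frobenius_pow])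
    also have "\<dots> = \<Theta> u + \<Theta> v ^ (p ^ a u)" by (simp add: \<Theta>_def power_mult_distrib)
    also have "\<dots> \<simeq> \<Theta> u + tw (\<Theta> u) (\<Theta> v)"
      unfolding tw_def using uv by (intro cg_add cg_refl frobenius_pow_cong cong_sym[OF tr])
    finally show ?thesis .
  qed
  have \<Theta>_inj: "u = v" if "u \<in> V" "v \<in> V" "\<Theta> u \<simeq> \<Theta> v" for u v
    using cg_mult_cancel[of "of_nat b" "\<Psi> u" "\<Psi> v"] that b0 inj by (simp add: \<Theta>_def)
  have pw: "[pw (\<Theta> u) = int (mu u)] (mod int q)" if u: "u \<in> V" for u
  proof -
    have "[p ^ trace_index (\<Theta> u) = p ^ a u] (mod q)" using tr[OF u] by (simp only: p_pow_cong_iff)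
    then have "[p ^ trace_index (\<Theta> u) = mu u] (mod q)" using mu[OF u] cong_sym cong_trans by blast
    then show ?thesis unfolding pw_def by (simp only: cong_int_iff)
  qed
  \<comment> \<open>The exponent \<open>i\<close> of an element is determined only modulo
    \<open>q\<close>; the chosen value does not depend on it because \<open>enc\<close> reduces its
    second argument modulo \<open>q\<close>.\<close>
  define F where "F x = (SOME y. \<exists>v\<in>V. \<exists>i. x = v \<cdot> t \<up> i \<and> y = enc (\<Theta> v) (int (K * i)))" for x
  have F: "F (v \<cdot> t \<up> i) = enc (\<Theta> v) (int (K * i))" if v: "v \<in> V" for v i
  proof -
    have "\<exists>y. \<exists>w\<in>V. \<exists>j. v \<cdot> t \<up> i = w \<cdot> t \<up> j \<and> y = enc (\<Theta> w) (int (K * j))" using v by blast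
    from someI_ex[OF this, folded F_def]
    obtain w j where w: "w \<in> V" "v \<cdot> t \<up> i = w \<cdot> t \<up> j" "F (v \<cdot> t \<up> i) = enc (\<Theta> w) (int (K * j))" by blast
    then have "v = w" "[i = j] (mod q)" using decomp_unique[OF v w(1)] by blast+
    then have "[K * i = K * j] (mod q)" by (intro cong_mult cong_refl)
    then have "[int (K * i) = int (K * j)] (mod int q)" by (simp only: cong_int_iff)
    then show ?thesis using w(3) \<open>v = w\<close> by (simp add: enc_eq_iff cong_sym)
  qed
  have Fc: "F x \<in> carrier model" if "x \<in> carrier B" for x
    using decomp[OF that] F by auto
  have "F \<in> hom (additive_group B) (additive_group model)"
  proof (rule homI)
    fix x y assume "x \<in> carrier (additive_group B)" "y \<in> carrier (additive_group B)"
    then obtain u v i j where uv: "u \<in> V" "v \<in> V" "x = u \<cdot> t \<up> i" "y = v \<cdot> t \<up> j" using decomp by (metis additive_group_simps(1))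
    have "\<Theta> (u \<cdot> ze i v) \<simeq> \<Theta> u + \<Theta> (ze i v)" using uv ze_V by (intro \<Theta>_add)
    also have "\<dots> \<simeq> \<Theta> u + Z (int (K * i)) * \<Theta> v"
      using uv by (intro cg_add cg_refl cg_trans[OF \<Theta>_ze] cg_mult cg_sym[OF Z_of_nat])
    finally have "enc (\<Theta> (u \<cdot> ze i v)) (int (K * (i + j))) = enc (\<Theta> u + Z (int (K * i)) * \<Theta> v) (int (K * i) + int (K * j))"
      by (simp add: enc_eq_iff distrib_left)
    moreover have "F (x \<cdot> y) = enc (\<Theta> (u \<cdot> ze i v)) (int (K * (i + j)))"
      unfolding uv(3,4) add_decomp[OF uv(1,2)] using uv ze_V by (intro F) simp
    ultimately show "F (x \<cdot> y) = F x \<otimes>\<^bsub>additive_group model\<^esub> F y"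
      unfolding additive_group_simps(2)[of model] using uv by (simp add: F)
  qed (simp add: Fc)
  moreover have "F \<in> hom (multiplicative_group B) (multiplicative_group model)"
  proof (rule homI)
    fix x y assume "x \<in> carrier (multiplicative_group B)" "y \<in> carrier (multiplicative_group B)"
    then obtain u v i j where uv: "u \<in> V" "v \<in> V" "x = u \<cdot> t \<up> i" "y = v \<cdot> t \<up> j" using decomp by (metis multiplicative_group_simps(1))
    have "[int (mu u) * int (K * j) = pw (\<Theta> u) * int (K * j)] (mod int q)"
      using uv by (intro cong_mult cong_refl cong_sym[OF pw])
    then have "[int (K * i) + int (mu u) * int (K * j) = int (K * i) + pw (\<Theta> u) * int (K * j)] (mod int q)"
      by (intro cong_add cong_refl)
    moreover have "int (K * (i + mu u * j)) = int (K * i) + int (mu u) * int (K * j)" by (simp add: algebra_simps)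
    ultimately have "enc (\<Theta> (u \<bullet> v)) (int (K * (i + mu u * j))) = enc (\<Theta> u + tw (\<Theta> u) (\<Theta> v)) (int (K * i) + pw (\<Theta> u) * int (K * j))"
      using \<Theta>_circ[OF uv(1,2)] by (simp only: enc_eq_iff)
    moreover have "F (x \<bullet> y) = enc (\<Theta> (u \<bullet> v)) (int (K * (i + mu u * j)))"
      unfolding uv(3,4) circ_decomp[OF uv(1,2)] using uv by (intro F) simp
    ultimately show "F (x \<bullet> y) = F x \<otimes>\<^bsub>multiplicative_group model\<^esub> F y"
      unfolding multiplicative_group_simps(2)[of model] using uv by (simp add: F)
  qed (simp add: Fc)
  moreover have "bij_betw F (carrier B) (carrier model)"
  proof -
    have "inj_on F (carrier B)"
    proof (rule inj_onI)
      fix x y assume xy: "x \<in> carrier B" "y \<in> carrier B" "F x = F y"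
      then obtain u v i j where uv: "u \<in> V" "v \<in> V" "x = u \<cdot> t \<up> i" "y = v \<cdot> t \<up> j" using decomp by metis
      then have "\<Theta> u \<simeq> \<Theta> v" "[int (K * i) = int (K * j)] (mod int q)" using xy(3) by (simp_all add: F enc_eq_iff)
      then have "u = v" "[K * i = K * j] (mod q)" using \<Theta>_inj uv by (simp_all only: cong_int_iff)
      moreover have "coprime K q" using K q prime_imp_coprime_nat coprime_commute by metis
      ultimately have "u = v" "[i = j] (mod q)" using cong_mult_lcancel_nat by blast+
      moreover have "t \<up> i = t \<up> j" using \<open>[i = j] (mod q)\<close> by (simp only: t_pow_eq_iff)
      ultimately show "x = y" using uv by simp
    qed
    moreover have "F ` carrier B = carrier model"
      using finite_model card_B card_model Fc calculation by (intro card_subset_eq) (auto simp: card_image)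
    ultimately show ?thesis by (simp add: bij_betw_def)
  qed
  ultimately show ?thesis by (auto simp: sb_isomorphic_def sb_hom_def)
qed

end

lemma (in finite_field_quotient) normal_form_isomorphic_model:
  assumes nf: "normal_form B V t"
  shows "sb_isomorphic B model"
proof -
  have "skew_brace B" using nf by (simp add: normal_form_def)
  then interpret normal_form_brace p q P B V t using nf by unfold_locales
  show ?thesis by (rule isomorphic_model)
qed

theorem theorem1p1:
  fixes p q n :: nat
  assumes "prime p" and "prime q"
    and "q dvd (p ^ p - 1) div (p - 1)"
    and "n = p ^ p * q"
  shows "\<exists>B\<^sub>1 B\<^sub>2 :: nat sbrace.
    (\<forall>B \<in> {B\<^sub>1, B\<^sub>2}. simple_skew_brace B \<and> card (carrier B) = n) \<and>
    \<not> sb_isomorphic B\<^sub>1 B\<^sub>2 \<and>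
    (\<forall>B :: 'a sbrace. simple_skew_brace B \<and> card (carrier B) = n \<longrightarrow>
       sb_isomorphic B B\<^sub>1 \<or> sb_isomorphic B B\<^sub>2) \<and>
    sb_isomorphic B\<^sub>1 (opposite B\<^sub>2) \<and> sb_isomorphic B\<^sub>2 (opposite B\<^sub>1) \<and>
    (\<exists>\<phi> \<in> hom (integer_mod_group q)
             (AutoGroup (product_group {..<p} (\<lambda>_. integer_mod_group p))).
       (\<exists>c \<in> carrier (integer_mod_group q).
          \<phi> c \<noteq> \<one>\<^bsub>AutoGroup (product_group {..<p} (\<lambda>_. integer_mod_group p))\<^esub>) \<and>
       (\<forall>B \<in> {B\<^sub>1, B\<^sub>2}. additive_group B \<cong>
          semidirect_product (product_group {..<p} (\<lambda>_. integer_mod_group p))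
            (integer_mod_group q) \<phi>)) \<and>
    (\<exists>P :: nat monoid. group P \<and> order P = p ^ p \<and>
       (\<exists>\<psi> \<in> hom P (AutoGroup (integer_mod_group q)).
          (\<exists>\<alpha> \<in> carrier (AutoGroup (integer_mod_group q)).
             group.ord (AutoGroup (integer_mod_group q)) \<alpha> = p \<and>
             \<psi> ` carrier P = generate (AutoGroup (integer_mod_group q)) {\<alpha>}) \<and>
          (\<forall>B \<in> {B\<^sub>1, B\<^sub>2}. multiplicative_group B \<cong>
             semidirect_product (integer_mod_group q) P \<psi>))) \<and>
    (\<forall>B \<in> {B\<^sub>1, B\<^sub>2}. cyclic_group (sb_AutoGroup B) \<and> order (sb_AutoGroup B) = p)"
proof -
  interpret prime_pair p q using assms(1-3) by unfold_locales
  obtain P where "finite_field_quotient p q P" using finite_field_quotient_exists by blast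
  then interpret F: finite_field_quotient p q P .
  have classification: "sb_isomorphic B F.model \<or> sb_isomorphic B (opposite F.model)"
    if simple: "simple_skew_brace B" and card: "card (carrier B) = n" for B :: "'a sbrace"
  proof -
    have "skew_brace B" using simple by (simp add: simple_skew_brace_def)
    then have "simple_brace_pq p q B" using simple card assms(4) by unfold_locales simp_all
    then obtain V t where "normal_form B V t \<or> normal_form (opposite B) V t"
      using simple_brace_pq.normal_form_exists by blast
    then show ?thesis
    proof
      assume "normal_form B V t"
      then show ?thesis by (intro disjI1 F.normal_form_isomorphic_model)
    next
      assume "normal_form (opposite B) V t"
      then have "sb_isomorphic (opposite B) F.model" by (rule F.normal_form_isomorphic_model)
      then show ?thesis by (intro disjI2 sb_isomorphic_opposite)
    qed
  qed
  let ?V = "product_group {..<p} (\<lambda>_. integer_mod_group p)"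
  obtain \<theta> where "\<theta> \<in> iso F.field_additive ?V" using F.field_additive_iso_product by (auto simp: is_iso_def)
  moreover have "group ?V" by simp
  ultimately obtain \<phi> where \<phi>: "\<phi> \<in> hom (integer_mod_group q) (AutoGroup ?V)"
      "\<exists>c \<in> carrier (integer_mod_group q). \<phi> c \<noteq> \<one>\<^bsub>AutoGroup ?V\<^esub>"
      "additive_group F.model \<cong> semidirect_product ?V (integer_mod_group q) \<phi>"
    using F.additive_model_semidirect[of ?V \<theta>] by blast
  have \<phi>': "additive_group (opposite F.model) \<cong> semidirect_product ?V (integer_mod_group q) \<phi>"
    using additive_group_opposite_iso[OF F.group_additive_model] \<phi>(3) by (rule iso_trans)
  obtain \<psi> where \<psi>: "\<psi> \<in> hom F.star_group (AutoGroup (integer_mod_group q))"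
     "\<exists>\<alpha> \<in> carrier (AutoGroup (integer_mod_group q)).
        group.ord (AutoGroup (integer_mod_group q)) \<alpha> = p \<and>
        \<psi> ` carrier F.star_group = generate (AutoGroup (integer_mod_group q)) {\<alpha>}"
     "multiplicative_group F.model \<cong> semidirect_product (integer_mod_group q) F.star_group \<psi>"
    using F.multiplicative_model_semidirect by blast
  show ?thesis
  proof (rule exI[of _ F.model], rule exI[of _ "opposite F.model"], intro conjI)
    show "\<forall>B\<in>{F.model, opposite F.model}. simple_skew_brace B \<and> card (carrier B) = n"
      using F.simple_model simple_opposite F.card_model assms(4) by simp
    show "\<not> sb_isomorphic F.model (opposite F.model)" by (rule F.not_isomorphic_opposite_model)
    show "\<forall>B :: 'a sbrace. simple_skew_brace B \<and> card (carrier B) = n \<longrightarrow>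
       sb_isomorphic B F.model \<or> sb_isomorphic B (opposite F.model)"
      using classification by blast
    show "sb_isomorphic F.model (opposite (opposite F.model))" "sb_isomorphic (opposite F.model) (opposite F.model)"
      by (simp_all add: sb_isomorphic_refl)
    show "\<exists>\<phi> \<in> hom (integer_mod_group q) (AutoGroup ?V).
       (\<exists>c \<in> carrier (integer_mod_group q). \<phi> c \<noteq> \<one>\<^bsub>AutoGroup ?V\<^esub>) \<and>
       (\<forall>B \<in> {F.model, opposite F.model}. additive_group B \<cong> semidirect_product ?V (integer_mod_group q) \<phi>)"
      using \<phi> \<phi>' by blast
    show "\<exists>P :: nat monoid. group P \<and> order P = p ^ p \<and>
       (\<exists>\<psi> \<in> hom P (AutoGroup (integer_mod_group q)).
          (\<exists>\<alpha> \<in> carrier (AutoGroup (integer_mod_group q)).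
             group.ord (AutoGroup (integer_mod_group q)) \<alpha> = p \<and>
             \<psi> ` carrier P = generate (AutoGroup (integer_mod_group q)) {\<alpha>}) \<and>
          (\<forall>B \<in> {F.model, opposite F.model}. multiplicative_group B \<cong>
             semidirect_product (integer_mod_group q) P \<psi>))"
      using \<psi> F.group_star_group F.order_star_group
      by (intro exI[of _ F.star_group] conjI bexI[of _ \<psi>]) simp_all
    show "\<forall>B \<in> {F.model, opposite F.model}. cyclic_group (sb_AutoGroup B) \<and> order (sb_AutoGroup B) = p"
      using F.cyclic_sb_AutoGroup_model F.order_sb_AutoGroup_model by (simp add: sb_AutoGroup_opposite)
  qed
qed

end
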